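(* Let $p$ be a prime. The functors $F \circ \mathrm{Fin}:\mathrm{pro}\text{-}sSet\to s\,\mathrm{pro}\text{-}\mathcal F$ and $i \circ G: s\,\mathrm{pro}\text{-}\mathcal F\to \mathrm{pro}\text{-}sSet$ induce inverse equivalences between the homotopy categories $\mathrm{Ho}(\mathrm{pro}\text{-}sSet)$ and $\mathrm{Ho}(s\,\mathrm{pro}\text{-}\mathcal{F})$, where the weak equivalences in both categories are the $\mathbb Z/p$-cohomology isomorphisms.
   Context: For a category $\mathcal C$, $\mathrm{pro}\text{-}\mathcal C$ has as objects all (small) cofiltered diagrams in $\mathcal C$, with morphisms $\mathrm{Hom}(X,Y)=\lim_s \operatorname{colim}_t \mathrm{Hom}_{\mathcal C}(X_t,Y_s)$; $c:\mathcal C\to\mathrm{pro}\text{-}\mathcal C$ is the constant pro-object functor. $sSet$ is the category of simplicial sets, $\mathcal F$ is the category of finite sets, $s\mathcal F$ is the category of simplicial finite sets (simplicial sets that are finite in each degree), and $s\,\mathrm{pro}\text{-}\mathcal F$ is the category of simplicial objects in pro-finite sets (equivalently, in totally disconnected compact Hausdorff spaces). $i:\mathrm{pro}\text{-}s\mathcal F\to\mathrm{pro}\text{-}sSet$ is the inclusion. For a constant pro-space $cX$, $\mathrm{Fin}\,cX$ is the cofiltered system of all simplicial finite quotients of $X$; for an arbitrary pro-space $X$, $\mathrm{Fin}\,X=\lim_s \mathrm{Fin}\,cX_s$, the limit being computed in $\mathrm{pro}\text{-}s\mathcal F$ ($\mathrm{Fin}$ is the left adjoint of $i$). $F:\mathrm{pro}\text{-}s\mathcal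 F\to s\,\mathrm{pro}\text{-}\mathcal F$ takes $X$ to the simplicial pro-finite set $[n]\mapsto X_n$, where $X_n$ is the pro-finite set $s\mapsto (X_s)_n$. $G: s\,\mathrm{pro}\text{-}\mathcal F\to\mathrm{pro}\text{-}s\mathcal F$ is the left adjoint of $F$; it is known that $G$ exists and that $FG$ is naturally isomorphic to the identity. Cohomology: for $X$ in $\mathrm{pro}\text{-}sSet$, $H^n(X;\mathbb Z/p)=\operatorname{colim}_sH^n(X_s;\mathbb Z/p)$. For $X$ in $s\,\mathrm{pro}\text{-}\mathcal F$, $H^*(X;\mathbb Z/p)$ is continuous cohomology, i.e. the cohomology of the cochain complex with $C^n=\mathrm{Hom}_{\mathrm{pro}\text{-}\mathcal F}(X_n,\mathbb Z/p)$. $\mathrm{Ho}$ denotes the localization of the category at the maps inducing isomorphisms on $H^*(-;\mathbb Z/p)$ in all degrees. *)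

theory Defs
  imports
    "HOL-Computational_Algebra.Primes"
    "HOL-Algebra.FiniteProduct"
    "HOL-Algebra.Elementary_Groups"
    "HOL-Algebra.Product_Groups"
begin

unbundle cardinal_syntax

section \<open>Categories and functors\<close>

text \<open>Composition is written in the order of functions: \<open>Cmp C g f\<close> is ``g after f''.\<close>

record ('o, 'm) cat =
  Ob :: "'o set"
  Mor :: "'m set"
  Dom :: "'m \<Rightarrow> 'o"
  Cod :: "'m \<Rightarrow> 'o"
  Idn :: "'o \<Rightarrow> 'm"
  Cmp :: "'m \<Rightarrow> 'm \<Rightarrow> 'm"

definition homs :: "('o, 'm) cat \<Rightarrow> 'o \<Rightarrow> 'o \<Rightarrow> 'm set" where
  "homs C a b = {f \<in> Mor C. Dom C f = a \<and> Cod C f = b}"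

definition is_cat :: "('o, 'm) cat \<Rightarrow> bool" where
  "is_cat C \<longleftrightarrow>
     (\<forall>f\<in>Mor C. Dom C f \<in> Ob C \<and> Cod C f \<in> Ob C) \<and>
     (\<forall>a\<in>Ob C. Idn C a \<in> homs C a a) \<and>
     (\<forall>f\<in>Mor C. \<forall>g\<in>Mor C. Cod C f = Dom C g \<longrightarrow> Cmp C g f \<in> homs C (Dom C f) (Cod C g)) \<and>
     (\<forall>f\<in>Mor C. Cmp C f (Idn C (Dom C f)) = f \<and> Cmp C (Idn C (Cod C f)) f = f) \<and>
     (\<forall>f\<in>Mor C. \<forall>g\<in>Mor C. \<forall>h\<in>Mor C. Cod C f = Dom C g \<and> Cod C g = Dom C h \<longrightarrow>
        Cmp C h (Cmp C g f) = Cmp C (Cmp C h g) f)"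

definition op_cat :: "('o, 'm) cat \<Rightarrow> ('o, 'm) cat" where
  "op_cat C = \<lparr>Ob = Ob C, Mor = Mor C, Dom = Cod C, Cod = Dom C, Idn = Idn C,
               Cmp = (\<lambda>g f. Cmp C f g)\<rparr>"

definition is_iso :: "('o, 'm) cat \<Rightarrow> 'm \<Rightarrow> bool" where
  "is_iso C f \<longleftrightarrow> f \<in> Mor C \<and>
     (\<exists>g\<in>homs C (Cod C f) (Dom C f).
        Cmp C g f = Idn C (Dom C f) \<and> Cmp C f g = Idn C (Cod C f))"

record ('a, 'f, 'o, 'm) ftr =
  fob :: "'a \<Rightarrow> 'o"
  fmor :: "'f \<Rightarrow> 'm"

definition is_functor :: "('a, 'f) cat \<Rightarrow> ('o, 'm) cat \<Rightarrow> ('a, 'f, 'o, 'm) ftr \<Rightarrow> bool" where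
  "is_functor A C T \<longleftrightarrow>
     (\<forall>a\<in>Ob A. fob T a \<in> Ob C) \<and>
     (\<forall>f\<in>Mor A. fmor T f \<in> homs C (fob T (Dom A f)) (fob T (Cod A f))) \<and>
     (\<forall>a\<in>Ob A. fmor T (Idn A a) = Idn C (fob T a)) \<and>
     (\<forall>f\<in>Mor A. \<forall>g\<in>Mor A. Cod A f = Dom A g \<longrightarrow>
        fmor T (Cmp A g f) = Cmp C (fmor T g) (fmor T f))"

definition id_ftr :: "('a, 'f, 'a, 'f) ftr" where
  "id_ftr = \<lparr>fob = (\<lambda>a. a), fmor = (\<lambda>f. f)\<rparr>"

definition comp_ftr ::
  "('b, 'g, 'c, 'h) ftr \<Rightarrow> ('a, 'f, 'b, 'g) ftr \<Rightarrow> ('a, 'f, 'c, 'h) ftr" where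
  "comp_ftr S T = \<lparr>fob = (\<lambda>a. fob S (fob T a)), fmor = (\<lambda>f. fmor S (fmor T f))\<rparr>"

definition naturally_isomorphic ::
  "('a, 'f) cat \<Rightarrow> ('o, 'm) cat \<Rightarrow> ('a, 'f, 'o, 'm) ftr \<Rightarrow> ('a, 'f, 'o, 'm) ftr \<Rightarrow> bool" where
  "naturally_isomorphic A C S T \<longleftrightarrow>
     (\<exists>\<alpha>. (\<forall>a\<in>Ob A. \<alpha> a \<in> homs C (fob S a) (fob T a) \<and> is_iso C (\<alpha> a)) \<and>
          (\<forall>f\<in>Mor A. Cmp C (\<alpha> (Cod A f)) (fmor S f) = Cmp C (fmor T f) (\<alpha> (Dom A f))))"

definition left_adjoint ::
  "('a, 'f) cat \<Rightarrow> ('o, 'm) cat \<Rightarrow> ('a, 'f, 'o, 'm) ftr \<Rightarrow> ('o, 'm, 'a, 'f) ftr \<Rightarrow> bool" where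
  "left_adjoint A C L R \<longleftrightarrow> is_functor A C L \<and> is_functor C A R \<and>
     (\<exists>\<Phi>. (\<forall>a\<in>Ob A. \<forall>c\<in>Ob C.
              bij_betw (\<Phi> a c) (homs C (fob L a) c) (homs A a (fob R c))) \<and>
          (\<forall>f\<in>Mor A. \<forall>g\<in>Mor C. \<forall>h\<in>homs C (fob L (Cod A f)) (Dom C g).
              \<Phi> (Dom A f) (Cod C g) (Cmp C g (Cmp C h (fmor L f))) =
              Cmp A (fmor R g) (Cmp A (\<Phi> (Cod A f) (Dom C g) h) f)))"

definition is_cone ::
  "('o, 'm) cat \<Rightarrow> ('a, 'f) cat \<Rightarrow> ('a, 'f, 'o, 'm) ftr \<Rightarrow> 'o \<Rightarrow> ('a \<Rightarrow> 'm) \<Rightarrow> bool" where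
  "is_cone C J D L \<pi> \<longleftrightarrow> L \<in> Ob C \<and> (\<forall>j\<in>Ob J. \<pi> j \<in> homs C L (fob D j)) \<and>
     (\<forall>u\<in>Mor J. Cmp C (fmor D u) (\<pi> (Dom J u)) = \<pi> (Cod J u))"

definition is_limit ::
  "('o, 'm) cat \<Rightarrow> ('a, 'f) cat \<Rightarrow> ('a, 'f, 'o, 'm) ftr \<Rightarrow> 'o \<Rightarrow> ('a \<Rightarrow> 'm) \<Rightarrow> bool" where
  "is_limit C J D L \<pi> \<longleftrightarrow> is_functor J C D \<and> is_cone C J D L \<pi> \<and>
     (\<forall>M \<rho>. is_cone C J D M \<rho> \<longrightarrow>
        (\<exists>!h. h \<in> homs C M L \<and> (\<forall>j\<in>Ob J. Cmp C (\<pi> j) h = \<rho> j)))"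

text \<open>The functor category. A functor or natural transformation is required to be
  \<open>undefined\<close> outside its domain, so that equality of HOL functions is the right equality.\<close>

definition functor_cat ::
  "('a, 'f) cat \<Rightarrow> ('o, 'm) cat \<Rightarrow>
   (('a, 'f, 'o, 'm) ftr, ('a, 'f, 'o, 'm) ftr \<times> ('a, 'f, 'o, 'm) ftr \<times> ('a \<Rightarrow> 'm)) cat" where
  "functor_cat A C =
    (let obs = {T. is_functor A C T \<and> fob T \<in> extensional (Ob A) \<and> fmor T \<in> extensional (Mor A)}
     in \<lparr>Ob = obs,
         Mor = {(S, T, \<alpha>). S \<in> obs \<and> T \<in> obs \<and> \<alpha> \<in> extensional (Ob A) \<and>
                  (\<forall>a\<in>Ob A. \<alpha> a \<in> homs C (fob S a) (fob T a)) \<and>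
                  (\<forall>f\<in>Mor A. Cmp C (\<alpha> (Cod A f)) (fmor S f) =
                               Cmp C (fmor T f) (\<alpha> (Dom A f)))},
         Dom = (\<lambda>(S, T, \<alpha>). S),
         Cod = (\<lambda>(S, T, \<alpha>). T),
         Idn = (\<lambda>T. (T, T, \<lambda>a\<in>Ob A. Idn C (fob T a))),
         Cmp = (\<lambda>(S', T', \<beta>) (S, T, \<alpha>). (S, T', \<lambda>a\<in>Ob A. Cmp C (\<beta> a) (\<alpha> a)))\<rparr>)"


section \<open>Localization\<close>

text \<open>Morphisms of the localization are zigzags, read from left to right, modulo the usual
  congruence; \<open>Bwd w\<close> is the formal inverse of \<open>w\<close>.\<close>

datatype 'm letter = Fwd 'm | Bwd 'm

fun zigzag :: "('o, 'm) cat \<Rightarrow> 'm set \<Rightarrow> 'o \<Rightarrow> 'm letter list \<Rightarrow> 'o \<Rightarrow> bool" where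
  "zigzag C W a [] b \<longleftrightarrow> a \<in> Ob C \<and> a = b"
| "zigzag C W a (Fwd f # ws) b \<longleftrightarrow> f \<in> Mor C \<and> Dom C f = a \<and> zigzag C W (Cod C f) ws b"
| "zigzag C W a (Bwd w # ws) b \<longleftrightarrow> w \<in> W \<and> w \<in> Mor C \<and> Cod C w = a \<and> zigzag C W (Dom C w) ws b"

inductive zig_rule :: "('o, 'm) cat \<Rightarrow> 'm set \<Rightarrow> 'm letter list \<Rightarrow> 'm letter list \<Rightarrow> bool"
  for C W where
  "a \<in> Ob C \<Longrightarrow> zig_rule C W [Fwd (Idn C a)] []"
| "f \<in> Mor C \<Longrightarrow> g \<in> Mor C \<Longrightarrow> Cod C f = Dom C g \<Longrightarrow>
     zig_rule C W [Fwd f, Fwd g] [Fwd (Cmp C g f)]"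
| "w \<in> W \<Longrightarrow> w \<in> Mor C \<Longrightarrow> zig_rule C W [Fwd w, Bwd w] []"
| "w \<in> W \<Longrightarrow> w \<in> Mor C \<Longrightarrow> zig_rule C W [Bwd w, Fwd w] []"

inductive zig_eq ::
  "('o, 'm) cat \<Rightarrow> 'm set \<Rightarrow> 'o \<Rightarrow> 'o \<Rightarrow> 'm letter list \<Rightarrow> 'm letter list \<Rightarrow> bool"
  for C W a b where
  "zigzag C W a ws b \<Longrightarrow> zig_eq C W a b ws ws"
| "zig_rule C W us vs \<Longrightarrow> zigzag C W a (xs @ us @ ys) b \<Longrightarrow> zigzag C W a (xs @ vs @ ys) b \<Longrightarrow>
     zig_eq C W a b (xs @ us @ ys) (xs @ vs @ ys)"
| "zig_eq C W a b us vs \<Longrightarrow> zig_eq C W a b vs us"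
| "zig_eq C W a b us vs \<Longrightarrow> zig_eq C W a b vs ws \<Longrightarrow> zig_eq C W a b us ws"

definition zig_class ::
  "('o, 'm) cat \<Rightarrow> 'm set \<Rightarrow> 'o \<Rightarrow> 'o \<Rightarrow> 'm letter list \<Rightarrow> 'm letter list set" where
  "zig_class C W a b ws = {vs. zig_eq C W a b ws vs}"

definition Ho :: "('o, 'm) cat \<Rightarrow> 'm set \<Rightarrow> ('o, 'o \<times> 'o \<times> 'm letter list set) cat" where
  "Ho C W =
    \<lparr>Ob = Ob C,
     Mor = {(a, b, zig_class C W a b ws) |a b ws. zigzag C W a ws b},
     Dom = (\<lambda>(a, b, K). a),
     Cod = (\<lambda>(a, b, K). b),
     Idn = (\<lambda>a. (a, a, zig_class C W a a [])),
     Cmp = (\<lambda>(b', c, L) (a, b, K). (a, c, \<Union>us\<in>K. \<Union>vs\<in>L. zig_class C W a c (us @ vs)))\<rparr>"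


definition Ho_functor ::
  "('p, 'n) cat \<Rightarrow> 'n set \<Rightarrow> ('o, 'm, 'p, 'n) ftr \<Rightarrow>
   ('o, 'o \<times> 'o \<times> 'm letter list set, 'p, 'p \<times> 'p \<times> 'n letter list set) ftr" where
  "Ho_functor D V T =
    \<lparr>fob = fob T,
     fmor = (\<lambda>(a, b, K). (fob T a, fob T b,
               \<Union>ws\<in>K. zig_class D V (fob T a) (fob T b) (map (map_letter (fmor T)) ws)))\<rparr>"

definition induce_inverse_equivalences ::
  "('o, 'm) cat \<Rightarrow> 'm set \<Rightarrow> ('p, 'n) cat \<Rightarrow> 'n set \<Rightarrow>
   ('o, 'm, 'p, 'n) ftr \<Rightarrow> ('p, 'n, 'o, 'm) ftr \<Rightarrow> bool" where
  "induce_inverse_equivalences C W D V S T \<longleftrightarrow>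
     is_functor C D S \<and> (\<forall>w\<in>W. fmor S w \<in> V) \<and>
     is_functor D C T \<and> (\<forall>v\<in>V. fmor T v \<in> W) \<and>
     is_functor (Ho C W) (Ho D V) (Ho_functor D V S) \<and>
     is_functor (Ho D V) (Ho C W) (Ho_functor C W T) \<and>
     naturally_isomorphic (Ho C W) (Ho C W)
       (comp_ftr (Ho_functor C W T) (Ho_functor D V S)) id_ftr \<and>
     naturally_isomorphic (Ho D V) (Ho D V)
       (comp_ftr (Ho_functor D V S) (Ho_functor C W T)) id_ftr"


section \<open>Smallness\<close>

text \<open>Smallness is relative to a Grothendieck universe, given by a type \<open>'u\<close> of inaccessible
  cardinality: a small set is one of cardinality less than \<open>'u\<close>. Up to bijection the
  small sets are then exactly the elements of the universe, and each of them can be realised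
  as a set of elements of \<open>'u\<close>.\<close>

definition inaccessible :: "'u itself \<Rightarrow> bool" where
  "inaccessible U \<longleftrightarrow>
     natLeq <o |UNIV :: 'u set| \<and>
     regularCard |UNIV :: 'u set| \<and>
     (\<forall>A :: 'u set. |A| <o |UNIV :: 'u set| \<longrightarrow> |Pow A| <o |UNIV :: 'u set| )"

definition small :: "'u set \<Rightarrow> bool" where
  "small A \<longleftrightarrow> |A| <o |UNIV :: 'u set|"

type_synonym 'u setm = "'u set \<times> 'u set \<times> ('u \<Rightarrow> 'u)"

definition sets_cat :: "('u set \<Rightarrow> bool) \<Rightarrow> ('u set, 'u setm) cat" where
  "sets_cat P =
    \<lparr>Ob = {A. P A},
     Mor = {(A, B, f). P A \<and> P B \<and> f \<in> A \<rightarrow>\<^sub>E B},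
     Dom = (\<lambda>(A, B, f). A),
     Cod = (\<lambda>(A, B, f). B),
     Idn = (\<lambda>A. (A, A, \<lambda>x\<in>A. x)),
     Cmp = (\<lambda>(B', C, g) (A, B, f). (A, C, compose A g f))\<rparr>"

definition apply_setm :: "'u setm \<Rightarrow> 'u \<Rightarrow> 'u" where
  "apply_setm f = snd (snd f)"

abbreviation Sets :: "('u set, 'u setm) cat" where
  "Sets \<equiv> sets_cat small"

abbreviation FinSets :: "('u set, 'u setm) cat" where
  "FinSets \<equiv> sets_cat finite"


section \<open>Simplicial objects\<close>

text \<open>The object \<open>n\<close> of the simplex category stands for the ordered set \<open>{0..n}\<close>.\<close>

type_synonym simplex_op = "nat \<times> nat \<times> (nat \<Rightarrow> nat)"

definition simplex_cat :: "(nat, simplex_op) cat" where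
  "simplex_cat =
    \<lparr>Ob = UNIV,
     Mor = {(m, n, \<theta>). \<theta> \<in> {..m} \<rightarrow>\<^sub>E {..n} \<and> mono_on {..m} \<theta>},
     Dom = (\<lambda>(m, n, \<theta>). m),
     Cod = (\<lambda>(m, n, \<theta>). n),
     Idn = (\<lambda>n. (n, n, \<lambda>k\<in>{..n}. k)),
     Cmp = (\<lambda>(n', q, \<eta>) (m, n, \<theta>). (m, q, compose {..m} \<eta> \<theta>))\<rparr>"

definition face :: "nat \<Rightarrow> nat \<Rightarrow> simplex_op" where
  "face n i = (n, Suc n, \<lambda>k\<in>{..n}. if k < i then k else Suc k)"

type_synonym ('o, 'm) sob = "(nat, simplex_op, 'o, 'm) ftr"
type_synonym ('o, 'm) sarr = "('o, 'm) sob \<times> ('o, 'm) sob \<times> (nat \<Rightarrow> 'm)"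

definition simp :: "('o, 'm) cat \<Rightarrow> (('o, 'm) sob, ('o, 'm) sarr) cat" where
  "simp C = functor_cat (op_cat simplex_cat) C"

definition at_level :: "('o, 'm) sarr \<Rightarrow> nat \<Rightarrow> 'm" where
  "at_level f = snd (snd f)"


section \<open>Pro-objects\<close>

definition cofiltered :: "('a, 'f) cat \<Rightarrow> bool" where
  "cofiltered J \<longleftrightarrow> Ob J \<noteq> {} \<and>
     (\<forall>i\<in>Ob J. \<forall>j\<in>Ob J. \<exists>k\<in>Ob J. homs J k i \<noteq> {} \<and> homs J k j \<noteq> {}) \<and>
     (\<forall>i\<in>Ob J. \<forall>j\<in>Ob J. \<forall>u\<in>homs J i j. \<forall>v\<in>homs J i j.
        \<exists>k\<in>Ob J. \<exists>w\<in>homs J k i. Cmp J u w = Cmp J v w)"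

type_synonym ('u, 'o, 'm) pob = "('u, 'u) cat \<times> ('u, 'u, 'o, 'm) ftr"
type_synonym ('u, 'o, 'm) parr =
  "('u, 'o, 'm) pob \<times> ('u, 'o, 'm) pob \<times> ('u \<Rightarrow> ('u \<times> 'm) set)"

abbreviation Idx :: "('u, 'o, 'm) pob \<Rightarrow> ('u, 'u) cat" where
  "Idx X \<equiv> fst X"

abbreviation Dia :: "('u, 'o, 'm) pob \<Rightarrow> ('u, 'u, 'o, 'm) ftr" where
  "Dia X \<equiv> snd X"

definition is_pob :: "('o, 'm) cat \<Rightarrow> ('u, 'o, 'm) pob \<Rightarrow> bool" where
  "is_pob C X \<longleftrightarrow>
     is_cat (Idx X) \<and> small (Ob (Idx X)) \<and> small (Mor (Idx X)) \<and> cofiltered (Idx X) \<and>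
     Dia X \<in> Ob (functor_cat (Idx X) C)"

text \<open>The class of \<open>f : X\<^sub>i \<rightarrow> b\<close> in the colimit over \<open>t\<close> of the sets \<open>Hom (X\<^sub>t, b)\<close>.\<close>

definition germ ::
  "('o, 'm) cat \<Rightarrow> ('u, 'o, 'm) pob \<Rightarrow> 'u \<Rightarrow> 'm \<Rightarrow> ('u \<times> 'm) set" where
  "germ C X i f =
    {(i', f'). i' \<in> Ob (Idx X) \<and> f' \<in> homs C (fob (Dia X) i') (Cod C f) \<and>
       (\<exists>k\<in>Ob (Idx X). \<exists>u\<in>homs (Idx X) k i. \<exists>v\<in>homs (Idx X) k i'.
          Cmp C f (fmor (Dia X) u) = Cmp C f' (fmor (Dia X) v))}"

text \<open>A morphism from \<open>X\<close> to \<open>Y\<close> is an element of the limit over \<open>s\<close> of the colimit over \<open>t\<close>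
  of the sets \<open>Hom (X\<^sub>t, Y\<^sub>s)\<close>, i.e. a compatible family of germs.\<close>

definition pro :: "('o, 'm) cat \<Rightarrow> (('u, 'o, 'm) pob, ('u, 'o, 'm) parr) cat" where
  "pro C =
    \<lparr>Ob = {X. is_pob C X},
     Mor = {(X, Y, \<phi>). is_pob C X \<and> is_pob C Y \<and> \<phi> \<in> extensional (Ob (Idx Y)) \<and>
              (\<forall>s\<in>Ob (Idx Y). \<exists>t\<in>Ob (Idx X). \<exists>f\<in>homs C (fob (Dia X) t) (fob (Dia Y) s).
                 \<phi> s = germ C X t f) \<and>
              (\<forall>u\<in>Mor (Idx Y). \<forall>(t, f)\<in>\<phi> (Dom (Idx Y) u).
                 (t, Cmp C (fmor (Dia Y) u) f) \<in> \<phi> (Cod (Idx Y) u))},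
     Dom = (\<lambda>(X, Y, \<phi>). X),
     Cod = (\<lambda>(X, Y, \<phi>). Y),
     Idn = (\<lambda>X. (X, X, \<lambda>s\<in>Ob (Idx X). germ C X s (Idn C (fob (Dia X) s)))),
     Cmp = (\<lambda>(Y', Z, \<psi>) (X, Y, \<phi>). (X, Z, \<lambda>r\<in>Ob (Idx Z).
              \<Union>(s, g)\<in>\<psi> r. \<Union>(t, f)\<in>\<phi> s. germ C X t (Cmp C g f)))\<rparr>"

definition germs :: "('u, 'o, 'm) parr \<Rightarrow> 'u \<Rightarrow> ('u \<times> 'm) set" where
  "germs \<phi> = snd (snd \<phi>)"


section \<open>The functors between the two categories\<close>

subsection \<open>The inclusion i\<close>

text \<open>Simplicial finite sets form a full subcategory of simplicial sets with the same
  representation of objects and morphisms, so the inclusion is the identity on objects and on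
  germs.\<close>

definition incl ::
  "(('u, ('u set, 'u setm) sob, ('u set, 'u setm) sarr) pob,
    ('u, ('u set, 'u setm) sob, ('u set, 'u setm) sarr) parr,
    ('u, ('u set, 'u setm) sob, ('u set, 'u setm) sarr) pob,
    ('u, ('u set, 'u setm) sob, ('u set, 'u setm) sarr) parr) ftr" where
  "incl = id_ftr"

subsection \<open>The functor F\<close>

definition level_pob :: "('u, ('o, 'm) sob, ('o, 'm) sarr) pob \<Rightarrow> nat \<Rightarrow> ('u, 'o, 'm) pob" where
  "level_pob X n =
    (Idx X, \<lparr>fob = (\<lambda>s\<in>Ob (Idx X). fob (fob (Dia X) s) n),
             fmor = (\<lambda>u\<in>Mor (Idx X). at_level (fmor (Dia X) u) n)\<rparr>)"

definition levelwise_ob ::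
  "('o, 'm) cat \<Rightarrow> ('u, ('o, 'm) sob, ('o, 'm) sarr) pob \<Rightarrow>
   (('u, 'o, 'm) pob, ('u, 'o, 'm) parr) sob" where
  "levelwise_ob C X =
    \<lparr>fob = level_pob X,
     fmor = (\<lambda>\<theta>\<in>Mor simplex_cat.
       (let n = Cod simplex_cat \<theta>; m = Dom simplex_cat \<theta> in
        (level_pob X n, level_pob X m,
         \<lambda>s\<in>Ob (Idx X). germ C (level_pob X n) s (fmor (fob (Dia X) s) \<theta>))))\<rparr>"

definition levelwise ::
  "('o, 'm) cat \<Rightarrow>
   (('u, ('o, 'm) sob, ('o, 'm) sarr) pob, ('u, ('o, 'm) sob, ('o, 'm) sarr) parr,
    (('u, 'o, 'm) pob, ('u, 'o, 'm) parr) sob, (('u, 'o, 'm) pob, ('u, 'o, 'm) parr) sarr) ftr" where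
  "levelwise C =
    \<lparr>fob = levelwise_ob C,
     fmor = (\<lambda>(X, Y, \<phi>). (levelwise_ob C X, levelwise_ob C Y,
       \<lambda>n. (level_pob X n, level_pob Y n,
         \<lambda>s\<in>Ob (Idx Y). \<Union>(t, f)\<in>\<phi> s. germ C (level_pob X n) t (at_level f n))))\<rparr>"

subsection \<open>The functor Fin\<close>

type_synonym 'u ssetob = "('u set, 'u setm) sob"
type_synonym 'u ssetarr = "('u set, 'u setm) sarr"

definition fin_quotients :: "'u ssetob \<Rightarrow> (nat \<Rightarrow> ('u \<times> 'u) set) set" where
  "fin_quotients X =
    {R. (\<forall>n. equiv (fob X n) (R n) \<and> finite (fob X n // R n)) \<and>
        (\<forall>\<theta>\<in>Mor simplex_cat. \<forall>(x, y)\<in>R (Cod simplex_cat \<theta>).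
           (apply_setm (fmor X \<theta>) x, apply_setm (fmor X \<theta>) y) \<in> R (Dom simplex_cat \<theta>))}"

text \<open>The quotient of \<open>X\<close> by \<open>R\<close>, formed on chosen representatives of the classes so that its
  elements again have type \<open>'u\<close>.\<close>

definition rep :: "(nat \<Rightarrow> ('u \<times> 'u) set) \<Rightarrow> nat \<Rightarrow> 'u \<Rightarrow> 'u" where
  "rep R n x = (SOME y. y \<in> R n `` {x})"

definition quotient_set :: "'u ssetob \<Rightarrow> (nat \<Rightarrow> ('u \<times> 'u) set) \<Rightarrow> nat \<Rightarrow> 'u set" where
  "quotient_set X R n = rep R n ` fob X n"

definition quotient_sset :: "'u ssetob \<Rightarrow> (nat \<Rightarrow> ('u \<times> 'u) set) \<Rightarrow> 'u ssetob" where
  "quotient_sset X R =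
    \<lparr>fob = quotient_set X R,
     fmor = (\<lambda>\<theta>\<in>Mor simplex_cat.
       (let n = Cod simplex_cat \<theta>; m = Dom simplex_cat \<theta> in
        (quotient_set X R n, quotient_set X R m,
         \<lambda>x\<in>quotient_set X R n. rep R m (apply_setm (fmor X \<theta>) x))))\<rparr>"

text \<open>The map \<open>X/Q \<rightarrow> Y/R\<close> induced by \<open>f : X \<rightarrow> Y\<close> when \<open>f\<close> maps \<open>Q\<close> into \<open>R\<close>.\<close>

definition quotient_map ::
  "'u ssetarr \<Rightarrow> (nat \<Rightarrow> ('u \<times> 'u) set) \<Rightarrow> (nat \<Rightarrow> ('u \<times> 'u) set) \<Rightarrow> 'u ssetarr" where
  "quotient_map f Q R =
    (let X = Dom (simp Sets) f; Y = Cod (simp Sets) f in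
     (quotient_sset X Q, quotient_sset Y R,
      \<lambda>n. (quotient_set X Q n, quotient_set Y R n,
           \<lambda>x\<in>quotient_set X Q n. rep R n (apply_setm (at_level f n) x))))"

definition quotient_cat ::
  "'u ssetob \<Rightarrow> (nat \<Rightarrow> ('u \<times> 'u) set,
                (nat \<Rightarrow> ('u \<times> 'u) set) \<times> (nat \<Rightarrow> ('u \<times> 'u) set)) cat" where
  "quotient_cat X =
    \<lparr>Ob = fin_quotients X,
     Mor = {(Q, R). Q \<in> fin_quotients X \<and> R \<in> fin_quotients X \<and> (\<forall>n. Q n \<subseteq> R n)},
     Dom = fst, Cod = snd, Idn = (\<lambda>R. (R, R)), Cmp = (\<lambda>g f. (fst f, snd g))\<rparr>"

text \<open>An isomorphic copy, with objects and morphisms of type \<open>'u\<close>, of a small category living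
  on other types.\<close>

definition code :: "'i set \<Rightarrow> 'i \<Rightarrow> 'u" where
  "code A = (SOME e. inj_on e A)"

definition decode :: "'i set \<Rightarrow> 'u \<Rightarrow> 'i" where
  "decode A = inv_into A (code A)"

definition copy_cat :: "('i, 'j) cat \<Rightarrow> ('u, 'u) cat" where
  "copy_cat J =
    \<lparr>Ob = code (Ob J) ` Ob J,
     Mor = code (Mor J) ` Mor J,
     Dom = (\<lambda>u. code (Ob J) (Dom J (decode (Mor J) u))),
     Cod = (\<lambda>u. code (Ob J) (Cod J (decode (Mor J) u))),
     Idn = (\<lambda>a. code (Mor J) (Idn J (decode (Ob J) a))),
     Cmp = (\<lambda>v u. code (Mor J) (Cmp J (decode (Mor J) v) (decode (Mor J) u)))\<rparr>"

definition Fin_const ::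
  "'u ssetob \<Rightarrow> ('u, 'u ssetob, 'u ssetarr) pob" where
  "Fin_const X =
    (copy_cat (quotient_cat X),
     \<lparr>fob = (\<lambda>s\<in>Ob (copy_cat (quotient_cat X)).
        quotient_sset X (decode (Ob (quotient_cat X)) s)),
      fmor = (\<lambda>u\<in>Mor (copy_cat (quotient_cat X)).
        case decode (Mor (quotient_cat X)) u of (Q, R) \<Rightarrow> quotient_map (Idn (simp Sets) X) Q R)\<rparr>)"

definition pullback_rel ::
  "'u ssetarr \<Rightarrow> (nat \<Rightarrow> ('u \<times> 'u) set) \<Rightarrow> nat \<Rightarrow> ('u \<times> 'u) set" where
  "pullback_rel f R n =
    {(x, y). x \<in> fob (Dom (simp Sets) f) n \<and> y \<in> fob (Dom (simp Sets) f) n \<and>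
       (apply_setm (at_level f n) x, apply_setm (at_level f n) y) \<in> R n}"

definition Fin_const_map ::
  "'u ssetarr \<Rightarrow> ('u, 'u ssetob, 'u ssetarr) parr" where
  "Fin_const_map f =
    (let X = Dom (simp Sets) f; Y = Cod (simp Sets) f in
     (Fin_const X, Fin_const Y,
      \<lambda>s\<in>Ob (Idx (Fin_const Y)).
        (let R = decode (Ob (quotient_cat Y)) s; Q = pullback_rel f R in
         germ (simp FinSets) (Fin_const X) (code (Ob (quotient_cat X)) Q) (quotient_map f Q R))))"

definition Fin_diagram ::
  "('u, 'u ssetob, 'u ssetarr) pob \<Rightarrow>
   ('u, 'u, ('u, 'u ssetob, 'u ssetarr) pob, ('u, 'u ssetob, 'u ssetarr) parr) ftr" where
  "Fin_diagram X =
    \<lparr>fob = (\<lambda>s. Fin_const (fob (Dia X) s)), fmor = (\<lambda>u. Fin_const_map (fmor (Dia X) u))\<rparr>"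

text \<open>Limits are unique only up to isomorphism, hence a predicate: \<open>T\<close> sends \<open>X\<close> to a limit of
  \<open>Fin_diagram X\<close>, and a morphism of pro-spaces to the morphism it induces on limits.\<close>

definition is_Fin ::
  "(('u, 'u ssetob, 'u ssetarr) pob, ('u, 'u ssetob, 'u ssetarr) parr,
    ('u, 'u ssetob, 'u ssetarr) pob, ('u, 'u ssetob, 'u ssetarr) parr) ftr \<Rightarrow> bool" where
  "is_Fin T \<longleftrightarrow> is_functor (pro (simp Sets)) (pro (simp FinSets)) T \<and>
     (\<exists>\<pi>. (\<forall>X\<in>Ob (pro (simp Sets)).
             is_limit (pro (simp FinSets)) (Idx X) (Fin_diagram X) (fob T X) (\<pi> X)) \<and>
          (\<forall>\<phi>\<in>Mor (pro (simp Sets)). \<forall>s\<in>Ob (Idx (Cod (pro (simp Sets)) \<phi>)).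
             \<forall>(t, f)\<in>germs \<phi> s.
               Cmp (pro (simp FinSets)) (\<pi> (Cod (pro (simp Sets)) \<phi>) s) (fmor T \<phi>) =
               Cmp (pro (simp FinSets)) (Fin_const_map f) (\<pi> (Dom (pro (simp Sets)) \<phi>) t)))"


section \<open>Cohomology\<close>

text \<open>A contravariant functor to abelian groups.\<close>

record ('o, 'm, 'g) presheaf =
  grp :: "'o \<Rightarrow> 'g monoid"
  pull :: "'m \<Rightarrow> 'g \<Rightarrow> 'g"

definition maps_to_Zmod :: "nat \<Rightarrow> ('u set, 'u setm, 'u \<Rightarrow> int) presheaf" where
  "maps_to_Zmod p =
    \<lparr>grp = (\<lambda>A. product_group A (\<lambda>_. integer_mod_group p)),
     pull = (\<lambda>(A, B, f) c. compose A c f)\<rparr>"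

subsection \<open>Filtered colimits over a pro-object\<close>

definition colim_class ::
  "('o, 'm, 'g) presheaf \<Rightarrow> ('u, 'o, 'm) pob \<Rightarrow> 'u \<Rightarrow> 'g \<Rightarrow> ('u \<times> 'g) set" where
  "colim_class P X s x =
    {(t, y). t \<in> Ob (Idx X) \<and> y \<in> carrier (grp P (fob (Dia X) t)) \<and>
       (\<exists>k\<in>Ob (Idx X). \<exists>u\<in>homs (Idx X) k s. \<exists>v\<in>homs (Idx X) k t.
          pull P (fmor (Dia X) u) x = pull P (fmor (Dia X) v) y)}"

text \<open>The extension of a presheaf to pro-objects by \<open>X \<mapsto> colim\<^sub>s P (X\<^sub>s)\<close>.\<close>

definition colim_presheaf ::
  "('o, 'm, 'g) presheaf \<Rightarrow>
   (('u, 'o, 'm) pob, ('u, 'o, 'm) parr, ('u \<times> 'g) set) presheaf" where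
  "colim_presheaf P =
    \<lparr>grp = (\<lambda>X.
       \<lparr>carrier = {colim_class P X s x |s x.
                     s \<in> Ob (Idx X) \<and> x \<in> carrier (grp P (fob (Dia X) s))},
        monoid.mult = (\<lambda>K L. \<Union>{colim_class P X s (x \<otimes>\<^bsub>grp P (fob (Dia X) s)\<^esub> y) |s x y.
                     (s, x) \<in> K \<and> (s, y) \<in> L}),
        one = (\<Union>s\<in>Ob (Idx X). colim_class P X s \<one>\<^bsub>grp P (fob (Dia X) s)\<^esub>)\<rparr>),
     pull = (\<lambda>(X, Y, \<phi>) K. \<Union>{colim_class P X t (pull P f y) |t f s y.
                     (s, y) \<in> K \<and> (t, f) \<in> \<phi> s})\<rparr>"

subsection \<open>The cochain complex of a simplicial object\<close>

definition coboundary ::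
  "('o, 'm, 'g) presheaf \<Rightarrow> ('o, 'm) sob \<Rightarrow> nat \<Rightarrow> 'g \<Rightarrow> 'g" where
  "coboundary P X n c =
    finprod (grp P (fob X (Suc n)))
      (\<lambda>i. pull P (fmor X (face n i)) c [^]\<^bsub>grp P (fob X (Suc n))\<^esub> ((-1) ^ i :: int))
      {..Suc n}"

definition cocycles :: "('o, 'm, 'g) presheaf \<Rightarrow> ('o, 'm) sob \<Rightarrow> nat \<Rightarrow> 'g set" where
  "cocycles P X n = kernel (grp P (fob X n)) (grp P (fob X (Suc n))) (coboundary P X n)"

definition coboundaries :: "('o, 'm, 'g) presheaf \<Rightarrow> ('o, 'm) sob \<Rightarrow> nat \<Rightarrow> 'g set" where
  "coboundaries P X n =
    (case n of 0 \<Rightarrow> {\<one>\<^bsub>grp P (fob X 0)\<^esub>}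
             | Suc m \<Rightarrow> coboundary P X m ` carrier (grp P (fob X m)))"

definition cohomology ::
  "('o, 'm, 'g) presheaf \<Rightarrow> nat \<Rightarrow> (('o, 'm) sob, ('o, 'm) sarr, 'g set) presheaf" where
  "cohomology P n =
    \<lparr>grp = (\<lambda>X. (grp P (fob X n))\<lparr>carrier := cocycles P X n\<rparr> Mod coboundaries P X n),
     pull = (\<lambda>(X, Y, \<alpha>) K. coboundaries P X n <#>\<^bsub>grp P (fob X n)\<^esub> pull P (\<alpha> n) ` K)\<rparr>"

definition inverted_by ::
  "('o, 'm) cat \<Rightarrow> (nat \<Rightarrow> ('o, 'm, 'g) presheaf) \<Rightarrow> 'm set" where
  "inverted_by C H =
    {f \<in> Mor C. \<forall>n. pull (H n) f \<in> iso (grp (H n) (Cod C f)) (grp (H n) (Dom C f))}"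

definition H_pro_sset ::
  "nat \<Rightarrow> nat \<Rightarrow> (('u, 'u ssetob, 'u ssetarr) pob, ('u, 'u ssetob, 'u ssetarr) parr,
                 ('u \<times> ('u \<Rightarrow> int) set) set) presheaf" where
  "H_pro_sset p n = colim_presheaf (cohomology (maps_to_Zmod p) n)"

text \<open>Since \<open>\<int>/p\<close> is a constant pro-object, \<open>Hom (P, \<int>/p)\<close> in pro-finite sets is the colimit
  over \<open>s\<close> of the groups of maps \<open>P\<^sub>s \<rightarrow> \<int>/p\<close>, so \<open>colim_presheaf (maps_to_Zmod p)\<close> gives the
  continuous cochains.\<close>

definition H_simp_pro_fin ::
  "nat \<Rightarrow> nat \<Rightarrow>
   ((('u, 'u set, 'u setm) pob, ('u, 'u set, 'u setm) parr) sob,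
    (('u, 'u set, 'u setm) pob, ('u, 'u set, 'u setm) parr) sarr,
    ('u \<times> ('u \<Rightarrow> int)) set set) presheaf" where
  "H_simp_pro_fin p n = cohomology (colim_presheaf (maps_to_Zmod p)) n"

end

(*
Write C^n(X; Z/p) for the mod p cochains. On pro-objects they form the filtered colimit of the
cochains of the stages, and as filtered colimits are exact, a map f of pro-simplicial finite sets
is a cohomology isomorphism if and only if F f is one. For every n the functor C^n is represented
by a simplicial finite set K. Hence a map of (pro-)objects that induces bijections on maps into K
induces isomorphisms of cochain complexes, and so is a weak equivalence. This applies to the unit
Z -> F G Z of the adjunction between G and F, and to the unit X -> Fin X, where a cochain on X_s
factors through a finite simplicial quotient of X_s since it corresponds to a map X_s -> K.
The counit G F Y -> Y is a weak equivalence by the triangle identity. On Ho(pro-sSet) the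
composite of the two functors is therefore isomorphic to the identity through the cospan
X -> Fin X <- G F Fin X, and on the other side through Z -> F G Z -> F Fin G Z.
*)
theory Submission
  imports Defs
begin

section \<open>Categories\<close>

text \<open>\<open>Fin\<close> and \<open>G\<close> are known only through universal properties, so
  nothing can be computed directly in a value of either. For \<open>Fin\<close> an explicit limit is
  built, indexed by all finite quotients of all stages, and results are transported along the
  comparison isomorphism with the given limit. For \<open>G\<close> no model is built: composition
  with the unit is bijective on maps into K, and the argument takes place inside K. The m-simplices
  of K are all functions from the operators n -> m to Z/p. A map into K is a family of coordinates,
  and naturality determines the family by its coordinate at the identity. Finiteness of the set of
  operators and of Z/p puts K among the simplicial finite sets, and it also allows all coordinates
  of a map into a level of K to be realised at a single stage of a pro-object. A natural
  transformation whose components are weak equivalences becomes a natural isomorphism between the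
  functors induced on localizations, because its naturality squares extend from morphisms to formal
  inverses; the homotopy categories are compared by this alone.\<close>

lemma homsI: "f \<in> Mor C \<Longrightarrow> Dom C f = a \<Longrightarrow> Cod C f = b \<Longrightarrow> f \<in> homs C a b"
  by (simp add: homs_def)

lemma homsD:
  assumes "f \<in> homs C a b"
  shows "f \<in> Mor C" "Dom C f = a" "Cod C f = b"
  using assms by (auto simp: homs_def)

lemma Mor_homs: "f \<in> Mor C \<Longrightarrow> f \<in> homs C (Dom C f) (Cod C f)"
  by (simp add: homs_def)

lemma cat_ob:
  assumes "is_cat C" "f \<in> homs C a b"
  shows "a \<in> Ob C" "b \<in> Ob C"
  using assms by (auto simp: is_cat_def homs_def)

lemma cat_id: "is_cat C \<Longrightarrow> a \<in> Ob C \<Longrightarrow> Idn C a \<in> homs C a a"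
  by (simp add: is_cat_def)

lemma cat_cmp: "is_cat C \<Longrightarrow> f \<in> homs C a b \<Longrightarrow> g \<in> homs C b c \<Longrightarrow> Cmp C g f \<in> homs C a c"
  by (auto simp: is_cat_def homs_def)

lemma cat_idr: "is_cat C \<Longrightarrow> f \<in> homs C a b \<Longrightarrow> Cmp C f (Idn C a) = f"
  by (auto simp: is_cat_def homs_def)

lemma cat_idl: "is_cat C \<Longrightarrow> f \<in> homs C a b \<Longrightarrow> Cmp C (Idn C b) f = f"
  by (auto simp: is_cat_def homs_def)

lemma cat_assoc:
  "is_cat C \<Longrightarrow> f \<in> homs C a b \<Longrightarrow> g \<in> homs C b c \<Longrightarrow> h \<in> homs C c d \<Longrightarrow>
    Cmp C h (Cmp C g f) = Cmp C (Cmp C h g) f"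
  by (auto simp: is_cat_def homs_def)

lemma is_catI:
  assumes "\<And>f. f \<in> Mor C \<Longrightarrow> Dom C f \<in> Ob C \<and> Cod C f \<in> Ob C"
    and "\<And>a. a \<in> Ob C \<Longrightarrow> Idn C a \<in> homs C a a"
    and "\<And>f g a b c. f \<in> homs C a b \<Longrightarrow> g \<in> homs C b c \<Longrightarrow> Cmp C g f \<in> homs C a c"
    and "\<And>f a b. f \<in> homs C a b \<Longrightarrow> Cmp C f (Idn C a) = f"
    and "\<And>f a b. f \<in> homs C a b \<Longrightarrow> Cmp C (Idn C b) f = f"
    and "\<And>f g h a b c d. f \<in> homs C a b \<Longrightarrow> g \<in> homs C b c \<Longrightarrow> h \<in> homs C c d \<Longrightarrow>
           Cmp C h (Cmp C g f) = Cmp C (Cmp C h g) f"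
  shows "is_cat C"
  unfolding is_cat_def using assms by (auto simp: homs_def)

lemma ftr_ob: "is_functor A C T \<Longrightarrow> a \<in> Ob A \<Longrightarrow> fob T a \<in> Ob C"
  by (simp add: is_functor_def)

lemma ftr_mor: "is_functor A C T \<Longrightarrow> f \<in> homs A a b \<Longrightarrow> fmor T f \<in> homs C (fob T a) (fob T b)"
  by (auto simp: is_functor_def homs_def)

lemma ftr_id: "is_functor A C T \<Longrightarrow> a \<in> Ob A \<Longrightarrow> fmor T (Idn A a) = Idn C (fob T a)"
  by (simp add: is_functor_def)

lemma ftr_cmp:
  "is_functor A C T \<Longrightarrow> f \<in> homs A a b \<Longrightarrow> g \<in> homs A b c \<Longrightarrow>
    fmor T (Cmp A g f) = Cmp C (fmor T g) (fmor T f)"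
  by (auto simp: is_functor_def homs_def)

lemma is_functorI:
  assumes "\<And>a. a \<in> Ob A \<Longrightarrow> fob T a \<in> Ob C"
    and "\<And>f a b. f \<in> homs A a b \<Longrightarrow> fmor T f \<in> homs C (fob T a) (fob T b)"
    and "\<And>a. a \<in> Ob A \<Longrightarrow> fmor T (Idn A a) = Idn C (fob T a)"
    and "\<And>f g a b c. f \<in> homs A a b \<Longrightarrow> g \<in> homs A b c \<Longrightarrow>
           fmor T (Cmp A g f) = Cmp C (fmor T g) (fmor T f)"
  shows "is_functor A C T"
  unfolding is_functor_def using assms by (auto simp: homs_def)

lemma comp_ftr_sel [simp]:
  "fob (comp_ftr S T) a = fob S (fob T a)" "fmor (comp_ftr S T) f = fmor S (fmor T f)"
  by (simp_all add: comp_ftr_def)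

lemma id_ftr_sel [simp]: "fob id_ftr a = a" "fmor id_ftr f = f"
  by (simp_all add: id_ftr_def)

lemma is_functor_comp:
  assumes "is_functor A B T" "is_functor B C S"
  shows "is_functor A C (comp_ftr S T)"
proof (rule is_functorI)
  fix f g a b c assume f: "f \<in> homs A a b" and g: "g \<in> homs A b c"
  show "fmor (comp_ftr S T) (Cmp A g f) = Cmp C (fmor (comp_ftr S T) g) (fmor (comp_ftr S T) f)"
    using ftr_cmp[OF assms(1) f g] ftr_cmp[OF assms(2) ftr_mor[OF assms(1) f] ftr_mor[OF assms(1) g]]
    by simp
qed (auto intro: ftr_ob[OF assms(1)] ftr_ob[OF assms(2)] ftr_mor[OF assms(1)] ftr_mor[OF assms(2)]
    simp: ftr_id[OF assms(1)] ftr_id[OF assms(2) ftr_ob[OF assms(1)]])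

lemma is_isoI:
  assumes "f \<in> homs C a b" "g \<in> homs C b a" "Cmp C g f = Idn C a" "Cmp C f g = Idn C b"
  shows "is_iso C f"
  using assms unfolding is_iso_def by (auto simp: homs_def)

lemma op_cat_sel [simp]:
  "Ob (op_cat C) = Ob C" "Mor (op_cat C) = Mor C" "Dom (op_cat C) = Cod C" "Cod (op_cat C) = Dom C"
  "Idn (op_cat C) = Idn C" "Cmp (op_cat C) g f = Cmp C f g"
  by (simp_all add: op_cat_def)

lemma homs_op_cat [simp]: "homs (op_cat C) a b = homs C b a"
  by (auto simp: homs_def)

lemma is_cat_op [simp]: "is_cat C \<Longrightarrow> is_cat (op_cat C)"
proof (rule is_catI)
  fix f g h a b c d assume C: "is_cat C" and
    "f \<in> homs (op_cat C) a b" "g \<in> homs (op_cat C) b c" "h \<in> homs (op_cat C) c d"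
  then show "Cmp (op_cat C) h (Cmp (op_cat C) g f) = Cmp (op_cat C) (Cmp (op_cat C) h g) f"
    using cat_assoc[OF C, of h d c g b f a] by simp
qed (auto intro: cat_id cat_cmp simp: cat_idl cat_idr, auto simp: is_cat_def)

section \<open>Natural transformations and functor categories\<close>

definition nat_trans ::
  "('a, 'f) cat \<Rightarrow> ('o, 'm) cat \<Rightarrow> ('a, 'f, 'o, 'm) ftr \<Rightarrow> ('a, 'f, 'o, 'm) ftr \<Rightarrow> ('a \<Rightarrow> 'm) \<Rightarrow> bool" where
  "nat_trans A C S T \<alpha> \<longleftrightarrow> (\<forall>a\<in>Ob A. \<alpha> a \<in> homs C (fob S a) (fob T a)) \<and>
     (\<forall>f\<in>Mor A. Cmp C (\<alpha> (Cod A f)) (fmor S f) = Cmp C (fmor T f) (\<alpha> (Dom A f)))"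

lemma functor_cat_Ob:
  "T \<in> Ob (functor_cat A C) \<longleftrightarrow>
     is_functor A C T \<and> fob T \<in> extensional (Ob A) \<and> fmor T \<in> extensional (Mor A)"
  by (simp add: functor_cat_def Let_def)

lemma functor_cat_homs:
  "f \<in> homs (functor_cat A C) S T \<longleftrightarrow>
     (\<exists>\<alpha>. f = (S, T, \<alpha>) \<and> S \<in> Ob (functor_cat A C) \<and> T \<in> Ob (functor_cat A C) \<and>
        \<alpha> \<in> extensional (Ob A) \<and> nat_trans A C S T \<alpha>)"
  by (auto simp: functor_cat_def Let_def homs_def nat_trans_def)

lemma functor_cat_sel [simp]:
  "Dom (functor_cat A C) = (\<lambda>(S, T, \<alpha>). S)"
  "Cod (functor_cat A C) = (\<lambda>(S, T, \<alpha>). T)"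
  "Idn (functor_cat A C) = (\<lambda>T. (T, T, \<lambda>a\<in>Ob A. Idn C (fob T a)))"
  "Cmp (functor_cat A C) = (\<lambda>(S', T', \<beta>) (S, T, \<alpha>). (S, T', \<lambda>a\<in>Ob A. Cmp C (\<beta> a) (\<alpha> a)))"
  by (simp_all add: functor_cat_def Let_def)

lemma nat_transD:
  assumes "nat_trans A C S T \<alpha>"
  shows "a \<in> Ob A \<Longrightarrow> \<alpha> a \<in> homs C (fob S a) (fob T a)"
    and "f \<in> homs A a b \<Longrightarrow> Cmp C (\<alpha> b) (fmor S f) = Cmp C (fmor T f) (\<alpha> a)"
  using assms by (auto simp: nat_trans_def homs_def)

lemma nat_transI:
  assumes "\<And>a. a \<in> Ob A \<Longrightarrow> \<alpha> a \<in> homs C (fob S a) (fob T a)"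
    and "\<And>f a b. f \<in> homs A a b \<Longrightarrow> Cmp C (\<alpha> b) (fmor S f) = Cmp C (fmor T f) (\<alpha> a)"
  shows "nat_trans A C S T \<alpha>"
  using assms by (auto simp: nat_trans_def homs_def)

lemma nat_trans_cmp:
  assumes C: "is_cat C" and A: "is_cat A" and S: "is_functor A C S" and T: "is_functor A C T"
    and U: "is_functor A C U" and a: "nat_trans A C S T \<alpha>" and b: "nat_trans A C T U \<beta>"
  shows "nat_trans A C S U (\<lambda>a\<in>Ob A. Cmp C (\<beta> a) (\<alpha> a))"
proof (rule nat_transI)
  fix x assume "x \<in> Ob A"
  then show "(\<lambda>a\<in>Ob A. Cmp C (\<beta> a) (\<alpha> a)) x \<in> homs C (fob S x) (fob U x)"
    using cat_cmp[OF C nat_transD(1)[OF a] nat_transD(1)[OF b], of x] by simp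
next
  fix f x y assume f: "f \<in> homs A x y"
  have xy: "x \<in> Ob A" "y \<in> Ob A" using cat_ob[OF A f] by auto
  note Sf = ftr_mor[OF S f] and Tf = ftr_mor[OF T f] and Uf = ftr_mor[OF U f]
  note ax = nat_transD(1)[OF a xy(1)] and ay = nat_transD(1)[OF a xy(2)]
  note bx = nat_transD(1)[OF b xy(1)] and yb = nat_transD(1)[OF b xy(2)]
  have "Cmp C (Cmp C (\<beta> y) (\<alpha> y)) (fmor S f) = Cmp C (\<beta> y) (Cmp C (\<alpha> y) (fmor S f))"
    using cat_assoc[OF C Sf ay yb] by simp
  also have "\<dots> = Cmp C (\<beta> y) (Cmp C (fmor T f) (\<alpha> x))" using nat_transD(2)[OF a f] by simp
  also have "\<dots> = Cmp C (Cmp C (\<beta> y) (fmor T f)) (\<alpha> x)" using cat_assoc[OF C ax Tf yb] by simp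
  also have "\<dots> = Cmp C (Cmp C (fmor U f) (\<beta> x)) (\<alpha> x)" using nat_transD(2)[OF b f] by simp
  also have "\<dots> = Cmp C (fmor U f) (Cmp C (\<beta> x) (\<alpha> x))" using cat_assoc[OF C ax bx Uf] by simp
  finally show "Cmp C ((\<lambda>a\<in>Ob A. Cmp C (\<beta> a) (\<alpha> a)) y) (fmor S f) =
      Cmp C (fmor U f) ((\<lambda>a\<in>Ob A. Cmp C (\<beta> a) (\<alpha> a)) x)"
    using xy by simp
qed

lemma is_cat_functor_cat [simp]:
  assumes A: "is_cat A" and C: "is_cat C"
  shows "is_cat (functor_cat A C)"
proof (rule is_catI)
  fix f assume "f \<in> Mor (functor_cat A C)"
  then show "Dom (functor_cat A C) f \<in> Ob (functor_cat A C) \<and> Cod (functor_cat A C) f \<in> Ob (functor_cat A C)"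
    by (auto simp: functor_cat_def Let_def)
next
  fix T assume T: "T \<in> Ob (functor_cat A C)"
  then have F: "is_functor A C T" by (simp add: functor_cat_Ob)
  have "nat_trans A C T T (\<lambda>a\<in>Ob A. Idn C (fob T a))"
    by (rule nat_transI) (auto intro: cat_id[OF C] ftr_ob[OF F] simp: cat_ob[OF A]
        cat_idr[OF C ftr_mor[OF F]] cat_idl[OF C ftr_mor[OF F]])
  then show "Idn (functor_cat A C) T \<in> homs (functor_cat A C) T T"
    using T by (simp add: functor_cat_homs)
next
  fix f g R S T assume "f \<in> homs (functor_cat A C) R S" "g \<in> homs (functor_cat A C) S T"
  then show "Cmp (functor_cat A C) g f \<in> homs (functor_cat A C) R T"
    using nat_trans_cmp[OF C A] by (auto simp: functor_cat_homs functor_cat_Ob)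
next
  fix f S T assume "f \<in> homs (functor_cat A C) S T"
  then obtain \<alpha> where f: "f = (S, T, \<alpha>)" and e: "\<alpha> \<in> extensional (Ob A)" and n: "nat_trans A C S T \<alpha>"
    by (auto simp: functor_cat_homs)
  \<comment> \<open>The composite is \<open>undefined\<close> outside \<open>Ob A\<close>, and by
    extensionality so is the given family. Hence the identity laws hold as equalities of HOL
    functions and not merely object by object.\<close>
  have "(\<lambda>a\<in>Ob A. Cmp C (\<alpha> a) ((\<lambda>a\<in>Ob A. Idn C (fob S a)) a)) = \<alpha>"
    by (rule extensionalityI[OF _ e]) (auto simp: cat_idr[OF C nat_transD(1)[OF n]])
  then show "Cmp (functor_cat A C) f (Idn (functor_cat A C) S) = f" using f by simp
  have "(\<lambda>a\<in>Ob A. Cmp C ((\<lambda>a\<in>Ob A. Idn C (fob T a)) a) (\<alpha> a)) = \<alpha>"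
    by (rule extensionalityI[OF _ e]) (auto simp: cat_idl[OF C nat_transD(1)[OF n]])
  then show "Cmp (functor_cat A C) (Idn (functor_cat A C) T) f = f" using f by simp
next
  fix f g h R S T U
  assume "f \<in> homs (functor_cat A C) R S" "g \<in> homs (functor_cat A C) S T"
    "h \<in> homs (functor_cat A C) T U"
  then obtain \<alpha> \<beta> \<gamma> where *: "f = (R, S, \<alpha>)" "g = (S, T, \<beta>)" "h = (T, U, \<gamma>)"
    "nat_trans A C R S \<alpha>" "nat_trans A C S T \<beta>" "nat_trans A C T U \<gamma>"
    by (auto simp: functor_cat_homs)
  have "Cmp C (\<gamma> a) (Cmp C (\<beta> a) (\<alpha> a)) = Cmp C (Cmp C (\<gamma> a) (\<beta> a)) (\<alpha> a)" if "a \<in> Ob A" for a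
    using cat_assoc[OF C] nat_transD(1)[OF *(4) that] nat_transD(1)[OF *(5) that]
      nat_transD(1)[OF *(6) that] by metis
  then show "Cmp (functor_cat A C) h (Cmp (functor_cat A C) g f) =
      Cmp (functor_cat A C) (Cmp (functor_cat A C) h g) f"
    using * by auto
qed

section \<open>Categories of sets and the simplex category\<close>

lemma sets_cat_sel [simp]:
  "Ob (sets_cat P) = {A. P A}"
  "Mor (sets_cat P) = {(A, B, f). P A \<and> P B \<and> f \<in> A \<rightarrow>\<^sub>E B}"
  "Dom (sets_cat P) = (\<lambda>(A, B, f). A)"
  "Cod (sets_cat P) = (\<lambda>(A, B, f). B)"
  "Idn (sets_cat P) = (\<lambda>A. (A, A, \<lambda>x\<in>A. x))"
  "Cmp (sets_cat P) = (\<lambda>(B', C, g) (A, B, f). (A, C, compose A g f))"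
  by (simp_all add: sets_cat_def)

lemma sets_cat_homs:
  "f \<in> homs (sets_cat P) A B \<longleftrightarrow> (\<exists>h. f = (A, B, h) \<and> P A \<and> P B \<and> h \<in> A \<rightarrow>\<^sub>E B)"
  by (auto simp: homs_def)

lemma is_cat_sets_cat [simp]: "is_cat (sets_cat P)"
proof (rule is_catI)
  fix f g A B C assume "f \<in> homs (sets_cat P) A B" "g \<in> homs (sets_cat P) B C"
  then show "Cmp (sets_cat P) g f \<in> homs (sets_cat P) A C"
    by (auto simp: sets_cat_homs compose_def) (metis PiE_mem)
next
  fix f g h A B C D
  assume "f \<in> homs (sets_cat P) A B" "g \<in> homs (sets_cat P) B C" "h \<in> homs (sets_cat P) C D"
  then show "Cmp (sets_cat P) h (Cmp (sets_cat P) g f) = Cmp (sets_cat P) (Cmp (sets_cat P) h g) f"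
    by (auto simp: sets_cat_homs compose_def fun_eq_iff)
next
  fix f A B assume "f \<in> homs (sets_cat P) A B"
  then show "Cmp (sets_cat P) f (Idn (sets_cat P) A) = f" "Cmp (sets_cat P) (Idn (sets_cat P) B) f = f"
    by (fastforce simp: sets_cat_homs compose_def fun_eq_iff PiE_def extensional_def Pi_def)+
qed (auto simp: sets_cat_homs)

lemma simplex_cat_sel [simp]:
  "Ob simplex_cat = UNIV"
  "Mor simplex_cat = {(m, n, \<theta>). \<theta> \<in> {..m} \<rightarrow>\<^sub>E {..n} \<and> mono_on {..m} \<theta>}"
  "Dom simplex_cat = (\<lambda>(m, n, \<theta>). m)"
  "Cod simplex_cat = (\<lambda>(m, n, \<theta>). n)"
  "Idn simplex_cat = (\<lambda>n. (n, n, \<lambda>k\<in>{..n}. k))"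
  "Cmp simplex_cat = (\<lambda>(n', q, \<eta>) (m, n, \<theta>). (m, q, compose {..m} \<eta> \<theta>))"
  by (simp_all add: simplex_cat_def)

lemma simplex_cat_homs:
  "f \<in> homs simplex_cat m n \<longleftrightarrow> (\<exists>\<theta>. f = (m, n, \<theta>) \<and> \<theta> \<in> {..m} \<rightarrow>\<^sub>E {..n} \<and> mono_on {..m} \<theta>)"
  by (auto simp: homs_def)

lemma is_cat_simplex_cat [simp]: "is_cat simplex_cat"
proof (rule is_catI)
  fix f g A B C assume "f \<in> homs simplex_cat A B" "g \<in> homs simplex_cat B C"
  then show "Cmp simplex_cat g f \<in> homs simplex_cat A C"
    by (fastforce simp: simplex_cat_homs compose_def mono_on_def PiE_def Pi_def)
next
  fix f g h A B C D
  assume "f \<in> homs simplex_cat A B" "g \<in> homs simplex_cat B C" "h \<in> homs simplex_cat C D"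
  then show "Cmp simplex_cat h (Cmp simplex_cat g f) = Cmp simplex_cat (Cmp simplex_cat h g) f"
    by (auto simp: simplex_cat_homs compose_def fun_eq_iff PiE_def Pi_def)
next
  fix f A B assume "f \<in> homs simplex_cat A B"
  then show "Cmp simplex_cat f (Idn simplex_cat A) = f" "Cmp simplex_cat (Idn simplex_cat B) f = f"
    by (fastforce simp: simplex_cat_homs compose_def fun_eq_iff PiE_def extensional_def Pi_def)+
qed (auto simp: simplex_cat_homs mono_on_def)

text \<open>An operator is a function between finite ordinals. This finiteness keeps the coefficient
  object K finite in each degree, makes the quotient defined by a cochain finite, and lets all
  coordinates of a map into K live at one stage of a pro-object.\<close>

lemma finite_simplex_homs: "finite (homs simplex_cat m n)"
proof -
  have "homs simplex_cat m n \<subseteq> (\<lambda>\<theta>. (m, n, \<theta>)) ` ({..m} \<rightarrow>\<^sub>E {..n})"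
    by (auto simp: simplex_cat_homs)
  then show ?thesis by (rule finite_subset) (auto intro: finite_PiE)
qed

lemma face_homs: "face n i \<in> homs simplex_cat n (Suc n)"
  by (auto simp: face_def simplex_cat_homs mono_on_def)

section \<open>Simplicial objects\<close>

lemma is_cat_simp [simp]: "is_cat C \<Longrightarrow> is_cat (simp C)"
  by (simp add: simp_def)

lemma simp_homs:
  "f \<in> homs (simp C) S T \<longleftrightarrow>
     (\<exists>\<alpha>. f = (S, T, \<alpha>) \<and> S \<in> Ob (simp C) \<and> T \<in> Ob (simp C) \<and>
        nat_trans (op_cat simplex_cat) C S T \<alpha>)"
  by (auto simp: simp_def functor_cat_homs)

text \<open>Every natural number is an object of the simplex category, so extensionality is a
  condition on the action of the operators only.\<close>

lemma simp_Ob: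
  "X \<in> Ob (simp C) \<longleftrightarrow>
    is_functor (op_cat simplex_cat) C X \<and> fmor X \<in> extensional (Mor simplex_cat)"
  by (simp add: simp_def functor_cat_Ob)

lemma simp_sel [simp]:
  "Dom (simp C) = (\<lambda>(S, T, \<alpha>). S)"
  "Cod (simp C) = (\<lambda>(S, T, \<alpha>). T)"
  "Idn (simp C) = (\<lambda>T. (T, T, \<lambda>n. Idn C (fob T n)))"
  "Cmp (simp C) = (\<lambda>(S', T', \<beta>) (S, T, \<alpha>). (S, T', \<lambda>n. Cmp C (\<beta> n) (\<alpha> n)))"
  by (simp_all add: simp_def restrict_UNIV)

lemma simp_ob: "X \<in> Ob (simp C) \<Longrightarrow> fob X n \<in> Ob C"
  by (auto simp: simp_Ob dest: ftr_ob)

lemma simp_mor: "X \<in> Ob (simp C) \<Longrightarrow> \<theta> \<in> homs simplex_cat m n \<Longrightarrow> fmor X \<theta> \<in> homs C (fob X n) (fob X m)"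
  by (auto simp: simp_Ob dest: ftr_mor)

lemma simp_id: "X \<in> Ob (simp C) \<Longrightarrow> fmor X (Idn simplex_cat n) = Idn C (fob X n)"
  using ftr_id[of "op_cat simplex_cat" C X n] by (simp add: simp_Ob)

lemma simp_cmp:
  "X \<in> Ob (simp C) \<Longrightarrow> \<theta> \<in> homs simplex_cat l m \<Longrightarrow> \<eta> \<in> homs simplex_cat m n \<Longrightarrow>
    fmor X (Cmp simplex_cat \<eta> \<theta>) = Cmp C (fmor X \<theta>) (fmor X \<eta>)"
  using ftr_cmp[of "op_cat simplex_cat" C X \<eta> n m \<theta> l] by (simp add: simp_Ob)

lemma simp_ObI:
  assumes "\<And>n. fob X n \<in> Ob C"
    and "\<And>\<theta> m n. \<theta> \<in> homs simplex_cat m n \<Longrightarrow> fmor X \<theta> \<in> homs C (fob X n) (fob X m)"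
    and "\<And>n. fmor X (Idn simplex_cat n) = Idn C (fob X n)"
    and "\<And>\<theta> \<eta> l m n. \<theta> \<in> homs simplex_cat l m \<Longrightarrow> \<eta> \<in> homs simplex_cat m n \<Longrightarrow>
      fmor X (Cmp simplex_cat \<eta> \<theta>) = Cmp C (fmor X \<theta>) (fmor X \<eta>)"
    and "fmor X \<in> extensional (Mor simplex_cat)"
  shows "X \<in> Ob (simp C)"
  unfolding simp_Ob
  by (intro conjI is_functorI) (use assms in \<open>auto simp del: simplex_cat_sel simp: simplex_cat_sel(1)\<close>)

lemma at_level_simp [simp]: "at_level (X, Y, \<alpha>) n = \<alpha> n"
  by (simp add: at_level_def)

lemma simp_at_level: "f \<in> homs (simp C) X Y \<Longrightarrow> at_level f n \<in> homs C (fob X n) (fob Y n)"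
  by (auto simp: simp_homs dest: nat_transD(1))

lemma simp_natural:
  "f \<in> homs (simp C) X Y \<Longrightarrow> \<theta> \<in> homs simplex_cat m n \<Longrightarrow>
    Cmp C (at_level f m) (fmor X \<theta>) = Cmp C (fmor Y \<theta>) (at_level f n)"
  by (auto simp: simp_homs dest!: nat_transD(2)[where f = \<theta> and a = n and b = m])

lemma simp_homsI:
  assumes "X \<in> Ob (simp C)" "Y \<in> Ob (simp C)" "\<And>n. \<alpha> n \<in> homs C (fob X n) (fob Y n)"
    and "\<And>\<theta> m n. \<theta> \<in> homs simplex_cat m n \<Longrightarrow> Cmp C (\<alpha> m) (fmor X \<theta>) = Cmp C (fmor Y \<theta>) (\<alpha> n)"
  shows "(X, Y, \<alpha>) \<in> homs (simp C) X Y"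
  unfolding simp_homs using assms by (auto intro!: nat_transI simp del: simplex_cat_sel)

lemma at_level_Cmp: 
  "f \<in> homs (simp C) X Y \<Longrightarrow> g \<in> homs (simp C) Y Z \<Longrightarrow>
    at_level (Cmp (simp C) g f) n = Cmp C (at_level g n) (at_level f n)"
  by (auto simp: simp_homs)

lemma at_level_Idn [simp]: "at_level (Idn (simp C) X) n = Idn C (fob X n)"
  by simp

lemma simp_hom_eqI:
  "f \<in> homs (simp C) X Y \<Longrightarrow> g \<in> homs (simp C) X Y \<Longrightarrow> (\<And>n. at_level f n = at_level g n) \<Longrightarrow> f = g"
  by (auto simp: simp_homs)

section \<open>Filtered colimits and pro-categories\<close>

text \<open>The record \<open>presheaf\<close> carries no laws. Functoriality on underlying sets is
  separated from the group structure so that hom sets, which carry no group structure, fall under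
  the same colimit arguments as cochain groups.\<close>

definition set_presheaf :: "('o, 'm) cat \<Rightarrow> ('o, 'm, 'g) presheaf \<Rightarrow> bool" where
  "set_presheaf C P \<longleftrightarrow>
     (\<forall>a b f x. f \<in> homs C a b \<longrightarrow> x \<in> carrier (grp P b) \<longrightarrow> pull P f x \<in> carrier (grp P a)) \<and>
     (\<forall>a x. a \<in> Ob C \<longrightarrow> x \<in> carrier (grp P a) \<longrightarrow> pull P (Idn C a) x = x) \<and>
     (\<forall>a b c f g x. f \<in> homs C a b \<longrightarrow> g \<in> homs C b c \<longrightarrow> x \<in> carrier (grp P c) \<longrightarrow>
        pull P (Cmp C g f) x = pull P f (pull P g x))"

lemma set_presheafD:
  assumes "set_presheaf C P"
  shows set_presheaf_mem: "f \<in> homs C a b \<Longrightarrow> x \<in> carrier (grp P b) \<Longrightarrow> pull P f x \<in> carrier (grp P a)"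
    and set_presheaf_id: "a \<in> Ob C \<Longrightarrow> x \<in> carrier (grp P a) \<Longrightarrow> pull P (Idn C a) x = x"
    and set_presheaf_cmp: "f \<in> homs C a b \<Longrightarrow> g \<in> homs C b c \<Longrightarrow> x \<in> carrier (grp P c) \<Longrightarrow>
        pull P (Cmp C g f) x = pull P f (pull P g x)"
  using assms unfolding set_presheaf_def by blast+

text \<open>Through the representable presheaf, the germs in the definition of \<open>pro\<close> become an
  instance of the classes in a filtered colimit.\<close>

definition hom_presheaf :: "('o, 'm) cat \<Rightarrow> 'o \<Rightarrow> ('o, 'm, 'm) presheaf" where
  "hom_presheaf C b =
     \<lparr>grp = (\<lambda>a. \<lparr>carrier = homs C a b, monoid.mult = undefined, one = undefined\<rparr>),
      pull = (\<lambda>f g. Cmp C g f)\<rparr>"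

lemma hom_presheaf_sel [simp]:
  "carrier (grp (hom_presheaf C b) a) = homs C a b" "pull (hom_presheaf C b) f g = Cmp C g f"
  by (simp_all add: hom_presheaf_def)

lemma set_presheaf_hom [simp]: "is_cat C \<Longrightarrow> set_presheaf C (hom_presheaf C b)"
  unfolding set_presheaf_def by (auto simp: cat_idr intro: cat_cmp cat_assoc)

lemma germ_eq_colim_class:
  assumes "f \<in> homs C a b"
  shows "germ C X i f = colim_class (hom_presheaf C b) X i f"
  using homsD[OF assms] by (auto simp: germ_def colim_class_def)

lemma pro_Ob: "X \<in> Ob (pro C) \<longleftrightarrow> is_pob C X"
  by (simp add: pro_def)

lemma pobD:
  assumes "is_pob C X"
  shows pob_cat: "is_cat (Idx X)" and pob_cofiltered: "cofiltered (Idx X)"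
    and pob_functor: "is_functor (Idx X) C (Dia X)"
    and pob_ob: "s \<in> Ob (Idx X) \<Longrightarrow> fob (Dia X) s \<in> Ob C"
    and pob_mor: "u \<in> homs (Idx X) s t \<Longrightarrow>
      fmor (Dia X) u \<in> homs C (fob (Dia X) s) (fob (Dia X) t)"
  using assms by (auto simp: is_pob_def functor_cat_Ob dest: ftr_mor ftr_ob)

lemma cofilteredD:
  assumes "cofiltered J"
  shows cofiltered_nonempty: "\<exists>i. i \<in> Ob J"
    and cofiltered_pair: "\<lbrakk>i \<in> Ob J; j \<in> Ob J\<rbrakk> \<Longrightarrow> \<exists>k u v. k \<in> Ob J \<and> u \<in> homs J k i \<and> v \<in> homs J k j"
    and cofiltered_par: "\<lbrakk>i \<in> Ob J; j \<in> Ob J; u \<in> homs J i j; v \<in> homs J i j\<rbrakk> \<Longrightarrow>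
      \<exists>k w. k \<in> Ob J \<and> w \<in> homs J k i \<and> Cmp J u w = Cmp J v w"
  using assms unfolding cofiltered_def by blast+

text \<open>The indices i and j are first dominated by a common one; the two resulting maps to l are
  then parallel and can be equalised.\<close>

lemma cofiltered_square:
  assumes J: "is_cat J" "cofiltered J" and u: "u \<in> homs J i l" and v: "v \<in> homs J j l"
  shows "\<exists>k a b. k \<in> Ob J \<and> a \<in> homs J k i \<and> b \<in> homs J k j \<and> Cmp J u a = Cmp J v b"
proof -
  have o: "i \<in> Ob J" "j \<in> Ob J" "l \<in> Ob J" using cat_ob[OF J(1)] u v by blast+
  obtain m a b where m: "m \<in> Ob J" "a \<in> homs J m i" "b \<in> homs J m j"
    using cofiltered_pair[OF J(2) o(1,2)] by blast
  have "Cmp J u a \<in> homs J m l" "Cmp J v b \<in> homs J m l"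
    using cat_cmp[OF J(1)] m u v by blast+
  then obtain k w where k: "k \<in> Ob J" "w \<in> homs J k m" "Cmp J (Cmp J u a) w = Cmp J (Cmp J v b) w"
    using cofiltered_par[OF J(2) m(1) o(3)] by blast
  then have "Cmp J u (Cmp J a w) = Cmp J v (Cmp J b w)"
    using cat_assoc[OF J(1) k(2) m(2) u] cat_assoc[OF J(1) k(2) m(3) v] by simp
  then show ?thesis using k m cat_cmp[OF J(1) k(2)] by blast
qed

locale colim =
  fixes C :: "('o, 'm) cat" and P :: "('o, 'm, 'g) presheaf" and X :: "('u, 'o, 'm) pob"
  assumes C: "is_cat C" and P: "set_presheaf C P" and X: "is_pob C X"
begin

abbreviation J where "J \<equiv> Idx X"
abbreviation car where "car s \<equiv> carrier (grp P (fob (Dia X) s))"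
abbreviation res where "res u \<equiv> pull P (fmor (Dia X) u)"
abbreviation cls where "cls \<equiv> colim_class P X"

lemmas J = pob_cat[OF X] pob_cofiltered[OF X]

lemma res_mem: "u \<in> homs J s t \<Longrightarrow> x \<in> car t \<Longrightarrow> res u x \<in> car s"
  using set_presheaf_mem[OF P pob_mor[OF X]] .

lemma res_cmp: "u \<in> homs J r s \<Longrightarrow> v \<in> homs J s t \<Longrightarrow> x \<in> car t \<Longrightarrow> res (Cmp J v u) x = res u (res v x)"
  by (simp add: ftr_cmp[OF pob_functor[OF X]] set_presheaf_cmp[OF P pob_mor[OF X] pob_mor[OF X]])

lemma res_id: "s \<in> Ob J \<Longrightarrow> x \<in> car s \<Longrightarrow> res (Idn J s) x = x"
  by (simp add: ftr_id[OF pob_functor[OF X]] set_presheaf_id[OF P pob_ob[OF X]])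

definition eqv :: "'u \<Rightarrow> 'g \<Rightarrow> 'u \<Rightarrow> 'g \<Rightarrow> bool" where
  "eqv s x t y \<longleftrightarrow> (\<exists>k u v. u \<in> homs J k s \<and> v \<in> homs J k t \<and> res u x = res v y)"

lemma mem_cls: "(t, y) \<in> cls s x \<longleftrightarrow> t \<in> Ob J \<and> y \<in> car t \<and> eqv s x t y"
  using cat_ob[OF J(1)] unfolding colim_class_def eqv_def by auto

lemma eqv_refl: "s \<in> Ob J \<Longrightarrow> eqv s x s x"
  unfolding eqv_def using cat_id[OF J(1)] by blast

lemma eqv_sym: "eqv s x t y \<Longrightarrow> eqv t y s x"
  unfolding eqv_def by metis

lemma eqv_trans:
  assumes "eqv r x s y" "eqv s y t z" "x \<in> car r" "y \<in> car s" "z \<in> car t"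
  shows "eqv r x t z"
proof -
  from assms obtain k u v where 1: "u \<in> homs J k r" "v \<in> homs J k s" "res u x = res v y"
    unfolding eqv_def by blast
  from assms obtain k' u' v' where 2: "u' \<in> homs J k' s" "v' \<in> homs J k' t" "res u' y = res v' z"
    unfolding eqv_def by blast
  \<comment> \<open>The two hypotheses restrict y to different stages k and k'. A square over s
    identifies these restrictions at l, and the chain of equalities can be run there.\<close>
  obtain l a b where 3: "a \<in> homs J l k" "b \<in> homs J l k'" "Cmp J v a = Cmp J u' b"
    using cofiltered_square[OF J 1(2) 2(1)] by blast
  have "res (Cmp J u a) x = res a (res u x)" using res_cmp[OF 3(1) 1(1)] assms by simp
  also have "\<dots> = res (Cmp J v a) y" using 1(3) res_cmp[OF 3(1) 1(2)] assms by simp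
  also have "\<dots> = res b (res u' y)" using 3 res_cmp[OF 3(2) 2(1)] assms by simp
  also have "\<dots> = res (Cmp J v' b) z" using 2(3) res_cmp[OF 3(2) 2(2)] assms by simp
  finally show ?thesis
    unfolding eqv_def using cat_cmp[OF J(1) 3(1) 1(1)] cat_cmp[OF J(1) 3(2) 2(2)] by blast
qed

lemma cls_eq_iff:
  assumes "s \<in> Ob J" "x \<in> car s" "t \<in> Ob J" "y \<in> car t"
  shows "cls s x = cls t y \<longleftrightarrow> eqv s x t y"
proof
  assume "cls s x = cls t y"
  then have "(t, y) \<in> cls s x" using assms eqv_refl by (simp add: mem_cls)
  then show "eqv s x t y" by (simp add: mem_cls)
next
  assume *: "eqv s x t y"
  have "(r, z) \<in> cls s x \<longleftrightarrow> (r, z) \<in> cls t y" for r z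
    unfolding mem_cls using eqv_trans[OF eqv_sym[OF *]] eqv_trans[OF *] assms by blast
  then show "cls s x = cls t y" by auto
qed

lemma cls_res:
  assumes "u \<in> homs J k s" "x \<in> car s"
  shows "cls k (res u x) = cls s x"
proof -
  have o: "k \<in> Ob J" "s \<in> Ob J" using cat_ob[OF J(1) assms(1)] by auto
  have "res (Idn J k) (res u x) = res u x" by (rule res_id[OF o(1) res_mem[OF assms]])
  then have "eqv k (res u x) s x" unfolding eqv_def using assms(1) cat_id[OF J(1) o(1)] by blast
  then show ?thesis using cls_eq_iff[OF o(1) res_mem[OF assms] o(2) assms(2)] by simp
qed

lemma cls_self: "s \<in> Ob J \<Longrightarrow> x \<in> car s \<Longrightarrow> (s, x) \<in> cls s x"
  by (simp add: mem_cls eqv_refl)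

lemma cls_mem_eq: "(t, y) \<in> cls s x \<Longrightarrow> s \<in> Ob J \<Longrightarrow> x \<in> car s \<Longrightarrow> cls t y = cls s x"
  using cls_eq_iff mem_cls by metis

definition colims :: "('u \<times> 'g) set set" where
  "colims = {cls s x |s x. s \<in> Ob J \<and> x \<in> car s}"

lemma colims_carrier: "carrier (grp (colim_presheaf P) X) = colims"
  by (simp add: colim_presheaf_def colims_def)

lemma colimsI: "s \<in> Ob J \<Longrightarrow> x \<in> car s \<Longrightarrow> cls s x \<in> colims"
  by (auto simp: colims_def)

lemma colimsE:
  assumes "K \<in> colims"
  obtains s x where "s \<in> Ob J" "x \<in> car s" "K = cls s x"
  using assms by (auto simp: colims_def)

lemma mem_colims: "K \<in> colims \<Longrightarrow> (s, x) \<in> K \<longleftrightarrow> s \<in> Ob J \<and> x \<in> car s \<and> K = cls s x"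
  using cls_mem_eq cls_self mem_cls by (elim colimsE) blast

text \<open>Both representatives are restricted to a common stage. The group operation of a colimit
  is computed on such pairs.\<close>

lemma colims2E:
  assumes "K \<in> colims" "L \<in> colims"
  obtains s x y where "s \<in> Ob J" "x \<in> car s" "y \<in> car s" "K = cls s x" "L = cls s y"
proof -
  obtain s x where s: "s \<in> Ob J" "x \<in> car s" "K = cls s x" using assms(1) by (rule colimsE)
  obtain t y where t: "t \<in> Ob J" "y \<in> car t" "L = cls t y" using assms(2) by (rule colimsE)
  obtain k u v where k: "k \<in> Ob J" "u \<in> homs J k s" "v \<in> homs J k t"
    using cofiltered_pair[OF J(2) s(1) t(1)] by blast
  show ?thesis
    by (rule that[OF k(1) res_mem[OF k(2) s(2)] res_mem[OF k(3) t(2)]]) (use cls_res k s t in simp_all)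
qed

end

section \<open>Morphisms and composition in the pro-category\<close>

lemma pro_homs:
  "\<phi> \<in> homs (pro C) X Y \<longleftrightarrow> fst \<phi> = X \<and> fst (snd \<phi>) = Y \<and> is_pob C X \<and> is_pob C Y \<and>
     germs \<phi> \<in> extensional (Ob (Idx Y)) \<and>
     (\<forall>s\<in>Ob (Idx Y). \<exists>t\<in>Ob (Idx X). \<exists>f\<in>homs C (fob (Dia X) t) (fob (Dia Y) s).
        germs \<phi> s = germ C X t f) \<and>
     (\<forall>u\<in>Mor (Idx Y). \<forall>(t, f)\<in>germs \<phi> (Dom (Idx Y) u).
        (t, Cmp C (fmor (Dia Y) u) f) \<in> germs \<phi> (Cod (Idx Y) u))"
  by (cases \<phi>) (auto simp: homs_def pro_def germs_def)

lemma pro_sel [simp]: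
  "Dom (pro C) = (\<lambda>(X, Y, \<phi>). X)"
  "Cod (pro C) = (\<lambda>(X, Y, \<phi>). Y)"
  "Idn (pro C) = (\<lambda>X. (X, X, \<lambda>s\<in>Ob (Idx X). germ C X s (Idn C (fob (Dia X) s))))"
  by (simp_all add: pro_def)

lemma germs_simp [simp]: "germs (X, Y, \<phi>) = \<phi>"
  by (simp add: germs_def)

context
  fixes C :: "('o, 'm) cat"
  assumes C: "is_cat C"
begin

lemma germ_eq_iff:
  assumes X: "is_pob C X" and "i \<in> Ob (Idx X)" "j \<in> Ob (Idx X)"
    and f: "f \<in> homs C (fob (Dia X) i) b" and g: "g \<in> homs C (fob (Dia X) j) b"
  shows "germ C X i f = germ C X j g \<longleftrightarrow>
    (\<exists>k u v. u \<in> homs (Idx X) k i \<and> v \<in> homs (Idx X) k j \<and>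
       Cmp C f (fmor (Dia X) u) = Cmp C g (fmor (Dia X) v))"
proof -
  interpret colim C "hom_presheaf C b" X by standard (use C X in auto)
  show ?thesis using cls_eq_iff[of i f j g] assms
    unfolding germ_eq_colim_class[OF f] germ_eq_colim_class[OF g] eqv_def by simp
qed

lemma mem_germ:
  assumes X: "is_pob C X" and i: "i \<in> Ob (Idx X)" and f: "f \<in> homs C (fob (Dia X) i) b"
  shows "(j, g) \<in> germ C X i f \<longleftrightarrow> j \<in> Ob (Idx X) \<and> g \<in> homs C (fob (Dia X) j) b \<and>
    germ C X i f = germ C X j g"
proof -
  interpret colim C "hom_presheaf C b" X by standard (use C X in auto)
  have "(j, g) \<in> cls i f \<longleftrightarrow> j \<in> Ob J \<and> g \<in> homs C (fob (Dia X) j) b \<and> cls i f = cls j g"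
    using mem_colims[OF colimsI[OF i], of f j g] f by auto
  then show ?thesis unfolding germ_eq_colim_class[OF f]
    using germ_eq_colim_class[of g C _ b X j] by auto
qed

lemma germ_res:
  assumes X: "is_pob C X" and u: "u \<in> homs (Idx X) k i" and f: "f \<in> homs C (fob (Dia X) i) b"
  shows "germ C X k (Cmp C f (fmor (Dia X) u)) = germ C X i f"
proof -
  interpret colim C "hom_presheaf C b" X by standard (use C X in auto)
  show ?thesis using cls_res[of u k i f] u f
    unfolding germ_eq_colim_class[OF f] germ_eq_colim_class[OF cat_cmp[OF C pob_mor[OF X u] f]] by simp
qed

lemma germ_cmp:
  assumes X: "is_pob C X" and i: "i \<in> Ob (Idx X)" and f: "f \<in> homs C (fob (Dia X) i) b"
    and m: "(j, g) \<in> germ C X i f" and h: "h \<in> homs C b c"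
  shows "(j, Cmp C h g) \<in> germ C X i (Cmp C h f)"
proof -
  have j: "j \<in> Ob (Idx X)" "g \<in> homs C (fob (Dia X) j) b" "germ C X i f = germ C X j g"
    using m mem_germ[OF X i f] by auto
  then obtain k u v where k: "u \<in> homs (Idx X) k i" "v \<in> homs (Idx X) k j"
    "Cmp C f (fmor (Dia X) u) = Cmp C g (fmor (Dia X) v)"
    using germ_eq_iff[OF X i j(1) f j(2)] by blast
  have "Cmp C (Cmp C h f) (fmor (Dia X) u) = Cmp C (Cmp C h g) (fmor (Dia X) v)"
    using cat_assoc[OF C pob_mor[OF X k(1)] f h] cat_assoc[OF C pob_mor[OF X k(2)] j(2) h] k(3) by simp
  then have "germ C X i (Cmp C h f) = germ C X j (Cmp C h g)"
    using germ_eq_iff[OF X i j(1) cat_cmp[OF C f h] cat_cmp[OF C j(2) h]] k(1,2) by blast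
  then show ?thesis using mem_germ[OF X i cat_cmp[OF C f h]] j(1) cat_cmp[OF C j(2) h] by simp
qed

lemma pro_homsD:
  assumes "\<phi> \<in> homs (pro C) X Y"
  shows "is_pob C X" "is_pob C Y" "\<phi> = (X, Y, germs \<phi>)"
  using assms by (auto simp: pro_homs germs_def prod_eq_iff)

lemma pro_rep:
  assumes "\<phi> \<in> homs (pro C) X Y" "s \<in> Ob (Idx Y)"
  shows "\<exists>t f. (t, f) \<in> germs \<phi> s"
proof -
  obtain t f where "t \<in> Ob (Idx X)" "f\<in>homs C (fob (Dia X) t) (fob (Dia Y) s)"
        "germs \<phi> s = germ C X t f" using assms unfolding pro_homs by blast
  then have "(t, f) \<in> germs \<phi> s" using mem_germ pro_homsD(1)[OF assms(1)] by metis
  then show ?thesis by blast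
qed

lemma pro_memD:
  assumes "\<phi> \<in> homs (pro C) X Y" "s \<in> Ob (Idx Y)" "(t, f) \<in> germs \<phi> s"
  shows "t \<in> Ob (Idx X)" "f \<in> homs C (fob (Dia X) t) (fob (Dia Y) s)" "germs \<phi> s = germ C X t f"
proof -
  obtain j g where "j \<in> Ob (Idx X)" "g\<in>homs C (fob (Dia X) j) (fob (Dia Y) s)"
        "germs \<phi> s = germ C X j g" using assms unfolding pro_homs by blast
  then show "t \<in> Ob (Idx X)" "f \<in> homs C (fob (Dia X) t) (fob (Dia Y) s)" "germs \<phi> s = germ C X t f"
    using mem_germ[OF pro_homsD(1)[OF assms(1)]] assms(3) by metis+
qed

lemma pro_compat:
  assumes "\<phi> \<in> homs (pro C) X Y" "u \<in> homs (Idx Y) s s'" "(t, f) \<in> germs \<phi> s"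
  shows "(t, Cmp C (fmor (Dia Y) u) f) \<in> germs \<phi> s'"
  using assms homsD[OF assms(2)] unfolding pro_homs by fastforce

text \<open>A germ is an equivalence class and is determined by any of its members, so one shared
  representative at each index suffices; elsewhere both families are
  \<open>undefined\<close>.\<close>

lemma pro_eqI:
  assumes p: "\<phi> \<in> homs (pro C) X Y" "\<psi> \<in> homs (pro C) X Y"
    and m: "\<And>s. s \<in> Ob (Idx Y) \<Longrightarrow> \<exists>t f. (t, f) \<in> germs \<phi> s \<and> (t, f) \<in> germs \<psi> s"
  shows "\<phi> = \<psi>"
proof -
  have "germs \<phi> = germs \<psi>"
  proof (rule extensionalityI)
    fix s assume s: "s \<in> Ob (Idx Y)"
    show "germs \<phi> s = germs \<psi> s" using m[OF s] pro_memD(3)[OF p(1) s] pro_memD(3)[OF p(2) s] by metis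
  qed (use p in \<open>auto simp: pro_homs\<close>)
  then show ?thesis using pro_homsD(3)[OF p(1)] pro_homsD(3)[OF p(2)] by metis
qed

text \<open>The definition of \<open>pro\<close> demands compatibility of every representative.
  Since postcomposition respects germs (\<open>germ_cmp\<close>), it is enough to test one chosen
  representative at each index.\<close>

lemma pro_homsI:
  assumes X: "is_pob C X" and Y: "is_pob C Y"
    and t: "\<And>s. s \<in> Ob (Idx Y) \<Longrightarrow> t s \<in> Ob (Idx X)"
    and f: "\<And>s. s \<in> Ob (Idx Y) \<Longrightarrow> f s \<in> homs C (fob (Dia X) (t s)) (fob (Dia Y) s)"
    and c: "\<And>u s s'. u \<in> homs (Idx Y) s s' \<Longrightarrow> s \<in> Ob (Idx Y) \<Longrightarrow> s' \<in> Ob (Idx Y) \<Longrightarrow>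
      germ C X (t s) (Cmp C (fmor (Dia Y) u) (f s)) = germ C X (t s') (f s')"
  shows "(X, Y, \<lambda>s\<in>Ob (Idx Y). germ C X (t s) (f s)) \<in> homs (pro C) X Y"
  unfolding pro_homs germs_simp
proof (intro conjI ballI)
  fix u assume "u \<in> Mor (Idx Y)"
  then have u: "u \<in> homs (Idx Y) (Dom (Idx Y) u) (Cod (Idx Y) u)" by (rule Mor_homs)
  note o = cat_ob[OF pob_cat[OF Y] u]
  show "case x of (ta, fa) \<Rightarrow> (ta, Cmp C (fmor (Dia Y) u) fa)
      \<in> (\<lambda>s\<in>Ob (Idx Y). germ C X (t s) (f s)) (Cod (Idx Y) u)"
    if "x \<in> (\<lambda>s\<in>Ob (Idx Y). germ C X (t s) (f s)) (Dom (Idx Y) u)" for x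
    using germ_cmp[OF X t f _ pob_mor[OF Y u]] that o c[OF u o] by (cases x) simp
qed (use X Y t f in auto)

lemma pro_mem_homsI:
  assumes X: "is_pob C X" and s: "s \<in> Ob (Idx Y)"
    and t: "t s \<in> Ob (Idx X)" and f: "f s \<in> homs C (fob (Dia X) (t s)) b"
  shows "(t s, f s) \<in> germs (X, Y, \<lambda>s\<in>Ob (Idx Y). germ C X (t s) (f s)) s"
  using mem_germ[OF X t f] s t f by simp

text \<open>Composition in \<open>pro\<close> is a union over all choices of representatives. All
  these choices give the same germ, so the union is that germ, and a composite may be computed from
  whichever representatives are at hand. Later computations with pro-morphisms rest on this.\<close>

lemma pro_Cmp_mem:
  assumes p: "\<phi> \<in> homs (pro C) X Y" and q: "\<psi> \<in> homs (pro C) Y Z" and r: "r \<in> Ob (Idx Z)"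
    and g: "(s, g) \<in> germs \<psi> r" and f: "(t, f) \<in> germs \<phi> s"
  shows "germs (Cmp (pro C) \<psi> \<phi>) r = germ C X t (Cmp C g f)"
    and "(t, Cmp C g f) \<in> germs (Cmp (pro C) \<psi> \<phi>) r"
proof -
  note X = pro_homsD(1)[OF p] and Y = pro_homsD(2)[OF p]
  note g' = pro_memD[OF q r g]
  note f' = pro_memD[OF p g'(1) f]
  have eq: "germ C X t' (Cmp C g2 f2) = germ C X t (Cmp C g f)"
    if g2: "(s', g2) \<in> germs \<psi> r" and f2: "(t', f2) \<in> germs \<phi> s'" for s' g2 t' f2
  proof -
    note g2' = pro_memD[OF q r g2]
    note f2' = pro_memD[OF p g2'(1) f2]
    obtain k u v where k: "u \<in> homs (Idx Y) k s'" "v \<in> homs (Idx Y) k s"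
      "Cmp C g2 (fmor (Dia Y) u) = Cmp C g (fmor (Dia Y) v)"
      using g2' g' germ_eq_iff[OF Y g2'(1) g'(1) g2'(2) g'(2)] by metis
    have kY: "k \<in> Ob (Idx Y)" using cat_ob[OF pob_cat[OF Y] k(1)] by simp
    obtain l h where h: "(l, h) \<in> germs \<phi> k" using pro_rep[OF p kY] by blast
    note h' = pro_memD[OF p kY h]
    note u = pob_mor[OF Y k(1)] and v = pob_mor[OF Y k(2)]
    have "(l, Cmp C (fmor (Dia Y) u) h) \<in> germs \<phi> s'" by (rule pro_compat[OF p k(1) h])
    then have "(l, Cmp C g2 (Cmp C (fmor (Dia Y) u) h)) \<in> germ C X t' (Cmp C g2 f2)"
      using germ_cmp[OF pro_homsD(1)[OF p] f2'(1,2) _ g2'(2)] f2'(3) by simp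
    then have 1: "germ C X t' (Cmp C g2 f2) = germ C X l (Cmp C g2 (Cmp C (fmor (Dia Y) u) h))"
      using mem_germ[OF X f2'(1) cat_cmp[OF C f2'(2) g2'(2)]] by simp
    have "(l, Cmp C (fmor (Dia Y) v) h) \<in> germs \<phi> s" by (rule pro_compat[OF p k(2) h])
    then have "(l, Cmp C g (Cmp C (fmor (Dia Y) v) h)) \<in> germ C X t (Cmp C g f)"
      using germ_cmp[OF pro_homsD(1)[OF p] f'(1,2) _ g'(2)] f'(3) by simp
    then have 2: "germ C X t (Cmp C g f) = germ C X l (Cmp C g (Cmp C (fmor (Dia Y) v) h))"
      using mem_germ[OF X f'(1) cat_cmp[OF C f'(2) g'(2)]] by simp
    have "Cmp C g2 (Cmp C (fmor (Dia Y) u) h) = Cmp C g (Cmp C (fmor (Dia Y) v) h)"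
      using cat_assoc[OF C h'(2) u g2'(2)] cat_assoc[OF C h'(2) v g'(2)] k(3) by simp
    then show ?thesis using 1 2 by simp
  qed
  have "germs (Cmp (pro C) \<psi> \<phi>) r = (\<Union>(s, g)\<in>germs \<psi> r. \<Union>(t, f)\<in>germs \<phi> s. germ C X t (Cmp C g f))"
    using pro_homsD(3)[OF p] pro_homsD(3)[OF q] r by (cases \<phi>; cases \<psi>) (auto simp: pro_def)
  also have "\<dots> = germ C X t (Cmp C g f)" using g f eq by fast
  finally show *: "germs (Cmp (pro C) \<psi> \<phi>) r = germ C X t (Cmp C g f)" .
  show "(t, Cmp C g f) \<in> germs (Cmp (pro C) \<psi> \<phi>) r"
    unfolding * using mem_germ[OF X f'(1) cat_cmp[OF C f'(2) g'(2)]] f'(1) cat_cmp[OF C f'(2) g'(2)] by simp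
qed

lemma pro_cmp:
  assumes p: "\<phi> \<in> homs (pro C) X Y" and q: "\<psi> \<in> homs (pro C) Y Z"
  shows "Cmp (pro C) \<psi> \<phi> \<in> homs (pro C) X Z"
  unfolding pro_homs
proof (intro conjI ballI)
  note X = pro_homsD(1)[OF p] and Y = pro_homsD(2)[OF p] and Z = pro_homsD(2)[OF q]
  show "fst (Cmp (pro C) \<psi> \<phi>) = X" "fst (snd (Cmp (pro C) \<psi> \<phi>)) = Z" "is_pob C X" "is_pob C Z"
    "germs (Cmp (pro C) \<psi> \<phi>) \<in> extensional (Ob (Idx Z))"
    using pro_homsD[OF p] pro_homsD[OF q] by (cases \<phi>; cases \<psi>; auto simp: pro_def)+
  have rep: "\<exists>s g t f. (s, g) \<in> germs \<psi> r \<and> (t, f) \<in> germs \<phi> s" if "r \<in> Ob (Idx Z)" for r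
    using pro_rep[OF q that] pro_memD(1)[OF q that] pro_rep[OF p] by metis
  fix r assume r: "r \<in> Ob (Idx Z)"
  obtain s g t f where gf: "(s, g) \<in> germs \<psi> r" "(t, f) \<in> germs \<phi> s" using rep[OF r] by blast
  note g' = pro_memD[OF q r gf(1)]
  note f' = pro_memD[OF p g'(1) gf(2)]
  show "\<exists>t\<in>Ob (Idx X). \<exists>f\<in>homs C (fob (Dia X) t) (fob (Dia Z) r). germs (Cmp (pro C) \<psi> \<phi>) r = germ C X t f"
    using pro_Cmp_mem(1)[OF p q r gf] f'(1) cat_cmp[OF C f'(2) g'(2)] by blast
next
  note X = pro_homsD(1)[OF p] and Y = pro_homsD(2)[OF p] and Z = pro_homsD(2)[OF q]
  fix u x assume "u \<in> Mor (Idx Z)" and x: "x \<in> germs (Cmp (pro C) \<psi> \<phi>) (Dom (Idx Z) u)"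
  then have u: "u \<in> homs (Idx Z) (Dom (Idx Z) u) (Cod (Idx Z) u)" by (simp add: Mor_homs)
  note o = cat_ob[OF pob_cat[OF Z] u]
  obtain s g where g: "(s, g) \<in> germs \<psi> (Dom (Idx Z) u)" using pro_rep[OF q o(1)] by blast
  note g' = pro_memD[OF q o(1) g]
  obtain t f where f: "(t, f) \<in> germs \<phi> s" using pro_rep[OF p g'(1)] by blast
  note f' = pro_memD[OF p g'(1) f]
  note uu = pob_mor[OF Z u]
  have "x \<in> germ C X t (Cmp C g f)" using x pro_Cmp_mem(1)[OF p q o(1) g f] by simp
  then have "(fst x, Cmp C (fmor (Dia Z) u) (snd x)) \<in> germ C X t (Cmp C (fmor (Dia Z) u) (Cmp C g f))"
    using germ_cmp[OF X f'(1) cat_cmp[OF C f'(2) g'(2)] _ uu, of "fst x" "snd x"] by simp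
  also have "Cmp C (fmor (Dia Z) u) (Cmp C g f) = Cmp C (Cmp C (fmor (Dia Z) u) g) f"
    by (rule cat_assoc[OF C f'(2) g'(2) uu])
  also have "germ C X t \<dots> = germs (Cmp (pro C) \<psi> \<phi>) (Cod (Idx Z) u)"
    using pro_Cmp_mem(1)[OF p q o(2) pro_compat[OF q u g] f] by simp
  finally show "case x of (t, f) \<Rightarrow> (t, Cmp C (fmor (Dia Z) u) f) \<in> germs (Cmp (pro C) \<psi> \<phi>) (Cod (Idx Z) u)"
    by (simp add: case_prod_unfold)
qed

lemma pro_id_mem:
  assumes X: "is_pob C X" and s: "s \<in> Ob (Idx X)"
  shows "(s, Idn C (fob (Dia X) s)) \<in> germs (Idn (pro C) X) s"
  using mem_germ[OF X s cat_id[OF C pob_ob[OF X s]]] s cat_id[OF C pob_ob[OF X s]] by simp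

lemma pro_id:
  assumes X: "is_pob C X"
  shows "Idn (pro C) X \<in> homs (pro C) X X"
  unfolding pro_sel
proof (rule pro_homsI[OF X X])
  fix u s s' assume u: "u \<in> homs (Idx X) s s'" and s: "s' \<in> Ob (Idx X)"
  have "Cmp C (fmor (Dia X) u) (Idn C (fob (Dia X) s)) = Cmp C (Idn C (fob (Dia X) s')) (fmor (Dia X) u)"
    using cat_idr[OF C pob_mor[OF X u]] cat_idl[OF C pob_mor[OF X u]] by simp
  then show "germ C X s (Cmp C (fmor (Dia X) u) (Idn C (fob (Dia X) s))) =
    germ C X s' (Idn C (fob (Dia X) s'))"
    using germ_res[OF X u cat_id[OF C pob_ob[OF X s]]] by simp
qed (auto intro: cat_id[OF C] pob_ob[OF X])

lemma is_cat_pro [simp]: "is_cat (pro C)"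
proof (rule is_catI)
  fix f :: "('u, 'o, 'm) parr" assume "f \<in> Mor (pro C)"
  then show "Dom (pro C) f \<in> Ob (pro C) \<and> Cod (pro C) f \<in> Ob (pro C)"
    by (auto simp: pro_def)
next
  fix X :: "('u, 'o, 'm) pob" assume "X \<in> Ob (pro C)"
  then show "Idn (pro C) X \<in> homs (pro C) X X" using pro_id unfolding pro_Ob by blast
next
  fix \<phi> \<psi> :: "('u, 'o, 'm) parr" and X Y Z
  assume "\<phi> \<in> homs (pro C) X Y" "\<psi> \<in> homs (pro C) Y Z"
  then show "Cmp (pro C) \<psi> \<phi> \<in> homs (pro C) X Z" by (rule pro_cmp)
next
  fix \<phi> :: "('u, 'o, 'm) parr" and X Y assume p: "\<phi> \<in> homs (pro C) X Y"
  note X = pro_homsD(1)[OF p] and Y = pro_homsD(2)[OF p]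
  show "Cmp (pro C) \<phi> (Idn (pro C) X) = \<phi>"
  proof (rule pro_eqI[OF pro_cmp[OF pro_id[OF X] p] p])
    fix s assume s: "s \<in> Ob (Idx Y)"
    obtain t f where f: "(t, f) \<in> germs \<phi> s" using pro_rep[OF p s] by blast
    note f' = pro_memD[OF p s f]
    show "\<exists>t f. (t, f) \<in> germs (Cmp (pro C) \<phi> (Idn (pro C) X)) s \<and> (t, f) \<in> germs \<phi> s"
      using pro_Cmp_mem(2)[OF pro_id[OF X] p s f pro_id_mem[OF X f'(1)]] cat_idr[OF C f'(2)] f by auto
  qed
  show "Cmp (pro C) (Idn (pro C) Y) \<phi> = \<phi>"
  proof (rule pro_eqI[OF pro_cmp[OF p pro_id[OF Y]] p])
    fix s assume s: "s \<in> Ob (Idx Y)"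
    obtain t f where f: "(t, f) \<in> germs \<phi> s" using pro_rep[OF p s] by blast
    note f' = pro_memD[OF p s f]
    show "\<exists>t f. (t, f) \<in> germs (Cmp (pro C) (Idn (pro C) Y) \<phi>) s \<and> (t, f) \<in> germs \<phi> s"
      using pro_Cmp_mem(2)[OF p pro_id[OF Y] s pro_id_mem[OF Y s] f] cat_idl[OF C f'(2)] f by auto
  qed
next
  fix \<phi> \<psi> \<chi> :: "('u, 'o, 'm) parr" and W X Y Z
  assume p: "\<phi> \<in> homs (pro C) W X" and q: "\<psi> \<in> homs (pro C) X Y" and r: "\<chi> \<in> homs (pro C) Y Z"
  show "Cmp (pro C) \<chi> (Cmp (pro C) \<psi> \<phi>) = Cmp (pro C) (Cmp (pro C) \<chi> \<psi>) \<phi>"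
  proof (rule pro_eqI[OF pro_cmp[OF pro_cmp[OF p q] r] pro_cmp[OF p pro_cmp[OF q r]]])
    fix s assume s: "s \<in> Ob (Idx Z)"
    obtain i f where f: "(i, f) \<in> germs \<chi> s" using pro_rep[OF r s] by blast
    note f' = pro_memD[OF r s f]
    obtain j g where g: "(j, g) \<in> germs \<psi> i" using pro_rep[OF q f'(1)] by blast
    note g' = pro_memD[OF q f'(1) g]
    obtain k h where h: "(k, h) \<in> germs \<phi> j" using pro_rep[OF p g'(1)] by blast
    note h' = pro_memD[OF p g'(1) h]
    show "\<exists>t k. (t, k) \<in> germs (Cmp (pro C) \<chi> (Cmp (pro C) \<psi> \<phi>)) s \<and>
        (t, k) \<in> germs (Cmp (pro C) (Cmp (pro C) \<chi> \<psi>) \<phi>) s"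
      using pro_Cmp_mem(2)[OF pro_cmp[OF p q] r s f pro_Cmp_mem(2)[OF p q f'(1) g h]]
        pro_Cmp_mem(2)[OF p pro_cmp[OF q r] s pro_Cmp_mem(2)[OF q r s f g] h]
        cat_assoc[OF C h'(2) g'(2) f'(2)] by auto
  qed
qed

end

section \<open>Presheaves of abelian groups\<close>

definition ab_presheaf :: "('o, 'm) cat \<Rightarrow> ('o, 'm, 'g) presheaf \<Rightarrow> bool" where
  "ab_presheaf C P \<longleftrightarrow> set_presheaf C P \<and> (\<forall>a\<in>Ob C. comm_group (grp P a)) \<and>
     (\<forall>a b f. f \<in> homs C a b \<longrightarrow> pull P f \<in> hom (grp P b) (grp P a))"

lemma ab_presheafD:
  assumes "ab_presheaf C P"
  shows ab_presheaf_set: "set_presheaf C P"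
    and ab_presheaf_grp: "a \<in> Ob C \<Longrightarrow> comm_group (grp P a)"
    and ab_presheaf_hom: "f \<in> homs C a b \<Longrightarrow> pull P f \<in> hom (grp P b) (grp P a)"
  using assms unfolding ab_presheaf_def by blast+

lemma hom_finprod:
  assumes G: "comm_group G" and H: "comm_group H" and h: "h \<in> hom G H"
    and A: "finite A" and f: "f \<in> A \<rightarrow> carrier G"
  shows "h (finprod G f A) = finprod H (\<lambda>i. h (f i)) A"
proof -
  interpret G: comm_group G by (rule G)
  interpret H: comm_group H by (rule H)
  interpret group_hom G H h
    by (simp add: group_hom_def group_hom_axioms_def h G.is_group H.is_group)
  show ?thesis using A f by (induction A rule: finite_induct) (auto simp: Pi_def)
qed

text \<open>As for composition, the defining union runs over all representatives, of the morphism
  and of the class, and collapses. \<open>rep\<close> varies the representative of the morphism;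
  \<open>eq\<close> varies that of the class as well, passing through a stage of Y where the two
  elements agree.\<close>

lemma pull_colim_class:
  assumes C: "is_cat C" and P: "set_presheaf C P" and p: "\<phi> \<in> homs (pro C) X Y"
    and s: "s \<in> Ob (Idx Y)" and f: "(t, f) \<in> germs \<phi> s" and y: "y \<in> carrier (grp P (fob (Dia Y) s))"
  shows "pull (colim_presheaf P) \<phi> (colim_class P Y s y) = colim_class P X t (pull P f y)"
proof -
  interpret X: colim C P X by standard (use C P pro_homsD(1)[OF C p] in auto)
  interpret Y: colim C P Y by standard (use C P pro_homsD(2)[OF C p] in auto)
  have mem: "t \<in> Ob X.J" "pull P f y \<in> X.car t" "f \<in> homs C (fob (Dia X) t) (fob (Dia Y) s)"
    if "s \<in> Ob Y.J" "(t, f) \<in> germs \<phi> s" "y \<in> Y.car s" for s t f y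
    using pro_memD[OF C p that(1,2)] set_presheaf_mem[OF P _ that(3)] by auto
  have rep: "X.cls t (pull P f y) = X.cls t' (pull P f' y)"
    if s: "s \<in> Ob Y.J" and f: "(t, f) \<in> germs \<phi> s" and f': "(t', f') \<in> germs \<phi> s" and y: "y \<in> Y.car s"
    for s t f t' f' y
  proof -
    note 1 = pro_memD[OF C p s f] and 2 = pro_memD[OF C p s f']
    then obtain k u v where k: "u \<in> homs X.J k t" "v \<in> homs X.J k t'"
      "Cmp C f (fmor (Dia X) u) = Cmp C f' (fmor (Dia X) v)"
      using germ_eq_iff[OF C X.X 1(1) 2(1) 1(2) 2(2)] by auto
    have "X.res u (pull P f y) = X.res v (pull P f' y)"
      using k set_presheaf_cmp[OF P pob_mor[OF X.X k(1)] 1(2) y]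
        set_presheaf_cmp[OF P pob_mor[OF X.X k(2)] 2(2) y] by simp
    then show ?thesis
      using X.cls_eq_iff[OF 1(1) mem(2)[OF s f y] 2(1) mem(2)[OF s f' y]] k(1,2)
      unfolding X.eqv_def by blast
  qed
  have eq: "X.cls t' (pull P f' y') = X.cls t (pull P f y)"
    if m: "(s', y') \<in> Y.cls s y" and f': "(t', f') \<in> germs \<phi> s'" for s' y' t' f'
  proof -
    have s': "s' \<in> Ob Y.J" "y' \<in> Y.car s'" "Y.eqv s y s' y'" using m unfolding Y.mem_cls by auto
    then obtain k u v where k: "u \<in> homs Y.J k s" "v \<in> homs Y.J k s'" "Y.res u y = Y.res v y'"
      unfolding Y.eqv_def by blast
    have ko: "k \<in> Ob Y.J" using cat_ob[OF Y.J(1) k(1)] by simp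
    obtain l h where h: "(l, h) \<in> germs \<phi> k" using pro_rep[OF C p ko] by blast
    note h' = pro_memD[OF C p ko h]
    have "X.cls t (pull P f y) = X.cls l (pull P (Cmp C (fmor (Dia Y) u) h) y)"
      by (rule rep[OF s f pro_compat[OF C p k(1) h] y])
    also have "\<dots> = X.cls l (pull P h (Y.res u y))"
      using set_presheaf_cmp[OF P h'(2) pob_mor[OF Y.X k(1)] y] by simp
    also have "\<dots> = X.cls l (pull P (Cmp C (fmor (Dia Y) v) h) y')"
      using set_presheaf_cmp[OF P h'(2) pob_mor[OF Y.X k(2)] s'(2)] k(3) by simp
    also have "\<dots> = X.cls t' (pull P f' y')"
      by (rule rep[OF s'(1) pro_compat[OF C p k(2) h] f' s'(2)])
    finally show ?thesis by simp
  qed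
  have "pull (colim_presheaf P) \<phi> (Y.cls s y) =
      \<Union>{X.cls t (pull P f y') |t f s' y'. (s', y') \<in> Y.cls s y \<and> (t, f) \<in> germs \<phi> s'}"
    using pro_homsD(3)[OF C p] by (cases \<phi>) (auto simp: colim_presheaf_def)
  also have "\<dots> = \<Union>{X.cls t (pull P f y)}"
    using eq Y.cls_self[OF s y] f by (intro arg_cong[where f = Union]) blast
  finally show ?thesis by simp
qed

locale ab_colim = colim C P X for C :: "('o, 'm) cat" and P :: "('o, 'm, 'g) presheaf" and X :: "('u, 'o, 'm) pob" +
  assumes AP: "ab_presheaf C P"
begin

abbreviation G where "G s \<equiv> grp P (fob (Dia X) s)"
abbreviation L where "L \<equiv> grp (colim_presheaf P) X"

lemma grpG: "s \<in> Ob J \<Longrightarrow> comm_group (G s)"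
  using ab_presheaf_grp[OF AP pob_ob[OF X]] .

lemma res_hom: "u \<in> homs J s t \<Longrightarrow> res u \<in> hom (G t) (G s)"
  using ab_presheaf_hom[OF AP pob_mor[OF X]] .

lemma mult_mem: "s \<in> Ob J \<Longrightarrow> x \<in> car s \<Longrightarrow> y \<in> car s \<Longrightarrow> x \<otimes>\<^bsub>G s\<^esub> y \<in> car s"
  using grpG by (simp add: comm_group_def Group.group.is_monoid monoid.m_closed)

lemma one_mem: "s \<in> Ob J \<Longrightarrow> \<one>\<^bsub>G s\<^esub> \<in> car s"
  using grpG by (simp add: comm_group_def Group.group.is_monoid monoid.one_closed)

lemma cls_mult:
  assumes s: "s \<in> Ob J" and x: "x \<in> car s" and y: "y \<in> car s"
  shows "cls s x \<otimes>\<^bsub>L\<^esub> cls s y = cls s (x \<otimes>\<^bsub>G s\<^esub> y)"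
proof -
  have eq: "cls t (x' \<otimes>\<^bsub>G t\<^esub> y') = cls s (x \<otimes>\<^bsub>G s\<^esub> y)"
    if "(t, x') \<in> cls s x" "(t, y') \<in> cls s y" for t x' y'
  proof -
    have t: "t \<in> Ob J" "x' \<in> car t" "y' \<in> car t" using that by (auto simp: mem_cls)
    from that obtain k u v where k: "u \<in> homs J k s" "v \<in> homs J k t" "res u x = res v x'"
      unfolding mem_cls eqv_def by blast
    from that obtain l u' v' where l: "u' \<in> homs J l s" "v' \<in> homs J l t" "res u' y = res v' y'"
      unfolding mem_cls eqv_def by blast
    \<comment> \<open>The two equalities come with different pairs of maps, while a single pair must
      witness both. The square makes the two maps to s agree; the further map w below makes the two
      maps to t agree as well.\<close>
    obtain m a b where m: "m \<in> Ob J" "a \<in> homs J m k" "b \<in> homs J m l" "Cmp J u a = Cmp J u' b"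
      using cofiltered_square[OF J k(1) l(1)] by blast
    obtain n w where n: "n \<in> Ob J" "w \<in> homs J n m" "Cmp J (Cmp J v a) w = Cmp J (Cmp J v' b) w"
      using cofiltered_par[OF J(2) m(1) t(1) cat_cmp[OF J(1) m(2) k(2)] cat_cmp[OF J(1) m(3) l(2)]] by blast
    define U where "U = Cmp J (Cmp J u a) w"
    define V where "V = Cmp J (Cmp J v a) w"
    note ua = cat_cmp[OF J(1) m(2) k(1)] and va = cat_cmp[OF J(1) m(2) k(2)]
      and ub = cat_cmp[OF J(1) m(3) l(1)] and vb = cat_cmp[OF J(1) m(3) l(2)]
    have U: "U \<in> homs J n s" and V: "V \<in> homs J n t"
      using cat_cmp[OF J(1) n(2)] ua va by (auto simp: U_def V_def)
    have "res U x = res V x'"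
      unfolding U_def V_def res_cmp[OF n(2) ua x] res_cmp[OF n(2) va t(2)]
        res_cmp[OF m(2) k(1) x] res_cmp[OF m(2) k(2) t(2)] k(3) by simp
    moreover have "res U y = res V y'"
      unfolding U_def V_def n(3) m(4) res_cmp[OF n(2) ub y] res_cmp[OF n(2) vb t(3)]
        res_cmp[OF m(3) l(1) y] res_cmp[OF m(3) l(2) t(3)] l(3) by simp
    ultimately have "res U (x \<otimes>\<^bsub>G s\<^esub> y) = res V (x' \<otimes>\<^bsub>G t\<^esub> y')"
      using hom_mult[OF res_hom[OF U] x y] hom_mult[OF res_hom[OF V] t(2,3)] by simp
    then show ?thesis
      using cls_eq_iff[OF s mult_mem[OF s x y] t(1) mult_mem[OF t]] U V unfolding eqv_def by blast
  qed
  have "cls s x \<otimes>\<^bsub>L\<^esub> cls s y =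
      \<Union>{cls t (x' \<otimes>\<^bsub>G t\<^esub> y') |t x' y'. (t, x') \<in> cls s x \<and> (t, y') \<in> cls s y}"
    by (simp add: colim_presheaf_def)
  also have "\<dots> = \<Union>{cls s (x \<otimes>\<^bsub>G s\<^esub> y)}"
    using eq cls_self[OF s] x y by (intro arg_cong[where f = Union]) blast
  finally show ?thesis by simp
qed

lemma cls_one:
  assumes s: "s \<in> Ob J"
  shows "\<one>\<^bsub>L\<^esub> = cls s \<one>\<^bsub>G s\<^esub>"
proof -
  have eq: "cls t \<one>\<^bsub>G t\<^esub> = cls s \<one>\<^bsub>G s\<^esub>" if t: "t \<in> Ob J" for t
  proof -
    obtain k u v where k: "k \<in> Ob J" "u \<in> homs J k s" "v \<in> homs J k t"
      using cofiltered_pair[OF J(2) s t] by blast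
    have g: "group (G r)" if "r \<in> Ob J" for r using grpG[OF that] by (simp add: comm_group_def)
    have "cls k (res u \<one>\<^bsub>G s\<^esub>) = cls s \<one>\<^bsub>G s\<^esub>" "cls k (res v \<one>\<^bsub>G t\<^esub>) = cls t \<one>\<^bsub>G t\<^esub>"
      using cls_res[OF k(2) one_mem[OF s]] cls_res[OF k(3) one_mem[OF t]] by auto
    moreover have "res u \<one>\<^bsub>G s\<^esub> = \<one>\<^bsub>G k\<^esub>" "res v \<one>\<^bsub>G t\<^esub> = \<one>\<^bsub>G k\<^esub>"
      using hom_one[OF res_hom[OF k(2)] g[OF s] g[OF k(1)]] hom_one[OF res_hom[OF k(3)] g[OF t] g[OF k(1)]]
      by auto
    ultimately show ?thesis by simp
  qed
  have "\<one>\<^bsub>L\<^esub> = (\<Union>t\<in>Ob J. cls t \<one>\<^bsub>G t\<^esub>)" by (simp add: colim_presheaf_def)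
  also have "\<dots> = cls s \<one>\<^bsub>G s\<^esub>" using eq s by blast
  finally show ?thesis .
qed

lemma comm_group_L: "comm_group L"
proof (rule comm_groupI, unfold colims_carrier)
  obtain r where r: "r \<in> Ob J" using cofiltered_nonempty[OF J(2)] by blast
  show "\<one>\<^bsub>L\<^esub> \<in> colims" using cls_one[OF r] colimsI[OF r one_mem[OF r]] by simp
next
  fix K M assume "K \<in> colims" "M \<in> colims"
  then obtain s x y where s: "s \<in> Ob J" "x \<in> car s" "y \<in> car s" "K = cls s x" "M = cls s y"
    by (rule colims2E)
  then show "K \<otimes>\<^bsub>L\<^esub> M \<in> colims" using cls_mult colimsI mult_mem by simp
  interpret comm_group "G s" by (rule grpG[OF s(1)])
  show "K \<otimes>\<^bsub>L\<^esub> M = M \<otimes>\<^bsub>L\<^esub> K" using s cls_mult m_comm by simp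
next
  fix K M N assume K: "K \<in> colims" and M: "M \<in> colims" and N: "N \<in> colims"
  obtain s x y where s: "s \<in> Ob J" "x \<in> car s" "y \<in> car s" "K = cls s x" "M = cls s y"
    using K M by (rule colims2E)
  obtain t z where t: "t \<in> Ob J" "z \<in> car t" "N = cls t z" using N by (rule colimsE)
  obtain k u v where k: "k \<in> Ob J" "u \<in> homs J k s" "v \<in> homs J k t"
    using cofiltered_pair[OF J(2) s(1) t(1)] by blast
  interpret comm_group "G k" by (rule grpG[OF k(1)])
  have e: "K = cls k (res u x)" "M = cls k (res u y)" "N = cls k (res v z)"
    using cls_res s t k by auto
  have m: "res u x \<in> car k" "res u y \<in> car k" "res v z \<in> car k"
    using res_mem s t k by auto
  show "K \<otimes>\<^bsub>L\<^esub> M \<otimes>\<^bsub>L\<^esub> N = K \<otimes>\<^bsub>L\<^esub> (M \<otimes>\<^bsub>L\<^esub> N)"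
    unfolding e using k(1) m cls_mult m_assoc by simp
next
  fix K assume "K \<in> colims"
  then obtain s x where s: "s \<in> Ob J" "x \<in> car s" "K = cls s x" by (rule colimsE)
  interpret comm_group "G s" by (rule grpG[OF s(1)])
  show "\<one>\<^bsub>L\<^esub> \<otimes>\<^bsub>L\<^esub> K = K" using s cls_one[OF s(1)] cls_mult[OF s(1) one_closed s(2)] by simp
  have "cls s (inv\<^bsub>G s\<^esub> x) \<otimes>\<^bsub>L\<^esub> K = \<one>\<^bsub>L\<^esub>"
    using s cls_one[OF s(1)] cls_mult[OF s(1) inv_closed[OF s(2)] s(2)] by simp
  then show "\<exists>y\<in>colims. y \<otimes>\<^bsub>L\<^esub> K = \<one>\<^bsub>L\<^esub>" using colimsI[OF s(1) inv_closed[OF s(2)]] by blast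
qed

end

lemma ab_colimI: "is_cat C \<Longrightarrow> ab_presheaf C P \<Longrightarrow> is_pob C X \<Longrightarrow> ab_colim C P X"
  by (simp add: ab_colim_def ab_colim_axioms_def colim_def ab_presheaf_set)

text \<open>The result is an \<open>ab_presheaf\<close> again, so colimits and cohomology can be
  formed one after the other in either order. The two orders are the two kinds of cohomology in the
  theorem.\<close>

lemma ab_presheaf_colim:
  assumes C: "is_cat C" and P: "ab_presheaf C P"
  shows "ab_presheaf (pro C) (colim_presheaf P :: (('u, 'o, 'm) pob, ('u, 'o, 'm) parr, ('u \<times> 'g) set) presheaf)"
proof -
  note PS = ab_presheaf_set[OF P]
  show ?thesis unfolding ab_presheaf_def set_presheaf_def
  proof (intro conjI allI impI ballI)
    fix X Y :: "('u, 'o, 'm) pob" and \<phi> assume p: "\<phi> \<in> homs (pro C) X Y"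
    interpret X: ab_colim C P X by (rule ab_colimI[OF C P pro_homsD(1)[OF C p]])
    interpret Y: ab_colim C P Y by (rule ab_colimI[OF C P pro_homsD(2)[OF C p]])
    have mem: "pull (colim_presheaf P) \<phi> x \<in> carrier X.L" if x: "x \<in> carrier Y.L" for x
    proof -
      obtain s y where s: "s \<in> Ob Y.J" "y \<in> Y.car s" "x = Y.cls s y"
        using x unfolding Y.colims_carrier by (rule Y.colimsE)
      obtain t f where f: "(t, f) \<in> germs \<phi> s" using pro_rep[OF C p s(1)] by blast
      note f' = pro_memD[OF C p s(1) f]
      show ?thesis
        using pull_colim_class[OF C PS p s(1) f s(2)] X.colimsI[OF f'(1)] set_presheaf_mem[OF PS f'(2) s(2)]
        by (simp add: s X.colims_carrier)
    qed
    then show "x \<in> carrier Y.L \<Longrightarrow> pull (colim_presheaf P) \<phi> x \<in> carrier X.L" for x .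
    show "pull (colim_presheaf P) \<phi> \<in> hom Y.L X.L"
    proof (rule homI[OF mem])
      fix x y assume "x \<in> carrier Y.L" "y \<in> carrier Y.L"
      then obtain s a b where s: "s \<in> Ob Y.J" "a \<in> Y.car s" "b \<in> Y.car s" "x = Y.cls s a" "y = Y.cls s b"
        unfolding Y.colims_carrier by (rule Y.colims2E)
      obtain t f where f: "(t, f) \<in> germs \<phi> s" using pro_rep[OF C p s(1)] by blast
      note f' = pro_memD[OF C p s(1) f]
      show "pull (colim_presheaf P) \<phi> (x \<otimes>\<^bsub>Y.L\<^esub> y) =
          pull (colim_presheaf P) \<phi> x \<otimes>\<^bsub>X.L\<^esub> pull (colim_presheaf P) \<phi> y"
        using s Y.cls_mult[OF s(1,2,3)] pull_colim_class[OF C PS p s(1) f] Y.mult_mem[OF s(1,2,3)]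
          hom_mult[OF ab_presheaf_hom[OF P f'(2)] s(2,3)] X.cls_mult[OF f'(1)] set_presheaf_mem[OF PS f'(2)]
        by simp
    qed
  next
    fix X :: "('u, 'o, 'm) pob" and x assume "X \<in> Ob (pro C)" and x: "x \<in> carrier (grp (colim_presheaf P) X)"
    then have X: "is_pob C X" by (simp add: pro_Ob)
    interpret X: ab_colim C P X by (rule ab_colimI[OF C P X])
    obtain s y where s: "s \<in> Ob X.J" "y \<in> X.car s" "x = X.cls s y"
      using x unfolding X.colims_carrier by (rule X.colimsE)
    show "pull (colim_presheaf P) (Idn (pro C) X) x = x"
      using pull_colim_class[OF C PS pro_id[OF C X] s(1) pro_id_mem[OF C X s(1)] s(2)]
        set_presheaf_id[OF PS pob_ob[OF X s(1)] s(2)] s by simp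
  next
    fix X Y Z :: "('u, 'o, 'm) pob" and \<phi> \<psi> x
    assume p: "\<phi> \<in> homs (pro C) X Y" and q: "\<psi> \<in> homs (pro C) Y Z"
      and x: "x \<in> carrier (grp (colim_presheaf P) Z)"
    interpret Z: ab_colim C P Z by (rule ab_colimI[OF C P pro_homsD(2)[OF C q]])
    obtain r z where r: "r \<in> Ob Z.J" "z \<in> Z.car r" "x = Z.cls r z"
      using x unfolding Z.colims_carrier by (rule Z.colimsE)
    obtain s g where g: "(s, g) \<in> germs \<psi> r" using pro_rep[OF C q r(1)] by blast
    note g' = pro_memD[OF C q r(1) g]
    obtain t f where f: "(t, f) \<in> germs \<phi> s" using pro_rep[OF C p g'(1)] by blast
    note f' = pro_memD[OF C p g'(1) f]
    show "pull (colim_presheaf P) (Cmp (pro C) \<psi> \<phi>) x =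
        pull (colim_presheaf P) \<phi> (pull (colim_presheaf P) \<psi> x)"
      using r pull_colim_class[OF C PS q r(1) g r(2)]
        pull_colim_class[OF C PS p g'(1) f set_presheaf_mem[OF PS g'(2) r(2)]]
        pull_colim_class[OF C PS pro_cmp[OF C p q] r(1) pro_Cmp_mem(2)[OF C p q r(1) g f] r(2)]
        set_presheaf_cmp[OF PS f'(2) g'(2) r(2)] by simp
  next
    fix X :: "('u, 'o, 'm) pob" assume "X \<in> Ob (pro C)"
    then interpret X: ab_colim C P X by (intro ab_colimI[OF C P]) (simp add: pro_Ob)
    show "comm_group (grp (colim_presheaf P) X)" by (rule X.comm_group_L)
  qed
qed

section \<open>Cohomology of simplicial objects\<close>

text \<open>The image of \<open>Z\<close> in \<open>G Mod B\<close>. As \<open>B\<close> is not required to be contained in \<open>Z\<close>, the identity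
  \<open>\<delta>\<delta> = 0\<close> is never needed.\<close>

definition coset_group :: "('g, 'a) monoid_scheme \<Rightarrow> 'g set \<Rightarrow> 'g set \<Rightarrow> 'g set monoid" where
  "coset_group G Z B = \<lparr>carrier = (\<lambda>z. B #>\<^bsub>G\<^esub> z) ` Z, monoid.mult = set_mult G, one = B\<rparr>"

lemma (in comm_group) coset_eq_iff:
  assumes B: "subgroup B G" and x: "x \<in> carrier G" and y: "y \<in> carrier G"
  shows "B #> x = B #> y \<longleftrightarrow> (\<exists>b\<in>B. x = b \<otimes> y)"
proof
  assume "B #> x = B #> y"
  then have "x \<in> B #> y" using rcos_self[OF x B] by simp
  then show "\<exists>b\<in>B. x = b \<otimes> y" by (auto simp: r_coset_def)
next
  assume "\<exists>b\<in>B. x = b \<otimes> y"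
  then have "x \<in> B #> y" by (auto simp: r_coset_def)
  then show "B #> x = B #> y" using repr_independence[OF _ y B] by metis
qed

lemma (in comm_group) coset_mult:
  assumes B: "subgroup B G" and x: "x \<in> carrier G" and y: "y \<in> carrier G"
  shows "(B #> x) <#> (B #> y) = B #> (x \<otimes> y)"
proof -
  interpret normal B G using B by (simp add: normal_iff_subgroup)
  show ?thesis using rcos_sum[OF x y] .
qed

lemma (in comm_group) comm_group_coset_group:
  assumes B: "subgroup B G" and Z: "subgroup Z G"
  shows "comm_group (coset_group G Z B)"
proof (rule comm_groupI)
  note c = subgroup.mem_carrier[OF Z]
  have one: "\<one>\<^bsub>coset_group G Z B\<^esub> = B #> \<one>"
    by (simp add: coset_group_def coset_mult_one[OF subgroup.subset[OF B]])
  have mult: "(B #> x) \<otimes>\<^bsub>coset_group G Z B\<^esub> (B #> y) = B #> (x \<otimes> y)" if "x \<in> Z" "y \<in> Z" for x y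
    using coset_mult[OF B] that c by (simp add: coset_group_def)
  have car: "carrier (coset_group G Z B) = (\<lambda>z. B #> z) ` Z" by (simp add: coset_group_def)
  show "\<one>\<^bsub>coset_group G Z B\<^esub> \<in> carrier (coset_group G Z B)"
    using one car subgroup.one_closed[OF Z] by auto
  fix x y assume "x \<in> carrier (coset_group G Z B)" "y \<in> carrier (coset_group G Z B)"
  then obtain a b where a: "a \<in> Z" "x = B #> a" and b: "b \<in> Z" "y = B #> b" using car by auto
  show "x \<otimes>\<^bsub>coset_group G Z B\<^esub> y \<in> carrier (coset_group G Z B)"
    using a b mult car subgroup.m_closed[OF Z] by auto
  show "x \<otimes>\<^bsub>coset_group G Z B\<^esub> y = y \<otimes>\<^bsub>coset_group G Z B\<^esub> x"
    using a b mult c m_comm by auto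
  show "\<one>\<^bsub>coset_group G Z B\<^esub> \<otimes>\<^bsub>coset_group G Z B\<^esub> x = x"
    using a mult[OF subgroup.one_closed[OF Z] a(1)] one c by auto
  have "(B #> inv a) \<otimes>\<^bsub>coset_group G Z B\<^esub> x = \<one>\<^bsub>coset_group G Z B\<^esub>"
    using a mult[OF subgroup.m_inv_closed[OF Z a(1)] a(1)] one c by auto
  then show "\<exists>y\<in>carrier (coset_group G Z B). y \<otimes>\<^bsub>coset_group G Z B\<^esub> x = \<one>\<^bsub>coset_group G Z B\<^esub>"
    using car subgroup.m_inv_closed[OF Z a(1)] by auto
  fix z assume "z \<in> carrier (coset_group G Z B)"
  then obtain d where d: "d \<in> Z" "z = B #> d" using car by auto
  show "x \<otimes>\<^bsub>coset_group G Z B\<^esub> y \<otimes>\<^bsub>coset_group G Z B\<^esub> z =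
      x \<otimes>\<^bsub>coset_group G Z B\<^esub> (y \<otimes>\<^bsub>coset_group G Z B\<^esub> z)"
    using a b d mult subgroup.m_closed[OF Z] c m_assoc by auto
qed

section \<open>Cochains, cocycles and coboundaries of one simplicial object\<close>

locale cochain_level =
  fixes C :: "('o, 'm) cat" and P :: "('o, 'm, 'g) presheaf" and X :: "('o, 'm) sob"
  assumes C: "is_cat C" and P: "ab_presheaf C P" and X: "X \<in> Ob (simp C)"
begin

abbreviation A where "A n \<equiv> grp P (fob X n)"
abbreviation d where "d \<equiv> coboundary P X"
abbreviation Z where "Z \<equiv> cocycles P X"
abbreviation B where "B \<equiv> coboundaries P X"

lemma grpA: "comm_group (A n)"
  using ab_presheaf_grp[OF P simp_ob[OF X]] .

lemma face_hom: "pull P (fmor X (face n i)) \<in> hom (A n) (A (Suc n))"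
  using ab_presheaf_hom[OF P simp_mor[OF X face_homs]] .

lemma d_hom: "d n \<in> hom (A n) (A (Suc n))"
proof -
  interpret G: comm_group "A n" by (rule grpA)
  interpret H: comm_group "A (Suc n)" by (rule grpA)
  have m: "pull P (fmor X (face n i)) x \<in> carrier (A (Suc n))" if "x \<in> carrier (A n)" for i x
    using hom_in_carrier[OF face_hom that] .
  show ?thesis
  proof (rule homI)
    fix x y assume x: "x \<in> carrier (A n)" and y: "y \<in> carrier (A n)"
    show "d n x \<in> carrier (A (Suc n))" unfolding coboundary_def using m[OF x] by (intro H.finprod_closed) auto
    show "d n (x \<otimes>\<^bsub>A n\<^esub> y) = d n x \<otimes>\<^bsub>A (Suc n)\<^esub> d n y"
      unfolding coboundary_def
      using m[OF x] m[OF y] hom_mult[OF face_hom x y]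
      by (subst H.finprod_multf[symmetric]) (auto simp: H.int_pow_distrib intro!: H.finprod_cong)
  qed
qed

lemma d_group_hom: "group_hom (A n) (A (Suc n)) (d n)"
  using grpA d_hom by (simp add: group_hom_def group_hom_axioms_def comm_group_def)

lemma Z_mem: "z \<in> Z n \<longleftrightarrow> z \<in> carrier (A n) \<and> d n z = \<one>\<^bsub>A (Suc n)\<^esub>"
  by (auto simp: cocycles_def kernel_def)

lemma Z_subgroup: "subgroup (Z n) (A n)"
  unfolding cocycles_def using group_hom.subgroup_kernel[OF d_group_hom] .

lemma B_mem: "b \<in> B n \<longleftrightarrow> (if n = 0 then b = \<one>\<^bsub>A 0\<^esub> else \<exists>c\<in>carrier (A (n - 1)). b = d (n - 1) c)"
  by (auto simp: coboundaries_def split: nat.split)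

lemma B_subgroup: "subgroup (B n) (A n)"
proof (cases n)
  case 0
  have "group (A 0)" using grpA by (simp add: comm_group_def)
  then show ?thesis using 0 by (simp add: coboundaries_def group.triv_subgroup)
next
  case (Suc m)
  then show ?thesis using group_hom.img_is_subgroup[OF d_group_hom] by (simp add: coboundaries_def)
qed

text \<open>Replacing the carrier by the cocycles leaves the multiplication unchanged, so the cosets
  in the subgroup of cocycles and those in the whole cochain group are the same sets.\<close>

lemma grp_cohomology: "grp (cohomology P n) X = coset_group (A n) (Z n) (B n)"
  by (auto simp: cohomology_def coset_group_def FactGroup_def RCOSETS_def r_coset_def set_mult_def fun_eq_iff)

lemma comm_group_cohomology: "comm_group (grp (cohomology P n) X)"
  unfolding grp_cohomology using comm_group.comm_group_coset_group[OF grpA B_subgroup Z_subgroup] .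

lemma carrier_cohomology: "carrier (grp (cohomology P n) X) = (\<lambda>z. B n #>\<^bsub>A n\<^esub> z) ` Z n"
  by (simp add: grp_cohomology coset_group_def)

lemma mult_cohomology:
  "x \<in> Z n \<Longrightarrow> y \<in> Z n \<Longrightarrow>
    (B n #>\<^bsub>A n\<^esub> x) \<otimes>\<^bsub>grp (cohomology P n) X\<^esub> (B n #>\<^bsub>A n\<^esub> y) = B n #>\<^bsub>A n\<^esub> (x \<otimes>\<^bsub>A n\<^esub> y)"
  using comm_group.coset_mult[OF grpA B_subgroup] by (simp add: grp_cohomology coset_group_def Z_mem)

lemma coset_eq: "x \<in> Z n \<Longrightarrow> y \<in> Z n \<Longrightarrow>
    B n #>\<^bsub>A n\<^esub> x = B n #>\<^bsub>A n\<^esub> y \<longleftrightarrow> (\<exists>b\<in>B n. x = b \<otimes>\<^bsub>A n\<^esub> y)"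
  using comm_group.coset_eq_iff[OF grpA B_subgroup] by (simp add: Z_mem)

end

section \<open>Induced maps on cochains and on cohomology\<close>

locale cochain_map =
  X: cochain_level C P X + Y: cochain_level C P Y
  for C :: "('o, 'm) cat" and P :: "('o, 'm, 'g) presheaf" and X Y :: "('o, 'm) sob" +
  fixes f assumes f: "f \<in> homs (simp C) X Y"
begin

abbreviation q where "q n \<equiv> pull P (at_level f n)"

lemma q_hom: "q n \<in> hom (Y.A n) (X.A n)"
  using ab_presheaf_hom[OF X.P simp_at_level[OF f]] .

lemma q_mem: "c \<in> carrier (Y.A n) \<Longrightarrow> q n c \<in> carrier (X.A n)"
  using hom_in_carrier[OF q_hom] .

lemma q_d:
  assumes c: "c \<in> carrier (Y.A n)"
  shows "q (Suc n) (Y.d n c) = X.d n (q n c)"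
proof -
  interpret HX: comm_group "X.A (Suc n)" by (rule X.grpA)
  interpret HY: comm_group "Y.A (Suc n)" by (rule Y.grpA)
  have m: "pull P (fmor Y (face n i)) c \<in> carrier (Y.A (Suc n))" for i
    using hom_in_carrier[OF Y.face_hom c] .
  have "pull P (at_level f (Suc n)) (pull P (fmor Y (face n i)) c) =
      pull P (fmor X (face n i)) (pull P (at_level f n) c)" for i
    using set_presheaf_cmp[OF ab_presheaf_set[OF X.P] simp_at_level[OF f] simp_mor[OF Y.X face_homs] c]
      set_presheaf_cmp[OF ab_presheaf_set[OF X.P] simp_mor[OF X.X face_homs] simp_at_level[OF f] c]
      simp_natural[OF f face_homs[of n i]] by metis
  then show ?thesis
    unfolding coboundary_def using m
    by (subst hom_finprod[OF Y.grpA X.grpA q_hom])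
       (auto simp: hom_int_pow[OF q_hom _ HY.is_group HX.is_group])
qed

lemma q_one: "q n \<one>\<^bsub>Y.A n\<^esub> = \<one>\<^bsub>X.A n\<^esub>"
  using hom_one[OF q_hom] X.grpA Y.grpA by (simp add: comm_group_def)

lemma q_Z: "z \<in> Y.Z n \<Longrightarrow> q n z \<in> X.Z n"
  using q_mem q_d[of z n] q_one[of "Suc n"] by (simp add: X.Z_mem Y.Z_mem)

lemma q_B: "b \<in> Y.B n \<Longrightarrow> q n b \<in> X.B n"
  using q_one[of 0] q_d q_mem by (cases n) (auto simp: X.B_mem Y.B_mem)

text \<open>The image of a coset of \<open>Y.B n\<close> lies in a coset of \<open>X.B n\<close>,
  because \<open>q\<close> preserves coboundaries, but it may be smaller. Multiplication by
  \<open>X.B n\<close> in the definition of \<open>pull\<close> fills it up to the whole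
  coset.\<close>

lemma pull_cohomology:
  assumes z: "z \<in> Y.Z n"
  shows "pull (cohomology P n) f (Y.B n #>\<^bsub>Y.A n\<^esub> z) = X.B n #>\<^bsub>X.A n\<^esub> q n z"
proof -
  interpret GX: comm_group "X.A n" by (rule X.grpA)
  interpret GY: comm_group "Y.A n" by (rule Y.grpA)
  have zc: "z \<in> carrier (Y.A n)" and qz: "q n z \<in> carrier (X.A n)"
    using z q_Z[OF z] by (auto simp: X.Z_mem Y.Z_mem)
  note XB = subgroup.mem_carrier[OF X.B_subgroup] and YB = subgroup.mem_carrier[OF Y.B_subgroup]
  have im: "q n (b \<otimes>\<^bsub>Y.A n\<^esub> z) = q n b \<otimes>\<^bsub>X.A n\<^esub> q n z" if "b \<in> Y.B n" for b
    using hom_mult[OF q_hom YB[OF that] zc] .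
  have f': "f = (X, Y, at_level f)" using f by (auto simp: simp_homs at_level_def)
  have "pull (cohomology P n) f (Y.B n #>\<^bsub>Y.A n\<^esub> z) =
      X.B n <#>\<^bsub>X.A n\<^esub> q n ` (Y.B n #>\<^bsub>Y.A n\<^esub> z)"
    by (subst f') (simp add: cohomology_def)
  also have "\<dots> = {a \<otimes>\<^bsub>X.A n\<^esub> (q n b \<otimes>\<^bsub>X.A n\<^esub> q n z) |a b. a \<in> X.B n \<and> b \<in> Y.B n}"
    using im by (auto simp: set_mult_def r_coset_def)
  also have "\<dots> = X.B n #>\<^bsub>X.A n\<^esub> q n z"
  proof -
    have "\<exists>b\<in>X.B n. a \<otimes>\<^bsub>X.A n\<^esub> (q n c \<otimes>\<^bsub>X.A n\<^esub> q n z) = b \<otimes>\<^bsub>X.A n\<^esub> q n z"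
      if a: "a \<in> X.B n" and c: "c \<in> Y.B n" for a c
      using subgroup.m_closed[OF X.B_subgroup a q_B[OF c]] GX.m_assoc[OF XB[OF a] XB[OF q_B[OF c]] qz]
      by metis
    moreover have "\<exists>a c. b \<otimes>\<^bsub>X.A n\<^esub> q n z = a \<otimes>\<^bsub>X.A n\<^esub> (q n c \<otimes>\<^bsub>X.A n\<^esub> q n z) \<and> a \<in> X.B n \<and> c \<in> Y.B n"
      if "b \<in> X.B n" for b
      using that subgroup.one_closed[OF Y.B_subgroup, of n] q_one[of n] GX.l_one[OF qz] by metis
    ultimately show ?thesis unfolding r_coset_def by blast
  qed
  finally show ?thesis .
qed

lemma cohomology_hom: "pull (cohomology P n) f \<in> hom (grp (cohomology P n) Y) (grp (cohomology P n) X)"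
proof (rule homI)
  fix x assume "x \<in> carrier (grp (cohomology P n) Y)"
  then obtain z where z: "z \<in> Y.Z n" "x = Y.B n #>\<^bsub>Y.A n\<^esub> z" unfolding Y.carrier_cohomology by auto
  show "pull (cohomology P n) f x \<in> carrier (grp (cohomology P n) X)"
    using pull_cohomology z q_Z unfolding X.carrier_cohomology by auto
  fix y assume "y \<in> carrier (grp (cohomology P n) Y)"
  then obtain w where w: "w \<in> Y.Z n" "y = Y.B n #>\<^bsub>Y.A n\<^esub> w" unfolding Y.carrier_cohomology by auto
  show "pull (cohomology P n) f (x \<otimes>\<^bsub>grp (cohomology P n) Y\<^esub> y) =
      pull (cohomology P n) f x \<otimes>\<^bsub>grp (cohomology P n) X\<^esub> pull (cohomology P n) f y"
    using z w pull_cohomology Y.mult_cohomology X.mult_cohomology q_Z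
      subgroup.m_closed[OF Y.Z_subgroup z(1) w(1)] hom_mult[OF q_hom]
    by (simp add: Y.Z_mem)
qed

text \<open>Three degrees are involved: surjectivity in degree n - 1 lifts coboundaries, bijectivity
  in degree n lifts and compares cochains, and injectivity in degree n + 1 shows that the lift of a
  cocycle is a cocycle.\<close>

lemma cohomology_iso:
  assumes bij: "\<And>n. bij_betw (q n) (carrier (Y.A n)) (carrier (X.A n))"
  shows "pull (cohomology P n) f \<in> iso (grp (cohomology P n) Y) (grp (cohomology P n) X)"
proof -
  have inj: "q m x = q m y \<Longrightarrow> x = y" if "x \<in> carrier (Y.A m)" "y \<in> carrier (Y.A m)" for m x y
    using bij[of m] that unfolding bij_betw_def inj_on_def by blast
  have sur: "\<exists>y\<in>carrier (Y.A m). x = q m y" if "x \<in> carrier (X.A m)" for m x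
    using bij[of m] that unfolding bij_betw_def by blast
  have surB: "\<exists>c\<in>Y.B n. b = q n c" if b: "b \<in> X.B n" for b
  proof (cases n)
    case 0
    then show ?thesis using b q_one[of 0] by (auto simp: X.B_mem Y.B_mem)
  next
    case (Suc m)
    then obtain a where a: "a \<in> carrier (X.A m)" "b = X.d m a" using b by (auto simp: X.B_mem)
    then obtain c where "c \<in> carrier (Y.A m)" "a = q m c" using sur by blast
    then have "Y.d m c \<in> Y.B n" "b = q n (Y.d m c)" using a Suc q_d by (auto simp: Y.B_mem)
    then show ?thesis by blast
  qed
  have surZ: "\<exists>w\<in>Y.Z n. z = q n w" if z: "z \<in> X.Z n" for z
  proof -
    obtain w where w: "w \<in> carrier (Y.A n)" "z = q n w" using sur z by (auto simp: X.Z_mem)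
    have "q (Suc n) (Y.d n w) = q (Suc n) \<one>\<^bsub>Y.A (Suc n)\<^esub>"
      using z w q_d q_one by (simp add: X.Z_mem)
    then have "Y.d n w = \<one>\<^bsub>Y.A (Suc n)\<^esub>"
      using inj hom_in_carrier[OF Y.d_hom w(1)] Y.grpA
      by (simp add: comm_group_def Group.group.is_monoid monoid.one_closed)
    then show ?thesis using w by (auto simp: Y.Z_mem)
  qed
  have "inj_on (pull (cohomology P n) f) (carrier (grp (cohomology P n) Y))"
  proof (rule inj_onI)
    fix x y assume x: "x \<in> carrier (grp (cohomology P n) Y)" and y: "y \<in> carrier (grp (cohomology P n) Y)"
      and eq: "pull (cohomology P n) f x = pull (cohomology P n) f y"
    obtain z where z: "z \<in> Y.Z n" "x = Y.B n #>\<^bsub>Y.A n\<^esub> z" using x unfolding Y.carrier_cohomology by auto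
    obtain w where w: "w \<in> Y.Z n" "y = Y.B n #>\<^bsub>Y.A n\<^esub> w" using y unfolding Y.carrier_cohomology by auto
    obtain b where b: "b \<in> X.B n" "q n z = b \<otimes>\<^bsub>X.A n\<^esub> q n w"
      using eq z w pull_cohomology X.coset_eq[OF q_Z q_Z] by auto
    obtain c where c: "c \<in> Y.B n" "b = q n c" using surB[OF b(1)] by blast
    interpret GY: comm_group "Y.A n" by (rule Y.grpA)
    have cc: "c \<in> carrier (Y.A n)" "z \<in> carrier (Y.A n)" "w \<in> carrier (Y.A n)"
      using subgroup.mem_carrier[OF Y.B_subgroup c(1)] z w by (auto simp: Y.Z_mem)
    have "q n z = q n (c \<otimes>\<^bsub>Y.A n\<^esub> w)" using b(2) c(2) hom_mult[OF q_hom cc(1,3)] by simp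
    then have "z = c \<otimes>\<^bsub>Y.A n\<^esub> w" using inj[OF cc(2) GY.m_closed[OF cc(1,3)]] by simp
    then show "x = y" using z w c Y.coset_eq by auto
  qed
  moreover have "pull (cohomology P n) f ` carrier (grp (cohomology P n) Y) = carrier (grp (cohomology P n) X)"
  proof -
    have "pull (cohomology P n) f ` carrier (grp (cohomology P n) Y) =
        (\<lambda>w. X.B n #>\<^bsub>X.A n\<^esub> q n w) ` Y.Z n"
      unfolding Y.carrier_cohomology image_image by (rule image_cong[OF refl pull_cohomology])
    also have "\<dots> = (\<lambda>z. X.B n #>\<^bsub>X.A n\<^esub> z) ` q n ` Y.Z n" by (simp add: image_image)
    also have "q n ` Y.Z n = X.Z n" using surZ q_Z by blast
    finally show ?thesis unfolding X.carrier_cohomology .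
  qed
  ultimately show ?thesis using cohomology_hom by (simp add: iso_def bij_betw_def)
qed

end

lemma cochain_mapI:
  assumes C: "is_cat C" and P: "ab_presheaf C P" and f: "f \<in> homs (simp C) X Y"
  shows "cochain_map C P X Y f"
  using C P f by (simp add: cochain_map_def cochain_map_axioms_def cochain_level_def cat_ob[OF is_cat_simp[OF C] f])

lemma ab_presheaf_cohomology:
  assumes C: "is_cat C" and P: "ab_presheaf C P"
  shows "ab_presheaf (simp C) (cohomology P n)"
  unfolding ab_presheaf_def set_presheaf_def
proof (intro conjI allI impI ballI)
  note PS = ab_presheaf_set[OF P]
  {
    fix X Y f assume f: "f \<in> homs (simp C) X Y"
    interpret cochain_map C P X Y f by (rule cochain_mapI[OF C P f])
    show "pull (cohomology P n) f \<in> hom (grp (cohomology P n) Y) (grp (cohomology P n) X)"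
      by (rule cohomology_hom)
    fix x assume "x \<in> carrier (grp (cohomology P n) Y)"
    then show "pull (cohomology P n) f x \<in> carrier (grp (cohomology P n) X)"
      using hom_in_carrier[OF cohomology_hom] by blast
  next
    fix X x assume X: "X \<in> Ob (simp C)" and x: "x \<in> carrier (grp (cohomology P n) X)"
    note i = cat_id[OF is_cat_simp[OF C] X]
    interpret cochain_map C P X X "Idn (simp C) X" by (rule cochain_mapI[OF C P i])
    obtain z where z: "z \<in> X.Z n" "x = X.B n #>\<^bsub>X.A n\<^esub> z" using x unfolding X.carrier_cohomology by auto
    then show "pull (cohomology P n) (Idn (simp C) X) x = x"
      using pull_cohomology[OF z(1)] set_presheaf_id[OF PS simp_ob[OF X]]
      by (simp only: at_level_Idn X.Z_mem)
  next
    fix X Y Z f g x assume f: "f \<in> homs (simp C) X Y" and g: "g \<in> homs (simp C) Y Z"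
      and x: "x \<in> carrier (grp (cohomology P n) Z)"
    interpret f: cochain_map C P X Y f by (rule cochain_mapI[OF C P f])
    interpret g: cochain_map C P Y Z g by (rule cochain_mapI[OF C P g])
    interpret gf: cochain_map C P X Z "Cmp (simp C) g f"
      by (rule cochain_mapI[OF C P cat_cmp[OF is_cat_simp[OF C] f g]])
    obtain z where z: "z \<in> g.Y.Z n" "x = g.Y.B n #>\<^bsub>g.Y.A n\<^esub> z" using x unfolding g.Y.carrier_cohomology by auto
    show "pull (cohomology P n) (Cmp (simp C) g f) x = pull (cohomology P n) f (pull (cohomology P n) g x)"
      using z gf.pull_cohomology[OF z(1)] g.pull_cohomology[OF z(1)] f.pull_cohomology[OF g.q_Z[OF z(1)]]
        set_presheaf_cmp[OF PS simp_at_level[OF f] simp_at_level[OF g]]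
      by (simp only: at_level_Cmp[OF f g] g.Y.Z_mem)
  next
    fix X assume "X \<in> Ob (simp C)"
    then interpret cochain_level C P X using C P by unfold_locales
    show "comm_group (grp (cohomology P n) X)" by (rule comm_group_cohomology)
  }
qed

section \<open>Levelwise pro-objects and the exactness of filtered colimits\<close>

lemma level_pob_Idx [simp]: "Idx (level_pob X n) = Idx X"
  by (simp add: level_pob_def)

lemma level_pob_ob [simp]: "s \<in> Ob (Idx X) \<Longrightarrow> fob (Dia (level_pob X n)) s = fob (fob (Dia X) s) n"
  by (simp add: level_pob_def)

lemma level_pob_mor: "u \<in> homs (Idx X) s t \<Longrightarrow> fmor (Dia (level_pob X n)) u = at_level (fmor (Dia X) u) n"
  by (simp add: level_pob_def homs_def)

lemma is_pob_level:
  assumes C: "is_cat C" and X: "is_pob (simp C) X"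
  shows "is_pob C (level_pob X n)"
proof -
  note J = pob_cat[OF X] and F = pob_functor[OF X]
  have "is_functor (Idx X) C (Dia (level_pob X n))"
  proof (rule is_functorI)
    fix u s t assume u: "u \<in> homs (Idx X) s t"
    then show "fmor (Dia (level_pob X n)) u \<in> homs C (fob (Dia (level_pob X n)) s) (fob (Dia (level_pob X n)) t)"
      using simp_at_level[OF pob_mor[OF X u]] cat_ob[OF J u] by (simp add: level_pob_mor)
    fix v r assume v: "v \<in> homs (Idx X) t r"
    show "fmor (Dia (level_pob X n)) (Cmp (Idx X) v u) =
        Cmp C (fmor (Dia (level_pob X n)) v) (fmor (Dia (level_pob X n)) u)"
      using level_pob_mor[OF u] level_pob_mor[OF v] level_pob_mor[OF cat_cmp[OF J u v]]
        ftr_cmp[OF F u v] at_level_Cmp[OF pob_mor[OF X u] pob_mor[OF X v]] by simp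
  next
    fix s assume s: "s \<in> Ob (Idx X)"
    show "fob (Dia (level_pob X n)) s \<in> Ob C" using s simp_ob[OF pob_ob[OF X s]] by simp
    show "fmor (Dia (level_pob X n)) (Idn (Idx X) s) = Idn C (fob (Dia (level_pob X n)) s)"
      using s level_pob_mor[OF cat_id[OF J s]] ftr_id[OF F s] by simp
  qed
  moreover have "fob (Dia (level_pob X n)) \<in> extensional (Ob (Idx X))"
    "fmor (Dia (level_pob X n)) \<in> extensional (Mor (Idx X))"
    by (simp_all add: level_pob_def)
  ultimately show ?thesis using X by (simp add: is_pob_def functor_cat_Ob)
qed

lemma levelwise_ob_fob [simp]: "fob (levelwise_ob C X) n = level_pob X n"
  by (simp add: levelwise_ob_def)

context
  fixes C :: "('o, 'm) cat"
  assumes C: "is_cat C"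
begin

lemma levelwise_ob_mor:
  assumes X: "is_pob (simp C) X" and \<theta>: "\<theta> \<in> homs simplex_cat m n"
  shows "fmor (levelwise_ob C X) \<theta> \<in> homs (pro C) (level_pob X n) (level_pob X m)"
    and "s \<in> Ob (Idx X) \<Longrightarrow> (s, fmor (fob (Dia X) s) \<theta>) \<in> germs (fmor (levelwise_ob C X) \<theta>) s"
proof -
  have eq: "fmor (levelwise_ob C X) \<theta> = (level_pob X n, level_pob X m,
      \<lambda>s\<in>Ob (Idx (level_pob X m)). germ C (level_pob X n) s (fmor (fob (Dia X) s) \<theta>))"
    using homsD[OF \<theta>] by (simp add: levelwise_ob_def del: simplex_cat_sel)
  note L = is_pob_level[OF C X]
  show "fmor (levelwise_ob C X) \<theta> \<in> homs (pro C) (level_pob X n) (level_pob X m)"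
    unfolding eq
  proof (rule pro_homsI[OF C L L])
    fix s assume "s \<in> Ob (Idx (level_pob X m))"
    then show "s \<in> Ob (Idx (level_pob X n))" "fmor (fob (Dia X) s) \<theta> \<in>
        homs C (fob (Dia (level_pob X n)) s) (fob (Dia (level_pob X m)) s)"
      using simp_mor[OF pob_ob[OF X] \<theta>] by auto
  next
    fix u s s' assume "u \<in> homs (Idx (level_pob X m)) s s'" "s \<in> Ob (Idx (level_pob X m))"
      "s' \<in> Ob (Idx (level_pob X m))"
    then have u: "u \<in> homs (Idx X) s s'" and s: "s \<in> Ob (Idx X)" "s' \<in> Ob (Idx X)" by auto
    have "germ C (level_pob X n) s (Cmp C (fmor (fob (Dia X) s') \<theta>) (fmor (Dia (level_pob X n)) u)) =
        germ C (level_pob X n) s' (fmor (fob (Dia X) s') \<theta>)"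
      by (rule germ_res[OF C L]) (use u s simp_mor[OF pob_ob[OF X s(2)] \<theta>] in auto)
    then show "germ C (level_pob X n) s (Cmp C (fmor (Dia (level_pob X m)) u) (fmor (fob (Dia X) s) \<theta>)) =
        germ C (level_pob X n) s' (fmor (fob (Dia X) s') \<theta>)"
      using simp_natural[OF pob_mor[OF X u] \<theta>] level_pob_mor[OF u] by simp
  qed
  show "(s, fmor (fob (Dia X) s) \<theta>) \<in> germs (fmor (levelwise_ob C X) \<theta>) s" if s: "s \<in> Ob (Idx X)"
    unfolding eq
    by (rule pro_mem_homsI[OF C L]) (use s simp_mor[OF pob_ob[OF X s] \<theta>] in auto)
qed

lemma levelwise_ob:
  assumes X: "is_pob (simp C) X"
  shows "levelwise_ob C X \<in> Ob (simp (pro C))"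
proof (rule simp_ObI)
  note L = is_pob_level[OF C X]
  note mor = levelwise_ob_mor[OF X]
  show "fob (levelwise_ob C X) n \<in> Ob (pro C)" for n using L by (simp add: pro_Ob)
  show "fmor (levelwise_ob C X) \<theta> \<in> homs (pro C) (fob (levelwise_ob C X) n) (fob (levelwise_ob C X) m)"
    if "\<theta> \<in> homs simplex_cat m n" for \<theta> m n using mor(1)[OF that] by simp
  show "fmor (levelwise_ob C X) (Idn simplex_cat n) = Idn (pro C) (fob (levelwise_ob C X) n)" for n
    unfolding levelwise_ob_fob
  proof (rule pro_eqI[OF C mor(1)[OF cat_id] pro_id[OF C L]])
    fix s assume "s \<in> Ob (Idx (level_pob X n))"
    then have s: "s \<in> Ob (Idx X)" by simp
    show "\<exists>t f. (t, f) \<in> germs (fmor (levelwise_ob C X) (Idn simplex_cat n)) s \<and>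
        (t, f) \<in> germs (Idn (pro C) (level_pob X n)) s"
      using mor(2)[OF cat_id[of simplex_cat n] s] pro_id_mem[OF C L, of s n] s
        simp_id[OF pob_ob[OF X s], of n] by (auto simp del: pro_sel simplex_cat_sel simp add: simplex_cat_sel(1))
  qed (auto simp del: simplex_cat_sel simp add: simplex_cat_sel(1))
  show "fmor (levelwise_ob C X) (Cmp simplex_cat \<eta> \<theta>) =
      Cmp (pro C) (fmor (levelwise_ob C X) \<theta>) (fmor (levelwise_ob C X) \<eta>)"
    if \<theta>: "\<theta> \<in> homs simplex_cat l m" and \<eta>: "\<eta> \<in> homs simplex_cat m n" for \<theta> \<eta> l m n
  proof (rule pro_eqI[OF C mor(1)[OF cat_cmp[OF is_cat_simplex_cat \<theta> \<eta>]] pro_cmp[OF C mor(1)[OF \<eta>] mor(1)[OF \<theta>]]])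
    fix s assume "s \<in> Ob (Idx (level_pob X l))"
    then have s: "s \<in> Ob (Idx X)" "s \<in> Ob (Idx (level_pob X l))" by auto
    show "\<exists>t f. (t, f) \<in> germs (fmor (levelwise_ob C X) (Cmp simplex_cat \<eta> \<theta>)) s \<and>
        (t, f) \<in> germs (Cmp (pro C) (fmor (levelwise_ob C X) \<theta>) (fmor (levelwise_ob C X) \<eta>)) s"
      using mor(2)[OF cat_cmp[OF is_cat_simplex_cat \<theta> \<eta>] s(1)] simp_cmp[OF pob_ob[OF X s(1)] \<theta> \<eta>]
        pro_Cmp_mem(2)[OF C mor(1)[OF \<eta>] mor(1)[OF \<theta>] s(2) mor(2)[OF \<theta> s(1)] mor(2)[OF \<eta> s(1)]] by auto
  qed
  show "fmor (levelwise_ob C X) \<in> extensional (Mor simplex_cat)" by (simp add: levelwise_ob_def)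
qed

lemma levelwise_fob [simp]: "fob (levelwise C) X = levelwise_ob C X"
  by (simp add: levelwise_def)

lemma levelwise_mor:
  assumes p: "\<phi> \<in> homs (pro (simp C)) X Y"
  shows levelwise_mor_simp: "fmor (levelwise C) \<phi> \<in> homs (simp (pro C)) (levelwise_ob C X) (levelwise_ob C Y)"
    and levelwise_mor_mem: "s \<in> Ob (Idx Y) \<Longrightarrow> (t, f) \<in> germs \<phi> s \<Longrightarrow>
      (t, at_level f n) \<in> germs (at_level (fmor (levelwise C) \<phi>) n) s"
proof -
  note SC = is_cat_simp[OF C]
  note X = pro_homsD(1)[OF SC p] and Y = pro_homsD(2)[OF SC p]
  note LX = is_pob_level[OF C X] and LY = is_pob_level[OF C Y]
  have al: "at_level (fmor (levelwise C) \<phi>) n = (level_pob X n, level_pob Y n,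
         \<lambda>s\<in>Ob (Idx (level_pob Y n)). \<Union>(t, f)\<in>germs \<phi> s. germ C (level_pob X n) t (at_level f n))" for n
    using pro_homsD(3)[OF SC p] by (cases \<phi>) (simp add: levelwise_def)
  have eq: "germ C (level_pob X n) t (at_level f n) = germ C (level_pob X n) t' (at_level f' n)"
    if s: "s \<in> Ob (Idx Y)" and f: "(t, f) \<in> germs \<phi> s" and f': "(t', f') \<in> germs \<phi> s" for s t f t' f' n
  proof -
    note 1 = pro_memD[OF SC p s f] and 2 = pro_memD[OF SC p s f']
    obtain k u v where k: "u \<in> homs (Idx X) k t" "v \<in> homs (Idx X) k t'"
      "Cmp (simp C) f (fmor (Dia X) u) = Cmp (simp C) f' (fmor (Dia X) v)"
      using germ_eq_iff[OF SC X 1(1) 2(1) 1(2) 2(2)] 1(3) 2(3) by auto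
    have "Cmp C (at_level f n) (fmor (Dia (level_pob X n)) u) =
        Cmp C (at_level f' n) (fmor (Dia (level_pob X n)) v)"
      using at_level_Cmp[OF pob_mor[OF X k(1)] 1(2), of n] at_level_Cmp[OF pob_mor[OF X k(2)] 2(2), of n] k(3)
      unfolding level_pob_mor[OF k(1)] level_pob_mor[OF k(2)] by simp
    then show ?thesis
      using germ_eq_iff[OF C LX[of n], of t t' "at_level f n" "fob (fob (Dia Y) s) n" "at_level f' n"]
        1 2 k(1,2) simp_at_level[OF 1(2)] simp_at_level[OF 2(2)] by auto
  qed
  \<comment> \<open>The definition of \<open>levelwise\<close> takes a union over all
    representatives. One representative is fixed at each index to bring it into the form to which
    \<open>pro_homsI\<close> applies; by \<open>eq\<close> the choice does not matter.\<close>
  define rp where "rp s = (SOME z. z \<in> germs \<phi> s)" for s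
  have rp: "(fst (rp s), snd (rp s)) \<in> germs \<phi> s" if "s \<in> Ob (Idx Y)" for s
    using pro_rep[OF SC p that] someI[of "\<lambda>z. z \<in> germs \<phi> s"] unfolding rp_def by auto
  note rpD = pro_memD[OF SC p _ rp]
  have al2: "at_level (fmor (levelwise C) \<phi>) n = (level_pob X n, level_pob Y n,
         \<lambda>s\<in>Ob (Idx (level_pob Y n)). germ C (level_pob X n) (fst (rp s)) (at_level (snd (rp s)) n))" for n
  proof -
    have "(\<Union>(t, f)\<in>germs \<phi> s. germ C (level_pob X n) t (at_level f n)) =
      germ C (level_pob X n) (fst (rp s)) (at_level (snd (rp s)) n)" if s: "s \<in> Ob (Idx Y)" for s
      using eq[OF s _ rp[OF s]] rp[OF s] by fast
    then show ?thesis unfolding al by (auto simp: fun_eq_iff)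
  qed
  have lev: "at_level (fmor (levelwise C) \<phi>) n \<in> homs (pro C) (level_pob X n) (level_pob Y n)" for n
    unfolding al2
  proof (rule pro_homsI[OF C LX LY])
    fix u s s' assume u: "u \<in> homs (Idx (level_pob Y n)) s s'"
      and "s \<in> Ob (Idx (level_pob Y n))" "s' \<in> Ob (Idx (level_pob Y n))"
    then have u: "u \<in> homs (Idx Y) s s'" and s: "s \<in> Ob (Idx Y)" "s' \<in> Ob (Idx Y)" by auto
    show "germ C (level_pob X n) (fst (rp s)) (Cmp C (fmor (Dia (level_pob Y n)) u) (at_level (snd (rp s)) n)) =
        germ C (level_pob X n) (fst (rp s')) (at_level (snd (rp s')) n)"
      using eq[OF s(2) pro_compat[OF SC p u rp[OF s(1)]] rp[OF s(2)], of n]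
        at_level_Cmp[OF rpD(2)[OF s(1) s(1)] pob_mor[OF Y u]] level_pob_mor[OF u] by simp
  qed (use rpD(1,2) simp_at_level in \<open>simp; blast\<close>)+
  show mem: "(t, at_level f n) \<in> germs (at_level (fmor (levelwise C) \<phi>) n) s"
    if "s \<in> Ob (Idx Y)" "(t, f) \<in> germs \<phi> s" for s t f n
  proof -
    note f' = pro_memD[OF SC p that]
    have "(t, at_level f n) \<in> germ C (level_pob X n) t (at_level f n)"
      using mem_germ[OF C LX[of n], of t "at_level f n" "fob (fob (Dia Y) s) n"]
        f'(1) simp_at_level[OF f'(2)] by auto
    then show ?thesis unfolding al using that by auto
  qed
  show "fmor (levelwise C) \<phi> \<in> homs (simp (pro C)) (levelwise_ob C X) (levelwise_ob C Y)"
  proof -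
    have "fmor (levelwise C) \<phi> = (levelwise_ob C X, levelwise_ob C Y, at_level (fmor (levelwise C) \<phi>))"
      using pro_homsD(3)[OF SC p] by (cases \<phi>) (simp add: levelwise_def at_level_def fun_eq_iff)
    also have "\<dots> \<in> homs (simp (pro C)) (levelwise_ob C X) (levelwise_ob C Y)"
    proof (rule simp_homsI[OF levelwise_ob[OF X] levelwise_ob[OF Y]])
      show "at_level (fmor (levelwise C) \<phi>) n \<in> homs (pro C) (fob (levelwise_ob C X) n) (fob (levelwise_ob C Y) n)" for n
        using lev by simp
      fix \<theta> m n assume \<theta>: "\<theta> \<in> homs simplex_cat m n"
      note X\<theta> = levelwise_ob_mor[OF X \<theta>] and Y\<theta> = levelwise_ob_mor[OF Y \<theta>]
      show "Cmp (pro C) (at_level (fmor (levelwise C) \<phi>) m) (fmor (levelwise_ob C X) \<theta>) =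
          Cmp (pro C) (fmor (levelwise_ob C Y) \<theta>) (at_level (fmor (levelwise C) \<phi>) n)"
      proof (rule pro_eqI[OF C pro_cmp[OF C X\<theta>(1) lev] pro_cmp[OF C lev Y\<theta>(1)]])
        fix s assume s: "s \<in> Ob (Idx (level_pob Y m))"
        then have s': "s \<in> Ob (Idx Y)" by simp
        obtain t f where f: "(t, f) \<in> germs \<phi> s" using pro_rep[OF SC p s'] by blast
        note f' = pro_memD[OF SC p s' f]
        show "\<exists>t f. (t, f) \<in> germs (Cmp (pro C) (at_level (fmor (levelwise C) \<phi>) m) (fmor (levelwise_ob C X) \<theta>)) s \<and>
            (t, f) \<in> germs (Cmp (pro C) (fmor (levelwise_ob C Y) \<theta>) (at_level (fmor (levelwise C) \<phi>) n)) s"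
          using pro_Cmp_mem(2)[OF C X\<theta>(1) lev s mem[OF s' f] X\<theta>(2)[OF f'(1)]]
            pro_Cmp_mem(2)[OF C lev Y\<theta>(1) s Y\<theta>(2)[OF s'] mem[OF s' f]]
            simp_natural[OF f'(2) \<theta>] by auto
      qed
    qed
    finally show ?thesis .
  qed
qed

end

section \<open>Cohomology of the colimit complex against the colimit of the cohomologies\<close>

locale comparison =
  fixes C :: "('o, 'm) cat" and P :: "('o, 'm, 'g) presheaf" and X :: "('u, ('o, 'm) sob, ('o, 'm) sarr) pob"
  assumes C: "is_cat C" and P: "ab_presheaf C P" and X: "is_pob (simp C) X"
begin

abbreviation LX where "LX \<equiv> levelwise_ob C X"
abbreviation LP :: "(('u, 'o, 'm) pob, ('u, 'o, 'm) parr, ('u \<times> 'g) set) presheaf" where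
  "LP \<equiv> colim_presheaf P"

sublocale T: cochain_level "pro C" LP LX
  by standard (use C ab_presheaf_colim[OF C P] levelwise_ob[OF C X] in auto)

sublocale L: ab_colim C P "level_pob X n" for n
  by (rule ab_colimI[OF C P is_pob_level[OF C X]])

sublocale H: ab_colim "simp C" "cohomology P n" X for n
  by (rule ab_colimI[OF is_cat_simp[OF C] ab_presheaf_cohomology[OF C P] X])

abbreviation J where "J \<equiv> Idx X"
abbreviation xob where "xob s \<equiv> fob (Dia X) s"
abbreviation A where "A s n \<equiv> grp P (fob (xob s) n)"
abbreviation Z where "Z s n \<equiv> cocycles P (xob s) n"
abbreviation B where "B s n \<equiv> coboundaries P (xob s) n"
abbreviation r where "r n u \<equiv> pull P (at_level (fmor (Dia X) u) n)"
abbreviation cls where "cls n \<equiv> colim_class P (level_pob X n)"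
abbreviation hcls where "hcls n s z \<equiv> colim_class (cohomology P n) X s (B s n #>\<^bsub>A s n\<^esub> z)"

lemmas J = pob_cat[OF X] pob_cofiltered[OF X]

lemma level: "s \<in> Ob J \<Longrightarrow> cochain_level C P (xob s)"
  by (intro cochain_level.intro C P pob_ob[OF X])

lemma lmap: "u \<in> homs J k s \<Longrightarrow> cochain_map C P (xob k) (xob s) (fmor (Dia X) u)"
  by (rule cochain_mapI[OF C P pob_mor[OF X]])

lemma cls_eq:
  assumes "s \<in> Ob J" "t \<in> Ob J" "x \<in> carrier (A s n)" "y \<in> carrier (A t n)"
  shows "cls n s x = cls n t y \<longleftrightarrow> (\<exists>k u v. u \<in> homs J k s \<and> v \<in> homs J k t \<and> r n u x = r n v y)"
proof -
  have "cls n s x = cls n t y \<longleftrightarrow> L.eqv n s x t y"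
    by (rule L.cls_eq_iff) (use assms in auto)
  also have "\<dots> \<longleftrightarrow> (\<exists>k u v. u \<in> homs J k s \<and> v \<in> homs J k t \<and> r n u x = r n v y)"
    unfolding L.eqv_def by (metis level_pob_Idx level_pob_mor)
  finally show ?thesis .
qed

lemma cls_res: "u \<in> homs J k s \<Longrightarrow> x \<in> carrier (A s n) \<Longrightarrow> cls n k (r n u x) = cls n s x"
  using L.cls_res[of u n k s x] cat_ob[OF J(1)] by (auto simp: level_pob_mor)

lemma cls_mult: "s \<in> Ob J \<Longrightarrow> x \<in> carrier (A s n) \<Longrightarrow> y \<in> carrier (A s n) \<Longrightarrow>
    cls n s x \<otimes>\<^bsub>T.A n\<^esub> cls n s y = cls n s (x \<otimes>\<^bsub>A s n\<^esub> y)"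
  using L.cls_mult[of s n x y] by simp

lemma cls_mem: "s \<in> Ob J \<Longrightarrow> x \<in> carrier (A s n) \<Longrightarrow> cls n s x \<in> carrier (T.A n)"
  using L.colimsI[of s n x] L.colims_carrier[of n] by simp

lemma cls_cases:
  assumes "c \<in> carrier (T.A n)"
  obtains s x where "s \<in> Ob J" "x \<in> carrier (A s n)" "c = cls n s x"
  using assms L.colimsE[of c n] unfolding levelwise_ob_fob L.colims_carrier by auto

lemma cls_hom: "s \<in> Ob J \<Longrightarrow> cls n s \<in> hom (A s n) (T.A n)"
  by (rule homI) (auto simp: cls_mem[simplified] cls_mult[simplified])

lemma cls_one: "s \<in> Ob J \<Longrightarrow> cls n s \<one>\<^bsub>A s n\<^esub> = \<one>\<^bsub>T.A n\<^esub>"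
  using L.cls_one[of s n] by simp

text \<open>The coboundary is a finite product of images under face maps. The map from a stage to
  the colimit is a homomorphism compatible with faces, so the alternating sum can be formed at the
  stage.\<close>

lemma d_cls:
  assumes s: "s \<in> Ob J" and c: "c \<in> carrier (A s n)"
  shows "T.d n (cls n s c) = cls (Suc n) s (coboundary P (xob s) n c)"
proof -
  interpret S: cochain_level C P "xob s" by (rule level[OF s])
  have face: "pull LP (fmor LX (face n i)) (cls n s c) =
      cls (Suc n) s (pull P (fmor (xob s) (face n i)) c)" for i
    by (rule pull_colim_class[OF C ab_presheaf_set[OF P] levelwise_ob_mor(1)[OF C X face_homs] _
          levelwise_ob_mor(2)[OF C X face_homs s]]) (use s c in auto)
  have m: "pull P (fmor (xob s) (face n i)) c \<in> carrier (A s (Suc n))" for i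
    using hom_in_carrier[OF S.face_hom c] .
  have g: "group (A s (Suc n))" "group (T.A (Suc n))"
    using S.grpA T.grpA by (auto simp: comm_group_def)
  show ?thesis unfolding coboundary_def face
    using m group.int_pow_closed[OF g(1) m]
    by (subst hom_finprod[OF S.grpA T.grpA cls_hom[OF s]])
       (auto simp: hom_int_pow[OF cls_hom[OF s, of "Suc n"] _ g, simplified])
qed

lemma cls_B: 
  assumes s: "s \<in> Ob J" and b: "b \<in> B s n"
  shows "cls n s b \<in> T.B n"
proof -
  interpret S: cochain_level C P "xob s" by (rule level[OF s])
  show ?thesis
  proof (cases n)
    case 0
    then show ?thesis using b cls_one[OF s, of 0] by (simp add: S.B_mem T.B_mem)
  next
    case (Suc m)
    then obtain c where "c \<in> carrier (A s m)" "b = coboundary P (xob s) m c" using b by (auto simp: S.B_mem)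
    then show ?thesis using Suc d_cls[OF s, of c m] cls_mem[OF s, of c m] by (auto simp: T.B_mem)
  qed
qed

lemma B_cases:
  assumes b: "b \<in> T.B n"
  obtains s x where "s \<in> Ob J" "x \<in> B s n" "b = cls n s x"
proof (cases n)
  case 0
  obtain s where s: "s \<in> Ob J" using cofiltered_nonempty[OF J(2)] by blast
  interpret S: cochain_level C P "xob s" by (rule level[OF s])
  show ?thesis using that[of s "\<one>\<^bsub>A s 0\<^esub>"] 0 b s cls_one[OF s, of 0] by (simp add: S.B_mem T.B_mem)
next
  case (Suc m)
  then obtain c where c: "c \<in> carrier (T.A m)" "b = T.d m c" using b by (auto simp: T.B_mem)
  obtain s x where s: "s \<in> Ob J" "x \<in> carrier (A s m)" "c = cls m s x" using c(1) by (rule cls_cases)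
  interpret S: cochain_level C P "xob s" by (rule level[OF s(1)])
  show ?thesis using that[of s "coboundary P (xob s) m x"] Suc c s d_cls[OF s(1,2)] by (auto simp: S.B_mem)
qed

lemma cls_Z: 
  assumes s: "s \<in> Ob J" and z: "z \<in> Z s n"
  shows "cls n s z \<in> T.Z n"
proof -
  interpret S: cochain_level C P "xob s" by (rule level[OF s])
  show ?thesis using z d_cls[OF s, of z n] cls_mem[OF s, of z n] cls_one[OF s, of "Suc n"]
    by (auto simp: S.Z_mem T.Z_mem)
qed

text \<open>The coboundary of a representative x vanishes only in the colimit, so x itself need not
  be a cocycle. It becomes one after restriction along a suitable u, and \<open>r n u x\<close> is
  the required representative.\<close>

lemma Z_cases:
  assumes z: "z \<in> T.Z n"
  obtains s x where "s \<in> Ob J" "x \<in> Z s n" "z = cls n s x"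
proof -
  have zc: "z \<in> carrier (T.A n)" "T.d n z = \<one>\<^bsub>T.A (Suc n)\<^esub>" using z by (auto simp: T.Z_mem)
  obtain s x where s: "s \<in> Ob J" "x \<in> carrier (A s n)" "z = cls n s x" using zc(1) by (rule cls_cases)
  interpret S: cochain_level C P "xob s" by (rule level[OF s(1)])
  have one: "\<one>\<^bsub>A s (Suc n)\<^esub> \<in> carrier (A s (Suc n))"
    using S.grpA by (simp add: comm_group_def Group.group.is_monoid monoid.one_closed)
  have "cls (Suc n) s (S.d n x) = cls (Suc n) s \<one>\<^bsub>A s (Suc n)\<^esub>"
    using zc(2) s d_cls[OF s(1,2)] cls_one[OF s(1), of "Suc n"] by simp
  then obtain k u v where k: "u \<in> homs J k s" "v \<in> homs J k s"
    "r (Suc n) u (S.d n x) = r (Suc n) v \<one>\<^bsub>A s (Suc n)\<^esub>"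
    using cls_eq[OF s(1) s(1) hom_in_carrier[OF S.d_hom s(2)] one] by blast
  interpret u: cochain_map C P "xob k" "xob s" "fmor (Dia X) u" by (rule lmap[OF k(1)])
  interpret v: cochain_map C P "xob k" "xob s" "fmor (Dia X) v" by (rule lmap[OF k(2)])
  have "r n u x \<in> Z k n" using u.q_d[OF s(2)] u.q_mem[OF s(2)] k(3) v.q_one[of "Suc n"] by (simp add: u.X.Z_mem)
  then show ?thesis using that[of k "r n u x"] cat_ob[OF J(1) k(1)] cls_res[OF k(1) s(2)] s(3) by simp
qed

lemma hcls_mem: "s \<in> Ob J \<Longrightarrow> z \<in> Z s n \<Longrightarrow> hcls n s z \<in> carrier (grp (colim_presheaf (cohomology P n)) X)"
  using H.colimsI[of s _ n] cochain_level.carrier_cohomology[OF level] unfolding H.colims_carrier by simp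

lemma hcls_cases:
  assumes "K \<in> carrier (grp (colim_presheaf (cohomology P n)) X)"
  obtains s z where "s \<in> Ob J" "z \<in> Z s n" "K = hcls n s z"
proof -
  obtain s x where s: "s \<in> Ob J" "x \<in> H.car n s" "K = colim_class (cohomology P n) X s x"
    using assms unfolding H.colims_carrier by (rule H.colimsE)
  then show ?thesis using that cochain_level.carrier_cohomology[OF level[OF s(1)]] by auto
qed

lemma hcls_eq:
  assumes s: "s \<in> Ob J" "t \<in> Ob J" and z: "z \<in> Z s n" and w: "w \<in> Z t n"
  shows "hcls n s z = hcls n t w \<longleftrightarrow> (\<exists>k u v. u \<in> homs J k s \<and> v \<in> homs J k t \<and>
    B k n #>\<^bsub>A k n\<^esub> r n u z = B k n #>\<^bsub>A k n\<^esub> r n v w)"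
proof -
  interpret S: cochain_level C P "xob s" by (rule level[OF s(1)])
  interpret S2: cochain_level C P "xob t" by (rule level[OF s(2)])
  have "hcls n s z = hcls n t w \<longleftrightarrow> H.eqv n s (B s n #>\<^bsub>A s n\<^esub> z) t (B t n #>\<^bsub>A t n\<^esub> w)"
    by (rule H.cls_eq_iff) (use s z w S.carrier_cohomology S2.carrier_cohomology in auto)
  then show ?thesis unfolding H.eqv_def
    using cochain_map.pull_cohomology[OF lmap _] z w by metis
qed

text \<open>A coboundary at a stage maps to a coboundary of the colimit complex. Conversely a
  coboundary of the colimit complex is the class of some x in \<open>B k n\<close>, and the equation
  in which it occurs already holds at a later stage. Together with \<open>Z_cases\<close> this is
  the exactness of filtered colimits.\<close>

lemma hcls_eq_iff:
  assumes s: "s \<in> Ob J" "t \<in> Ob J" and z: "z \<in> Z s n" and w: "w \<in> Z t n"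
  shows "hcls n s z = hcls n t w \<longleftrightarrow>
    T.B n #>\<^bsub>T.A n\<^esub> cls n s z = T.B n #>\<^bsub>T.A n\<^esub> cls n t w"
proof -
  have zc: "z \<in> carrier (A s n)" "w \<in> carrier (A t n)"
    using z w level[OF s(1)] level[OF s(2)] by (auto simp: cochain_level.Z_mem)
  have T: "T.B n #>\<^bsub>T.A n\<^esub> cls n s z = T.B n #>\<^bsub>T.A n\<^esub> cls n t w \<longleftrightarrow>
      (\<exists>b\<in>T.B n. cls n s z = b \<otimes>\<^bsub>T.A n\<^esub> cls n t w)"
    using T.coset_eq cls_Z s z w by auto
  show ?thesis
  proof
    assume "hcls n s z = hcls n t w"
    then obtain k u v where k: "u \<in> homs J k s" "v \<in> homs J k t"
      "B k n #>\<^bsub>A k n\<^esub> r n u z = B k n #>\<^bsub>A k n\<^esub> r n v w" using hcls_eq[OF assms] by blast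
    have ko: "k \<in> Ob J" using cat_ob[OF J(1) k(1)] by simp
    interpret u: cochain_map C P "xob k" "xob s" "fmor (Dia X) u" by (rule lmap[OF k(1)])
    interpret v: cochain_map C P "xob k" "xob t" "fmor (Dia X) v" by (rule lmap[OF k(2)])
    obtain b where b: "b \<in> B k n" "r n u z = b \<otimes>\<^bsub>A k n\<^esub> r n v w"
      using k(3) u.X.coset_eq[OF u.q_Z[OF z] v.q_Z[OF w]] by auto
    have "cls n s z = cls n k b \<otimes>\<^bsub>T.A n\<^esub> cls n t w"
      using cls_mult[OF ko subgroup.mem_carrier[OF u.X.B_subgroup b(1)] v.q_mem[OF zc(2)]] b(2)
        cls_res[OF k(1) zc(1)] cls_res[OF k(2) zc(2)] by simp
    then show "T.B n #>\<^bsub>T.A n\<^esub> cls n s z = T.B n #>\<^bsub>T.A n\<^esub> cls n t w"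
      unfolding T using cls_B[OF ko b(1)] by blast
  next
    assume "T.B n #>\<^bsub>T.A n\<^esub> cls n s z = T.B n #>\<^bsub>T.A n\<^esub> cls n t w"
    then obtain b where b: "b \<in> T.B n" "cls n s z = b \<otimes>\<^bsub>T.A n\<^esub> cls n t w" unfolding T by blast
    obtain k x where k: "k \<in> Ob J" "x \<in> B k n" "b = cls n k x" using b(1) by (rule B_cases)
    \<comment> \<open>The coboundary x lives at k and the cocycle w at t; they are multiplied at a
      common stage j. The product agrees with z only after passing to a still later stage l.\<close>
    obtain j p q where j: "j \<in> Ob J" "p \<in> homs J j k" "q \<in> homs J j t"
      using cofiltered_pair[OF J(2) k(1) s(2)] by blast
    interpret p: cochain_map C P "xob j" "xob k" "fmor (Dia X) p" by (rule lmap[OF j(2)])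
    interpret q: cochain_map C P "xob j" "xob t" "fmor (Dia X) q" by (rule lmap[OF j(3)])
    interpret Aj: comm_group "A j n" by (rule p.X.grpA)
    have x: "x \<in> carrier (A k n)" using subgroup.mem_carrier[OF p.Y.B_subgroup k(2)] .
    have m: "r n p x \<in> carrier (A j n)" "r n q w \<in> carrier (A j n)"
      using p.q_mem[OF x] q.q_mem[OF zc(2)] by auto
    have "cls n s z = cls n j (r n p x \<otimes>\<^bsub>A j n\<^esub> r n q w)"
      using b(2) k(3) cls_res[OF j(2) x] cls_res[OF j(3) zc(2)] cls_mult[OF j(1) m] by simp
    then obtain l u v where l: "u \<in> homs J l s" "v \<in> homs J l j"
      "r n u z = r n v (r n p x \<otimes>\<^bsub>A j n\<^esub> r n q w)"
      using cls_eq[OF s(1) j(1) zc(1) Aj.m_closed[OF m]] by blast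
    interpret u: cochain_map C P "xob l" "xob s" "fmor (Dia X) u" by (rule lmap[OF l(1)])
    interpret v: cochain_map C P "xob l" "xob j" "fmor (Dia X) v" by (rule lmap[OF l(2)])
    note qv = cat_cmp[OF J(1) l(2) j(3)]
    have "r n v (r n q w) = r n (Cmp J q v) w"
      using set_presheaf_cmp[OF ab_presheaf_set[OF P] simp_at_level[OF pob_mor[OF X l(2)]]
          simp_at_level[OF pob_mor[OF X j(3)]] zc(2)] ftr_cmp[OF pob_functor[OF X] l(2) j(3)]
        at_level_Cmp[OF pob_mor[OF X l(2)] pob_mor[OF X j(3)]] by simp
    then have "r n u z = r n v (r n p x) \<otimes>\<^bsub>A l n\<^esub> r n (Cmp J q v) w"
      using l(3) hom_mult[OF v.q_hom m] by simp
    moreover have "r n v (r n p x) \<in> B l n" using v.q_B[OF p.q_B[OF k(2)]] .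
    ultimately have "B l n #>\<^bsub>A l n\<^esub> r n u z = B l n #>\<^bsub>A l n\<^esub> r n (Cmp J q v) w"
      using u.X.coset_eq[OF u.q_Z[OF z] cochain_map.q_Z[OF lmap[OF qv] w]] by blast
    then show "hcls n s z = hcls n t w" using hcls_eq[OF assms] l(1) qv by blast
  qed
qed

text \<open>The comparison map is read off from an arbitrary representing cocycle;
  \<open>hcls_eq_iff\<close> makes the choice harmless.\<close>

definition theta :: "nat \<Rightarrow> ('u \<times> 'g set) set \<Rightarrow> ('u \<times> 'g) set set" where
  "theta n K = (SOME c. \<exists>s z. s \<in> Ob J \<and> z \<in> Z s n \<and> K = hcls n s z \<and> c = T.B n #>\<^bsub>T.A n\<^esub> cls n s z)"

lemma theta_hcls:
  assumes s: "s \<in> Ob J" and z: "z \<in> Z s n"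
  shows "theta n (hcls n s z) = T.B n #>\<^bsub>T.A n\<^esub> cls n s z"
  unfolding theta_def
  by (rule some_equality) (use s z hcls_eq_iff in auto)

lemma theta_iso:
  "theta n \<in> iso (grp (colim_presheaf (cohomology P n)) X) (grp (cohomology LP n) LX)"
  unfolding iso_def bij_betw_def
proof (intro CollectI conjI)
  show "inj_on (theta n) (carrier (grp (colim_presheaf (cohomology P n)) X))"
  proof (rule inj_onI)
    fix K M assume K: "K \<in> carrier (grp (colim_presheaf (cohomology P n)) X)"
      and M: "M \<in> carrier (grp (colim_presheaf (cohomology P n)) X)" and eq: "theta n K = theta n M"
    obtain s z where s: "s \<in> Ob J" "z \<in> Z s n" "K = hcls n s z" using K by (rule hcls_cases)
    obtain t w where t: "t \<in> Ob J" "w \<in> Z t n" "M = hcls n t w" using M by (rule hcls_cases)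
    show "K = M" using eq s t theta_hcls hcls_eq_iff by auto
  qed
  have mem: "theta n K \<in> carrier (grp (cohomology LP n) LX)"
    if K: "K \<in> carrier (grp (colim_presheaf (cohomology P n)) X)" for K
  proof -
    obtain s z where s: "s \<in> Ob J" "z \<in> Z s n" "K = hcls n s z" using K by (rule hcls_cases)
    then show ?thesis using theta_hcls cls_Z unfolding T.carrier_cohomology by auto
  qed
  have "c \<in> theta n ` carrier (grp (colim_presheaf (cohomology P n)) X)"
    if c: "c \<in> carrier (grp (cohomology LP n) LX)" for c
  proof -
    obtain z where z: "z \<in> T.Z n" "c = T.B n #>\<^bsub>T.A n\<^esub> z" using c unfolding T.carrier_cohomology by auto
    obtain s x where s: "s \<in> Ob J" "x \<in> Z s n" "z = cls n s x" using z(1) by (rule Z_cases)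
    show ?thesis using theta_hcls[OF s(1,2)] hcls_mem[OF s(1,2)] z(2) s(3) by (metis image_eqI)
  qed
  then show "theta n ` carrier (grp (colim_presheaf (cohomology P n)) X) = carrier (grp (cohomology LP n) LX)"
    using mem by blast
  show "theta n \<in> hom (grp (colim_presheaf (cohomology P n)) X) (grp (cohomology LP n) LX)"
  proof (rule homI)
    fix K M assume K: "K \<in> carrier (grp (colim_presheaf (cohomology P n)) X)"
      and M: "M \<in> carrier (grp (colim_presheaf (cohomology P n)) X)"
    obtain s x y where s: "s \<in> Ob J" "x \<in> H.car n s" "y \<in> H.car n s"
      "K = colim_class (cohomology P n) X s x" "M = colim_class (cohomology P n) X s y"
      using K M unfolding H.colims_carrier by (rule H.colims2E)
    interpret S: cochain_level C P "xob s" by (rule level[OF s(1)])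
    obtain z w where zw: "z \<in> Z s n" "x = B s n #>\<^bsub>A s n\<^esub> z" "w \<in> Z s n" "y = B s n #>\<^bsub>A s n\<^esub> w"
      using s(2,3) unfolding S.carrier_cohomology by auto
    have zwc: "z \<in> carrier (A s n)" "w \<in> carrier (A s n)" using zw by (auto simp: S.Z_mem)
    have "K \<otimes>\<^bsub>grp (colim_presheaf (cohomology P n)) X\<^esub> M = hcls n s (z \<otimes>\<^bsub>A s n\<^esub> w)"
      using H.cls_mult[OF s(1-3)] S.mult_cohomology[OF zw(1,3)] s(4,5) zw(2,4) by simp
    then show "theta n (K \<otimes>\<^bsub>grp (colim_presheaf (cohomology P n)) X\<^esub> M) =
        theta n K \<otimes>\<^bsub>grp (cohomology LP n) LX\<^esub> theta n M"
      using theta_hcls[OF s(1)] zw s(4,5) subgroup.m_closed[OF S.Z_subgroup zw(1,3)]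
        cls_mult[OF s(1) zwc] T.mult_cohomology[OF cls_Z[OF s(1) zw(1)] cls_Z[OF s(1) zw(3)]] by simp
  qed (rule mem)
qed

end

text \<open>Agreement on the carrier is enough because the group axioms keep products in the
  carrier, where the two functions coincide.\<close>

lemma iso_cong: "f \<in> iso G H \<Longrightarrow> group G \<Longrightarrow> (\<And>x. x \<in> carrier G \<Longrightarrow> g x = f x) \<Longrightarrow> g \<in> iso G H"
  by (auto simp: iso_def hom_def Pi_def bij_betw_def inj_on_def group.is_monoid monoid.m_closed)

text \<open>The isomorphisms \<open>theta\<close> of X and Y intertwine the two induced maps, so
  each is a conjugate of the other. For \<open>FinSets\<close> this compares the weak equivalences
  of the two categories; for \<open>Sets\<close> it allows weak equivalences of pro-spaces to be
  tested on a single cochain complex.\<close>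

theorem iso_levelwise_iff:
  assumes C: "is_cat C" and P: "ab_presheaf C P" and p: "\<phi> \<in> homs (pro (simp C)) X Y"
  shows "pull (colim_presheaf (cohomology P n)) \<phi> \<in>
      iso (grp (colim_presheaf (cohomology P n)) Y) (grp (colim_presheaf (cohomology P n)) X) \<longleftrightarrow>
    pull (cohomology (colim_presheaf P) n) (fmor (levelwise C) \<phi>) \<in>
      iso (grp (cohomology (colim_presheaf P) n) (levelwise_ob C Y))
          (grp (cohomology (colim_presheaf P) n) (levelwise_ob C X))"
    (is "?p \<in> iso ?HY ?HX \<longleftrightarrow> ?q \<in> iso ?TY ?TX")
proof -
  note SC = is_cat_simp[OF C]
  interpret X: comparison C P X by standard (use C P pro_homsD(1)[OF SC p] in auto)
  interpret Y: comparison C P Y by standard (use C P pro_homsD(2)[OF SC p] in auto)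
  note lp = levelwise_mor_simp[OF C p]
  interpret q: cochain_map "pro C" X.LP X.LX Y.LX "fmor (levelwise C) \<phi>"
    by (rule cochain_mapI[OF is_cat_pro[OF C] ab_presheaf_colim[OF C P] lp])
  have nat: "?q (Y.theta n K) = X.theta n (?p K)" if K: "K \<in> carrier ?HY" for K
  proof -
    obtain s z where s: "s \<in> Ob Y.J" "z \<in> Y.Z s n" "K = Y.hcls n s z" using K by (rule Y.hcls_cases)
    interpret S: cochain_level C P "fob (Dia Y) s" by (rule Y.level[OF s(1)])
    have zc: "z \<in> carrier (Y.A s n)" using s(2) by (simp add: S.Z_mem)
    obtain t f where f: "(t, f) \<in> germs \<phi> s" using pro_rep[OF SC p s(1)] by blast
    note f' = pro_memD[OF SC p s(1) f]
    interpret f: cochain_map C P "fob (Dia X) t" "fob (Dia Y) s" f by (rule cochain_mapI[OF C P f'(2)])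
    have "?p K = X.hcls n t (f.q n z)"
      using pull_colim_class[OF SC ab_presheaf_set[OF ab_presheaf_cohomology[OF C P]] p s(1) f,
          of "Y.B s n #>\<^bsub>Y.A s n\<^esub> z" n] s(2,3) S.carrier_cohomology f.pull_cohomology[OF s(2)] by simp
    then have "X.theta n (?p K) = X.T.B n #>\<^bsub>X.T.A n\<^esub> X.cls n t (f.q n z)"
      using X.theta_hcls[OF f'(1) f.q_Z[OF s(2)]] by simp
    moreover have "q.q n (Y.cls n s z) = X.cls n t (f.q n z)"
      by (rule pull_colim_class[OF C ab_presheaf_set[OF P] simp_at_level[OF lp, unfolded levelwise_ob_fob] _
            levelwise_mor_mem[OF C p s(1) f]]) (use s zc in auto)
    moreover have "?q (Y.theta n K) = X.T.B n #>\<^bsub>X.T.A n\<^esub> q.q n (Y.cls n s z)"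
      using Y.theta_hcls[OF s(1,2)] s(3) q.pull_cohomology[OF Y.cls_Z[OF s(1,2)]] by simp
    ultimately show ?thesis by simp
  qed
  have g: "group ?HX" "group ?HY" "group ?TX" "group ?TY"
    using X.H.comm_group_L Y.H.comm_group_L X.T.comm_group_cohomology Y.T.comm_group_cohomology
    by (auto simp: comm_group_def)
  note inv = group.iso_set_sym[OF g(1) X.theta_iso] group.iso_set_sym[OF g(2) Y.theta_iso]
  show ?thesis
  proof
    assume "?p \<in> iso ?HY ?HX"
    note i = iso_set_trans[OF iso_set_trans[OF inv(2) this] X.theta_iso]
    show "?q \<in> iso ?TY ?TX"
    proof (rule iso_cong[OF i g(4)])
      fix c assume c: "c \<in> carrier ?TY"
      have e: "inv_into (carrier ?HY) (Y.theta n) c \<in> carrier ?HY"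
        "Y.theta n (inv_into (carrier ?HY) (Y.theta n) c) = c"
        using Y.theta_iso[of n] c inv_into_into[of c "Y.theta n" "carrier ?HY"]
          f_inv_into_f[of c "Y.theta n" "carrier ?HY"]
        by (auto simp: iso_def bij_betw_def)
      then show "?q c = (X.theta n \<circ> (?p \<circ> inv_into (carrier ?HY) (Y.theta n))) c"
        using nat[OF e(1)] e(2) by simp
    qed
  next
    assume q: "?q \<in> iso ?TY ?TX"
    note i = iso_set_trans[OF iso_set_trans[OF Y.theta_iso this] inv(1)]
    show "?p \<in> iso ?HY ?HX"
    proof (rule iso_cong[OF i g(2)])
      fix c assume c: "c \<in> carrier ?HY"
      have "?p c \<in> carrier ?HX"
        using hom_in_carrier[OF ab_presheaf_hom[OF ab_presheaf_colim[OF SC ab_presheaf_cohomology[OF C P]] p] c] .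
      then have "inv_into (carrier ?HX) (X.theta n) (X.theta n (?p c)) = ?p c"
        using X.theta_iso[of n] by (auto simp: iso_def bij_betw_def)
      then show "?p c = (inv_into (carrier ?HX) (X.theta n) \<circ> (?q \<circ> Y.theta n)) c"
        using nat[OF c] by simp
    qed
  qed
qed

section \<open>Equivalences of localizations\<close>

context
  fixes C :: "('o, 'm) cat" and W :: "'m set"
  assumes C: "is_cat C"
begin

lemma zigzag_ob: "zigzag C W a ws b \<Longrightarrow> a \<in> Ob C \<and> b \<in> Ob C"
  using C by (induction C W a ws b rule: zigzag.induct) (auto simp: is_cat_def)

lemma zigzag_append: "zigzag C W a (xs @ ys) b \<longleftrightarrow> (\<exists>c. zigzag C W a xs c \<and> zigzag C W c ys b)"
proof (induction xs arbitrary: a)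
  case Nil
  then show ?case using zigzag_ob by auto
next
  case (Cons l xs)
  then show ?case by (cases l) auto
qed

lemma zig_eq_zigzag: "zig_eq C W a b us vs \<Longrightarrow> zigzag C W a us b \<and> zigzag C W a vs b"
  by (induction rule: zig_eq.induct) auto

lemma zig_eq_append:
  assumes "zig_eq C W a b us vs" "zigzag C W z xs a" "zigzag C W b ys c"
  shows "zig_eq C W z c (xs @ us @ ys) (xs @ vs @ ys)"
  using assms
proof (induction rule: zig_eq.induct)
  case (1 ws)
  then show ?case by (intro zig_eq.intros(1)) (auto simp: zigzag_append)
next
  case (2 us vs xs' ys')
  have "zig_eq C W z c ((xs @ xs') @ us @ (ys' @ ys)) ((xs @ xs') @ vs @ (ys' @ ys))"
    by (rule zig_eq.intros(2)[OF 2(1)]) (use 2 in \<open>auto simp: zigzag_append\<close>)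
  then show ?case by simp
next
  case (3 us vs)
  then show ?case by (blast intro: zig_eq.intros(3))
next
  case (4 us vs ws)
  then show ?case by (blast intro: zig_eq.intros(4))
qed

lemma zig_eq_append2:
  assumes "zig_eq C W a b us us'" "zig_eq C W b c vs vs'"
  shows "zig_eq C W a c (us @ vs) (us' @ vs')"
proof -
  note 1 = zig_eq_zigzag[OF assms(1)] and 2 = zig_eq_zigzag[OF assms(2)]
  have "zig_eq C W a c ([] @ us @ vs) ([] @ us' @ vs)"
    by (rule zig_eq_append[OF assms(1)]) (use 1 2 zigzag_ob in auto)
  moreover have "zig_eq C W a c (us' @ vs @ []) (us' @ vs' @ [])"
    by (rule zig_eq_append[OF assms(2)]) (use 1 2 zigzag_ob in auto)
  ultimately show ?thesis using zig_eq.intros(4) by fastforce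
qed

lemma zig_class_eq_iff:
  assumes "zigzag C W a us b"
  shows "zig_class C W a b us = zig_class C W a b vs \<longleftrightarrow> zig_eq C W a b us vs"
proof
  assume "zig_class C W a b us = zig_class C W a b vs"
  moreover have "us \<in> zig_class C W a b us" using assms by (simp add: zig_class_def zig_eq.intros(1))
  ultimately show "zig_eq C W a b us vs" by (auto simp: zig_class_def intro: zig_eq.intros(3))
next
  assume "zig_eq C W a b us vs"
  then show "zig_class C W a b us = zig_class C W a b vs"
    unfolding zig_class_def by (blast intro: zig_eq.intros(3,4))
qed

lemma zig_step:
  assumes "zig_rule C W us vs" "zigzag C W a (xs @ us @ ys) b" "zigzag C W a (xs @ vs @ ys) b"
    "l = xs @ us @ ys" "r = xs @ vs @ ys"
  shows "zig_eq C W a b l r" "zig_eq C W a b r l"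
  using zig_eq.intros(2)[OF assms(1-3)] zig_eq.intros(3) assms(4,5) by auto

lemma Ho_sel [simp]:
  "Ob (Ho C W) = Ob C" "Dom (Ho C W) = (\<lambda>(a, b, K). a)" "Cod (Ho C W) = (\<lambda>(a, b, K). b)"
  "Idn (Ho C W) = (\<lambda>a. (a, a, zig_class C W a a []))"
  by (simp_all add: Ho_def)

lemma Ho_homs: "m \<in> homs (Ho C W) a b \<longleftrightarrow> (\<exists>ws. zigzag C W a ws b \<and> m = (a, b, zig_class C W a b ws))"
  by (auto simp: homs_def Ho_def)

text \<open>Concatenation respects \<open>zig_eq\<close> on both sides, so the union over all
  representing zigzags in the definition of composition is a single class.\<close>

lemma Ho_cmp:
  assumes u: "zigzag C W a us b" and v: "zigzag C W b vs c"
  shows "Cmp (Ho C W) (b, c, zig_class C W b c vs) (a, b, zig_class C W a b us) =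
    (a, c, zig_class C W a c (us @ vs))"
proof -
  have uv: "zigzag C W a (us @ vs) c" using u v zigzag_append by blast
  have "zig_class C W a c (us' @ vs') = zig_class C W a c (us @ vs)"
    if "us' \<in> zig_class C W a b us" "vs' \<in> zig_class C W b c vs" for us' vs'
    using zig_class_eq_iff[OF uv, of "us' @ vs'"] zig_eq_append2[of a b us us' c vs vs'] that
    by (simp add: zig_class_def)
  moreover have "us \<in> zig_class C W a b us" "vs \<in> zig_class C W b c vs"
    using u v by (auto simp: zig_class_def intro: zig_eq.intros(1))
  ultimately have "(\<Union>us'\<in>zig_class C W a b us. \<Union>vs'\<in>zig_class C W b c vs. zig_class C W a c (us' @ vs')) =
      zig_class C W a c (us @ vs)" by blast
  then show ?thesis by (simp add: Ho_def)
qed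

end

locale relative_functor =
  fixes C :: "('o, 'm) cat" and W :: "'m set" and D :: "('p, 'n) cat" and V :: "'n set"
    and S :: "('o, 'm, 'p, 'n) ftr"
  assumes C: "is_cat C" and D: "is_cat D" and S: "is_functor C D S" and WV: "\<And>w. w \<in> W \<Longrightarrow> fmor S w \<in> V"
begin

abbreviation m where "m \<equiv> map (map_letter (fmor S))"

lemma fmor_sel: "f \<in> Mor C \<Longrightarrow> fmor S f \<in> Mor D \<and> Dom D (fmor S f) = fob S (Dom C f) \<and> Cod D (fmor S f) = fob S (Cod C f)"
  using ftr_mor[OF S Mor_homs] by (auto simp: homs_def)

lemma zigzag_map: "zigzag C W a ws b \<Longrightarrow> zigzag D V (fob S a) (m ws) (fob S b)"
proof (induction ws arbitrary: a)
  case Nil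
  then show ?case using ftr_ob[OF S] by auto
next
  case (Cons l ws)
  then show ?case using fmor_sel WV by (cases l) auto
qed

lemma zig_rule_map: "zig_rule C W us vs \<Longrightarrow> zig_rule D V (m us) (m vs)"
proof (induction rule: zig_rule.induct)
  case (1 a)
  then show ?case using zig_rule.intros(1)[OF ftr_ob[OF S 1]] ftr_id[OF S 1] by simp
next
  case (2 f g)
  have "fmor S (Cmp C g f) = Cmp D (fmor S g) (fmor S f)"
    using ftr_cmp[OF S homsI homsI] 2 by metis
  then show ?case using zig_rule.intros(2)[of "fmor S f" D "fmor S g" V] fmor_sel 2 by simp
next
  case (3 w)
  then show ?case using zig_rule.intros(3)[OF WV, of w D] fmor_sel by simp
next
  case (4 w)
  then show ?case using zig_rule.intros(4)[OF WV, of w D] fmor_sel by simp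
qed

lemma zig_eq_map: "zig_eq C W a b us vs \<Longrightarrow> zig_eq D V (fob S a) (fob S b) (m us) (m vs)"
proof (induction rule: zig_eq.induct)
  case (2 us vs xs ys)
  then show ?case
    using zig_eq.intros(2)[OF zig_rule_map[OF 2(1)], of "fob S a" "m xs" "m ys" "fob S b"]
      zigzag_map[OF 2(2)] zigzag_map[OF 2(3)] by simp
next
  case (4 us vs ws)
  then show ?case by (blast intro: zig_eq.intros(4))
qed (simp_all add: zigzag_map zig_eq.intros(1) zig_eq.intros(3))

lemma Ho_functor_sel [simp]: "fob (Ho_functor D V S) a = fob S a"
  by (simp add: Ho_functor_def)

lemma Ho_functor_mor:
  assumes ws: "zigzag C W a ws b"
  shows "fmor (Ho_functor D V S) (a, b, zig_class C W a b ws) =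
    (fob S a, fob S b, zig_class D V (fob S a) (fob S b) (m ws))"
proof -
  have "zig_class D V (fob S a) (fob S b) (m vs) = zig_class D V (fob S a) (fob S b) (m ws)"
    if "vs \<in> zig_class C W a b ws" for vs
    using zig_class_eq_iff[OF D zigzag_map[OF ws], of "m vs"] zig_eq_map that by (simp add: zig_class_def)
  moreover have "ws \<in> zig_class C W a b ws" using ws by (auto simp: zig_class_def intro: zig_eq.intros(1))
  ultimately have "(\<Union>vs\<in>zig_class C W a b ws. zig_class D V (fob S a) (fob S b) (m vs)) =
      zig_class D V (fob S a) (fob S b) (m ws)" by blast
  then show ?thesis by (simp add: Ho_functor_def)
qed

lemma is_functor_Ho: "is_functor (Ho C W) (Ho D V) (Ho_functor D V S)"
proof (rule is_functorI)
  fix a assume a: "a \<in> Ob (Ho C W)"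
  then show "fob (Ho_functor D V S) a \<in> Ob (Ho D V)"
    using ftr_ob[OF S] by (simp add: Ho_sel(1)[OF C] Ho_sel(1)[OF D])
  show "fmor (Ho_functor D V S) (Idn (Ho C W) a) = Idn (Ho D V) (fob (Ho_functor D V S) a)"
    using a Ho_functor_mor[of a "[]" a] by (simp add: Ho_sel[OF C] Ho_sel[OF D])
next
  fix f a b assume f: "f \<in> homs (Ho C W) a b"
  then obtain us where us: "zigzag C W a us b" "f = (a, b, zig_class C W a b us)"
    unfolding Ho_homs[OF C] by blast
  then show "fmor (Ho_functor D V S) f \<in> homs (Ho D V) (fob (Ho_functor D V S) a) (fob (Ho_functor D V S) b)"
    using Ho_functor_mor[OF us(1)] zigzag_map[OF us(1)] unfolding Ho_homs[OF D] by auto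
  fix g c assume "g \<in> homs (Ho C W) b c"
  then obtain vs where vs: "zigzag C W b vs c" "g = (b, c, zig_class C W b c vs)"
    unfolding Ho_homs[OF C] by blast
  have uv: "zigzag C W a (us @ vs) c" using us vs zigzag_append[OF C] by blast
  show "fmor (Ho_functor D V S) (Cmp (Ho C W) g f) =
      Cmp (Ho D V) (fmor (Ho_functor D V S) g) (fmor (Ho_functor D V S) f)"
    unfolding us(2) vs(2) Ho_cmp[OF C us(1) vs(1)] Ho_functor_mor[OF us(1)] Ho_functor_mor[OF vs(1)]
      Ho_functor_mor[OF uv] Ho_cmp[OF D zigzag_map[OF us(1)] zigzag_map[OF vs(1)]] by simp
qed

end

text \<open>\<open>Ho_functor\<close> of an identity or of a composite is compared with the expected
  functor only on actual morphisms of \<open>Ho\<close>. The functor records need not be equal as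
  HOL functions, so natural isomorphisms are moved across this weaker agreement.\<close>

lemma naturally_isomorphic_cong:
  assumes "naturally_isomorphic A C S T"
    and "\<And>a. a \<in> Ob A \<Longrightarrow> fob S' a = fob S a \<and> fob T' a = fob T a"
    and "\<And>f. f \<in> Mor A \<Longrightarrow> fmor S' f = fmor S f \<and> fmor T' f = fmor T f"
  shows "naturally_isomorphic A C S' T'"
  using assms unfolding naturally_isomorphic_def by metis

lemma naturally_isomorphic_sym:
  assumes A: "is_cat A" and C: "is_cat C" and S: "is_functor A C S" and T: "is_functor A C T"
    and n: "naturally_isomorphic A C S T"
  shows "naturally_isomorphic A C T S"
proof -
  obtain \<alpha> where \<alpha>: "\<And>a. a \<in> Ob A \<Longrightarrow> \<alpha> a \<in> homs C (fob S a) (fob T a) \<and> is_iso C (\<alpha> a)"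
    and nat: "\<And>f. f \<in> Mor A \<Longrightarrow> Cmp C (\<alpha> (Cod A f)) (fmor S f) = Cmp C (fmor T f) (\<alpha> (Dom A f))"
    using n unfolding naturally_isomorphic_def by blast
  have "\<exists>b. b \<in> homs C (fob T a) (fob S a) \<and> Cmp C b (\<alpha> a) = Idn C (fob S a) \<and> Cmp C (\<alpha> a) b = Idn C (fob T a)"
    if "a \<in> Ob A" for a
    using \<alpha>[OF that] homsD[of "\<alpha> a" C "fob S a" "fob T a"] unfolding is_iso_def by auto
  then obtain \<beta> where \<beta>: "\<And>a. a \<in> Ob A \<Longrightarrow> \<beta> a \<in> homs C (fob T a) (fob S a)"
    "\<And>a. a \<in> Ob A \<Longrightarrow> Cmp C (\<beta> a) (\<alpha> a) = Idn C (fob S a)" "\<And>a. a \<in> Ob A \<Longrightarrow> Cmp C (\<alpha> a) (\<beta> a) = Idn C (fob T a)"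
    by metis
  show ?thesis unfolding naturally_isomorphic_def
  proof (intro exI[of _ \<beta>] conjI ballI)
    fix a assume a: "a \<in> Ob A"
    show "\<beta> a \<in> homs C (fob T a) (fob S a)" by (rule \<beta>(1)[OF a])
    show "is_iso C (\<beta> a)" by (rule is_isoI[OF \<beta>(1)[OF a] conjunct1[OF \<alpha>[OF a]] \<beta>(3)[OF a] \<beta>(2)[OF a]])
  next
    fix f assume f: "f \<in> Mor A"
    let ?a = "Dom A f" and ?b = "Cod A f"
    note fh = Mor_homs[OF f]
    note o = cat_ob[OF A fh]
    note Sf = ftr_mor[OF S fh] and Tf = ftr_mor[OF T fh]
    note \<alpha>a = conjunct1[OF \<alpha>[OF o(1)]] and \<alpha>b = conjunct1[OF \<alpha>[OF o(2)]]
    have "Cmp C (\<beta> ?b) (fmor T f) = Cmp C (Cmp C (\<beta> ?b) (fmor T f)) (Cmp C (\<alpha> ?a) (\<beta> ?a))"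
      using \<beta>(3)[OF o(1)] cat_idr[OF C cat_cmp[OF C Tf \<beta>(1)[OF o(2)]]] by simp
    also have "\<dots> = Cmp C (\<beta> ?b) (Cmp C (Cmp C (fmor T f) (\<alpha> ?a)) (\<beta> ?a))"
      using cat_assoc[OF C \<beta>(1)[OF o(1)] \<alpha>a cat_cmp[OF C Tf \<beta>(1)[OF o(2)]]]
        cat_assoc[OF C \<alpha>a Tf \<beta>(1)[OF o(2)]] cat_assoc[OF C \<beta>(1)[OF o(1)] cat_cmp[OF C \<alpha>a Tf] \<beta>(1)[OF o(2)]] by simp
    also have "\<dots> = Cmp C (\<beta> ?b) (Cmp C (Cmp C (\<alpha> ?b) (fmor S f)) (\<beta> ?a))" using nat[OF f] by simp
    also have "\<dots> = Cmp C (Cmp C (Cmp C (\<beta> ?b) (\<alpha> ?b)) (fmor S f)) (\<beta> ?a)"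
      using cat_assoc[OF C \<beta>(1)[OF o(1)] cat_cmp[OF C Sf \<alpha>b] \<beta>(1)[OF o(2)]] cat_assoc[OF C Sf \<alpha>b \<beta>(1)[OF o(2)]] by simp
    also have "\<dots> = Cmp C (fmor S f) (\<beta> ?a)" using \<beta>(2)[OF o(2)] cat_idl[OF C Sf] by simp
    finally show "Cmp C (\<beta> ?b) (fmor T f) = Cmp C (fmor S f) (\<beta> ?a)" .
  qed
qed

lemma is_iso_Cmp:
  assumes C: "is_cat C" and f: "f \<in> homs C a b" "is_iso C f" and g: "g \<in> homs C b c" "is_iso C g"
  shows "is_iso C (Cmp C g f)"
proof -
  obtain f' where f': "f' \<in> homs C b a" "Cmp C f' f = Idn C a" "Cmp C f f' = Idn C b"
    using f homsD[OF f(1)] unfolding is_iso_def by auto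
  obtain g' where g': "g' \<in> homs C c b" "Cmp C g' g = Idn C b" "Cmp C g g' = Idn C c"
    using g homsD[OF g(1)] unfolding is_iso_def by auto
  show ?thesis
  proof (rule is_isoI[OF cat_cmp[OF C f(1) g(1)] cat_cmp[OF C g'(1) f'(1)]])
    show "Cmp C (Cmp C f' g') (Cmp C g f) = Idn C a"
      using cat_assoc[OF C cat_cmp[OF C f(1) g(1)] g'(1) f'(1)] cat_assoc[OF C f(1) g(1) g'(1)]
        cat_idl[OF C f(1)] f' g' by simp
    show "Cmp C (Cmp C g f) (Cmp C f' g') = Idn C c"
      using cat_assoc[OF C cat_cmp[OF C g'(1) f'(1)] f(1) g(1)] cat_assoc[OF C g'(1) f'(1) f(1)]
        cat_idl[OF C g'(1)] f' g' by simp
  qed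
qed

lemma naturally_isomorphic_trans:
  assumes A: "is_cat A" and C: "is_cat C" and R: "is_functor A C R" and S: "is_functor A C S" and T: "is_functor A C T"
    and n: "naturally_isomorphic A C R S" "naturally_isomorphic A C S T"
  shows "naturally_isomorphic A C R T"
proof -
  obtain \<alpha> where \<alpha>: "\<And>a. a \<in> Ob A \<Longrightarrow> \<alpha> a \<in> homs C (fob R a) (fob S a) \<and> is_iso C (\<alpha> a)"
    and nat: "\<And>f. f \<in> Mor A \<Longrightarrow> Cmp C (\<alpha> (Cod A f)) (fmor R f) = Cmp C (fmor S f) (\<alpha> (Dom A f))"
    using n(1) unfolding naturally_isomorphic_def by blast
  obtain \<beta> where \<beta>: "\<And>a. a \<in> Ob A \<Longrightarrow> \<beta> a \<in> homs C (fob S a) (fob T a) \<and> is_iso C (\<beta> a)"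
    and nat': "\<And>f. f \<in> Mor A \<Longrightarrow> Cmp C (\<beta> (Cod A f)) (fmor S f) = Cmp C (fmor T f) (\<beta> (Dom A f))"
    using n(2) unfolding naturally_isomorphic_def by blast
  show ?thesis unfolding naturally_isomorphic_def
  proof (intro exI[of _ "\<lambda>a. Cmp C (\<beta> a) (\<alpha> a)"] conjI ballI)
    fix a assume a: "a \<in> Ob A"
    show "Cmp C (\<beta> a) (\<alpha> a) \<in> homs C (fob R a) (fob T a)" "is_iso C (Cmp C (\<beta> a) (\<alpha> a))"
      using \<alpha>[OF a] \<beta>[OF a] cat_cmp[OF C] is_iso_Cmp[OF C] by blast+
  next
    fix f assume f: "f \<in> Mor A"
    note fh = Mor_homs[OF f]
    note o = cat_ob[OF A fh]
    note a = conjunct1[OF \<alpha>[OF o(1)]] conjunct1[OF \<alpha>[OF o(2)]] and b = conjunct1[OF \<beta>[OF o(1)]] conjunct1[OF \<beta>[OF o(2)]]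
    show "Cmp C (Cmp C (\<beta> (Cod A f)) (\<alpha> (Cod A f))) (fmor R f) = Cmp C (fmor T f) (Cmp C (\<beta> (Dom A f)) (\<alpha> (Dom A f)))"
      using cat_assoc[OF C ftr_mor[OF R fh] a(2) b(2)] cat_assoc[OF C a(1) ftr_mor[OF S fh] b(2)]
        cat_assoc[OF C a(1) b(1) ftr_mor[OF T fh]] nat[OF f] nat'[OF f] by simp
  qed
qed

section \<open>The localization as a category, and natural weak equivalences\<close>

lemma is_cat_Ho:
  assumes C: "is_cat C"
  shows "is_cat (Ho C W)"
proof (rule is_catI)
  fix f assume "f \<in> Mor (Ho C W)"
  then show "Dom (Ho C W) f \<in> Ob (Ho C W) \<and> Cod (Ho C W) f \<in> Ob (Ho C W)"
    using zigzag_ob[OF C] by (auto simp: Ho_def)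
next
  fix a assume "a \<in> Ob (Ho C W)"
  then have "zigzag C W a [] a" by (simp add: Ho_sel[OF C])
  then show "Idn (Ho C W) a \<in> homs (Ho C W) a a" unfolding Ho_homs[OF C] Ho_sel(4)[OF C] by blast
next
  fix f g a b c assume "f \<in> homs (Ho C W) a b" "g \<in> homs (Ho C W) b c"
  then obtain us vs where "zigzag C W a us b" "f = (a, b, zig_class C W a b us)"
    "zigzag C W b vs c" "g = (b, c, zig_class C W b c vs)" unfolding Ho_homs[OF C] by blast
  then show "Cmp (Ho C W) g f \<in> homs (Ho C W) a c"
    using Ho_cmp[OF C] zigzag_append[OF C] unfolding Ho_homs[OF C] by metis
next
  fix f a b assume "f \<in> homs (Ho C W) a b"
  then obtain us where us: "zigzag C W a us b" "f = (a, b, zig_class C W a b us)" unfolding Ho_homs[OF C] by blast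
  have "zigzag C W a [] a" "zigzag C W b [] b" using zigzag_ob[OF C us(1)] by auto
  then show "Cmp (Ho C W) f (Idn (Ho C W) a) = f" "Cmp (Ho C W) (Idn (Ho C W) b) f = f"
    using Ho_cmp[OF C _ us(1), of a "[]"] Ho_cmp[OF C us(1), of "[]" b] us(2) by (auto simp: Ho_sel[OF C])
next
  fix f g h a b c d assume "f \<in> homs (Ho C W) a b" "g \<in> homs (Ho C W) b c" "h \<in> homs (Ho C W) c d"
  then obtain us vs ws where *: "zigzag C W a us b" "f = (a, b, zig_class C W a b us)"
    "zigzag C W b vs c" "g = (b, c, zig_class C W b c vs)"
    "zigzag C W c ws d" "h = (c, d, zig_class C W c d ws)" unfolding Ho_homs[OF C] by blast
  have "zigzag C W a (us @ vs) c" "zigzag C W b (vs @ ws) d" using * zigzag_append[OF C] by blast+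
  then show "Cmp (Ho C W) h (Cmp (Ho C W) g f) = Cmp (Ho C W) (Cmp (Ho C W) h g) f"
    using * by (simp add: Ho_cmp[OF C])
qed

locale natural_weq =
  K: relative_functor C W D V K + L: relative_functor C W D V L
  for C :: "('o, 'm) cat" and W :: "'m set" and D :: "('p, 'n) cat" and V :: "'n set"
    and K L :: "('o, 'm, 'p, 'n) ftr" +
  fixes \<beta> :: "'o \<Rightarrow> 'n"
  assumes \<beta>: "\<And>a. a \<in> Ob C \<Longrightarrow> \<beta> a \<in> homs D (fob K a) (fob L a)" and \<beta>V: "\<And>a. a \<in> Ob C \<Longrightarrow> \<beta> a \<in> V"
    and nat: "\<And>f a b. f \<in> homs C a b \<Longrightarrow> Cmp D (\<beta> b) (fmor K f) = Cmp D (fmor L f) (\<beta> a)"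
begin

lemma Fwd_square:
  assumes f: "f \<in> homs C a c"
  shows "zig_eq D V (fob K a) (fob L c) [Fwd (fmor K f), Fwd (\<beta> c)] [Fwd (\<beta> a), Fwd (fmor L f)]"
proof -
  have o: "a \<in> Ob C" "c \<in> Ob C" using cat_ob[OF K.C f] by auto
  note Kf = ftr_mor[OF K.S f] and Lf = ftr_mor[OF L.S f] and ba = \<beta>[OF o(1)] and bc = \<beta>[OF o(2)]
  note h = homsD[OF Kf] homsD[OF Lf] homsD[OF ba] homsD[OF bc] homsD[OF cat_cmp[OF K.D Kf bc]] homsD[OF cat_cmp[OF K.D ba Lf]]
  have 1: "zig_eq D V (fob K a) (fob L c) [Fwd (fmor K f), Fwd (\<beta> c)] [Fwd (Cmp D (\<beta> c) (fmor K f))]"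
    by (rule zig_step(1)[OF K.D zig_rule.intros(2)[of "fmor K f" D "\<beta> c"], where xs = "[]" and ys = "[]"])
       (use h o ftr_ob[OF L.S] in auto)
  have 2: "zig_eq D V (fob K a) (fob L c) [Fwd (Cmp D (fmor L f) (\<beta> a))] [Fwd (\<beta> a), Fwd (fmor L f)]"
    by (rule zig_step(2)[OF K.D zig_rule.intros(2)[of "\<beta> a" D "fmor L f"], where xs = "[]" and ys = "[]"])
       (use h o ftr_ob[OF L.S] in auto)
  show ?thesis by (rule zig_eq.intros(4)[OF 1]) (use 2 nat[OF f] in simp)
qed

text \<open>Append \<open>fmor L w\<close> followed by its formal inverse, replace the middle by the
  naturality square of w read backwards, and cancel \<open>fmor K w\<close> against its formal
  inverse.\<close>

lemma Bwd_square:
  assumes w: "w \<in> homs C c a" "w \<in> W"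
  shows "zig_eq D V (fob K a) (fob L c) [Bwd (fmor K w), Fwd (\<beta> c)] [Fwd (\<beta> a), Bwd (fmor L w)]"
proof -
  have o: "a \<in> Ob C" "c \<in> Ob C" using cat_ob[OF K.C w(1)] by auto
  note Kw = ftr_mor[OF K.S w(1)] and Lw = ftr_mor[OF L.S w(1)] and ba = \<beta>[OF o(1)] and bc = \<beta>[OF o(2)]
  note h = homsD[OF Kw] homsD[OF Lw] homsD[OF ba] homsD[OF bc]
  note V = K.WV[OF w(2)] L.WV[OF w(2)]
  have 1: "zig_eq D V (fob K a) (fob L c) [Bwd (fmor K w), Fwd (\<beta> c)]
      [Bwd (fmor K w), Fwd (\<beta> c), Fwd (fmor L w), Bwd (fmor L w)]"
    by (rule zig_step(2)[OF K.D zig_rule.intros(3)[OF V(2)], where xs = "[Bwd (fmor K w), Fwd (\<beta> c)]" and ys = "[]"])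
       (use h o V ftr_ob[OF L.S] in auto)
  have 2: "zig_eq D V (fob K a) (fob L c) ([Bwd (fmor K w)] @ [Fwd (\<beta> c), Fwd (fmor L w)] @ [Bwd (fmor L w)])
      ([Bwd (fmor K w)] @ [Fwd (fmor K w), Fwd (\<beta> a)] @ [Bwd (fmor L w)])"
    by (rule zig_eq_append[OF K.D zig_eq.intros(3)[OF Fwd_square[OF w(1)]]]) (use h o V ftr_ob[OF L.S] ftr_ob[OF K.S] in auto)
  have 3: "zig_eq D V (fob K a) (fob L c) [Bwd (fmor K w), Fwd (fmor K w), Fwd (\<beta> a), Bwd (fmor L w)] [Fwd (\<beta> a), Bwd (fmor L w)]"
    by (rule zig_step(1)[OF K.D zig_rule.intros(4)[OF V(1)], where xs = "[]" and ys = "[Fwd (\<beta> a), Bwd (fmor L w)]"])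
       (use h o V ftr_ob[OF L.S] in auto)
  show ?thesis by (rule zig_eq.intros(4)[OF 1 zig_eq.intros(4)[OF 2[simplified] 3]])
qed

text \<open>The component of \<open>\<beta>\<close> is moved past the zigzag one letter at a time,
  by \<open>Fwd_square\<close> or \<open>Bwd_square\<close> according to the direction of the
  letter.\<close>

lemma zig_natural:
  "zigzag C W a ws b \<Longrightarrow> zig_eq D V (fob K a) (fob L b) (K.m ws @ [Fwd (\<beta> b)]) ([Fwd (\<beta> a)] @ L.m ws)"
proof (induction ws arbitrary: a)
  case Nil
  then have "a \<in> Ob C" "a = b" by auto
  then show ?case using homsD[OF \<beta>[of a]] ftr_ob[OF L.S] by (auto intro!: zig_eq.intros(1))
next
  case (Cons l ws)
  have step: "zig_eq D V (fob K a) (fob L b) (K.m (l # ws) @ [Fwd (\<beta> b)]) ([Fwd (\<beta> a)] @ L.m (l # ws))"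
    if sq: "zig_eq D V (fob K a) (fob L c) [map_letter (fmor K) l, Fwd (\<beta> c)] [Fwd (\<beta> a), map_letter (fmor L) l]"
      and z: "zigzag C W c ws b" for c
  proof -
    have z1: "zigzag D V (fob K a) [map_letter (fmor K) l] (fob K c)"
      using zig_eq_zigzag[OF K.D sq] zigzag_append[OF K.D, where xs = "[map_letter (fmor K) l]" and ys = "[Fwd (\<beta> c)]"]
        homsD[OF \<beta>[of c]] zigzag_ob[OF K.C z] by auto
    have 1: "zig_eq D V (fob K a) (fob L b) ([map_letter (fmor K) l] @ (K.m ws @ [Fwd (\<beta> b)]))
        ([map_letter (fmor K) l] @ ([Fwd (\<beta> c)] @ L.m ws))"
      by (rule zig_eq_append2[OF K.D zig_eq.intros(1)[OF z1] Cons.IH[OF z]])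
    have 2: "zig_eq D V (fob K a) (fob L b) ([map_letter (fmor K) l, Fwd (\<beta> c)] @ L.m ws)
        ([Fwd (\<beta> a), map_letter (fmor L) l] @ L.m ws)"
      by (rule zig_eq_append2[OF K.D sq zig_eq.intros(1)[OF L.zigzag_map[OF z]]])
    show ?thesis using zig_eq.intros(4)[OF 1] 2 by simp
  qed
  show ?case
  proof (cases l)
    case (Fwd f)
    then have f: "f \<in> homs C a (Cod C f)" and z: "zigzag C W (Cod C f) ws b"
      using Cons.prems by (auto simp: homs_def)
    show ?thesis using step[OF _ z] Fwd_square[OF f] Fwd by simp
  next
    case (Bwd w)
    then have w: "w \<in> homs C (Dom C w) a" "w \<in> W" and z: "zigzag C W (Dom C w) ws b"
      using Cons.prems by (auto simp: homs_def)
    show ?thesis using step[OF _ z] Bwd_square[OF w] Bwd by simp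
  qed
qed

lemma natural_iso_Ho: "naturally_isomorphic (Ho C W) (Ho D V) (Ho_functor D V K) (Ho_functor D V L)"
  unfolding naturally_isomorphic_def
proof (intro exI conjI ballI)
  let ?\<alpha> = "\<lambda>a. (fob K a, fob L a, zig_class D V (fob K a) (fob L a) [Fwd (\<beta> a)])"
  have z: "zigzag D V (fob K a) [Fwd (\<beta> a)] (fob L a)" "zigzag D V (fob L a) [Bwd (\<beta> a)] (fob K a)" if "a \<in> Ob C" for a
    using homsD[OF \<beta>[OF that]] \<beta>V[OF that] ftr_ob[OF L.S that] ftr_ob[OF K.S that] by auto
  {
    fix a assume "a \<in> Ob (Ho C W)"
    then have a: "a \<in> Ob C" by (simp add: Ho_sel[OF K.C])
    show "?\<alpha> a \<in> homs (Ho D V) (fob (Ho_functor D V K) a) (fob (Ho_functor D V L) a)"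
      using z(1)[OF a] unfolding Ho_homs[OF K.D] K.Ho_functor_sel L.Ho_functor_sel by blast
    show "is_iso (Ho D V) (?\<alpha> a)"
    proof (rule is_isoI)
      let ?\<beta> = "(fob L a, fob K a, zig_class D V (fob L a) (fob K a) [Bwd (\<beta> a)])"
      show "?\<alpha> a \<in> homs (Ho D V) (fob K a) (fob L a)" "?\<beta> \<in> homs (Ho D V) (fob L a) (fob K a)"
        using z[OF a] unfolding Ho_homs[OF K.D] by blast+
      note m = homsD[OF \<beta>[OF a]] \<beta>V[OF a] ftr_ob[OF L.S a] ftr_ob[OF K.S a]
      have 1: "zig_eq D V (fob K a) (fob K a) [Fwd (\<beta> a), Bwd (\<beta> a)] []"
        by (rule zig_step(1)[OF K.D zig_rule.intros(3)[OF \<beta>V[OF a] m(1)], where xs = "[]" and ys = "[]"]) (use m in auto)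
      have 2: "zig_eq D V (fob L a) (fob L a) [Bwd (\<beta> a), Fwd (\<beta> a)] []"
        by (rule zig_step(1)[OF K.D zig_rule.intros(4)[OF \<beta>V[OF a] m(1)], where xs = "[]" and ys = "[]"]) (use m in auto)
      show "Cmp (Ho D V) ?\<beta> (?\<alpha> a) = Idn (Ho D V) (fob K a)"
        using Ho_cmp[OF K.D z(1)[OF a] z(2)[OF a]]
          zig_class_eq_iff[OF K.D, of V "fob K a" "[Fwd (\<beta> a), Bwd (\<beta> a)]" "fob K a" "[]"]
          1 zig_eq_zigzag[OF K.D 1] by (simp add: Ho_sel[OF K.D])
      show "Cmp (Ho D V) (?\<alpha> a) ?\<beta> = Idn (Ho D V) (fob L a)"
        using Ho_cmp[OF K.D z(2)[OF a] z(1)[OF a]]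
          zig_class_eq_iff[OF K.D, of V "fob L a" "[Bwd (\<beta> a), Fwd (\<beta> a)]" "fob L a" "[]"]
          2 zig_eq_zigzag[OF K.D 2] by (simp add: Ho_sel[OF K.D])
    qed
  }
  fix f assume "f \<in> Mor (Ho C W)"
  then obtain a b ws where f: "f = (a, b, zig_class C W a b ws)" and ws: "zigzag C W a ws b"
    by (auto simp: Ho_def)
  have o: "a \<in> Ob C" "b \<in> Ob C" using zigzag_ob[OF K.C ws] by auto
  have "Cmp (Ho D V) (?\<alpha> b) (fmor (Ho_functor D V K) f) =
      (fob K a, fob L b, zig_class D V (fob K a) (fob L b) (K.m ws @ [Fwd (\<beta> b)]))"
    unfolding f K.Ho_functor_mor[OF ws] by (rule Ho_cmp[OF K.D K.zigzag_map[OF ws] z(1)[OF o(2)]])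
  also have "\<dots> = (fob K a, fob L b, zig_class D V (fob K a) (fob L b) ([Fwd (\<beta> a)] @ L.m ws))"
    using zig_class_eq_iff[OF K.D] zig_natural[OF ws] zig_eq_zigzag[OF K.D zig_natural[OF ws]] by blast
  also have "\<dots> = Cmp (Ho D V) (fmor (Ho_functor D V L) f) (?\<alpha> a)"
    unfolding f L.Ho_functor_mor[OF ws] by (rule Ho_cmp[OF K.D z(1)[OF o(1)] L.zigzag_map[OF ws], symmetric])
  finally show "Cmp (Ho D V) (?\<alpha> (Cod (Ho C W) f)) (fmor (Ho_functor D V K) f) =
      Cmp (Ho D V) (fmor (Ho_functor D V L) f) (?\<alpha> (Dom (Ho C W) f))"
    using f by (simp add: Ho_sel[OF K.C])
qed

end

lemma relative_functor_id: "is_cat C \<Longrightarrow> relative_functor C W C W id_ftr"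
  by unfold_locales (auto simp: is_functor_def Mor_homs is_cat_def)

lemma relative_functor_comp:
  "relative_functor C W D V S \<Longrightarrow> relative_functor D V E U T \<Longrightarrow> relative_functor C W E U (comp_ftr T S)"
  by (auto simp: relative_functor_def intro: is_functor_comp)

lemma Ho_functor_id:
  assumes C: "is_cat C" and f: "f \<in> Mor (Ho C W)"
  shows "fmor (Ho_functor C W id_ftr) f = f"
proof -
  obtain a b ws where f: "f = (a, b, zig_class C W a b ws)" and ws: "zigzag C W a ws b"
    using f by (auto simp: Ho_def)
  have m: "map (map_letter (fmor id_ftr)) ws = ws" by (simp add: id_ftr_def letter.map_id0[unfolded id_def])
  show ?thesis using relative_functor.Ho_functor_mor[OF relative_functor_id[OF C] ws] unfolding f m by simp
qed

lemma Ho_functor_comp: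
  assumes S: "relative_functor C W D V S" and T: "relative_functor D V E U T" and f: "f \<in> Mor (Ho C W)"
  shows "fmor (Ho_functor E U (comp_ftr T S)) f = fmor (Ho_functor E U T) (fmor (Ho_functor D V S) f)"
proof -
  obtain a b ws where f: "f = (a, b, zig_class C W a b ws)" and ws: "zigzag C W a ws b"
    using f by (auto simp: Ho_def)
  interpret S: relative_functor C W D V S by (rule S)
  interpret T: relative_functor D V E U T by (rule T)
  interpret TS: relative_functor C W E U "comp_ftr T S" by (rule relative_functor_comp[OF S T])
  have m: "TS.m ws = T.m (S.m ws)" by (simp add: letter.map_comp comp_def comp_ftr_def)
  show ?thesis
    unfolding f TS.Ho_functor_mor[OF ws] S.Ho_functor_mor[OF ws] T.Ho_functor_mor[OF S.zigzag_map[OF ws]] m comp_ftr_sel ..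
qed

text \<open>\<open>\<alpha>\<close> starts at the identity functor, as does
  \<open>\<epsilon>\<close>, so these point against the required direction and are inverted after
  localization: the first is composed with \<open>\<beta>\<close> through L, the second gives its
  isomorphism at once.\<close>

theorem induce_inverse_equivalencesI:
  assumes S: "relative_functor C W D V S" and T: "relative_functor D V C W T"
    and \<alpha>: "natural_weq C W C W id_ftr L \<alpha>" and \<beta>: "natural_weq C W C W (comp_ftr T S) L \<beta>"
    and \<epsilon>: "natural_weq D V D V id_ftr (comp_ftr S T) \<epsilon>"
  shows "induce_inverse_equivalences C W D V S T"
proof -
  interpret S: relative_functor C W D V S by (rule S)
  interpret T: relative_functor D V C W T by (rule T)
  interpret \<alpha>: natural_weq C W C W id_ftr L \<alpha> by (rule \<alpha>)
  interpret \<beta>: natural_weq C W C W "comp_ftr T S" L \<beta> by (rule \<beta>)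
  interpret \<epsilon>: natural_weq D V D V id_ftr "comp_ftr S T" \<epsilon> by (rule \<epsilon>)
  note HC = is_cat_Ho[OF S.C, of W] and HD = is_cat_Ho[OF S.D, of V]
  have "naturally_isomorphic (Ho C W) (Ho C W) (Ho_functor C W (comp_ftr T S)) (Ho_functor C W id_ftr)"
    by (rule naturally_isomorphic_trans[OF HC HC \<beta>.K.is_functor_Ho \<alpha>.L.is_functor_Ho \<alpha>.K.is_functor_Ho \<beta>.natural_iso_Ho
          naturally_isomorphic_sym[OF HC HC \<alpha>.K.is_functor_Ho \<alpha>.L.is_functor_Ho \<alpha>.natural_iso_Ho]])
  then have 1: "naturally_isomorphic (Ho C W) (Ho C W) (comp_ftr (Ho_functor C W T) (Ho_functor D V S)) id_ftr"
    by (rule naturally_isomorphic_cong) (auto simp: Ho_functor_id[OF S.C] Ho_functor_comp[OF S T])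
  have "naturally_isomorphic (Ho D V) (Ho D V) (Ho_functor D V (comp_ftr S T)) (Ho_functor D V id_ftr)"
    by (rule naturally_isomorphic_sym[OF HD HD \<epsilon>.K.is_functor_Ho \<epsilon>.L.is_functor_Ho \<epsilon>.natural_iso_Ho])
  then have 2: "naturally_isomorphic (Ho D V) (Ho D V) (comp_ftr (Ho_functor D V S) (Ho_functor C W T)) id_ftr"
    by (rule naturally_isomorphic_cong) (auto simp: Ho_functor_id[OF S.D] Ho_functor_comp[OF T S])
  show ?thesis
    unfolding induce_inverse_equivalences_def
    using 1 2 S.S S.WV S.is_functor_Ho T.S T.WV T.is_functor_Ho by blast
qed

section \<open>Full subcategories and constant pro-objects\<close>

text \<open>The structure maps are required to be equal as functions, not only on the smaller
  category. This is inherited by \<open>simp\<close> and allows the inclusion to be the identity on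
  objects and morphisms.\<close>

definition full_sub :: "('o, 'm) cat \<Rightarrow> ('o, 'm) cat \<Rightarrow> bool" where
  "full_sub C D \<longleftrightarrow> Dom C = Dom D \<and> Cod C = Cod D \<and> Idn C = Idn D \<and> Cmp C = Cmp D \<and> Ob C \<subseteq> Ob D \<and>
     (\<forall>f. f \<in> Mor C \<longleftrightarrow> f \<in> Mor D \<and> Dom D f \<in> Ob C \<and> Cod D f \<in> Ob C)"

lemma full_subD:
  assumes "full_sub C D"
  shows "Idn C = Idn D" "Cmp C = Cmp D" "a \<in> Ob C \<Longrightarrow> a \<in> Ob D"
    and full_sub_homs: "a \<in> Ob C \<Longrightarrow> b \<in> Ob C \<Longrightarrow> homs C a b = homs D a b"
  using assms by (auto simp: full_sub_def homs_def)

lemma full_sub_functor: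
  assumes A: "is_cat A" and s: "full_sub C D"
  shows "is_functor A C T \<longleftrightarrow> is_functor A D T \<and> (\<forall>a\<in>Ob A. fob T a \<in> Ob C)"
proof
  assume T: "is_functor A C T"
  have "is_functor A D T"
    by (rule is_functorI)
      (use ftr_ob[OF T] ftr_id[OF T] ftr_cmp[OF T] ftr_mor[OF T] full_subD[OF s] cat_ob[OF A] in auto)
  then show "is_functor A D T \<and> (\<forall>a\<in>Ob A. fob T a \<in> Ob C)" using ftr_ob[OF T] by blast
next
  assume T: "is_functor A D T \<and> (\<forall>a\<in>Ob A. fob T a \<in> Ob C)"
  then have T': "is_functor A D T" by simp
  show "is_functor A C T"
    by (rule is_functorI)
      (use T ftr_id[OF T'] ftr_cmp[OF T'] ftr_mor[OF T'] full_subD[OF s] cat_ob[OF A] in auto)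
qed

lemma full_sub_sets: "(\<And>A. P A \<Longrightarrow> Q A) \<Longrightarrow> full_sub (sets_cat P) (sets_cat Q)"
  by (auto simp: full_sub_def)

lemma simp_Ob_sub:
  "full_sub C D \<Longrightarrow> X \<in> Ob (simp C) \<longleftrightarrow> X \<in> Ob (simp D) \<and> (\<forall>n. fob X n \<in> Ob C)"
  using full_sub_functor[of "op_cat simplex_cat" C D X] by (auto simp: simp_Ob)

lemma full_sub_simp:
  assumes "is_cat C" "is_cat D" and s: "full_sub C D"
  shows "full_sub (simp C) (simp D)"
proof -
  have homs_eq: "f \<in> homs (simp C) X Y \<longleftrightarrow> f \<in> homs (simp D) X Y \<and> X \<in> Ob (simp C) \<and> Y \<in> Ob (simp C)" for f X Y
    unfolding simp_homs simp_Ob_sub[OF s]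
    using full_subD(1,2)[OF s] full_sub_homs[OF s] by (auto simp: nat_trans_def)
  have "f \<in> Mor (simp C) \<longleftrightarrow> f \<in> Mor (simp D) \<and> Dom (simp D) f \<in> Ob (simp C) \<and> Cod (simp D) f \<in> Ob (simp C)" for f
    using homs_eq[of f "Dom (simp D) f" "Cod (simp D) f"] by (simp add: homs_def)
  then show ?thesis unfolding full_sub_def using simp_Ob_sub[OF s] full_subD(1,2)[OF s] by auto
qed

context
  fixes C D :: "('o, 'm) cat"
  assumes C: "is_cat C" and D: "is_cat D" and s: "full_sub C D"
begin

lemma is_pob_sub: "is_pob C X \<longleftrightarrow> is_pob D X \<and> (\<forall>s\<in>Ob (Idx X). fob (Dia X) s \<in> Ob C)"
  using full_sub_functor[OF _ s, of "Idx X" "Dia X"] by (auto simp: is_pob_def functor_cat_Ob)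

text \<open>A germ refers to the hom sets of the ambient category and so could grow in D. All its
  members are maps from stages of X to b, and since both ends lie in C, fullness gives the same
  maps.\<close>

lemma germ_sub:
  assumes "is_pob C X" "b \<in> Ob C" "f \<in> homs C a b"
  shows "germ C X i f = germ D X i f"
proof -
  have "Cod C f = b" "Cod D f = b" using assms(3) s by (auto simp: homs_def full_sub_def)
  then show ?thesis
    unfolding germ_def using full_sub_homs[OF s] pob_ob[OF assms(1)] assms(2) full_subD(2)[OF s] by auto
qed

lemma pro_homs_sub:
  assumes X: "is_pob C X" and Y: "is_pob C Y"
  shows "homs (pro C) X Y = homs (pro D) X Y"
proof -
  have "is_pob D X" "is_pob D Y" using X Y is_pob_sub[of X] is_pob_sub[of Y] by auto
  moreover have "(\<exists>t\<in>Ob (Idx X). \<exists>f\<in>homs C (fob (Dia X) t) (fob (Dia Y) s). \<phi> = germ C X t f) \<longleftrightarrow>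
     (\<exists>t\<in>Ob (Idx X). \<exists>f\<in>homs D (fob (Dia X) t) (fob (Dia Y) s). \<phi> = germ D X t f)"
    if "s \<in> Ob (Idx Y)" for s \<phi>
    using germ_sub[OF X pob_ob[OF Y that]] full_sub_homs[OF s pob_ob[OF X] pob_ob[OF Y that]] by metis
  ultimately show ?thesis
    using X Y full_subD(2)[OF s] unfolding pro_homs set_eq_iff by simp
qed

lemma pro_Idn_sub: "is_pob C X \<Longrightarrow> Idn (pro C) X = Idn (pro D) X"
  using germ_sub[OF _ pob_ob cat_id[OF C pob_ob], of X X] full_subD(1)[OF s] by (simp add: fun_eq_iff)

lemma pro_Cmp_sub:
  assumes p: "\<phi> \<in> homs (pro C) X Y" and q: "\<psi> \<in> homs (pro C) Y Z"
  shows "Cmp (pro C) \<psi> \<phi> = Cmp (pro D) \<psi> \<phi>"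
proof -
  note X = pro_homsD(1)[OF C p] and Y = pro_homsD(2)[OF C p] and Z = pro_homsD(2)[OF C q]
  have p': "\<phi> \<in> homs (pro D) X Y" and q': "\<psi> \<in> homs (pro D) Y Z"
    using p q pro_homs_sub[OF X Y] pro_homs_sub[OF Y Z] by auto
  have c: "Cmp (pro C) \<psi> \<phi> \<in> homs (pro D) X Z" using pro_cmp[OF C p q] pro_homs_sub[OF X Z] by auto
  show ?thesis
  proof (rule pro_eqI[OF D c pro_cmp[OF D p' q']])
    fix r assume r: "r \<in> Ob (Idx Z)"
    obtain s g where g: "(s, g) \<in> germs \<psi> r" using pro_rep[OF C q r] by blast
    note g' = pro_memD[OF C q r g]
    obtain t f where f: "(t, f) \<in> germs \<phi> s" using pro_rep[OF C p g'(1)] by blast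
    show "\<exists>t f. (t, f) \<in> germs (Cmp (pro C) \<psi> \<phi>) r \<and> (t, f) \<in> germs (Cmp (pro D) \<psi> \<phi>) r"
      using pro_Cmp_mem(2)[OF C p q r g f] pro_Cmp_mem(2)[OF D p' q' r g f] full_subD(2)[OF s] by auto
  qed
qed

lemma is_functor_pro_sub: "is_functor (pro C) (pro D) id_ftr"
proof (rule is_functorI)
  fix X :: "('u, 'o, 'm) pob" assume "X \<in> Ob (pro C)"
  then have X: "is_pob C X" by (simp add: pro_Ob)
  show "fob id_ftr X \<in> Ob (pro D)" using X is_pob_sub[of X] by (simp add: pro_Ob)
  show "fmor id_ftr (Idn (pro C) X) = Idn (pro D) (fob id_ftr X)" using pro_Idn_sub[OF X] by simp
next
  fix \<phi> :: "('u, 'o, 'm) parr" and X Y assume p: "\<phi> \<in> homs (pro C) X Y"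
  then show "fmor id_ftr \<phi> \<in> homs (pro D) (fob id_ftr X) (fob id_ftr Y)"
    using pro_homs_sub[OF pro_homsD(1,2)[OF C p]] by simp
  fix \<psi> Z assume q: "\<psi> \<in> homs (pro C) Y Z"
  show "fmor id_ftr (Cmp (pro C) \<psi> \<phi>) = Cmp (pro D) (fmor id_ftr \<psi>) (fmor id_ftr \<phi>)"
    using pro_Cmp_sub[OF p q] by simp
qed

end

section \<open>Constant pro-objects\<close>

definition point_cat :: "('u, 'u) cat" where
  "point_cat = \<lparr>Ob = {undefined}, Mor = {undefined}, Dom = (\<lambda>_. undefined), Cod = (\<lambda>_. undefined),
     Idn = (\<lambda>_. undefined), Cmp = (\<lambda>_ _. undefined)\<rparr>"

lemma point_cat_sel [simp]: "Ob point_cat = {undefined}" "Mor point_cat = {undefined}"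
  "Dom point_cat u = undefined" "Cod point_cat u = undefined" "Idn point_cat a = undefined" "Cmp point_cat u v = undefined"
  by (simp_all add: point_cat_def)

lemma point_cat_homs [simp]: "homs point_cat a b = (if a = undefined \<and> b = undefined then {undefined} else {})"
  by (auto simp: homs_def)

text \<open>The only index is \<open>undefined\<close>, an element available in every type
  \<open>'u\<close>.\<close>

definition const_pob :: "('o, 'm) cat \<Rightarrow> 'o \<Rightarrow> ('u, 'o, 'm) pob" where
  "const_pob C c = (point_cat, \<lparr>fob = (\<lambda>s\<in>{undefined}. c), fmor = (\<lambda>u\<in>{undefined}. Idn C c)\<rparr>)"

lemma const_pob_sel [simp]: "Idx (const_pob C c) = point_cat" "fob (Dia (const_pob C c)) undefined = c"
  "fmor (Dia (const_pob C c)) undefined = Idn C c"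
  by (simp_all add: const_pob_def)

lemma small_finite:
  assumes "infinite (UNIV :: 'u set)" "finite (A :: 'u set)"
  shows "small A"
  unfolding small_def
  by (rule finite_ordLess_infinite[OF card_of_Well_order card_of_Well_order]) (use assms in \<open>simp_all add: Field_card_of\<close>)

lemma is_pob_const:
  assumes C: "is_cat C" and c: "c \<in> Ob C" and u: "infinite (UNIV :: 'u set)"
  shows "is_pob C (const_pob C c :: ('u, 'o, 'm) pob)"
proof -
  have "is_cat (point_cat :: ('u, 'u) cat)" by (rule is_catI) (auto split: if_splits)
  moreover have "cofiltered (point_cat :: ('u, 'u) cat)" by (auto simp: cofiltered_def)
  moreover have "is_functor (point_cat :: ('u, 'u) cat) C (Dia (const_pob C c))"
    by (rule is_functorI) (use c cat_id[OF C c] cat_idl[OF C cat_id[OF C c]] in \<open>auto split: if_splits\<close>)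
  ultimately show ?thesis
    by (simp add: is_pob_def functor_cat_Ob small_finite[OF u]) (simp add: const_pob_def)
qed

text \<open>Maps into a constant pro-object form the colimit of the sets of maps out of the stages,
  so a map out of one stage already defines one. Simplicial maps into K become maps of pro-objects
  in this way.\<close>

lemma const_pob_hom:
  assumes C: "is_cat C" and X: "is_pob C X" and u: "infinite (UNIV :: 'u set)"
    and t: "t \<in> Ob (Idx X)" and f: "f \<in> homs C (fob (Dia X) t) c"
  shows "\<exists>\<phi>\<in>homs (pro C) X (const_pob C c :: ('u, 'o, 'm) pob). (t, f) \<in> germs \<phi> undefined"
proof -
  have c: "is_pob C (const_pob C c :: ('u, 'o, 'm) pob)"
    by (rule is_pob_const[OF C cat_ob(2)[OF C f] u])
  have "(X, const_pob C c, \<lambda>s\<in>Ob (Idx (const_pob C c :: ('u, 'o, 'm) pob)). germ C X t f) \<in> homs (pro C) X (const_pob C c)"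
    by (rule pro_homsI[OF C X c]) (use t f cat_idl[OF C f] in \<open>auto split: if_splits\<close>)
  moreover have "(t, f) \<in> germs (X, const_pob C c, \<lambda>s\<in>Ob (Idx (const_pob C c :: ('u, 'o, 'm) pob)). germ C X t f) undefined"
    using mem_germ[OF C X t f] t f by simp
  ultimately show ?thesis by blast
qed

lemma const_pob_eqI:
  assumes C: "is_cat C" and p: "\<phi> \<in> homs (pro C) X (const_pob C c)" "\<psi> \<in> homs (pro C) X (const_pob C c)"
    and m: "(t, f) \<in> germs \<phi> undefined" "(t, f) \<in> germs \<psi> undefined"
  shows "\<phi> = \<psi>"
  using pro_eqI[OF C p] m by auto

lemma level_pob_const: "level_pob (const_pob (simp C) K) m = const_pob C (fob K m)"
  by (auto simp: level_pob_def const_pob_def fun_eq_iff)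

section \<open>Finite families in a filtered colimit\<close>

context colim
begin

text \<open>The equality is witnessed by two possibly different maps from l to k. A map equalising
  them turns the witness into restriction along one map.\<close>

lemma cls_eq_coequalize:
  assumes "k \<in> Ob J" "x \<in> car k" "y \<in> car k" "cls k x = cls k y"
  shows "\<exists>l w. w \<in> homs J l k \<and> res w x = res w y"
proof -
  obtain l u v where l: "u \<in> homs J l k" "v \<in> homs J l k" "res u x = res v y"
    using assms cls_eq_iff[OF assms(1,2,1,3)] unfolding eqv_def by blast
  obtain m w where m: "w \<in> homs J m l" "Cmp J u w = Cmp J v w"
    using cofiltered_par[OF J(2) _ assms(1) l(1,2)] cat_ob[OF J(1) l(1)] by blast
  have "res (Cmp J u w) x = res (Cmp J u w) y"
    using res_cmp[OF m(1) l(1) assms(2)] res_cmp[OF m(1) l(2) assms(3)] l(3) m(2) by simp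
  then show ?thesis using cat_cmp[OF J(1) m(1) l(1)] by blast
qed

text \<open>With \<open>colims_finite_common\<close> this says that filtered colimits of sets
  commute with finite products; here the injectivity. The stages equalising the individual pairs are
  reached one after another, and earlier equalities survive further restriction.\<close>

lemma cls_eq_coequalize_finite:
  assumes k: "k \<in> Ob J" and "finite I" and "\<And>i. i \<in> I \<Longrightarrow> x i \<in> car k \<and> y i \<in> car k \<and> cls k (x i) = cls k (y i)"
  shows "\<exists>l w. w \<in> homs J l k \<and> (\<forall>i\<in>I. res w (x i) = res w (y i))"
  using assms(2,3)
proof (induction I rule: finite_induct)
  case empty
  then show ?case using cat_id[OF J(1) k] by blast
next
  case (insert i I)
  then obtain l w where l: "w \<in> homs J l k" "\<forall>i\<in>I. res w (x i) = res w (y i)" by auto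
  have o: "l \<in> Ob J" using cat_ob[OF J(1) l(1)] by simp
  have i: "x i \<in> car k" "y i \<in> car k" "cls k (x i) = cls k (y i)" using insert.prems by auto
  obtain m v where m: "v \<in> homs J m l" "res v (res w (x i)) = res v (res w (y i))"
    using cls_eq_coequalize[OF o res_mem[OF l(1) i(1)] res_mem[OF l(1) i(2)]] cls_res[OF l(1)] i by auto
  have "res (Cmp J w v) (x j) = res (Cmp J w v) (y j)" if "j \<in> insert i I" for j
    using res_cmp[OF m(1) l(1)] insert.prems[OF that] that m(2) l(2) by auto
  then show ?case using cat_cmp[OF J(1) m(1) l(1)] by blast
qed

text \<open>The surjectivity half: finitely many classes are brought to one stage by successive
  common refinements.\<close>

lemma colims_finite_common:
  assumes "finite I" and "\<And>i. i \<in> I \<Longrightarrow> c i \<in> colims"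
  shows "\<exists>k x. k \<in> Ob J \<and> (\<forall>i\<in>I. x i \<in> car k \<and> c i = cls k (x i))"
  using assms
proof (induction I rule: finite_induct)
  case empty
  then show ?case using cofiltered_nonempty[OF J(2)] by auto
next
  case (insert i I)
  then obtain k x where k: "k \<in> Ob J" "\<forall>i\<in>I. x i \<in> car k \<and> c i = cls k (x i)" by auto
  obtain s y where s: "s \<in> Ob J" "y \<in> car s" "c i = cls s y" using insert.prems[of i] colimsE by blast
  obtain l u v where l: "l \<in> Ob J" "u \<in> homs J l k" "v \<in> homs J l s"
    using cofiltered_pair[OF J(2) k(1) s(1)] by blast
  have "\<forall>j\<in>insert i I. (if j = i then res v y else res u (x j)) \<in> car l \<and>
      c j = cls l (if j = i then res v y else res u (x j))"
    using k(2) s res_mem[OF l(2)] res_mem[OF l(3)] cls_res[OF l(2)] cls_res[OF l(3)] by auto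
  then show ?case
    using l(1) by (intro exI[of _ l] exI[of _ "\<lambda>j. if j = i then res v y else res u (x j)"]) simp
qed

end

section \<open>Mod p cochains\<close>

lemma maps_to_Zmod_carrier [simp]:
  "carrier (grp (maps_to_Zmod p) A) = A \<rightarrow>\<^sub>E carrier (integer_mod_group p)"
  by (simp add: maps_to_Zmod_def)

lemma maps_to_Zmod_pull [simp]: "pull (maps_to_Zmod p) (A, B, f) c = compose A c f"
  by (simp add: maps_to_Zmod_def)

text \<open>The predicate Q is arbitrary so that the same coefficients serve simplicial sets and
  simplicial finite sets.\<close>

lemma ab_presheaf_maps: "ab_presheaf (sets_cat (Q :: 'u set \<Rightarrow> bool)) (maps_to_Zmod p)"
  unfolding ab_presheaf_def set_presheaf_def
proof (intro conjI allI impI ballI)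
  interpret Z: comm_group "integer_mod_group p" by (rule abelian_integer_mod_group)
  {
    fix A B f x assume "f \<in> homs (sets_cat Q) A B" and x: "x \<in> carrier (grp (maps_to_Zmod p) B)"
    then show "pull (maps_to_Zmod p) f x \<in> carrier (grp (maps_to_Zmod p) A)"
      by (auto simp: sets_cat_homs compose_def)
  next
    fix A :: "'u set" and x assume "x \<in> carrier (grp (maps_to_Zmod p) A)"
    then show "pull (maps_to_Zmod p) (Idn (sets_cat Q) A) x = x"
      by (auto simp: compose_def fun_eq_iff PiE_def extensional_def)
  next
    fix A B C f g x assume "f \<in> homs (sets_cat Q) A B" "g \<in> homs (sets_cat Q) B C"
    then show "pull (maps_to_Zmod p) (Cmp (sets_cat Q) g f) x = pull (maps_to_Zmod p) f (pull (maps_to_Zmod p) g x)"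
      by (auto simp: sets_cat_homs compose_def fun_eq_iff PiE_def)
  next
    fix A :: "'u set"
    have "group (grp (maps_to_Zmod p) A)" by (simp add: maps_to_Zmod_def)
    then show "comm_group (grp (maps_to_Zmod p) A)"
      by (rule group.group_comm_groupI) (auto simp: maps_to_Zmod_def fun_eq_iff Z.m_comm add.commute)
  next
    fix A B f assume f: "f \<in> homs (sets_cat Q) A B"
    then obtain h where h: "f = (A, B, h)" "h \<in> A \<rightarrow>\<^sub>E B" by (auto simp: sets_cat_homs)
    have hm: "h a \<in> B" if "a \<in> A" for a using h(2) that by auto
    show "pull (maps_to_Zmod p) f \<in> hom (grp (maps_to_Zmod p) B) (grp (maps_to_Zmod p) A)"
    proof (rule homI)
      fix x assume x: "x \<in> carrier (grp (maps_to_Zmod p) B)"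
      then show "pull (maps_to_Zmod p) f x \<in> carrier (grp (maps_to_Zmod p) A)"
        using hm by (auto simp: h compose_def)
    next
      fix x y
      show "pull (maps_to_Zmod p) f (x \<otimes>\<^bsub>grp (maps_to_Zmod p) B\<^esub> y) =
        pull (maps_to_Zmod p) f x \<otimes>\<^bsub>grp (maps_to_Zmod p) A\<^esub> pull (maps_to_Zmod p) f y"
        using hm by (auto simp: h compose_def maps_to_Zmod_def fun_eq_iff)
    qed
  }
qed

section \<open>The simplicial finite set representing cochains\<close>

lemma inj_on_code:
  assumes "\<exists>e :: 'i \<Rightarrow> 'u. inj_on e A"
  shows "inj_on (code A :: 'i \<Rightarrow> 'u) A"
  unfolding code_def using assms by (rule someI_ex)

lemma decode_code: "inj_on (code A :: 'i \<Rightarrow> 'u) A \<Longrightarrow> x \<in> A \<Longrightarrow> decode A (code A x :: 'u) = x"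
  unfolding decode_def by (rule inv_into_f_f)

lemma inj_on_code_finite:
  assumes "infinite (UNIV :: 'u set)" "finite A"
  shows "inj_on (code A :: 'i \<Rightarrow> 'u) A"
proof (rule inj_on_code)
  obtain B :: "'u set" where "finite B" "card B = card A"
    using infinite_arbitrarily_large[OF assms(1)] by blast
  then obtain e where "bij_betw e A B" using finite_same_card_bij[OF assms(2)] by metis
  then show "\<exists>e :: 'i \<Rightarrow> 'u. inj_on e A" by (auto simp: bij_betw_def)
qed

text \<open>The operators n -> m are the n-simplices of the standard m-simplex, so these functions
  are its unnormalised n-cochains mod p.\<close>

definition cochain_fns :: "nat \<Rightarrow> nat \<Rightarrow> nat \<Rightarrow> (simplex_op \<Rightarrow> int) set" where
  "cochain_fns p n m = (homs simplex_cat n m \<rightarrow>\<^sub>E carrier (integer_mod_group p))"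

text \<open>As \<open>m\<close> varies these sets form a simplicial set; a map into it amounts to the \<open>n\<close>-cochain
  obtained by composing with the coordinate at the identity of \<open>n\<close>.\<close>

definition coeff_set :: "nat \<Rightarrow> nat \<Rightarrow> nat \<Rightarrow> 'u set" where
  "coeff_set p n m = code (cochain_fns p n m) ` cochain_fns p n m"

definition coord :: "nat \<Rightarrow> nat \<Rightarrow> nat \<Rightarrow> simplex_op \<Rightarrow> 'u \<Rightarrow> int" where
  "coord p n m \<eta> = (\<lambda>x\<in>coeff_set p n m. decode (cochain_fns p n m) x \<eta>)"

definition to_coeff :: "nat \<Rightarrow> nat \<Rightarrow> nat \<Rightarrow> 'u set \<Rightarrow> (simplex_op \<Rightarrow> 'u \<Rightarrow> int) \<Rightarrow> 'u setm" where
  "to_coeff p n m A x = (A, coeff_set p n m,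
     \<lambda>a\<in>A. code (cochain_fns p n m) (\<lambda>\<eta>\<in>homs simplex_cat n m. x \<eta> a))"

text \<open>An operator acts by reindexing coordinates along composition with it. This is
  restriction of cochains along the corresponding map of standard simplices.\<close>

definition coeff_ob :: "nat \<Rightarrow> nat \<Rightarrow> 'u ssetob" where
  "coeff_ob p n = \<lparr>fob = coeff_set p n,
     fmor = (\<lambda>\<theta>\<in>Mor simplex_cat. to_coeff p n (Dom simplex_cat \<theta>) (coeff_set p n (Cod simplex_cat \<theta>))
        (\<lambda>\<eta>. coord p n (Cod simplex_cat \<theta>) (Cmp simplex_cat \<theta> \<eta>)))\<rparr>"

locale coefficients =
  fixes p n :: nat and tu :: "'u itself"
  assumes p: "p > 0" and inf: "infinite (UNIV :: 'u set)"
begin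

abbreviation Zp where "Zp \<equiv> carrier (integer_mod_group p)"
abbreviation K :: "nat \<Rightarrow> 'u set" where "K \<equiv> coeff_set p n"
abbreviation KO :: "'u ssetob" where "KO \<equiv> coeff_ob p n"
abbreviation ev :: "nat \<Rightarrow> simplex_op \<Rightarrow> 'u \<Rightarrow> int" where "ev \<equiv> coord p n"
abbreviation P :: "('u set, 'u setm, 'u \<Rightarrow> int) presheaf" where "P \<equiv> maps_to_Zmod p"

text \<open>\<open>integer_mod_group 0\<close> is the group of integers; p > 0 makes the group of
  values finite, and there are finitely many operators.\<close>

lemma finite_fns: "finite (cochain_fns p n m)"
  unfolding cochain_fns_def using p finite_simplex_homs by (auto intro!: finite_PiE simp: carrier_integer_mod_group)

lemma finite_K: "finite (K m)"
  unfolding coeff_set_def using finite_fns by blast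

lemmas inj_fns = inj_on_code_finite[OF inf finite_fns]

lemma decode_fns: "y \<in> cochain_fns p n m \<Longrightarrow> decode (cochain_fns p n m) (code (cochain_fns p n m) y :: 'u) = y"
  by (rule decode_code[OF inj_fns])

lemma ev_mem: "\<eta> \<in> homs simplex_cat n m \<Longrightarrow> ev m \<eta> \<in> K m \<rightarrow>\<^sub>E Zp"
  by (auto simp: coord_def coeff_set_def decode_fns) (auto simp: cochain_fns_def)

lemma ev_inj:
  assumes "x \<in> K m" "y \<in> K m" "\<And>\<eta>. \<eta> \<in> homs simplex_cat n m \<Longrightarrow> ev m \<eta> x = ev m \<eta> y"
  shows "x = y"
proof -
  obtain f g where fg: "f \<in> cochain_fns p n m" "x = code (cochain_fns p n m) f"
    "g \<in> cochain_fns p n m" "y = code (cochain_fns p n m) g" using assms(1,2) by (auto simp: coeff_set_def)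
  have "f = g"
  proof (rule PiE_ext)
    show "f \<in> homs simplex_cat n m \<rightarrow>\<^sub>E Zp" "g \<in> homs simplex_cat n m \<rightarrow>\<^sub>E Zp"
      using fg by (auto simp: cochain_fns_def)
    show "f \<eta> = g \<eta>" if "\<eta> \<in> homs simplex_cat n m" for \<eta>
      using assms(3)[OF that] assms(1,2) decode_fns[OF fg(1)] decode_fns[OF fg(3)] fg by (simp add: coord_def)
  qed
  then show ?thesis using fg by simp
qed

text \<open>With \<open>coeff_eqI\<close> this exhibits \<open>K m\<close> as the power of Z/p
  indexed by the operators n -> m: a map from a finite set into it is the same as a family of
  coordinate functions.\<close>

lemma to_coeff:
  assumes x: "\<And>\<eta>. \<eta> \<in> homs simplex_cat n m \<Longrightarrow> x \<eta> \<in> A \<rightarrow>\<^sub>E Zp" and A: "finite A"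
  shows "to_coeff p n m A x \<in> homs FinSets A (K m)"
    and "\<eta> \<in> homs simplex_cat n m \<Longrightarrow> pull P (to_coeff p n m A x) (ev m \<eta>) = x \<eta>"
proof -
  have f: "(\<lambda>\<eta>\<in>homs simplex_cat n m. x \<eta> a) \<in> cochain_fns p n m" if "a \<in> A" for a
    using x that by (fastforce simp: cochain_fns_def)
  then show 1: "to_coeff p n m A x \<in> homs FinSets A (K m)"
    using A finite_K by (auto simp: to_coeff_def sets_cat_homs coeff_set_def)
  assume \<eta>: "\<eta> \<in> homs simplex_cat n m"
  have "code (cochain_fns p n m) (\<lambda>\<eta>\<in>homs simplex_cat n m. x \<eta> a) \<in> K m" if "a \<in> A" for a
    using f[OF that] by (simp add: coeff_set_def)
  then show "pull P (to_coeff p n m A x) (ev m \<eta>) = x \<eta>"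
    using f \<eta> x[OF \<eta>] by (auto simp: to_coeff_def compose_def coord_def decode_fns fun_eq_iff PiE_def extensional_def)
qed

lemma coeff_eqI:
  assumes "f \<in> homs FinSets A (K m)" "g \<in> homs FinSets A (K m)"
    and "\<And>\<eta>. \<eta> \<in> homs simplex_cat n m \<Longrightarrow> pull P f (ev m \<eta>) = pull P g (ev m \<eta>)"
  shows "f = g"
proof -
  obtain f' g' where fg: "f = (A, K m, f')" "f' \<in> A \<rightarrow>\<^sub>E K m" "g = (A, K m, g')" "g' \<in> A \<rightarrow>\<^sub>E K m"
    using assms(1,2) by (auto simp: sets_cat_homs)
  have "f' a = g' a" if a: "a \<in> A" for a
  proof (rule ev_inj)
    show "f' a \<in> K m" "g' a \<in> K m" using fg a by auto
    show "ev m \<eta> (f' a) = ev m \<eta> (g' a)" if "\<eta> \<in> homs simplex_cat n m" for \<eta>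
      using fun_cong[OF assms(3)[OF that], of a] a fg by (simp add: compose_def)
  qed
  then show ?thesis using PiE_ext[OF fg(2,4)] fg by simp
qed

lemmas PS = ab_presheaf_set[OF ab_presheaf_maps[of finite p]]

lemma coeff_mor:
  assumes \<theta>: "\<theta> \<in> homs simplex_cat l m"
  shows "fmor KO \<theta> \<in> homs FinSets (K m) (K l)"
    and "\<eta> \<in> homs simplex_cat n l \<Longrightarrow> pull P (fmor KO \<theta>) (ev l \<eta>) = ev m (Cmp simplex_cat \<theta> \<eta>)"
proof -
  have eq: "fmor KO \<theta> = to_coeff p n l (K m) (\<lambda>\<eta>. ev m (Cmp simplex_cat \<theta> \<eta>))"
    using homsD[OF \<theta>] by (simp add: coeff_ob_def del: simplex_cat_sel)
  have x: "ev m (Cmp simplex_cat \<theta> \<eta>) \<in> K m \<rightarrow>\<^sub>E Zp" if "\<eta> \<in> homs simplex_cat n l" for \<eta>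
    by (rule ev_mem[OF cat_cmp[OF is_cat_simplex_cat that \<theta>]])
  show "fmor KO \<theta> \<in> homs FinSets (K m) (K l)" unfolding eq by (rule to_coeff(1)[OF x finite_K])
  show "\<eta> \<in> homs simplex_cat n l \<Longrightarrow> pull P (fmor KO \<theta>) (ev l \<eta>) = ev m (Cmp simplex_cat \<theta> \<eta>)"
    unfolding eq by (rule to_coeff(2)[OF x finite_K])
qed

lemma coeff_ob_fob [simp]: "fob KO = K"
  by (simp add: coeff_ob_def)

lemma ev_carrier: "\<eta> \<in> homs simplex_cat n m \<Longrightarrow> ev m \<eta> \<in> carrier (grp P (K m))"
  using ev_mem by simp

lemma coeff_ob: "KO \<in> Ob (simp FinSets)"
proof (rule simp_ObI)
  note i = cat_id[OF is_cat_simplex_cat, of m for m, unfolded simplex_cat_sel(1), OF UNIV_I]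
  show "fob KO m \<in> Ob FinSets" for m using finite_K by simp
  show "fmor KO \<theta> \<in> homs FinSets (fob KO m) (fob KO l)"
    if "\<theta> \<in> homs simplex_cat l m" for \<theta> l m using coeff_mor(1)[OF that] by simp
  show "fmor KO (Idn simplex_cat m) = Idn FinSets (fob KO m)" for m
    unfolding coeff_ob_fob
  proof (rule coeff_eqI[OF coeff_mor(1)[OF i] cat_id])
    show "pull P (fmor KO (Idn simplex_cat m)) (ev m \<eta>) = pull P (Idn FinSets (K m)) (ev m \<eta>)"
      if "\<eta> \<in> homs simplex_cat n m" for \<eta>
      using coeff_mor(2)[OF i that] cat_idl[OF is_cat_simplex_cat that]
        set_presheaf_id[OF PS _ ev_carrier[OF that]] finite_K by (simp del: simplex_cat_sel sets_cat_sel add: sets_cat_sel(1))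
  qed (use finite_K in auto)
  show "fmor KO (Cmp simplex_cat \<eta> \<theta>) = Cmp FinSets (fmor KO \<theta>) (fmor KO \<eta>)"
    if \<theta>: "\<theta> \<in> homs simplex_cat k l" and \<eta>: "\<eta> \<in> homs simplex_cat l m" for \<theta> \<eta> k l m
  proof (rule coeff_eqI[OF coeff_mor(1)[OF cat_cmp[OF is_cat_simplex_cat \<theta> \<eta>]]
          cat_cmp[OF is_cat_sets_cat coeff_mor(1)[OF \<eta>] coeff_mor(1)[OF \<theta>]]])
    fix \<zeta> assume \<zeta>: "\<zeta> \<in> homs simplex_cat n k"
    show "pull P (fmor KO (Cmp simplex_cat \<eta> \<theta>)) (ev k \<zeta>) =
        pull P (Cmp FinSets (fmor KO \<theta>) (fmor KO \<eta>)) (ev k \<zeta>)"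
      using coeff_mor(2)[OF cat_cmp[OF is_cat_simplex_cat \<theta> \<eta>] \<zeta>] coeff_mor(2)[OF \<theta> \<zeta>]
        coeff_mor(2)[OF \<eta> cat_cmp[OF is_cat_simplex_cat \<zeta> \<theta>]]
        set_presheaf_cmp[OF PS coeff_mor(1)[OF \<eta>] coeff_mor(1)[OF \<theta>] ev_carrier[OF \<zeta>]]
        cat_assoc[OF is_cat_simplex_cat \<zeta> \<theta> \<eta>] by simp
  qed
  show "fmor KO \<in> extensional (Mor simplex_cat)" by (simp add: coeff_ob_def)
qed

section \<open>Continuous cochains as maps into the coefficient object\<close>

abbreviation LP :: "(('u, 'u set, 'u setm) pob, ('u, 'u set, 'u setm) parr, ('u \<times> ('u \<Rightarrow> int)) set) presheaf" where
  "LP \<equiv> colim_presheaf P"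

abbreviation cK :: "('u, 'u ssetob, 'u ssetarr) pob" where "cK \<equiv> const_pob (simp FinSets) KO"

text \<open>The coordinate at \<open>\<eta>\<close> regarded as a continuous cochain: its class in
  the colimit over the one-object index category.\<close>

abbreviation kap :: "nat \<Rightarrow> simplex_op \<Rightarrow> ('u \<times> ('u \<Rightarrow> int)) set" where
  "kap m \<eta> \<equiv> colim_class P (level_pob cK m) undefined (ev m \<eta>)"

lemmas F = is_cat_sets_cat[of finite]
lemmas SF = is_cat_simp[OF F]
lemmas LPS = ab_presheaf_set[OF ab_presheaf_colim[OF F ab_presheaf_maps[of finite p]]]

lemma is_pob_cK: "is_pob (simp FinSets) cK"
  by (rule is_pob_const[OF SF coeff_ob inf])

lemma level_cK: "level_pob cK m = const_pob FinSets (K m)"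
  by (simp add: level_pob_const)

lemma pull_kap:
  assumes ph: "\<phi> \<in> homs (pro FinSets) Q (level_pob cK m)" and f: "(t, f) \<in> germs \<phi> undefined"
    and \<eta>: "\<eta> \<in> homs simplex_cat n m"
  shows "pull LP \<phi> (kap m \<eta>) = colim_class P Q t (pull P f (ev m \<eta>))"
  by (rule pull_colim_class[OF F PS ph _ f]) (use ev_mem[OF \<eta>] in \<open>simp_all add: level_cK\<close>)

lemma kap_mem:
  assumes \<eta>: "\<eta> \<in> homs simplex_cat n m"
  shows "kap m \<eta> \<in> carrier (grp LP (level_pob cK m))"
proof -
  interpret colim FinSets P "level_pob cK m"
    by standard (use PS is_pob_level[OF F is_pob_cK] in auto)
  show ?thesis unfolding colims_carrier by (rule colimsI) (use ev_mem[OF \<eta>] in \<open>simp_all add: level_cK\<close>)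
qed

text \<open>Representatives of both maps are moved to one stage k. Each coordinate of the two agrees
  after some further restriction, and as there are finitely many coordinates, one restriction serves
  all of them. There the representatives are equal by \<open>coeff_eqI\<close>.\<close>

lemma kap_separates:
  assumes ph: "\<phi> \<in> homs (pro FinSets) Q (level_pob cK m)" and ps: "\<psi> \<in> homs (pro FinSets) Q (level_pob cK m)"
    and eq: "\<And>\<eta>. \<eta> \<in> homs simplex_cat n m \<Longrightarrow> pull LP \<phi> (kap m \<eta>) = pull LP \<psi> (kap m \<eta>)"
  shows "\<phi> = \<psi>"
proof -
  note Q = pro_homsD(1)[OF F ph]
  interpret colim FinSets P Q by standard (use PS Q in auto)
  have u: "undefined \<in> Ob (Idx (level_pob cK m))" by simp
  obtain t f where f: "(t, f) \<in> germs \<phi> undefined" using pro_rep[OF F ph u] by blast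
  obtain t' f' where f': "(t', f') \<in> germs \<psi> undefined" using pro_rep[OF F ps u] by blast
  note fD = pro_memD[OF F ph u f] and f'D = pro_memD[OF F ps u f']
  obtain k a b where k: "k \<in> Ob J" "a \<in> homs J k t" "b \<in> homs J k t'"
    using cofiltered_pair[OF J(2) fD(1) f'D(1)] by blast
  let ?g = "Cmp FinSets f (fmor (Dia Q) a)" and ?g' = "Cmp FinSets f' (fmor (Dia Q) b)"
  have fK: "f \<in> homs FinSets (fob (Dia Q) t) (K m)" "f' \<in> homs FinSets (fob (Dia Q) t') (K m)"
    using fD(2) f'D(2) by (auto simp: level_cK)
  have g: "?g \<in> homs FinSets (fob (Dia Q) k) (K m)" "?g' \<in> homs FinSets (fob (Dia Q) k) (K m)"
    by (rule cat_cmp[OF F pob_mor[OF Q k(2)] fK(1)], rule cat_cmp[OF F pob_mor[OF Q k(3)] fK(2)])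
  have mg: "(k, ?g) \<in> germs \<phi> undefined" "(k, ?g') \<in> germs \<psi> undefined"
    using fD(3) f'D(3) germ_res[OF F Q k(2) fK(1)] germ_res[OF F Q k(3) fK(2)]
      mem_germ[OF F Q fD(1) fK(1)] mem_germ[OF F Q f'D(1) fK(2)] k(1) g by auto
  have "\<exists>l w. w \<in> homs J l k \<and> (\<forall>\<eta>\<in>homs simplex_cat n m. res w (pull P ?g (ev m \<eta>)) = res w (pull P ?g' (ev m \<eta>)))"
  proof (rule cls_eq_coequalize_finite[OF k(1) finite_simplex_homs])
    fix \<eta> assume \<eta>: "\<eta> \<in> homs simplex_cat n m"
    show "pull P ?g (ev m \<eta>) \<in> car k \<and> pull P ?g' (ev m \<eta>) \<in> car k \<and>
        cls k (pull P ?g (ev m \<eta>)) = cls k (pull P ?g' (ev m \<eta>))"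
      using eq[OF \<eta>] pull_kap[OF ph mg(1) \<eta>] pull_kap[OF ps mg(2) \<eta>]
        set_presheaf_mem[OF PS g(1) ev_carrier[OF \<eta>]] set_presheaf_mem[OF PS g(2) ev_carrier[OF \<eta>]] by simp
  qed
  then obtain l w where w: "w \<in> homs J l k"
    "\<And>\<eta>. \<eta> \<in> homs simplex_cat n m \<Longrightarrow> res w (pull P ?g (ev m \<eta>)) = res w (pull P ?g' (ev m \<eta>))" by blast
  note wm = pob_mor[OF Q w(1)]
  have "Cmp FinSets ?g (fmor (Dia Q) w) = Cmp FinSets ?g' (fmor (Dia Q) w)"
  proof (rule coeff_eqI[OF cat_cmp[OF F wm g(1)] cat_cmp[OF F wm g(2)]])
    show "pull P (Cmp FinSets ?g (fmor (Dia Q) w)) (ev m \<eta>) = pull P (Cmp FinSets ?g' (fmor (Dia Q) w)) (ev m \<eta>)"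
      if \<eta>: "\<eta> \<in> homs simplex_cat n m" for \<eta>
      using w(2)[OF \<eta>] set_presheaf_cmp[OF PS wm g(1) ev_carrier[OF \<eta>]]
        set_presheaf_cmp[OF PS wm g(2) ev_carrier[OF \<eta>]] by simp
  qed
  then have "germ FinSets Q k ?g = germ FinSets Q k ?g'"
    using germ_res[OF F Q w(1) g(1)] germ_res[OF F Q w(1) g(2)] by metis
  then have "(k, ?g') \<in> germs \<phi> undefined"
    using pro_memD(3)[OF F ph u mg(1)] mem_germ[OF F Q k(1) g(1)] k(1) g(2) by simp
  then show ?thesis using const_pob_eqI[OF F ph[unfolded level_cK] ps[unfolded level_cK]] mg(2) by blast
qed

text \<open>The finitely many prescribed cochains have representatives at one stage k of Q, where
  \<open>to_coeff\<close> assembles them into a map to the finite set \<open>K m\<close>.\<close>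

lemma kap_exists:
  assumes Q: "is_pob FinSets Q" and c: "\<And>\<eta>. \<eta> \<in> homs simplex_cat n m \<Longrightarrow> c \<eta> \<in> carrier (grp LP Q)"
  shows "\<exists>\<phi>\<in>homs (pro FinSets) Q (level_pob cK m). \<forall>\<eta>\<in>homs simplex_cat n m. pull LP \<phi> (kap m \<eta>) = c \<eta>"
proof -
  interpret colim FinSets P Q by standard (use PS Q in auto)
  obtain k x where k: "k \<in> Ob J" "\<And>\<eta>. \<eta> \<in> homs simplex_cat n m \<Longrightarrow> x \<eta> \<in> car k \<and> c \<eta> = cls k (x \<eta>)"
    using colims_finite_common[OF finite_simplex_homs, of n m c] c[unfolded colims_carrier] by blast
  have x: "x \<eta> \<in> fob (Dia Q) k \<rightarrow>\<^sub>E Zp" if "\<eta> \<in> homs simplex_cat n m" for \<eta> using k(2)[OF that] by simp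
  have fin: "finite (fob (Dia Q) k)" using pob_ob[OF Q k(1)] by simp
  obtain \<phi> where ph: "\<phi> \<in> homs (pro FinSets) Q (const_pob FinSets (K m))"
    "(k, to_coeff p n m (fob (Dia Q) k) x) \<in> germs \<phi> undefined"
    using const_pob_hom[OF F Q inf k(1) to_coeff(1)[where x = x and m = m, OF x fin]] by blast
  have "pull LP \<phi> (kap m \<eta>) = c \<eta>" if \<eta>: "\<eta> \<in> homs simplex_cat n m" for \<eta>
    using pull_kap[OF ph(1)[folded level_cK] ph(2) \<eta>] to_coeff(2)[OF x fin \<eta>] k(2)[OF \<eta>] by simp
  then show ?thesis using ph(1) unfolding level_cK by blast
qed

abbreviation FK where "FK \<equiv> levelwise_ob FinSets cK"

lemma pull_FK_kap:
  assumes \<theta>: "\<theta> \<in> homs simplex_cat l m" and \<eta>: "\<eta> \<in> homs simplex_cat n l"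
  shows "pull LP (fmor FK \<theta>) (kap l \<eta>) = kap m (Cmp simplex_cat \<theta> \<eta>)"
proof -
  have u: "undefined \<in> Ob (Idx cK)" by simp
  have m: "(undefined, fmor KO \<theta>) \<in> germs (fmor FK \<theta>) undefined"
    using levelwise_ob_mor(2)[OF F is_pob_cK \<theta> u] by simp
  show ?thesis
    using pull_kap[OF levelwise_ob_mor(1)[OF F is_pob_cK \<theta>] m \<eta>] coeff_mor(2)[OF \<theta> \<eta>] by simp
qed

lemmas simplex_id = cat_id[OF is_cat_simplex_cat, of m for m, unfolded simplex_cat_sel(1), OF UNIV_I]

text \<open>The tautological n-cochain of K, namely the coordinate at the identity operator; every
  n-cochain is a pullback of it.\<close>

definition univ :: "('u \<times> ('u \<Rightarrow> int)) set" where
  "univ = kap n (Idn simplex_cat n)"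

text \<open>The Yoneda argument: the coordinate at \<open>\<eta>\<close> is \<open>univ\<close>
  pulled back along \<open>fmor FK \<eta>\<close>, and naturality of g moves this operator to Z.
  Hence the coordinates of g in all degrees are determined by the pullback of \<open>univ\<close> in
  degree n.\<close>

lemma coordinate_univ:
  assumes g: "g \<in> homs (simp (pro FinSets)) Z FK" and \<eta>: "\<eta> \<in> homs simplex_cat n m"
  shows "pull LP (at_level g m) (kap m \<eta>) = pull LP (fmor Z \<eta>) (pull LP (at_level g n) univ)"
proof -
  note Z = cat_ob(1)[OF is_cat_simp[OF is_cat_pro[OF F]] g]
  note FKo = levelwise_ob[OF F is_pob_cK]
  note gl = simp_at_level[OF g, unfolded levelwise_ob_fob]
  note FKm = simp_mor[OF FKo \<eta>, unfolded levelwise_ob_fob]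
  have "pull LP (at_level g n) univ \<in> carrier (grp LP (fob Z n))"
    unfolding univ_def by (rule set_presheaf_mem[OF LPS gl kap_mem[OF simplex_id]])
  have "kap m \<eta> = pull LP (fmor FK \<eta>) univ"
    using pull_FK_kap[OF \<eta> simplex_id] cat_idr[OF is_cat_simplex_cat \<eta>] by (simp add: univ_def)
  then have "pull LP (at_level g m) (kap m \<eta>) = pull LP (Cmp (pro FinSets) (fmor FK \<eta>) (at_level g m)) univ"
    using set_presheaf_cmp[OF LPS gl FKm kap_mem[OF simplex_id]] by (simp add: univ_def)
  also have "\<dots> = pull LP (Cmp (pro FinSets) (at_level g n) (fmor Z \<eta>)) univ"
    using simp_natural[OF g \<eta>] by simp
  also have "\<dots> = pull LP (fmor Z \<eta>) (pull LP (at_level g n) univ)"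
    unfolding univ_def by (rule set_presheaf_cmp[OF LPS simp_mor[OF Z \<eta>] gl kap_mem[OF simplex_id]])
  finally show ?thesis .
qed

lemma univ_separates:
  assumes g: "g \<in> homs (simp (pro FinSets)) Z FK" and h: "h \<in> homs (simp (pro FinSets)) Z FK"
    and eq: "pull LP (at_level g n) univ = pull LP (at_level h n) univ"
  shows "g = h"
proof (rule simp_hom_eqI[OF g h])
  show "at_level g m = at_level h m" for m
    by (rule kap_separates[OF simp_at_level[OF g, unfolded levelwise_ob_fob] simp_at_level[OF h, unfolded levelwise_ob_fob]])
       (simp add: coordinate_univ[OF g] coordinate_univ[OF h] eq)
qed

text \<open>By \<open>coordinate_univ\<close> the coordinates of the map are forced to be the
  pullbacks of c along the operators of Z. \<open>kap_exists\<close> provides the levels, and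
  \<open>kap_separates\<close> shows that they commute with the operators.\<close>

lemma univ_represents:
  assumes Z: "Z \<in> Ob (simp (pro FinSets))" and c: "c \<in> carrier (grp LP (fob Z n))"
  shows "\<exists>g\<in>homs (simp (pro FinSets)) Z FK. pull LP (at_level g n) univ = c"
proof -
  have "\<forall>m. \<exists>\<phi>\<in>homs (pro FinSets) (fob Z m) (level_pob cK m).
      \<forall>\<eta>\<in>homs simplex_cat n m. pull LP \<phi> (kap m \<eta>) = pull LP (fmor Z \<eta>) c"
  proof
    fix m
    show "\<exists>\<phi>\<in>homs (pro FinSets) (fob Z m) (level_pob cK m).
      \<forall>\<eta>\<in>homs simplex_cat n m. pull LP \<phi> (kap m \<eta>) = pull LP (fmor Z \<eta>) c"
      by (rule kap_exists) (use simp_ob[OF Z, of m] set_presheaf_mem[OF LPS simp_mor[OF Z] c] in \<open>simp_all add: pro_Ob\<close>)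
  qed
  then obtain g where "\<forall>m. g m \<in> homs (pro FinSets) (fob Z m) (level_pob cK m) \<and>
      (\<forall>\<eta>\<in>homs simplex_cat n m. pull LP (g m) (kap m \<eta>) = pull LP (fmor Z \<eta>) c)" by metis
  then have g: "\<And>m. g m \<in> homs (pro FinSets) (fob Z m) (level_pob cK m)"
    "\<And>m \<eta>. \<eta> \<in> homs simplex_cat n m \<Longrightarrow> pull LP (g m) (kap m \<eta>) = pull LP (fmor Z \<eta>) c" by blast+
  note FKo = levelwise_ob[OF F is_pob_cK]
  have "(Z, FK, g) \<in> homs (simp (pro FinSets)) Z FK"
  proof (rule simp_homsI[OF Z FKo])
    show "g m \<in> homs (pro FinSets) (fob Z m) (fob FK m)" for m using g(1) by simp
    fix \<theta> l m assume \<theta>: "\<theta> \<in> homs simplex_cat l m"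
    note FK\<theta> = simp_mor[OF FKo \<theta>, unfolded levelwise_ob_fob] and Z\<theta> = simp_mor[OF Z \<theta>]
    show "Cmp (pro FinSets) (g l) (fmor Z \<theta>) = Cmp (pro FinSets) (fmor FK \<theta>) (g m)"
    proof (rule kap_separates)
      show "Cmp (pro FinSets) (g l) (fmor Z \<theta>) \<in> homs (pro FinSets) (fob Z m) (level_pob cK l)"
        by (rule pro_cmp[OF F Z\<theta> g(1)])
      show "Cmp (pro FinSets) (fmor FK \<theta>) (g m) \<in> homs (pro FinSets) (fob Z m) (level_pob cK l)"
        by (rule pro_cmp[OF F g(1) FK\<theta>])
      fix \<eta> assume \<eta>: "\<eta> \<in> homs simplex_cat n l"
      note \<theta>\<eta> = cat_cmp[OF is_cat_simplex_cat \<eta> \<theta>]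
      have "pull LP (Cmp (pro FinSets) (g l) (fmor Z \<theta>)) (kap l \<eta>) = pull LP (fmor Z \<theta>) (pull LP (fmor Z \<eta>) c)"
        using set_presheaf_cmp[OF LPS Z\<theta> g(1) kap_mem[OF \<eta>]] g(2)[OF \<eta>] by simp
      also have "\<dots> = pull LP (fmor Z (Cmp simplex_cat \<theta> \<eta>)) c"
        using set_presheaf_cmp[OF LPS Z\<theta> simp_mor[OF Z \<eta>] c] simp_cmp[OF Z \<eta> \<theta>] by simp
      also have "\<dots> = pull LP (Cmp (pro FinSets) (fmor FK \<theta>) (g m)) (kap l \<eta>)"
        using set_presheaf_cmp[OF LPS g(1) FK\<theta> kap_mem[OF \<eta>]] g(2)[OF \<theta>\<eta>] pull_FK_kap[OF \<theta> \<eta>] by simp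
      finally show "pull LP (Cmp (pro FinSets) (g l) (fmor Z \<theta>)) (kap l \<eta>) =
          pull LP (Cmp (pro FinSets) (fmor FK \<theta>) (g m)) (kap l \<eta>)" .
    qed
  qed
  moreover have "pull LP (g n) univ = c"
    using g(2)[OF simplex_id] simp_id[OF Z, of n] set_presheaf_id[OF LPS simp_ob[OF Z] c] by (simp only: univ_def)
  ultimately show ?thesis by (intro bexI[of _ "(Z, FK, g)"]) simp_all
qed

text \<open>The map is wanted between pro-simplicial finite sets, whereas
  \<open>univ_represents\<close> would give one only after applying \<open>levelwise\<close>. The
  cochain lives on a single stage, and its classifying simplicial map out of that stage defines a
  map into the constant object \<open>cK\<close>.\<close>

lemma univ_represents_pro:
  assumes Y: "is_pob (simp FinSets) Y" and c: "c \<in> carrier (grp LP (level_pob Y n))"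
  shows "\<exists>\<phi>\<in>homs (pro (simp FinSets)) Y cK. pull LP (at_level (fmor (levelwise FinSets) \<phi>) n) univ = c"
proof -
  interpret colim FinSets P "level_pob Y n" by standard (use PS is_pob_level[OF F Y] in auto)
  obtain s x where s: "s \<in> Ob (Idx Y)" "x \<in> car s" "c = cls s x"
    using c unfolding colims_carrier by (rule colimsE) simp
  let ?Y = "fob (Dia Y) s"
  have Ys: "?Y \<in> Ob (simp FinSets)" using pob_ob[OF Y s(1)] .
  have x: "x \<in> carrier (grp P (fob ?Y n))" using s by simp
  have xm: "pull P (fmor ?Y \<eta>) x \<in> fob ?Y m \<rightarrow>\<^sub>E Zp" if "\<eta> \<in> homs simplex_cat n m" for \<eta> m
    using set_presheaf_mem[OF PS simp_mor[OF Ys that] x] by simp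
  have fin: "finite (fob ?Y m)" for m using simp_ob[OF Ys, of m] by simp
  define h where "h m = to_coeff p n m (fob ?Y m) (\<lambda>\<eta>. pull P (fmor ?Y \<eta>) x)" for m
  have h: "h m \<in> homs FinSets (fob ?Y m) (K m)" for m unfolding h_def by (rule to_coeff(1)[OF xm fin])
  have hp: "pull P (h m) (ev m \<eta>) = pull P (fmor ?Y \<eta>) x" if "\<eta> \<in> homs simplex_cat n m" for \<eta> m
    unfolding h_def using to_coeff(2)[OF xm fin that] by simp
  have f: "(?Y, KO, h) \<in> homs (simp FinSets) ?Y KO"
  proof (rule simp_homsI[OF Ys coeff_ob])
    show "h m \<in> homs FinSets (fob ?Y m) (fob KO m)" for m using h by simp
    fix \<theta> l m assume \<theta>: "\<theta> \<in> homs simplex_cat l m"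
    show "Cmp FinSets (h l) (fmor ?Y \<theta>) = Cmp FinSets (fmor KO \<theta>) (h m)"
    proof (rule coeff_eqI[OF cat_cmp[OF F simp_mor[OF Ys \<theta>] h] cat_cmp[OF F h coeff_mor(1)[OF \<theta>]]])
      fix \<eta> assume \<eta>: "\<eta> \<in> homs simplex_cat n l"
      show "pull P (Cmp FinSets (h l) (fmor ?Y \<theta>)) (ev l \<eta>) =
          pull P (Cmp FinSets (fmor KO \<theta>) (h m)) (ev l \<eta>)"
        using set_presheaf_cmp[OF PS simp_mor[OF Ys \<theta>] h ev_carrier[OF \<eta>]] hp[OF \<eta>]
          set_presheaf_cmp[OF PS h coeff_mor(1)[OF \<theta>] ev_carrier[OF \<eta>]] coeff_mor(2)[OF \<theta> \<eta>]
          hp[OF cat_cmp[OF is_cat_simplex_cat \<eta> \<theta>]]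
          set_presheaf_cmp[OF PS simp_mor[OF Ys \<theta>] simp_mor[OF Ys \<eta>] x] simp_cmp[OF Ys \<eta> \<theta>] by simp
    qed
  qed
  obtain \<phi> where ph: "\<phi> \<in> homs (pro (simp FinSets)) Y cK" "(s, (?Y, KO, h)) \<in> germs \<phi> undefined"
    using const_pob_hom[OF SF Y inf s(1) f] by blast
  have "(s, h n) \<in> germs (at_level (fmor (levelwise FinSets) \<phi>) n) undefined"
    using levelwise_mor_mem[OF F ph(1) _ ph(2), of n] by simp
  then have "pull LP (at_level (fmor (levelwise FinSets) \<phi>) n) univ = cls s (pull P (h n) (ev n (Idn simplex_cat n)))"
    unfolding univ_def
    using pull_kap[OF simp_at_level[OF levelwise_mor_simp[OF F ph(1)], unfolded levelwise_ob_fob] _ simplex_id] by blast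
  also have "\<dots> = c"
    using hp[OF simplex_id] simp_id[OF Ys, of n] set_presheaf_id[OF PS simp_ob[OF Ys] x] s(3) by simp
  finally show ?thesis using ph(1) by blast
qed

end

text \<open>The universal property \<open>bij\<close> is applied to the target \<open>cK\<close>.
  Two cochains on Y with equal pullbacks are represented by maps whose composites with
  \<open>\<eta>\<close> agree by \<open>univ_separates\<close>, hence by equal maps. A cochain on Z
  is represented by a map to \<open>FK\<close>, which factors through \<open>\<eta>\<close>, and the
  factor represents a preimage.\<close>

lemma adjunction_unit_cochains:
  assumes p: "p > 0" and inf: "infinite (UNIV :: 'u set)"
    and Z: "Z \<in> Ob (simp (pro FinSets))" and Y: "is_pob (simp FinSets) (Y :: ('u, 'u ssetob, 'u ssetarr) pob)"
    and \<eta>: "\<eta> \<in> homs (simp (pro FinSets)) Z (levelwise_ob FinSets Y)"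
    and bij: "\<And>X. is_pob (simp FinSets) X \<Longrightarrow> bij_betw (\<lambda>h. Cmp (simp (pro FinSets)) (fmor (levelwise FinSets) h) \<eta>)
      (homs (pro (simp FinSets)) Y X) (homs (simp (pro FinSets)) Z (levelwise_ob FinSets X))"
  shows "bij_betw (pull (colim_presheaf (maps_to_Zmod p)) (at_level \<eta> n))
    (carrier (grp (colim_presheaf (maps_to_Zmod p)) (level_pob Y n)))
    (carrier (grp (colim_presheaf (maps_to_Zmod p)) (fob Z n)))"
proof -
  interpret coefficients p n "TYPE('u)" by standard (use p inf in auto)
  note \<eta>l = simp_at_level[OF \<eta>, of n, unfolded levelwise_ob_fob]
  have comp: "pull LP (at_level (Cmp (simp (pro FinSets)) (fmor (levelwise FinSets) h) \<eta>) n) univ =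
      pull LP (at_level \<eta> n) (pull LP (at_level (fmor (levelwise FinSets) h) n) univ)"
    if h: "h \<in> homs (pro (simp FinSets)) Y cK" for h
  proof -
    note Fh = levelwise_mor_simp[OF F h]
    show ?thesis unfolding at_level_Cmp[OF \<eta> Fh] univ_def
      by (rule set_presheaf_cmp[OF LPS \<eta>l simp_at_level[OF Fh, unfolded levelwise_ob_fob] kap_mem[OF simplex_id]])
  qed
  note b = bij[OF is_pob_cK]
  show ?thesis unfolding bij_betw_def
  proof
    show "inj_on (pull LP (at_level \<eta> n)) (carrier (grp LP (level_pob Y n)))"
    proof (rule inj_onI)
      fix c d assume c: "c \<in> carrier (grp LP (level_pob Y n))" and d: "d \<in> carrier (grp LP (level_pob Y n))"
        and eq: "pull LP (at_level \<eta> n) c = pull LP (at_level \<eta> n) d"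
      obtain h k where h: "h \<in> homs (pro (simp FinSets)) Y cK" "pull LP (at_level (fmor (levelwise FinSets) h) n) univ = c"
        and k: "k \<in> homs (pro (simp FinSets)) Y cK" "pull LP (at_level (fmor (levelwise FinSets) k) n) univ = d"
        using univ_represents_pro[OF Y c] univ_represents_pro[OF Y d] by blast
      have "Cmp (simp (pro FinSets)) (fmor (levelwise FinSets) h) \<eta> = Cmp (simp (pro FinSets)) (fmor (levelwise FinSets) k) \<eta>"
        by (rule univ_separates) (use b h k comp eq in \<open>auto simp: bij_betw_def\<close>)
      then have "h = k" using b h(1) k(1) unfolding bij_betw_def inj_on_def by blast
      then show "c = d" using h k by simp
    qed
    show "pull LP (at_level \<eta> n) ` carrier (grp LP (level_pob Y n)) = carrier (grp LP (fob Z n))"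
    proof (rule subset_antisym)
      show "pull LP (at_level \<eta> n) ` carrier (grp LP (level_pob Y n)) \<subseteq> carrier (grp LP (fob Z n))"
        using set_presheaf_mem[OF LPS \<eta>l] by blast
      show "carrier (grp LP (fob Z n)) \<subseteq> pull LP (at_level \<eta> n) ` carrier (grp LP (level_pob Y n))"
      proof
        fix c assume c: "c \<in> carrier (grp LP (fob Z n))"
        obtain g where g: "g \<in> homs (simp (pro FinSets)) Z FK" "pull LP (at_level g n) univ = c"
          using univ_represents[OF Z c] by blast
        obtain h where h: "h \<in> homs (pro (simp FinSets)) Y cK" "g = Cmp (simp (pro FinSets)) (fmor (levelwise FinSets) h) \<eta>"
          using b g(1) unfolding bij_betw_def by blast
        note Fh = simp_at_level[OF levelwise_mor_simp[OF F h(1)], unfolded levelwise_ob_fob]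
        have "pull LP (at_level (fmor (levelwise FinSets) h) n) univ \<in> carrier (grp LP (level_pob Y n))"
          unfolding univ_def by (rule set_presheaf_mem[OF LPS Fh kap_mem[OF simplex_id]])
        then show "c \<in> pull LP (at_level \<eta> n) ` carrier (grp LP (level_pob Y n))"
          using comp[OF h(1)] g(2) h(2) by blast
      qed
    qed
  qed
qed

section \<open>Smallness and transport of index categories\<close>

locale universe =
  fixes U :: "'u itself"
  assumes U: "inaccessible TYPE('u)"
begin

lemma inaccessible_infinite: "infinite (UNIV :: 'u set)"
  using U ordLess_imp_ordLeq infinite_iff_natLeq_ordLeq unfolding inaccessible_def by blast

lemma small_subset: "|B| <o |UNIV :: 'u set| \<Longrightarrow> A \<subseteq> B \<Longrightarrow> |A| <o |UNIV :: 'u set|"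
  using card_of_mono1 ordLeq_ordLess_trans by blast

lemma small_image: "|A| <o |UNIV :: 'u set| \<Longrightarrow> |f ` A| <o |UNIV :: 'u set|"
  using card_of_image ordLeq_ordLess_trans by blast

lemma small_inj: "|B| <o |UNIV :: 'u set| \<Longrightarrow> inj_on f A \<Longrightarrow> f ` A \<subseteq> B \<Longrightarrow> |A| <o |UNIV :: 'u set|"
  by (rule ordLeq_ordLess_trans[of _ "|B|"]) (use card_of_ordLeq[of A B] in blast)+

lemma inj_on_code_small:
  assumes "|A :: 'i set| <o |UNIV :: 'u set|"
  shows "inj_on (code A :: 'i \<Rightarrow> 'u) A"
proof (rule inj_on_code)
  have "|A| \<le>o |UNIV :: 'u set|" using assms ordLess_imp_ordLeq by blast
  then show "\<exists>e :: 'i \<Rightarrow> 'u. inj_on e A" using card_of_ordLeq[of A "UNIV :: 'u set"] by blast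
qed

text \<open>Inaccessibility speaks of subsets of \<open>'u\<close> only, so A is first injected into
  \<open>'u\<close> and its subsets are carried along by taking images.\<close>

lemma small_Pow:
  assumes A: "|A :: 'i set| <o |UNIV :: 'u set|"
  shows "|Pow A| <o |UNIV :: 'u set|"
proof -
  note i = inj_on_code_small[OF A]
  have "|Pow ((code A :: 'i \<Rightarrow> 'u) ` A)| <o |UNIV :: 'u set|"
    using U small_image[OF A] unfolding inaccessible_def by blast
  moreover have "inj_on ((`) (code A :: 'i \<Rightarrow> 'u)) (Pow A)" using inj_on_image_Pow[OF i] .
  ultimately show ?thesis by (rule small_inj) auto
qed

text \<open>Regularity of the cardinal of \<open>'u\<close> bounds a union of few small sets;
  tagging the elements by their index makes the union a disjoint one.\<close>

lemma small_Sigma: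
  assumes I: "|I| <o |UNIV :: 'u set|" and A: "\<And>i. i \<in> I \<Longrightarrow> |A i| <o |UNIV :: 'u set|"
  shows "|Sigma I A| <o |UNIV :: 'u set|"
proof -
  have "|\<Union>i\<in>I. (\<lambda>a. (i, a)) ` A i| <o |UNIV :: 'u set|"
  proof (rule card_of_UNION_ordLess_infinite_Field_regularCard[OF _ _ I])
    show "regularCard |UNIV :: 'u set|" using U by (simp add: inaccessible_def)
    show "Cinfinite |UNIV :: 'u set|"
      using inaccessible_infinite card_of_Card_order[of "UNIV :: 'u set"]
      by (simp only: cinfinite_def Field_card_of simp_thms)
    show "\<forall>i\<in>I. |(\<lambda>a. (i, a)) ` A i| <o |UNIV :: 'u set|" using small_image[OF A] by blast
  qed
  moreover have "(\<Union>i\<in>I. (\<lambda>a. (i, a)) ` A i) = Sigma I A" by auto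
  ultimately show ?thesis by simp
qed

lemma small_nat: "|UNIV :: nat set| <o |UNIV :: 'u set|"
  using U card_of_nat ordIso_ordLess_trans unfolding inaccessible_def by blast

end

section \<open>Index categories copied into the universe\<close>

definition copy_pob :: "('i, 'j) cat \<Rightarrow> ('i, 'j, 'o, 'm) ftr \<Rightarrow> ('u, 'o, 'm) pob" where
  "copy_pob J T = (copy_cat J,
     \<lparr>fob = (\<lambda>s\<in>Ob (copy_cat J). fob T (decode (Ob J) s)),
      fmor = (\<lambda>u\<in>Mor (copy_cat J). fmor T (decode (Mor J) u))\<rparr>)"

text \<open>A pro-object must be indexed by a category with objects and morphisms in
  \<open>'u\<close>, whereas finite quotients are families of relations. The two smallness
  assumptions make \<open>code\<close> injective, so that their system has a copy on
  \<open>'u\<close>.\<close>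

locale copied = universe U for U :: "'u itself" +
  fixes J :: "('i, 'j) cat"
  assumes J: "is_cat J"
    and small_Ob: "|Ob J| <o |UNIV :: 'u set|" and small_Mor: "|Mor J| <o |UNIV :: 'u set|"
begin

abbreviation co :: "'i \<Rightarrow> 'u" where "co \<equiv> code (Ob J)"
abbreviation cm :: "'j \<Rightarrow> 'u" where "cm \<equiv> code (Mor J)"
abbreviation J' :: "('u, 'u) cat" where "J' \<equiv> copy_cat J"

lemmas decode_Ob [simp] = decode_code[OF inj_on_code_small[OF small_Ob]]
lemmas decode_Mor [simp] = decode_code[OF inj_on_code_small[OF small_Mor]]

lemma copy_Ob: "a \<in> Ob J' \<longleftrightarrow> (\<exists>i\<in>Ob J. a = co i)"
  by (auto simp: copy_cat_def)

lemma copy_ObI: "i \<in> Ob J \<Longrightarrow> co i \<in> Ob J'"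
  using copy_Ob by blast

lemma copy_Idn: "i \<in> Ob J \<Longrightarrow> Idn J' (co i) = cm (Idn J i)"
  by (simp add: copy_cat_def)

lemma copy_Cmp: "f \<in> Mor J \<Longrightarrow> g \<in> Mor J \<Longrightarrow> Cmp J' (cm g) (cm f) = cm (Cmp J g f)"
  by (simp add: copy_cat_def)

lemma copy_homs: "u \<in> homs J' a b \<longleftrightarrow> (\<exists>i j f. i \<in> Ob J \<and> j \<in> Ob J \<and> f \<in> homs J i j \<and> a = co i \<and> b = co j \<and> u = cm f)"
proof
  assume "u \<in> homs J' a b"
  then obtain f where f: "f \<in> Mor J" "u = cm f" "a = co (Dom J f)" "b = co (Cod J f)"
    by (auto simp: homs_def copy_cat_def)
  note h = Mor_homs[OF f(1)]
  show "\<exists>i j f. i \<in> Ob J \<and> j \<in> Ob J \<and> f \<in> homs J i j \<and> a = co i \<and> b = co j \<and> u = cm f"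
    using h f cat_ob[OF J h] by blast
next
  assume "\<exists>i j f. i \<in> Ob J \<and> j \<in> Ob J \<and> f \<in> homs J i j \<and> a = co i \<and> b = co j \<and> u = cm f"
  then show "u \<in> homs J' a b" by (auto simp: homs_def copy_cat_def)
qed

lemma copy_homsI: "f \<in> homs J i j \<Longrightarrow> cm f \<in> homs J' (co i) (co j)"
  using copy_homs cat_ob[OF J] by blast

lemma co_inj: "i \<in> Ob J \<Longrightarrow> j \<in> Ob J \<Longrightarrow> co i = co j \<Longrightarrow> i = j"
  using decode_Ob by metis

lemma copy_homsD:
  assumes "u \<in> homs J' (co i) (co j)" "i \<in> Ob J" "j \<in> Ob J"
  obtains f where "f \<in> homs J i j" "u = cm f"
proof -
  obtain i' j' f where f: "i' \<in> Ob J" "j' \<in> Ob J" "f \<in> homs J i' j'" "co i = co i'" "co j = co j'" "u = cm f"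
    using assms(1) unfolding copy_homs by blast
  have "i = i'" "j = j'" using co_inj f assms by auto
  then show ?thesis using that f by blast
qed

lemma is_cat_copy: "is_cat J'"
proof (rule is_catI)
  fix u assume "u \<in> Mor J'"
  then have "u \<in> homs J' (Dom J' u) (Cod J' u)" by (rule Mor_homs)
  then obtain i j where "i \<in> Ob J" "j \<in> Ob J" "Dom J' u = co i" "Cod J' u = co j" unfolding copy_homs by blast
  then show "Dom J' u \<in> Ob J' \<and> Cod J' u \<in> Ob J'" using copy_ObI by simp
next
  fix a assume "a \<in> Ob J'"
  then obtain i where i: "i \<in> Ob J" "a = co i" unfolding copy_Ob by blast
  then show "Idn J' a \<in> homs J' a a" using copy_Idn copy_homsI[OF cat_id[OF J i(1)]] by simp
next
  fix f g a b c assume f: "f \<in> homs J' a b" and g: "g \<in> homs J' b c"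
  then obtain i j f' where f': "i \<in> Ob J" "j \<in> Ob J" "f' \<in> homs J i j" "a = co i" "b = co j" "f = cm f'"
    unfolding copy_homs by blast
  obtain k where k: "k \<in> Ob J" "c = co k" using g unfolding copy_homs by blast
  obtain g' where g': "g' \<in> homs J j k" "g = cm g'" using copy_homsD g f'(2,5) k by metis
  show "Cmp J' g f \<in> homs J' a c"
    using copy_Cmp homsD(1)[OF f'(3)] homsD(1)[OF g'(1)] f' g' k copy_homsI[OF cat_cmp[OF J f'(3) g'(1)]] by simp
next
  fix f a b assume "f \<in> homs J' a b"
  then obtain i j f' where f': "i \<in> Ob J" "j \<in> Ob J" "f' \<in> homs J i j" "a = co i" "b = co j" "f = cm f'"
    unfolding copy_homs by blast
  note m = homsD(1)[OF f'(3)] homsD(1)[OF cat_id[OF J f'(1)]] homsD(1)[OF cat_id[OF J f'(2)]]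
  show "Cmp J' f (Idn J' a) = f" using f' m copy_Cmp copy_Idn cat_idr[OF J f'(3)] by simp
  show "Cmp J' (Idn J' b) f = f" using f' m copy_Cmp copy_Idn cat_idl[OF J f'(3)] by simp
next
  fix f g h a b c d assume "f \<in> homs J' a b" and g: "g \<in> homs J' b c" and h: "h \<in> homs J' c d"
  then obtain i j f' where f': "i \<in> Ob J" "j \<in> Ob J" "f' \<in> homs J i j" "a = co i" "b = co j" "f = cm f'"
    unfolding copy_homs by blast
  obtain k where k: "k \<in> Ob J" "c = co k" using g unfolding copy_homs by blast
  obtain l where l: "l \<in> Ob J" "d = co l" using h unfolding copy_homs by blast
  obtain g' where g': "g' \<in> homs J j k" "g = cm g'" using copy_homsD g f'(2,5) k by metis
  obtain h' where h': "h' \<in> homs J k l" "h = cm h'" using copy_homsD h l k by metis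
  show "Cmp J' h (Cmp J' g f) = Cmp J' (Cmp J' h g) f"
    using f' g' h' copy_Cmp homsD(1)[OF f'(3)] homsD(1)[OF g'(1)] homsD(1)[OF h'(1)]
      homsD(1)[OF cat_cmp[OF J f'(3) g'(1)]] homsD(1)[OF cat_cmp[OF J g'(1) h'(1)]] cat_assoc[OF J f'(3) g'(1) h'(1)]
    by simp
qed

lemma cofiltered_copy:
  assumes c: "cofiltered J"
  shows "cofiltered J'"
  unfolding cofiltered_def
proof (intro conjI ballI)
  show "Ob J' \<noteq> {}" using cofiltered_nonempty[OF c] copy_ObI by blast
next
  fix a b assume "a \<in> Ob J'" "b \<in> Ob J'"
  then obtain i j where i: "i \<in> Ob J" "a = co i" and j: "j \<in> Ob J" "b = co j" unfolding copy_Ob by blast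
  obtain k u v where k: "k \<in> Ob J" "u \<in> homs J k i" "v \<in> homs J k j" using cofiltered_pair[OF c i(1) j(1)] by blast
  show "\<exists>k\<in>Ob J'. homs J' k a \<noteq> {} \<and> homs J' k b \<noteq> {}"
    using copy_ObI[OF k(1)] copy_homsI[OF k(2)] copy_homsI[OF k(3)] i j by blast
  fix f g assume f: "f \<in> homs J' a b" and g: "g \<in> homs J' a b"
  obtain f' where f': "f' \<in> homs J i j" "f = cm f'" using copy_homsD f i j by metis
  obtain g' where g': "g' \<in> homs J i j" "g = cm g'" using copy_homsD g i j by metis
  obtain l w where w: "l \<in> Ob J" "w \<in> homs J l i" "Cmp J f' w = Cmp J g' w"
    using cofiltered_par[OF c i(1) j(1) f'(1) g'(1)] by blast
  have "Cmp J' f (cm w) = Cmp J' g (cm w)"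
    using w f' g' copy_Cmp homsD(1)[OF w(2)] homsD(1)[OF f'(1)] homsD(1)[OF g'(1)] by simp
  then show "\<exists>k\<in>Ob J'. \<exists>w\<in>homs J' k a. Cmp J' f w = Cmp J' g w"
    using copy_ObI[OF w(1)] copy_homsI[OF w(2)] i(2) by blast
qed

lemma copy_pob_Idx [simp]: "Idx (copy_pob J T :: ('u, 'o, 'm) pob) = J'"
  by (simp add: copy_pob_def)

lemma copy_pob_fob [simp]: "i \<in> Ob J \<Longrightarrow> fob (Dia (copy_pob J T :: ('u, 'o, 'm) pob)) (co i) = fob T i"
  by (simp add: copy_pob_def copy_ObI)

lemma copy_pob_fmor [simp]: "f \<in> homs J i j \<Longrightarrow> fmor (Dia (copy_pob J T :: ('u, 'o, 'm) pob)) (cm f) = fmor T f"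
  using homsD(1)[of f J i j] by (simp add: copy_pob_def copy_cat_def)

lemma is_pob_copy:
  assumes c: "cofiltered J" and T: "is_functor J C T"
  shows "is_pob C (copy_pob J T :: ('u, 'o, 'm) pob)"
proof -
  let ?X = "copy_pob J T :: ('u, 'o, 'm) pob"
  have "is_functor J' C (Dia ?X)"
  proof (rule is_functorI)
    fix a assume "a \<in> Ob J'"
    then obtain i where i: "i \<in> Ob J" "a = co i" unfolding copy_Ob by blast
    then show "fob (Dia ?X) a \<in> Ob C" "fmor (Dia ?X) (Idn J' a) = Idn C (fob (Dia ?X) a)"
      using ftr_ob[OF T i(1)] ftr_id[OF T i(1)] copy_Idn[OF i(1)] copy_pob_fmor[OF cat_id[OF J i(1)], of T]
        copy_pob_fob[OF i(1), of T] by simp_all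
  next
    fix f a b assume "f \<in> homs J' a b"
    then obtain i j f' where f': "i \<in> Ob J" "j \<in> Ob J" "f' \<in> homs J i j" "a = co i" "b = co j" "f = cm f'"
      unfolding copy_homs by blast
    then show "fmor (Dia ?X) f \<in> homs C (fob (Dia ?X) a) (fob (Dia ?X) b)" using ftr_mor[OF T f'(3)] by simp
    fix g c assume g: "g \<in> homs J' b c"
    obtain k where k: "k \<in> Ob J" "c = co k" using g unfolding copy_homs by blast
    obtain g' where g': "g' \<in> homs J j k" "g = cm g'" using copy_homsD g f'(2,5) k by metis
    show "fmor (Dia ?X) (Cmp J' g f) = Cmp C (fmor (Dia ?X) g) (fmor (Dia ?X) f)"
      using f' g' copy_Cmp homsD(1)[OF f'(3)] homsD(1)[OF g'(1)] ftr_cmp[OF T f'(3) g'(1)]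
        copy_pob_fmor[OF cat_cmp[OF J f'(3) g'(1)], of T] by simp
  qed
  moreover have "small (Ob J')" "small (Mor J')"
    unfolding small_def using small_image[OF small_Ob] small_image[OF small_Mor]
    by (simp_all add: copy_cat_def)
  moreover have "fob (Dia ?X) \<in> extensional (Ob J')" "fmor (Dia ?X) \<in> extensional (Mor J')"
    by (simp_all add: copy_pob_def)
  ultimately show ?thesis
    using is_cat_copy cofiltered_copy[OF c] by (simp add: is_pob_def functor_cat_Ob)
qed

end

section \<open>Finite quotients of simplicial sets\<close>

lemma apply_setm_mem: "f \<in> homs (sets_cat P) A B \<Longrightarrow> x \<in> A \<Longrightarrow> apply_setm f x \<in> B"
  by (auto simp: sets_cat_homs apply_setm_def)

lemma apply_setm_Cmp:
  "f \<in> homs (sets_cat P) A B \<Longrightarrow> g \<in> homs (sets_cat P) B C \<Longrightarrow> x \<in> A \<Longrightarrow>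
    apply_setm (Cmp (sets_cat P) g f) x = apply_setm g (apply_setm f x)"
  by (auto simp: sets_cat_homs apply_setm_def compose_def)

lemma apply_setm_Idn: "x \<in> A \<Longrightarrow> apply_setm (Idn (sets_cat P) A) x = x"
  by (simp add: apply_setm_def)

lemma apply_setm_eqI:
  assumes "f \<in> homs (sets_cat P) A B" "g \<in> homs (sets_cat P) A B" "\<And>x. x \<in> A \<Longrightarrow> apply_setm f x = apply_setm g x"
  shows "f = g"
proof -
  obtain f' g' where fg: "f = (A, B, f')" "g = (A, B, g')" "f' \<in> A \<rightarrow>\<^sub>E B" "g' \<in> A \<rightarrow>\<^sub>E B"
    using assms(1,2) by (auto simp: sets_cat_homs)
  have "f' = g'" by (rule PiE_ext[OF fg(3,4)]) (use assms(3) fg in \<open>simp add: apply_setm_def\<close>)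
  then show ?thesis using fg by simp
qed

lemma apply_setm_simp [simp]: "apply_setm (A, B, f) x = f x"
  by (simp add: apply_setm_def)

abbreviation ap :: "'u ssetarr \<Rightarrow> nat \<Rightarrow> 'u \<Rightarrow> 'u" where
  "ap f n \<equiv> apply_setm (at_level f n)"

abbreviation opr :: "'u ssetob \<Rightarrow> simplex_op \<Rightarrow> 'u \<Rightarrow> 'u" where
  "opr X \<theta> \<equiv> apply_setm (fmor X \<theta>)"

lemma ap_mem: "f \<in> homs (simp (sets_cat P)) X Y \<Longrightarrow> x \<in> fob X n \<Longrightarrow> ap f n x \<in> fob Y n"
  using apply_setm_mem[OF simp_at_level] .

lemma opr_mem: "X \<in> Ob (simp (sets_cat P)) \<Longrightarrow> \<theta> \<in> homs simplex_cat m n \<Longrightarrow> x \<in> fob X n \<Longrightarrow> opr X \<theta> x \<in> fob X m"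
  using apply_setm_mem[OF simp_mor] .

lemma ap_natural:
  assumes f: "f \<in> homs (simp (sets_cat P)) X Y" and \<theta>: "\<theta> \<in> homs simplex_cat m n" and x: "x \<in> fob X n"
  shows "ap f m (opr X \<theta> x) = opr Y \<theta> (ap f n x)"
proof -
  note o = cat_ob[OF is_cat_simp[OF is_cat_sets_cat] f]
  show ?thesis using simp_natural[OF f \<theta>] apply_setm_Cmp[OF simp_mor[OF o(1) \<theta>] simp_at_level[OF f] x]
      apply_setm_Cmp[OF simp_at_level[OF f] simp_mor[OF o(2) \<theta>] x] by simp
qed

lemma ap_Cmp:
  "f \<in> homs (simp (sets_cat P)) X Y \<Longrightarrow> g \<in> homs (simp (sets_cat P)) Y Z \<Longrightarrow> x \<in> fob X n \<Longrightarrow>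
    ap (Cmp (simp (sets_cat P)) g f) n x = ap g n (ap f n x)"
  using apply_setm_Cmp[OF simp_at_level simp_at_level] at_level_Cmp by metis

lemma ap_eqI:
  "f \<in> homs (simp (sets_cat P)) X Y \<Longrightarrow> g \<in> homs (simp (sets_cat P)) X Y \<Longrightarrow>
    (\<And>n x. x \<in> fob X n \<Longrightarrow> ap f n x = ap g n x) \<Longrightarrow> f = g"
  by (rule simp_hom_eqI) (auto intro: apply_setm_eqI[OF simp_at_level simp_at_level])

lemma opr_Cmp:
  "X \<in> Ob (simp (sets_cat P)) \<Longrightarrow> \<theta> \<in> homs simplex_cat l m \<Longrightarrow> \<eta> \<in> homs simplex_cat m n \<Longrightarrow> x \<in> fob X n \<Longrightarrow>
    opr X (Cmp simplex_cat \<eta> \<theta>) x = opr X \<theta> (opr X \<eta> x)"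
  using apply_setm_Cmp[OF simp_mor simp_mor] simp_cmp by metis

lemma opr_Idn: "X \<in> Ob (simp (sets_cat P)) \<Longrightarrow> x \<in> fob X n \<Longrightarrow> opr X (Idn simplex_cat n) x = x"
  using apply_setm_Idn simp_id by metis

lemma kernel_equiv: "equiv A {(x, y). x \<in> A \<and> y \<in> A \<and> g x = g y}"
  by (auto simp: equiv_def refl_on_def sym_def trans_def)

lemma finite_kernel_quotient:
  assumes "finite (g ` A)"
  shows "finite (A // {(x, y). x \<in> A \<and> y \<in> A \<and> g x = g y})"
proof -
  have "A // {(x, y). x \<in> A \<and> y \<in> A \<and> g x = g y} \<subseteq> (\<lambda>z. {y \<in> A. z = g y}) ` g ` A"
    by (auto simp: quotient_def)
  then show ?thesis using assms finite_subset by blast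
qed

text \<open>Presenting each relation as the kernel of a function with finite image gives the
  equivalence property and the finiteness of the quotient at once, and leaves only compatibility
  with the operators.\<close>

lemma fin_quotientsI:
  assumes "\<And>n. R n = {(x, y). x \<in> fob X n \<and> y \<in> fob X n \<and> g n x = g n y}"
    and "\<And>n. finite (g n ` fob X n)"
    and "\<And>\<theta> m n x y. \<theta> \<in> homs simplex_cat m n \<Longrightarrow> (x, y) \<in> R n \<Longrightarrow> (opr X \<theta> x, opr X \<theta> y) \<in> R m"
  shows "R \<in> fin_quotients X"
  unfolding fin_quotients_def
proof (intro CollectI conjI allI ballI)
  show "equiv (fob X n) (R n)" "finite (fob X n // R n)" for n
    using kernel_equiv[of "fob X n" "g n"] finite_kernel_quotient[OF assms(2)[of n]] assms(1)[of n] by simp_all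
  fix \<theta> z assume "\<theta> \<in> Mor simplex_cat" "z \<in> R (Cod simplex_cat \<theta>)"
  then show "case z of (x, y) \<Rightarrow> (opr X \<theta> x, opr X \<theta> y) \<in> R (Dom simplex_cat \<theta>)"
    using assms(3)[OF Mor_homs] by (cases z) auto
qed

lemma fin_quotientsD:
  assumes "R \<in> fin_quotients X"
  shows fin_quotients_equiv: "equiv (fob X n) (R n)" and fin_quotients_finite: "finite (fob X n // R n)"
    and fin_quotients_opr: "\<theta> \<in> homs simplex_cat m n \<Longrightarrow> (x, y) \<in> R n \<Longrightarrow> (opr X \<theta> x, opr X \<theta> y) \<in> R m"
    and fin_quotients_mem: "(x, y) \<in> R n \<Longrightarrow> x \<in> fob X n \<and> y \<in> fob X n"
    and fin_quotients_iff: "(x, y) \<in> R n \<longleftrightarrow> x \<in> fob X n \<and> y \<in> fob X n \<and> R n `` {x} = R n `` {y}"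
proof -
  show e: "equiv (fob X n) (R n)" for n using assms by (simp add: fin_quotients_def)
  show "finite (fob X n // R n)" using assms by (simp add: fin_quotients_def)
  show "\<theta> \<in> homs simplex_cat m n \<Longrightarrow> (x, y) \<in> R n \<Longrightarrow> (opr X \<theta> x, opr X \<theta> y) \<in> R m"
    using assms homsD[of \<theta> simplex_cat m n] unfolding fin_quotients_def by blast
  show "(x, y) \<in> R n \<Longrightarrow> x \<in> fob X n \<and> y \<in> fob X n" using e[of n] equiv_type by blast
  show "(x, y) \<in> R n \<longleftrightarrow> x \<in> fob X n \<and> y \<in> fob X n \<and> R n `` {x} = R n `` {y}"
    using equiv_class_eq_iff[OF e] by blast
qed

text \<open>The coarsest quotient has at most one simplex in each degree. It shows that the system
  of quotients is not empty.\<close>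

lemma fin_quotients_total:
  assumes "X \<in> Ob (simp (sets_cat P))"
  shows "(\<lambda>n. fob X n \<times> fob X n) \<in> fin_quotients X"
  by (rule fin_quotientsI[where g = "\<lambda>n x. ()"]) (use opr_mem[OF assms] in auto)

text \<open>Classes of the intersection correspond to pairs of classes, of which there are finitely
  many. Intersections are the common refinements that make the system of quotients
  cofiltered.\<close>

lemma fin_quotients_inter:
  assumes R: "R \<in> fin_quotients X" and S: "S \<in> fin_quotients X"
  shows "(\<lambda>n. R n \<inter> S n) \<in> fin_quotients X"
proof (rule fin_quotientsI[where g = "\<lambda>n x. (R n `` {x}, S n `` {x})"])
  show "R n \<inter> S n = {(x, y). x \<in> fob X n \<and> y \<in> fob X n \<and> (R n `` {x}, S n `` {x}) = (R n `` {y}, S n `` {y})}" for n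
    using fin_quotients_iff[OF R] fin_quotients_iff[OF S] by auto
  show "finite ((\<lambda>x. (R n `` {x}, S n `` {x})) ` fob X n)" for n
    by (rule finite_subset[of _ "(fob X n // R n) \<times> (fob X n // S n)"])
       (use fin_quotients_finite[OF R] fin_quotients_finite[OF S] in \<open>auto simp: quotient_def\<close>)
qed (use fin_quotients_opr[OF R] fin_quotients_opr[OF S] in auto)

lemma pullback_rel_mem:
  "f \<in> homs (simp Sets) X Y \<Longrightarrow> (x, y) \<in> pullback_rel f R n \<longleftrightarrow> x \<in> fob X n \<and> y \<in> fob X n \<and> (ap f n x, ap f n y) \<in> R n"
  by (auto simp: pullback_rel_def simp_homs)

text \<open>Classes of the pullback inject into classes of R, which keeps it finite. It is the
  largest relation along which f descends to the quotient by R.\<close>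

lemma fin_quotients_pullback:
  assumes R: "R \<in> fin_quotients Y" and f: "f \<in> homs (simp Sets) X Y"
  shows "pullback_rel f R \<in> fin_quotients X"
proof (rule fin_quotientsI[where g = "\<lambda>n x. R n `` {ap f n x}"])
  note X = cat_ob(1)[OF is_cat_simp[OF is_cat_sets_cat] f]
  show "pullback_rel f R n = {(x, y). x \<in> fob X n \<and> y \<in> fob X n \<and> R n `` {ap f n x} = R n `` {ap f n y}}" for n
    using pullback_rel_mem[OF f] fin_quotients_iff[OF R] ap_mem[OF f] by fastforce
  show "finite ((\<lambda>x. R n `` {ap f n x}) ` fob X n)" for n
    by (rule finite_subset[of _ "fob Y n // R n"])
       (use fin_quotients_finite[OF R] ap_mem[OF f] in \<open>auto simp: quotient_def\<close>)
  fix \<theta> m n x y assume \<theta>: "\<theta> \<in> homs simplex_cat m n" and "(x, y) \<in> pullback_rel f R n"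
  then show "(opr X \<theta> x, opr X \<theta> y) \<in> pullback_rel f R m"
    using pullback_rel_mem[OF f] fin_quotients_opr[OF R \<theta>] opr_mem[OF X \<theta>] ap_natural[OF f \<theta>] by auto
qed

text \<open>The kernel of the simplicial map from X to K that classifies the cochain c, written
  without K. It identifies two simplices when all their n-dimensional images under operators have
  the same value under c.\<close>

definition cochain_rel :: "'u ssetob \<Rightarrow> nat \<Rightarrow> ('u \<Rightarrow> int) \<Rightarrow> nat \<Rightarrow> ('u \<times> 'u) set" where
  "cochain_rel X n c m = {(x, y). x \<in> fob X m \<and> y \<in> fob X m \<and>
     (\<forall>\<theta>\<in>homs simplex_cat n m. c (opr X \<theta> x) = c (opr X \<theta> y))}"

lemma fin_quotients_cochain_rel:
  assumes X: "X \<in> Ob (simp (sets_cat P))" and c: "c \<in> fob X n \<rightarrow> A" and A: "finite A"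
  shows "cochain_rel X n c \<in> fin_quotients X"
proof (rule fin_quotientsI[where g = "\<lambda>m x. \<lambda>\<theta>\<in>homs simplex_cat n m. c (opr X \<theta> x)"])
  show "cochain_rel X n c m = {(x, y). x \<in> fob X m \<and> y \<in> fob X m \<and>
      (\<lambda>\<theta>\<in>homs simplex_cat n m. c (opr X \<theta> x)) = (\<lambda>\<theta>\<in>homs simplex_cat n m. c (opr X \<theta> y))}" for m
    by (auto simp: cochain_rel_def fun_eq_iff restrict_def)
  show "finite ((\<lambda>x. \<lambda>\<theta>\<in>homs simplex_cat n m. c (opr X \<theta> x)) ` fob X m)" for m
    by (rule finite_subset[of _ "homs simplex_cat n m \<rightarrow>\<^sub>E A"])
       (use c opr_mem[OF X] in \<open>auto intro!: finite_PiE simp: finite_simplex_homs A simp del: simplex_cat_sel\<close>)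
  fix \<theta> l m x y assume \<theta>: "\<theta> \<in> homs simplex_cat l m" and xy: "(x, y) \<in> cochain_rel X n c m"
  \<comment> \<open>Composition with \<open>\<theta>\<close> sends operators n -> l to operators n
    -> m, so the conditions at l on the images are among those known at m.\<close>
  then have "c (opr X \<eta> (opr X \<theta> x)) = c (opr X \<eta> (opr X \<theta> y))" if \<eta>: "\<eta> \<in> homs simplex_cat n l" for \<eta>
    using opr_Cmp[OF X \<eta> \<theta>] cat_cmp[OF is_cat_simplex_cat \<eta> \<theta>] by (auto simp: cochain_rel_def)
  then show "(opr X \<theta> x, opr X \<theta> y) \<in> cochain_rel X n c l"
    using xy opr_mem[OF X \<theta>] by (simp add: cochain_rel_def)
qed

section \<open>Quotients formed on chosen representatives\<close>

lemma rep_rel: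
  assumes R: "R \<in> fin_quotients X" and x: "x \<in> fob X n"
  shows "(x, rep R n x) \<in> R n"
proof -
  have "x \<in> R n `` {x}" using fin_quotients_iff[OF R, of x x] x by auto
  then have "rep R n x \<in> R n `` {x}" unfolding rep_def by (rule someI)
  then show ?thesis by simp
qed

lemma rep_mem: "R \<in> fin_quotients X \<Longrightarrow> x \<in> fob X n \<Longrightarrow> rep R n x \<in> fob X n"
  using rep_rel fin_quotients_mem by metis

lemma rep_eq: "R \<in> fin_quotients X \<Longrightarrow> (x, y) \<in> R n \<Longrightarrow> rep R n x = rep R n y"
  using fin_quotients_iff[of R X x y n] by (simp add: rep_def)

lemma quotient_set_sub: "R \<in> fin_quotients X \<Longrightarrow> quotient_set X R n \<subseteq> fob X n"
  using rep_mem by (auto simp: quotient_set_def)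

lemma rep_quotient_set: "R \<in> fin_quotients X \<Longrightarrow> x \<in> quotient_set X R n \<Longrightarrow> rep R n x = x"
  using rep_eq rep_rel by (fastforce simp: quotient_set_def)

text \<open>Operators preserve the relation, so replacing a simplex by its representative before
  applying an operator leaves the class of the result unchanged. This is why the operators on
  representatives compose.\<close>

lemma rep_rep_opr:
  assumes R: "R \<in> fin_quotients X" and \<theta>: "\<theta> \<in> homs simplex_cat m n" and x: "x \<in> fob X n"
  shows "rep R m (opr X \<theta> (rep R n x)) = rep R m (opr X \<theta> x)"
  using rep_eq[OF R fin_quotients_opr[OF R \<theta> rep_rel[OF R x]]] by simp

lemma finite_quotient_set:
  assumes R: "R \<in> fin_quotients X"
  shows "finite (quotient_set X R n)"
proof -
  have "quotient_set X R n = (\<lambda>c. SOME y. y \<in> c) ` (fob X n // R n)"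
    unfolding quotient_set_def rep_def quotient_def by blast
  then show ?thesis using fin_quotients_finite[OF R] by simp
qed

lemma quotient_sset_fob [simp]: "fob (quotient_sset X R) = quotient_set X R"
  by (simp add: quotient_sset_def)

lemma quotient_sset_fmor:
  "\<theta> \<in> homs simplex_cat m n \<Longrightarrow> fmor (quotient_sset X R) \<theta> =
    (quotient_set X R n, quotient_set X R m, \<lambda>x\<in>quotient_set X R n. rep R m (opr X \<theta> x))"
  using homsD[of \<theta> simplex_cat m n] by (simp add: quotient_sset_def del: simplex_cat_sel)

lemma rep_in: "x \<in> fob X n \<Longrightarrow> rep R n x \<in> quotient_set X R n"
  by (simp add: quotient_set_def)

lemma quotient_sset:
  assumes X: "X \<in> Ob (simp (sets_cat P))" and R: "R \<in> fin_quotients X"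
  shows "quotient_sset X R \<in> Ob (simp FinSets)"
proof (rule simp_ObI)
  note sub = subsetD[OF quotient_set_sub[OF R]]
  show "fob (quotient_sset X R) n \<in> Ob FinSets" for n using finite_quotient_set[OF R] by simp
  show m: "fmor (quotient_sset X R) \<theta> \<in> homs FinSets (fob (quotient_sset X R) n) (fob (quotient_sset X R) m)"
    if "\<theta> \<in> homs simplex_cat m n" for \<theta> m n
    unfolding quotient_sset_fmor[OF that] quotient_sset_fob
    using finite_quotient_set[OF R] by (auto simp: sets_cat_homs intro!: rep_in opr_mem[OF X that sub])
  note i = cat_id[OF is_cat_simplex_cat, of n for n, unfolded simplex_cat_sel(1), OF UNIV_I]
  show "fmor (quotient_sset X R) (Idn simplex_cat n) = Idn FinSets (fob (quotient_sset X R) n)" for n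
    unfolding quotient_sset_fmor[OF i] using opr_Idn[OF X sub] rep_quotient_set[OF R]
    by (simp del: simplex_cat_sel add: fun_eq_iff restrict_def)
  show "fmor (quotient_sset X R) (Cmp simplex_cat \<eta> \<theta>) =
      Cmp FinSets (fmor (quotient_sset X R) \<theta>) (fmor (quotient_sset X R) \<eta>)"
    if \<theta>: "\<theta> \<in> homs simplex_cat l m" and \<eta>: "\<eta> \<in> homs simplex_cat m n" for \<theta> \<eta> l m n
  proof -
    have "rep R l (opr X (Cmp simplex_cat \<eta> \<theta>) x) = rep R l (opr X \<theta> (rep R m (opr X \<eta> x)))"
      if x: "x \<in> quotient_set X R n" for x
      using rep_rep_opr[OF R \<theta> opr_mem[OF X \<eta> sub[OF x]]] opr_Cmp[OF X \<theta> \<eta> sub[OF x]] by simp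
    moreover have "rep R m (opr X \<eta> x) \<in> quotient_set X R m" if "x \<in> quotient_set X R n" for x
      using rep_in opr_mem[OF X \<eta> sub[OF that]] .
    ultimately show ?thesis
      using quotient_sset_fmor[OF \<theta>, of X R] quotient_sset_fmor[OF \<eta>, of X R]
        quotient_sset_fmor[OF cat_cmp[OF is_cat_simplex_cat \<theta> \<eta>], of X R]
      by (auto simp del: simplex_cat_sel simp: compose_def fun_eq_iff)
  qed
  show "fmor (quotient_sset X R) \<in> extensional (Mor simplex_cat)" by (simp add: quotient_sset_def)
qed

definition quotient_proj :: "'u ssetob \<Rightarrow> (nat \<Rightarrow> ('u \<times> 'u) set) \<Rightarrow> 'u ssetarr" where
  "quotient_proj X R = (X, quotient_sset X R, \<lambda>n. (fob X n, quotient_set X R n, \<lambda>x\<in>fob X n. rep R n x))"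

lemma ap_quotient_proj [simp]: "x \<in> fob X n \<Longrightarrow> ap (quotient_proj X R) n x = rep R n x"
  by (simp add: quotient_proj_def)

definition rel_le :: "'u ssetarr \<Rightarrow> (nat \<Rightarrow> ('u \<times> 'u) set) \<Rightarrow> (nat \<Rightarrow> ('u \<times> 'u) set) \<Rightarrow> bool" where
  "rel_le f Q R \<longleftrightarrow> (\<forall>n x y. (x, y) \<in> Q n \<longrightarrow> (ap f n x, ap f n y) \<in> R n)"

lemma rel_le_pullback: "f \<in> homs (simp Sets) X Y \<Longrightarrow> rel_le f (pullback_rel f R) R"
  by (simp add: rel_le_def pullback_rel_mem)

lemma rel_le_Idn: "Q \<in> fin_quotients X \<Longrightarrow> rel_le (Idn (simp Sets) X) Q R \<longleftrightarrow> (\<forall>n. Q n \<subseteq> R n)"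
  using fin_quotients_mem[of Q X] unfolding rel_le_def by (force simp: apply_setm_def)

context universe
begin

lemma full_sub_FinSets: "full_sub (FinSets :: ('u set, 'u setm) cat) Sets"
  by (rule full_sub_sets) (rule small_finite[OF inaccessible_infinite])

lemma full_sub_sFinSets: "full_sub (simp (FinSets :: ('u set, 'u setm) cat)) (simp Sets)"
  by (rule full_sub_simp[OF is_cat_sets_cat is_cat_sets_cat full_sub_FinSets])

lemma quotient_sset_Sets:
  "X \<in> Ob (simp Sets) \<Longrightarrow> R \<in> fin_quotients (X :: 'u ssetob) \<Longrightarrow> quotient_sset X R \<in> Ob (simp Sets)"
  using full_subD(3)[OF full_sub_sFinSets quotient_sset] .

lemma quotient_proj:
  assumes X: "X \<in> Ob (simp Sets)" and R: "R \<in> fin_quotients (X :: 'u ssetob)"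
  shows "quotient_proj X R \<in> homs (simp Sets) X (quotient_sset X R)"
  unfolding quotient_proj_def
proof (rule simp_homsI[OF X quotient_sset_Sets[OF X R]])
  note q = quotient_sset_Sets[OF X R]
  show p: "(fob X n, quotient_set X R n, \<lambda>x\<in>fob X n. rep R n x) \<in> homs Sets (fob X n) (fob (quotient_sset X R) n)" for n
    using simp_ob[OF X, of n] simp_ob[OF q, of n] rep_in by (auto simp: sets_cat_homs)
  fix \<theta> m n assume \<theta>: "\<theta> \<in> homs simplex_cat m n"
  show "Cmp Sets (fob X m, quotient_set X R m, \<lambda>x\<in>fob X m. rep R m x) (fmor X \<theta>) =
      Cmp Sets (fmor (quotient_sset X R) \<theta>) (fob X n, quotient_set X R n, \<lambda>x\<in>fob X n. rep R n x)"
  proof (rule apply_setm_eqI[OF cat_cmp[OF is_cat_sets_cat simp_mor[OF X \<theta>] p] cat_cmp[OF is_cat_sets_cat p simp_mor[OF q \<theta>]]])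
    fix x assume x: "x \<in> fob X n"
    show "apply_setm (Cmp Sets (fob X m, quotient_set X R m, \<lambda>x\<in>fob X m. rep R m x) (fmor X \<theta>)) x =
      apply_setm (Cmp Sets (fmor (quotient_sset X R) \<theta>) (fob X n, quotient_set X R n, \<lambda>x\<in>fob X n. rep R n x)) x"
      unfolding apply_setm_Cmp[OF simp_mor[OF X \<theta>] p x] apply_setm_Cmp[OF p simp_mor[OF q \<theta>] x]
      using x opr_mem[OF X \<theta> x] quotient_sset_fmor[OF \<theta>, of X R] rep_in[OF x] rep_rep_opr[OF R \<theta> x] by simp
  qed
qed

text \<open>In each degree the quotient is a subset of X that the projection fixes pointwise. A
  simplex of the quotient is thus its own preimage, although the subset need not be stable under the
  operators of X.\<close>

lemma quotient_proj_surj: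
  assumes "R \<in> fin_quotients (X :: 'u ssetob)" "z \<in> quotient_set X R n"
  shows "z \<in> fob X n" "ap (quotient_proj X R) n z = z"
  using subsetD[OF quotient_set_sub[OF assms(1)] assms(2)] rep_quotient_set[OF assms] by auto

text \<open>Identities between maps out of a quotient are checked after composition with the
  projection, where they become identities between maps out of X; functoriality of
  \<open>quotient_map\<close> is obtained in this way.\<close>

lemma quotient_proj_epi:
  assumes X: "X \<in> Ob (simp Sets)" and R: "R \<in> fin_quotients (X :: 'u ssetob)"
    and g: "g \<in> homs (simp Sets) (quotient_sset X R) T" and h: "h \<in> homs (simp Sets) (quotient_sset X R) T"
    and eq: "Cmp (simp Sets) g (quotient_proj X R) = Cmp (simp Sets) h (quotient_proj X R)"
  shows "g = h"
proof (rule ap_eqI[OF g h])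
  fix n x assume "x \<in> fob (quotient_sset X R) n"
  then have x: "x \<in> quotient_set X R n" by simp
  note s = quotient_proj_surj[OF R x]
  show "ap g n x = ap h n x"
    using ap_Cmp[OF quotient_proj[OF X R] g s(1)] ap_Cmp[OF quotient_proj[OF X R] h s(1)] eq s(2) by simp
qed

lemma quotient_map:
  assumes f: "f \<in> homs (simp Sets) X Y" and Q: "Q \<in> fin_quotients (X :: 'u ssetob)" and R: "R \<in> fin_quotients Y"
    and le: "rel_le f Q R"
  shows quotient_map_homs: "quotient_map f Q R \<in> homs (simp FinSets) (quotient_sset X Q) (quotient_sset Y R)"
    and quotient_map_Sets: "quotient_map f Q R \<in> homs (simp Sets) (quotient_sset X Q) (quotient_sset Y R)"
    and quotient_map_proj: "Cmp (simp Sets) (quotient_map f Q R) (quotient_proj X Q) =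
      Cmp (simp Sets) (quotient_proj Y R) f"
proof -
  note X = cat_ob(1)[OF is_cat_simp[OF is_cat_sets_cat] f] and Y = cat_ob(2)[OF is_cat_simp[OF is_cat_sets_cat] f]
  note qX = quotient_sset_Sets[OF X Q] and qY = quotient_sset_Sets[OF Y R]
  have eq: "quotient_map f Q R = (quotient_sset X Q, quotient_sset Y R,
      \<lambda>n. (quotient_set X Q n, quotient_set Y R n, \<lambda>x\<in>quotient_set X Q n. rep R n (ap f n x)))"
    using f by (auto simp: quotient_map_def simp_homs Let_def)
  note sub = subsetD[OF quotient_set_sub[OF Q]]
  have rr: "rep R n (ap f n (rep Q n x)) = rep R n (ap f n x)" if "x \<in> fob X n" for n x
    using rep_eq[OF R] le rep_rel[OF Q that] unfolding rel_le_def by metis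
  have lev: "(quotient_set X Q n, quotient_set Y R n, \<lambda>x\<in>quotient_set X Q n. rep R n (ap f n x)) \<in>
      homs Sets (quotient_set X Q n) (quotient_set Y R n)" for n
    using simp_ob[OF qX, of n] simp_ob[OF qY, of n]
    by (auto simp: sets_cat_homs intro!: rep_in ap_mem[OF f sub])
  show S: "quotient_map f Q R \<in> homs (simp Sets) (quotient_sset X Q) (quotient_sset Y R)"
    unfolding eq
  proof (rule simp_homsI[OF qX qY])
    show "(quotient_set X Q n, quotient_set Y R n, \<lambda>x\<in>quotient_set X Q n. rep R n (ap f n x)) \<in>
      homs Sets (fob (quotient_sset X Q) n) (fob (quotient_sset Y R) n)" for n using lev by simp
    fix \<theta> m n assume \<theta>: "\<theta> \<in> homs simplex_cat m n"
    note X\<theta> = simp_mor[OF qX \<theta>, unfolded quotient_sset_fob] and Y\<theta> = simp_mor[OF qY \<theta>, unfolded quotient_sset_fob]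
    show "Cmp Sets (quotient_set X Q m, quotient_set Y R m, \<lambda>x\<in>quotient_set X Q m. rep R m (ap f m x))
        (fmor (quotient_sset X Q) \<theta>) = Cmp Sets (fmor (quotient_sset Y R) \<theta>)
        (quotient_set X Q n, quotient_set Y R n, \<lambda>x\<in>quotient_set X Q n. rep R n (ap f n x))"
    proof (rule apply_setm_eqI[OF cat_cmp[OF is_cat_sets_cat X\<theta> lev] cat_cmp[OF is_cat_sets_cat lev Y\<theta>]])
      fix x assume x: "x \<in> quotient_set X Q n"
      note ox = opr_mem[OF X \<theta> sub[OF x]]
      show "apply_setm (Cmp Sets (quotient_set X Q m, quotient_set Y R m, \<lambda>x\<in>quotient_set X Q m. rep R m (ap f m x))
          (fmor (quotient_sset X Q) \<theta>)) x = apply_setm (Cmp Sets (fmor (quotient_sset Y R) \<theta>)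
          (quotient_set X Q n, quotient_set Y R n, \<lambda>x\<in>quotient_set X Q n. rep R n (ap f n x))) x"
        unfolding apply_setm_Cmp[OF X\<theta> lev x] apply_setm_Cmp[OF lev Y\<theta> x]
        using x rep_in[OF ox] quotient_sset_fmor[OF \<theta>, of X Q] quotient_sset_fmor[OF \<theta>, of Y R]
          rep_in[OF ap_mem[OF f sub[OF x]]] rr[OF ox] ap_natural[OF f \<theta> sub[OF x]]
          rep_rep_opr[OF R \<theta> ap_mem[OF f sub[OF x]]] by simp
    qed
  qed
  show "quotient_map f Q R \<in> homs (simp FinSets) (quotient_sset X Q) (quotient_sset Y R)"
    using S full_sub_homs[OF full_sub_sFinSets quotient_sset[OF X Q] quotient_sset[OF Y R]] by simp
  note pX = quotient_proj[OF X Q] and pY = quotient_proj[OF Y R]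
  show "Cmp (simp Sets) (quotient_map f Q R) (quotient_proj X Q) = Cmp (simp Sets) (quotient_proj Y R) f"
  proof (rule ap_eqI[OF cat_cmp[OF is_cat_simp[OF is_cat_sets_cat] pX S] cat_cmp[OF is_cat_simp[OF is_cat_sets_cat] f pY]])
    fix n x assume x: "x \<in> fob X n"
    show "ap (Cmp (simp Sets) (quotient_map f Q R) (quotient_proj X Q)) n x =
        ap (Cmp (simp Sets) (quotient_proj Y R) f) n x"
      unfolding ap_Cmp[OF pX S x] ap_Cmp[OF f pY x]
      using x ap_mem[OF f x] rep_in[OF x] rr[OF x] by (simp add: eq)
  qed
qed

lemma quotient_map_Cmp:
  assumes f: "f \<in> homs (simp Sets) X Y" and g: "g \<in> homs (simp Sets) Y Z"
    and Q: "Q \<in> fin_quotients (X :: 'u ssetob)" and R: "R \<in> fin_quotients Y" and S: "S \<in> fin_quotients Z"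
    and le: "rel_le f Q R" "rel_le g R S"
  shows "rel_le (Cmp (simp Sets) g f) Q S"
    and "quotient_map (Cmp (simp Sets) g f) Q S = Cmp (simp Sets) (quotient_map g R S) (quotient_map f Q R)"
proof -
  let ?S = "simp (Sets :: ('u set, 'u setm) cat)"
  have c: "is_cat ?S" by simp
  note X = cat_ob(1)[OF c f]
  show l: "rel_le (Cmp ?S g f) Q S"
    unfolding rel_le_def
  proof (intro allI impI)
    fix n x y assume xy: "(x, y) \<in> Q n"
    then have "x \<in> fob X n" "y \<in> fob X n" using fin_quotients_mem[OF Q] by auto
    then show "(ap (Cmp ?S g f) n x, ap (Cmp ?S g f) n y) \<in> S n"
      using le xy ap_Cmp[OF f g] unfolding rel_le_def by simp
  qed
  note gf = cat_cmp[OF c f g]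
  note mf = quotient_map_Sets[OF f Q R le(1)] and mg = quotient_map_Sets[OF g R S le(2)] and mgf = quotient_map_Sets[OF gf Q S l]
  note pX = quotient_proj[OF X Q] and pY = quotient_proj[OF cat_ob(2)[OF c f] R] and pZ = quotient_proj[OF cat_ob(2)[OF c g] S]
  show "quotient_map (Cmp ?S g f) Q S = Cmp ?S (quotient_map g R S) (quotient_map f Q R)"
  proof (rule quotient_proj_epi[OF X Q mgf cat_cmp[OF c mf mg]])
    have "Cmp ?S (Cmp ?S (quotient_map g R S) (quotient_map f Q R)) (quotient_proj X Q) =
        Cmp ?S (quotient_map g R S) (Cmp ?S (quotient_proj Y R) f)"
      using cat_assoc[OF c pX mf mg] quotient_map_proj[OF f Q R le(1)] by simp
    also have "\<dots> = Cmp ?S (Cmp ?S (quotient_proj Z S) g) f"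
      using cat_assoc[OF c f pY mg] quotient_map_proj[OF g R S le(2)] by simp
    also have "\<dots> = Cmp ?S (quotient_map (Cmp ?S g f) Q S) (quotient_proj X Q)"
      using cat_assoc[OF c f g pZ] quotient_map_proj[OF gf Q S l] by simp
    finally show "Cmp ?S (quotient_map (Cmp ?S g f) Q S) (quotient_proj X Q) =
      Cmp ?S (Cmp ?S (quotient_map g R S) (quotient_map f Q R)) (quotient_proj X Q)" by simp
  qed
qed

lemma quotient_map_Idn:
  assumes X: "X \<in> Ob (simp Sets)" and Q: "Q \<in> fin_quotients (X :: 'u ssetob)"
  shows "quotient_map (Idn (simp Sets) X) Q Q = Idn (simp Sets) (quotient_sset X Q)"
proof -
  let ?S = "simp (Sets :: ('u set, 'u setm) cat)"
  have c: "is_cat ?S" by simp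
  note i = cat_id[OF c X] and iq = cat_id[OF c quotient_sset_Sets[OF X Q]] and p = quotient_proj[OF X Q]
  have le: "rel_le (Idn ?S X) Q Q" using rel_le_Idn[OF Q] by blast
  show ?thesis
    by (rule quotient_proj_epi[OF X Q quotient_map_Sets[OF i Q Q le] iq])
       (use quotient_map_proj[OF i Q Q le] cat_idr[OF c p] cat_idl[OF c p] in simp)
qed

end

section \<open>The pro-system of all finite quotients\<close>

lemma germ_self:
  assumes "is_cat C" "is_pob C X" "i \<in> Ob (Idx X)" "f \<in> homs C (fob (Dia X) i) b"
  shows "(i, f) \<in> germ C X i f"
  using mem_germ[OF assms(1-4)] assms(3,4) by simp

lemma quotient_cat_sel [simp]:
  "Ob (quotient_cat X) = fin_quotients X" "Idn (quotient_cat X) = (\<lambda>R. (R, R))"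
  "Cmp (quotient_cat X) = (\<lambda>g f. (fst f, snd g))"
  by (simp_all add: quotient_cat_def)

lemma quotient_cat_homs:
  "m \<in> homs (quotient_cat X) Q R \<longleftrightarrow>
     m = (Q, R) \<and> Q \<in> fin_quotients X \<and> R \<in> fin_quotients X \<and> (\<forall>n. Q n \<subseteq> R n)"
  by (cases m) (auto simp: quotient_cat_def homs_def)

lemma is_cat_quotient_cat [simp]: "is_cat (quotient_cat X)"
  by (rule is_catI) (auto simp: quotient_cat_homs, auto simp: quotient_cat_def)

definition quotient_ftr ::
  "'u ssetob \<Rightarrow> (nat \<Rightarrow> ('u \<times> 'u) set, (nat \<Rightarrow> ('u \<times> 'u) set) \<times> (nat \<Rightarrow> ('u \<times> 'u) set), 'u ssetob, 'u ssetarr) ftr" where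
  "quotient_ftr X = \<lparr>fob = quotient_sset X, fmor = (\<lambda>(Q, R). quotient_map (Idn (simp Sets) X) Q R)\<rparr>"

lemma Fin_const_copy: "Fin_const X = copy_pob (quotient_cat X) (quotient_ftr X)"
  by (simp add: Fin_const_def copy_pob_def quotient_ftr_def)

text \<open>\<open>Fin X\<close> is modelled on the finite quotients of all the \<open>X\<^sub>s\<close>; a morphism over \<open>u : s \<rightarrow> t\<close>
  exists when \<open>X\<^sub>u\<close> descends to the quotients.\<close>

definition quot_cat ::
  "('u, 'u ssetob, 'u ssetarr) pob \<Rightarrow> ('u \<times> (nat \<Rightarrow> ('u \<times> 'u) set),
     ('u \<times> (nat \<Rightarrow> ('u \<times> 'u) set)) \<times> 'u \<times> 'u \<times> (nat \<Rightarrow> ('u \<times> 'u) set)) cat" where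
  "quot_cat X =
    \<lparr>Ob = (SIGMA s:Ob (Idx X). fin_quotients (fob (Dia X) s)),
     Mor = {((s, Q), u, (t, R)). s \<in> Ob (Idx X) \<and> t \<in> Ob (Idx X) \<and> Q \<in> fin_quotients (fob (Dia X) s) \<and>
       R \<in> fin_quotients (fob (Dia X) t) \<and> u \<in> homs (Idx X) s t \<and> rel_le (fmor (Dia X) u) Q R},
     Dom = fst, Cod = (\<lambda>m. snd (snd m)), Idn = (\<lambda>a. (a, Idn (Idx X) (fst a), a)),
     Cmp = (\<lambda>g f. (fst f, Cmp (Idx X) (fst (snd g)) (fst (snd f)), snd (snd g)))\<rparr>"

lemma quot_cat_sel [simp]:
  "Ob (quot_cat X) = (SIGMA s:Ob (Idx X). fin_quotients (fob (Dia X) s))"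
  "Idn (quot_cat X) = (\<lambda>a. (a, Idn (Idx X) (fst a), a))"
  "Cmp (quot_cat X) = (\<lambda>g f. (fst f, Cmp (Idx X) (fst (snd g)) (fst (snd f)), snd (snd g)))"
  by (simp_all add: quot_cat_def)

lemma quot_cat_homs:
  "m \<in> homs (quot_cat X) (s, Q) (t, R) \<longleftrightarrow>
     (\<exists>u. m = ((s, Q), u, (t, R)) \<and> s \<in> Ob (Idx X) \<and> t \<in> Ob (Idx X) \<and> Q \<in> fin_quotients (fob (Dia X) s) \<and>
       R \<in> fin_quotients (fob (Dia X) t) \<and> u \<in> homs (Idx X) s t \<and> rel_le (fmor (Dia X) u) Q R)"
  by (cases m) (auto simp: quot_cat_def homs_def)

definition quot_ftr ::
  "('u, 'u ssetob, 'u ssetarr) pob \<Rightarrow> ('u \<times> (nat \<Rightarrow> ('u \<times> 'u) set),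
     ('u \<times> (nat \<Rightarrow> ('u \<times> 'u) set)) \<times> 'u \<times> 'u \<times> (nat \<Rightarrow> ('u \<times> 'u) set), 'u ssetob, 'u ssetarr) ftr" where
  "quot_ftr X = \<lparr>fob = (\<lambda>(s, R). quotient_sset (fob (Dia X) s) R),
     fmor = (\<lambda>((s, Q), u, (t, R)). quotient_map (fmor (Dia X) u) Q R)\<rparr>"

context universe
begin

abbreviation sS :: "('u ssetob, 'u ssetarr) cat" where "sS \<equiv> simp Sets"
abbreviation sF :: "('u ssetob, 'u ssetarr) cat" where "sF \<equiv> simp FinSets"

lemmas cS = is_cat_sets_cat[of "small :: 'u set \<Rightarrow> bool"]
lemmas cF = is_cat_sets_cat[of "finite :: 'u set \<Rightarrow> bool"]
lemmas csS = is_cat_simp[OF cS]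
lemmas csF = is_cat_simp[OF cF]
lemmas sub = full_sub_sFinSets
lemmas subI = full_subD(1)[OF sub] and subC = full_subD(2)[OF sub]

lemma quotient_map_le1:
  assumes f: "f \<in> homs sS X Y" and Q: "Q \<in> fin_quotients X" and Q': "Q' \<in> fin_quotients X" and R: "R \<in> fin_quotients Y"
    and le: "\<And>n. Q n \<subseteq> Q' n" "rel_le f Q' R"
  shows "rel_le f Q R" and "quotient_map f Q R = Cmp sS (quotient_map f Q' R) (quotient_map (Idn sS X) Q Q')"
  using quotient_map_Cmp[OF cat_id[OF csS cat_ob(1)[OF csS f]] f Q Q' R _ le(2)] rel_le_Idn[OF Q] le(1)
    cat_idr[OF csS f] by auto

lemma quotient_map_le2:
  assumes f: "f \<in> homs sS X Y" and Q: "Q \<in> fin_quotients X" and R: "R \<in> fin_quotients Y" and R': "R' \<in> fin_quotients Y"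
    and le: "rel_le f Q R" "\<And>n. R n \<subseteq> R' n"
  shows "rel_le f Q R'" and "quotient_map f Q R' = Cmp sS (quotient_map (Idn sS Y) R R') (quotient_map f Q R)"
  using quotient_map_Cmp[OF f cat_id[OF csS cat_ob(2)[OF csS f]] Q R R' le(1)] rel_le_Idn[OF R] le(2)
    cat_idl[OF csS f] by auto

text \<open>A quotient is determined by its graph, a subset of the disjoint union of all
  \<open>fob X n \<times> fob X n\<close>. That union is small since it is indexed by
  \<open>nat\<close>, and its power set is small by the strong limit property of the
  universe.\<close>

lemma small_fin_quotients:
  assumes X: "X \<in> Ob sS"
  shows "|fin_quotients X| <o |UNIV :: 'u set|"
proof -
  let ?T = "SIGMA n:(UNIV :: nat set). SIGMA x:fob X n. fob X n"
  have s: "|fob X n| <o |UNIV :: 'u set|" for n using simp_ob[OF X, of n] by (simp add: small_def)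
  have "|?T| <o |UNIV :: 'u set|"
    by (rule small_Sigma[OF small_nat], rule small_Sigma[OF s], rule s)
  then have "|Pow ?T| <o |UNIV :: 'u set|" by (rule small_Pow)
  moreover have "inj_on (\<lambda>R. {(n, x, y). (x, y) \<in> R n}) (fin_quotients X)"
    by (rule inj_onI) (auto simp: set_eq_iff fun_eq_iff)
  ultimately show ?thesis
    by (rule small_inj) (use fin_quotients_mem in fast)
qed

lemma copied_quotient_cat:
  assumes X: "X \<in> Ob sS"
  shows "copied TYPE('u) (quotient_cat X)"
proof
  have s: "|SIGMA Q:fin_quotients X. fin_quotients X| <o |UNIV :: 'u set|"
    by (rule small_Sigma) (rule small_fin_quotients[OF X])+
  show "|Mor (quotient_cat X)| <o |UNIV :: 'u set|"
    by (rule small_subset[OF s]) (auto simp: quotient_cat_def)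
qed (use small_fin_quotients[OF X] in \<open>auto simp: U\<close>)

text \<open>Quotients are ordered by inclusion: intersections are lower bounds, and parallel
  morphisms coincide, so the equalising condition is met by an identity.\<close>

lemma is_pob_Fin_const:
  assumes X: "X \<in> Ob sS"
  shows "is_pob sF (Fin_const X)"
  unfolding Fin_const_copy
proof (rule copied.is_pob_copy[OF copied_quotient_cat[OF X]])
  note i = cat_id[OF csS X]
  show "cofiltered (quotient_cat X)"
    unfolding cofiltered_def
  proof (intro conjI ballI)
    show "Ob (quotient_cat X) \<noteq> {}" using fin_quotients_total[OF X] by auto
    fix Q R assume QR: "Q \<in> Ob (quotient_cat X)" "R \<in> Ob (quotient_cat X)"
    then have "(\<lambda>n. Q n \<inter> R n) \<in> fin_quotients X" using fin_quotients_inter by auto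
    then show "\<exists>k\<in>Ob (quotient_cat X). homs (quotient_cat X) k Q \<noteq> {} \<and> homs (quotient_cat X) k R \<noteq> {}"
      using QR by (intro bexI[of _ "\<lambda>n. Q n \<inter> R n"]) (auto simp: quotient_cat_homs ex_in_conv[symmetric])
    fix u v assume "u \<in> homs (quotient_cat X) Q R" "v \<in> homs (quotient_cat X) Q R"
    then have "u = v" by (simp add: quotient_cat_homs)
    then show "\<exists>k\<in>Ob (quotient_cat X). \<exists>w\<in>homs (quotient_cat X) k Q. Cmp (quotient_cat X) u w = Cmp (quotient_cat X) v w"
      using QR cat_id[OF is_cat_quotient_cat QR(1)] by blast
  qed
  show "is_functor (quotient_cat X) sF (quotient_ftr X)"
  proof (rule is_functorI)
    fix Q assume "Q \<in> Ob (quotient_cat X)"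
    then have Q: "Q \<in> fin_quotients X" by simp
    show "fob (quotient_ftr X) Q \<in> Ob sF" using quotient_sset[OF X Q] by (simp add: quotient_ftr_def)
    show "fmor (quotient_ftr X) (Idn (quotient_cat X) Q) = Idn sF (fob (quotient_ftr X) Q)"
      using quotient_map_Idn[OF X Q] subI by (simp add: quotient_ftr_def)
  next
    fix f Q R assume "f \<in> homs (quotient_cat X) Q R"
    then have f: "f = (Q, R)" "Q \<in> fin_quotients X" "R \<in> fin_quotients X" "\<And>n. Q n \<subseteq> R n"
      by (auto simp: quotient_cat_homs)
    have le: "rel_le (Idn sS X) Q R" using rel_le_Idn[OF f(2)] f(4) by blast
    show "fmor (quotient_ftr X) f \<in> homs sF (fob (quotient_ftr X) Q) (fob (quotient_ftr X) R)"
      using quotient_map_homs[OF i f(2,3) le] f(1) by (simp add: quotient_ftr_def)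
    fix g T assume "g \<in> homs (quotient_cat X) R T"
    then have g: "g = (R, T)" "T \<in> fin_quotients X" "\<And>n. R n \<subseteq> T n" by (auto simp: quotient_cat_homs)
    show "fmor (quotient_ftr X) (Cmp (quotient_cat X) g f) = Cmp sF (fmor (quotient_ftr X) g) (fmor (quotient_ftr X) f)"
      using quotient_map_le2(2)[OF i f(2,3) g(2) le g(3)] f(1) g(1) subC by (simp add: quotient_ftr_def)
  qed
qed

lemma Fin_const_sel:
  assumes X: "X \<in> Ob sS"
  shows "Idx (Fin_const X) = copy_cat (quotient_cat X)"
    and "R \<in> fin_quotients X \<Longrightarrow> fob (Dia (Fin_const X)) (code (fin_quotients X) R) = quotient_sset X R"
    and "m \<in> homs (quotient_cat X) Q R \<Longrightarrow>
      fmor (Dia (Fin_const X)) (code (Mor (quotient_cat X)) m) = quotient_map (Idn sS X) Q R"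
proof -
  interpret copied U "quotient_cat X" by (rule copied_quotient_cat[OF X])
  show "Idx (Fin_const X) = copy_cat (quotient_cat X)" by (simp add: Fin_const_copy)
  show "R \<in> fin_quotients X \<Longrightarrow> fob (Dia (Fin_const X)) (code (fin_quotients X) R) = quotient_sset X R"
    using copy_pob_fob[of R "quotient_ftr X"] by (simp add: Fin_const_copy quotient_ftr_def)
  show "m \<in> homs (quotient_cat X) Q R \<Longrightarrow>
      fmor (Dia (Fin_const X)) (code (Mor (quotient_cat X)) m) = quotient_map (Idn sS X) Q R"
    using copy_pob_fmor[of m Q R "quotient_ftr X"] by (simp add: Fin_const_copy quotient_ftr_def quotient_cat_homs)
qed

lemma Fin_const_Ob: "X \<in> Ob sS \<Longrightarrow> a \<in> Ob (Idx (Fin_const X)) \<longleftrightarrow> (\<exists>R\<in>fin_quotients X. a = code (fin_quotients X) R)"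
  using copied.copy_Ob[OF copied_quotient_cat] Fin_const_sel(1) by simp

lemma Fin_const_homs:
  assumes X: "X \<in> Ob sS"
  shows "u \<in> homs (Idx (Fin_const X)) a b \<longleftrightarrow> (\<exists>Q R. Q \<in> fin_quotients X \<and> R \<in> fin_quotients X \<and>
    (\<forall>n. Q n \<subseteq> R n) \<and> a = code (fin_quotients X) Q \<and> b = code (fin_quotients X) R \<and>
    u = code (Mor (quotient_cat X)) (Q, R))"
  using copied.copy_homs[OF copied_quotient_cat[OF X]] Fin_const_sel(1)[OF X]
  by (auto simp: quotient_cat_homs)

lemma decode_fin_quotients:
  "X \<in> Ob sS \<Longrightarrow> R \<in> fin_quotients X \<Longrightarrow> decode (fin_quotients X) (code (fin_quotients X) R :: 'u) = R"
  using copied.decode_Ob[OF copied_quotient_cat, of X R] by simp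

lemma Fin_const_map:
  assumes f: "f \<in> homs sS X Y"
  shows Fin_const_map_homs: "Fin_const_map f \<in> homs (pro sF) (Fin_const X) (Fin_const Y)"
    and Fin_const_map_mem: "R \<in> fin_quotients Y \<Longrightarrow>
      (code (fin_quotients X) (pullback_rel f R), quotient_map f (pullback_rel f R) R) \<in>
        germs (Fin_const_map f) (code (fin_quotients Y) R)"
proof -
  note X = cat_ob(1)[OF csS f] and Y = cat_ob(2)[OF csS f]
  note FX = is_pob_Fin_const[OF X] and FY = is_pob_Fin_const[OF Y]
  let ?Q = "\<lambda>s. pullback_rel f (decode (fin_quotients Y) s)"
  let ?t = "\<lambda>s. code (fin_quotients X) (?Q s) :: 'u"
  let ?f = "\<lambda>s. quotient_map f (?Q s) (decode (fin_quotients Y) s)"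
  have eq: "Fin_const_map f = (Fin_const X, Fin_const Y, \<lambda>s\<in>Ob (Idx (Fin_const Y)). germ sF (Fin_const X) (?t s) (?f s))"
    using f by (auto simp: Fin_const_map_def simp_homs Let_def)
  have t: "?t s \<in> Ob (Idx (Fin_const X)) \<and> ?f s \<in> homs sF (fob (Dia (Fin_const X)) (?t s)) (fob (Dia (Fin_const Y)) s)"
    if s: "s \<in> Ob (Idx (Fin_const Y))" for s
  proof -
    obtain R where R: "R \<in> fin_quotients Y" "s = code (fin_quotients Y) R"
      using s[unfolded Fin_const_Ob[OF Y]] by blast
    note Q = fin_quotients_pullback[OF R(1) f]
    show ?thesis using R decode_fin_quotients[OF Y R(1)] Fin_const_Ob[OF X] Q Fin_const_sel(2)[OF X Q]
        Fin_const_sel(2)[OF Y R(1)] quotient_map_homs[OF f Q R(1) rel_le_pullback[OF f]] by auto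
  qed
  show "Fin_const_map f \<in> homs (pro sF) (Fin_const X) (Fin_const Y)"
    unfolding eq
  proof (rule pro_homsI[OF csF FX FY])
    fix u s s' assume "u \<in> homs (Idx (Fin_const Y)) s s'"
    then obtain R R' where R: "R \<in> fin_quotients Y" "R' \<in> fin_quotients Y" "\<And>n. R n \<subseteq> R' n"
      "s = code (fin_quotients Y) R" "s' = code (fin_quotients Y) R'" "u = code (Mor (quotient_cat Y)) (R, R')"
      unfolding Fin_const_homs[OF Y] by blast
    note Q = fin_quotients_pullback[OF R(1) f] and Q' = fin_quotients_pullback[OF R(2) f]
    have QQ: "pullback_rel f R n \<subseteq> pullback_rel f R' n" for n
      using pullback_rel_mem[OF f] subsetD[OF R(3)] by (auto simp: pullback_rel_mem[OF f])
    have uY: "fmor (Dia (Fin_const Y)) u = quotient_map (Idn sS Y) R R'"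
      using Fin_const_sel(3)[OF Y, of "(R, R')" R R'] R by (simp add: quotient_cat_homs)
    let ?v = "code (Mor (quotient_cat X)) (pullback_rel f R, pullback_rel f R') :: 'u"
    have v: "?v \<in> homs (Idx (Fin_const X)) (code (fin_quotients X) (pullback_rel f R)) (code (fin_quotients X) (pullback_rel f R'))"
      unfolding Fin_const_homs[OF X] using Q Q' QQ by blast
    have vX: "fmor (Dia (Fin_const X)) ?v = quotient_map (Idn sS X) (pullback_rel f R) (pullback_rel f R')"
      using Fin_const_sel(3)[OF X, of "(pullback_rel f R, pullback_rel f R')"] Q Q' QQ by (simp add: quotient_cat_homs)
    \<comment> \<open>Both sides are the map that f induces from the quotient by
      \<open>pullback_rel f R\<close> to the quotient by R', factored once over Y/R and once over
      the quotient by \<open>pullback_rel f R'\<close>.\<close>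
    have "Cmp sF (quotient_map (Idn sS Y) R R') (quotient_map f (pullback_rel f R) R) =
        Cmp sF (quotient_map f (pullback_rel f R') R') (fmor (Dia (Fin_const X)) ?v)"
      using quotient_map_le1(2)[OF f Q Q' R(2) QQ rel_le_pullback[OF f]]
        quotient_map_le2(2)[OF f Q R(1,2) rel_le_pullback[OF f] R(3)] vX subC by simp
    moreover have "germ sF (Fin_const X) (code (fin_quotients X) (pullback_rel f R))
        (Cmp sF (quotient_map f (pullback_rel f R') R') (fmor (Dia (Fin_const X)) ?v)) =
        germ sF (Fin_const X) (code (fin_quotients X) (pullback_rel f R')) (quotient_map f (pullback_rel f R') R')"
      by (rule germ_res[OF csF FX v]) (use Fin_const_sel(2)[OF X Q'] quotient_map_homs[OF f Q' R(2) rel_le_pullback[OF f]] in simp)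
    ultimately show "germ sF (Fin_const X) (?t s) (Cmp sF (fmor (Dia (Fin_const Y)) u) (?f s)) = germ sF (Fin_const X) (?t s') (?f s')"
      using R decode_fin_quotients[OF Y R(1)] decode_fin_quotients[OF Y R(2)] uY by simp
  qed (use t in auto)
  assume R: "R \<in> fin_quotients Y"
  have s: "code (fin_quotients Y) R \<in> Ob (Idx (Fin_const Y))" using Fin_const_Ob[OF Y] R by blast
  show "(code (fin_quotients X) (pullback_rel f R), quotient_map f (pullback_rel f R) R) \<in>
        germs (Fin_const_map f) (code (fin_quotients Y) R)"
    unfolding eq germs_simp
    using s germ_self[OF csF FX conjunct1[OF t[OF s]] conjunct2[OF t[OF s]]]
      decode_fin_quotients[OF Y R] by simp
qed

end

section \<open>An explicit model of the finite completion\<close>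

locale pro_space = universe U for U :: "'u itself" +
  fixes X :: "('u, 'u ssetob, 'u ssetarr) pob"
  assumes X: "is_pob (simp Sets) X"
begin

abbreviation J where "J \<equiv> Idx X"
abbreviation xob where "xob s \<equiv> fob (Dia X) s"
abbreviation xmor where "xmor u \<equiv> fmor (Dia X) u"
abbreviation co :: "'u \<times> (nat \<Rightarrow> ('u \<times> 'u) set) \<Rightarrow> 'u" where "co \<equiv> code (Ob (quot_cat X))"
abbreviation cm :: "('u \<times> (nat \<Rightarrow> ('u \<times> 'u) set)) \<times> 'u \<times> 'u \<times> (nat \<Rightarrow> ('u \<times> 'u) set) \<Rightarrow> 'u" where "cm \<equiv> code (Mor (quot_cat X))"
abbreviation fq where "fq s \<equiv> fin_quotients (xob s)"

definition QX :: "('u, 'u ssetob, 'u ssetarr) pob" where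
  "QX = copy_pob (quot_cat X) (quot_ftr X)"

lemmas J = pob_cat[OF X] pob_cofiltered[OF X]

lemma is_cat_quot: "is_cat (quot_cat X)"
proof (rule is_catI)
  fix m assume "m \<in> Mor (quot_cat X)"
  then show "Dom (quot_cat X) m \<in> Ob (quot_cat X) \<and> Cod (quot_cat X) m \<in> Ob (quot_cat X)"
    by (auto simp: quot_cat_def)
next
  fix a assume "a \<in> Ob (quot_cat X)"
  then obtain s Q where a: "a = (s, Q)" "s \<in> Ob J" "Q \<in> fq s" by auto
  have "rel_le (xmor (Idn J s)) Q Q"
    using rel_le_Idn[OF a(3)] ftr_id[OF pob_functor[OF X] a(2)] by auto
  then show "Idn (quot_cat X) a \<in> homs (quot_cat X) a a"
    unfolding a(1) quot_cat_homs using a cat_id[OF J(1) a(2)] by simp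
next
  fix f g a b c assume fg: "f \<in> homs (quot_cat X) a b" "g \<in> homs (quot_cat X) b c"
  obtain s Q t R r T where abc: "a = (s, Q)" "b = (t, R)" "c = (r, T)" by (metis surj_pair)
  obtain u where f: "f = ((s, Q), u, (t, R))" "s \<in> Ob J" "t \<in> Ob J" "Q \<in> fq s" "R \<in> fq t" "u \<in> homs J s t" "rel_le (xmor u) Q R"
    using fg(1) unfolding abc quot_cat_homs by blast
  obtain v where g: "g = ((t, R), v, (r, T))" "r \<in> Ob J" "T \<in> fq r" "v \<in> homs J t r" "rel_le (xmor v) R T"
    using fg(2) unfolding abc quot_cat_homs by blast
  have "rel_le (xmor (Cmp J v u)) Q T"
    using quotient_map_Cmp(1)[OF pob_mor[OF X f(6)] pob_mor[OF X g(4)] f(4,5) g(3) f(7) g(5)]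
      ftr_cmp[OF pob_functor[OF X] f(6) g(4)] by simp
  then show "Cmp (quot_cat X) g f \<in> homs (quot_cat X) a c"
    unfolding abc quot_cat_homs using f g cat_cmp[OF J(1) f(6) g(4)] by simp
next
  fix f a b assume "f \<in> homs (quot_cat X) a b"
  then show "Cmp (quot_cat X) f (Idn (quot_cat X) a) = f" "Cmp (quot_cat X) (Idn (quot_cat X) b) f = f"
    by (cases a; cases b; auto simp: quot_cat_homs cat_idl[OF J(1)] cat_idr[OF J(1)])+
next
  fix f g h a b c d assume "f \<in> homs (quot_cat X) a b" "g \<in> homs (quot_cat X) b c" "h \<in> homs (quot_cat X) c d"
  then show "Cmp (quot_cat X) h (Cmp (quot_cat X) g f) = Cmp (quot_cat X) (Cmp (quot_cat X) h g) f"
    by (cases a; cases b; cases c; cases d) (auto simp: quot_cat_homs cat_assoc[OF J(1)])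
qed

lemma cofiltered_quot: "cofiltered (quot_cat X)"
  unfolding cofiltered_def
proof (intro conjI ballI)
  obtain s where s: "s \<in> Ob J" using cofiltered_nonempty[OF J(2)] by blast
  show "Ob (quot_cat X) \<noteq> {}" using s fin_quotients_total[OF pob_ob[OF X s]] by auto
next
  fix a b assume "a \<in> Ob (quot_cat X)" "b \<in> Ob (quot_cat X)"
  then obtain s Q t R where a: "a = (s, Q)" "s \<in> Ob J" "Q \<in> fq s" and b: "b = (t, R)" "t \<in> Ob J" "R \<in> fq t" by auto
  obtain k u v where k: "k \<in> Ob J" "u \<in> homs J k s" "v \<in> homs J k t" using cofiltered_pair[OF J(2) a(2) b(2)] by blast
  note pu = fin_quotients_pullback[OF a(3) pob_mor[OF X k(2)]] and pv = fin_quotients_pullback[OF b(3) pob_mor[OF X k(3)]]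
  \<comment> \<open>Both quotients are pulled back to the common stage k; on their intersection both
    \<open>xmor u\<close> and \<open>xmor v\<close> descend to the given quotients.\<close>
  define T where "T n = pullback_rel (xmor u) Q n \<inter> pullback_rel (xmor v) R n" for n
  have T: "T \<in> fq k" unfolding T_def using fin_quotients_inter[OF pu pv] .
  have "rel_le (xmor u) T Q" "rel_le (xmor v) T R"
    using rel_le_pullback[OF pob_mor[OF X k(2)]] rel_le_pullback[OF pob_mor[OF X k(3)]] by (auto simp: rel_le_def T_def)
  then have "((k, T), u, a) \<in> homs (quot_cat X) (k, T) a" "((k, T), v, b) \<in> homs (quot_cat X) (k, T) b"
    unfolding a(1) b(1) quot_cat_homs using k T a b by auto
  then show "\<exists>k\<in>Ob (quot_cat X). homs (quot_cat X) k a \<noteq> {} \<and> homs (quot_cat X) k b \<noteq> {}"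
    using k(1) T by (intro bexI[of _ "(k, T)"]) auto
  fix f g assume "f \<in> homs (quot_cat X) a b" "g \<in> homs (quot_cat X) a b"
  then obtain u v where uv: "f = (a, u, b)" "g = (a, v, b)" "u \<in> homs J s t" "v \<in> homs J s t"
    unfolding a(1) b(1) quot_cat_homs by blast
  obtain k w where k: "k \<in> Ob J" "w \<in> homs J k s" "Cmp J u w = Cmp J v w"
    using cofiltered_par[OF J(2) a(2) b(2) uv(3,4)] by blast
  \<comment> \<open>An equalising map of J must be lifted to the category of quotients. Pulling Q
    back along w gives a quotient of the stage k to which \<open>xmor w\<close> descends.\<close>
  let ?T = "pullback_rel (xmor w) Q"
  have T: "?T \<in> fq k" using fin_quotients_pullback[OF a(3) pob_mor[OF X k(2)]] .
  have "((k, ?T), w, a) \<in> homs (quot_cat X) (k, ?T) a"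
    unfolding a(1) quot_cat_homs using k T a rel_le_pullback[OF pob_mor[OF X k(2)]] by auto
  moreover have "Cmp (quot_cat X) f ((k, ?T), w, a) = Cmp (quot_cat X) g ((k, ?T), w, a)"
    using uv k(3) by simp
  moreover have "(k, ?T) \<in> Ob (quot_cat X)" using k(1) T by simp
  ultimately show "\<exists>k\<in>Ob (quot_cat X). \<exists>w\<in>homs (quot_cat X) k a. Cmp (quot_cat X) f w = Cmp (quot_cat X) g w"
    by blast
qed

lemma small_quot_Ob: "|Ob (quot_cat X)| <o |UNIV :: 'u set|"
proof -
  have "|Ob J| <o |UNIV :: 'u set|" using X by (simp add: is_pob_def small_def)
  then show ?thesis unfolding quot_cat_sel using small_fin_quotients[OF pob_ob[OF X]] by (rule small_Sigma)
qed

lemma small_quot_Mor: "|Mor (quot_cat X)| <o |UNIV :: 'u set|"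
proof -
  have "|Mor J| <o |UNIV :: 'u set|" using X by (simp add: is_pob_def small_def)
  then have "|SIGMA a:Ob (quot_cat X). SIGMA u:Mor J. Ob (quot_cat X)| <o |UNIV :: 'u set|"
    by (intro small_Sigma small_quot_Ob)
  then show ?thesis by (rule small_subset) (auto simp: quot_cat_def homs_def)
qed

sublocale Q: copied U "quot_cat X"
  by standard (rule is_cat_quot small_quot_Ob small_quot_Mor)+

lemma QX_Idx [simp]: "Idx QX = copy_cat (quot_cat X)"
  by (simp add: QX_def)

lemma QX_Ob: "a \<in> Ob (Idx QX) \<longleftrightarrow> (\<exists>s R. s \<in> Ob J \<and> R \<in> fq s \<and> a = co (s, R))"
  using Q.copy_Ob by auto

lemma QX_ObI: "s \<in> Ob J \<Longrightarrow> R \<in> fq s \<Longrightarrow> co (s, R) \<in> Ob (Idx QX)"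
  using QX_Ob by blast

lemma QX_homs:
  "m \<in> homs (Idx QX) a b \<longleftrightarrow> (\<exists>s Q u t R. a = co (s, Q) \<and> b = co (t, R) \<and> m = cm ((s, Q), u, (t, R)) \<and>
     s \<in> Ob J \<and> t \<in> Ob J \<and> Q \<in> fq s \<and> R \<in> fq t \<and> u \<in> homs J s t \<and> rel_le (xmor u) Q R)"
proof
  assume "m \<in> homs (Idx QX) a b"
  then obtain i j f where f: "f \<in> homs (quot_cat X) i j" "a = co i" "b = co j" "m = cm f"
    unfolding QX_Idx Q.copy_homs by blast
  obtain s Q t R where ij: "i = (s, Q)" "j = (t, R)" by (metis surj_pair)
  show "\<exists>s Q u t R. a = co (s, Q) \<and> b = co (t, R) \<and> m = cm ((s, Q), u, (t, R)) \<and>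
     s \<in> Ob J \<and> t \<in> Ob J \<and> Q \<in> fq s \<and> R \<in> fq t \<and> u \<in> homs J s t \<and> rel_le (xmor u) Q R"
    using f unfolding ij quot_cat_homs by blast
next
  assume "\<exists>s Q u t R. a = co (s, Q) \<and> b = co (t, R) \<and> m = cm ((s, Q), u, (t, R)) \<and>
     s \<in> Ob J \<and> t \<in> Ob J \<and> Q \<in> fq s \<and> R \<in> fq t \<and> u \<in> homs J s t \<and> rel_le (xmor u) Q R"
  then obtain s Q u t R where *: "a = co (s, Q)" "b = co (t, R)" "m = cm ((s, Q), u, (t, R))"
     "s \<in> Ob J" "t \<in> Ob J" "Q \<in> fq s" "R \<in> fq t" "u \<in> homs J s t" "rel_le (xmor u) Q R" by blast
  then have "((s, Q), u, (t, R)) \<in> homs (quot_cat X) (s, Q) (t, R)" unfolding quot_cat_homs by blast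
  then show "m \<in> homs (Idx QX) a b" unfolding QX_Idx *(1-3) by (rule Q.copy_homsI)
qed

lemma QX_fob: "s \<in> Ob J \<Longrightarrow> R \<in> fq s \<Longrightarrow> fob (Dia QX) (co (s, R)) = quotient_sset (xob s) R"
  using Q.copy_pob_fob[of "(s, R)" "quot_ftr X"] by (simp add: QX_def quot_ftr_def)

lemma QX_fmor:
  "s \<in> Ob J \<Longrightarrow> t \<in> Ob J \<Longrightarrow> Q \<in> fq s \<Longrightarrow> R \<in> fq t \<Longrightarrow> u \<in> homs J s t \<Longrightarrow> rel_le (xmor u) Q R \<Longrightarrow>
    fmor (Dia QX) (cm ((s, Q), u, (t, R))) = quotient_map (xmor u) Q R"
  using Q.copy_pob_fmor[of "((s, Q), u, (t, R))" "(s, Q)" "(t, R)" "quot_ftr X"]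
  by (simp add: QX_def quot_ftr_def quot_cat_homs)

lemma is_pob_QX: "is_pob sF QX"
  unfolding QX_def
proof (rule Q.is_pob_copy[OF cofiltered_quot is_functorI])
  fix a assume "a \<in> Ob (quot_cat X)"
  then obtain s Q where a: "a = (s, Q)" "s \<in> Ob J" "Q \<in> fq s" by auto
  show "fob (quot_ftr X) a \<in> Ob sF" using a quotient_sset[OF pob_ob[OF X]] by (simp add: quot_ftr_def)
  show "fmor (quot_ftr X) (Idn (quot_cat X) a) = Idn sF (fob (quot_ftr X) a)"
    using a quotient_map_Idn[OF pob_ob[OF X a(2)] a(3)] ftr_id[OF pob_functor[OF X] a(2)] subI
    by (simp add: quot_ftr_def)
next
  fix f a b assume f: "f \<in> homs (quot_cat X) a b"
  obtain s Q t R where ab: "a = (s, Q)" "b = (t, R)" by (metis surj_pair)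
  obtain u where f: "f = ((s, Q), u, (t, R))" "s \<in> Ob J" "t \<in> Ob J" "Q \<in> fq s" "R \<in> fq t" "u \<in> homs J s t" "rel_le (xmor u) Q R"
    using f unfolding ab quot_cat_homs by blast
  show "fmor (quot_ftr X) f \<in> homs sF (fob (quot_ftr X) a) (fob (quot_ftr X) b)"
    using f ab quotient_map_homs[OF pob_mor[OF X f(6)] f(4,5,7)] by (simp add: quot_ftr_def)
  fix g c assume g: "g \<in> homs (quot_cat X) b c"
  obtain r T where c: "c = (r, T)" by (metis surj_pair)
  obtain v where g: "g = ((t, R), v, (r, T))" "r \<in> Ob J" "T \<in> fq r" "v \<in> homs J t r" "rel_le (xmor v) R T"
    using g unfolding ab c quot_cat_homs by blast
  show "fmor (quot_ftr X) (Cmp (quot_cat X) g f) = Cmp sF (fmor (quot_ftr X) g) (fmor (quot_ftr X) f)"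
    using f g quotient_map_Cmp(2)[OF pob_mor[OF X f(6)] pob_mor[OF X g(4)] f(4,5) g(3) f(7) g(5)]
      ftr_cmp[OF pob_functor[OF X] f(6) g(4)] subC by (simp add: quot_ftr_def)
qed

lemma is_pob_QX_S: "is_pob sS QX"
  using is_pob_QX is_pob_sub[OF csF csS sub, of QX] by simp

lemma QX_homsI:
  "s \<in> Ob J \<Longrightarrow> t \<in> Ob J \<Longrightarrow> Q \<in> fq s \<Longrightarrow> R \<in> fq t \<Longrightarrow> u \<in> homs J s t \<Longrightarrow> rel_le (xmor u) Q R \<Longrightarrow>
    cm ((s, Q), u, (t, R)) \<in> homs (Idx QX) (co (s, Q)) (co (t, R))"
  unfolding QX_homs by blast

text \<open>The quotients of one stage s form a subsystem of \<open>QX\<close> that is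
  \<open>Fin_const (xob s)\<close>, so the leg of the cone at s consists of germs of
  identities.\<close>

definition proj :: "'u \<Rightarrow> ('u, 'u ssetob, 'u ssetarr) parr" where
  "proj s = (QX, Fin_const (xob s), \<lambda>a\<in>Ob (Idx (Fin_const (xob s))).
     germ sF QX (co (s, decode (fq s) a)) (Idn sF (quotient_sset (xob s) (decode (fq s) a))))"

lemma proj:
  assumes s: "s \<in> Ob J"
  shows proj_homs: "proj s \<in> homs (pro sF) QX (Fin_const (xob s))"
    and proj_mem: "R \<in> fq s \<Longrightarrow> (co (s, R), Idn sF (quotient_sset (xob s) R)) \<in> germs (proj s) (code (fq s) R)"
proof -
  note Xs = pob_ob[OF X s]
  note dec = decode_fin_quotients[OF Xs]
  have i: "Idn sF (quotient_sset (xob s) R) \<in> homs sF (fob (Dia QX) (co (s, R))) (quotient_sset (xob s) R)"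
    if "R \<in> fq s" for R
    using cat_id[OF csF quotient_sset[OF Xs that]] QX_fob[OF s that] by simp
  show "proj s \<in> homs (pro sF) QX (Fin_const (xob s))"
    unfolding proj_def
  proof (rule pro_homsI[OF csF is_pob_QX is_pob_Fin_const[OF Xs]])
    fix a assume "a \<in> Ob (Idx (Fin_const (xob s)))"
    then obtain R where R: "R \<in> fq s" "a = code (fq s) R" using Fin_const_Ob[OF Xs] by blast
    show "co (s, decode (fq s) a) \<in> Ob (Idx QX)" using R dec QX_ObI[OF s] by simp
    show "Idn sF (quotient_sset (xob s) (decode (fq s) a)) \<in>
        homs sF (fob (Dia QX) (co (s, decode (fq s) a))) (fob (Dia (Fin_const (xob s))) a)"
      using R dec i[OF R(1)] Fin_const_sel(2)[OF Xs R(1)] by simp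
  next
    fix m a b assume "m \<in> homs (Idx (Fin_const (xob s))) a b"
    then obtain Q R where R: "Q \<in> fq s" "R \<in> fq s" "\<And>n. Q n \<subseteq> R n" "a = code (fq s) Q" "b = code (fq s) R"
      "m = code (Mor (quotient_cat (xob s))) (Q, R)" unfolding Fin_const_homs[OF Xs] by blast
    have m: "fmor (Dia (Fin_const (xob s))) m = quotient_map (Idn sS (xob s)) Q R"
      using Fin_const_sel(3)[OF Xs, of "(Q, R)" Q R] R by (simp add: quotient_cat_homs)
    have X1: "xmor (Idn J s) = Idn sS (xob s)" using ftr_id[OF pob_functor[OF X] s] .
    have le: "rel_le (xmor (Idn J s)) Q R" using rel_le_Idn[OF R(1)] R(3) X1 by auto
    note k = QX_homsI[OF s s R(1,2) cat_id[OF J(1) s] le] and kf = QX_fmor[OF s s R(1,2) cat_id[OF J(1) s] le]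
    have qm: "quotient_map (Idn sS (xob s)) Q R \<in> homs sF (quotient_sset (xob s) Q) (quotient_sset (xob s) R)"
      using quotient_map_homs[OF cat_id[OF csS Xs] R(1,2)] le X1 by simp
    have "germ sF QX (co (s, Q)) (Cmp sF (Idn sF (quotient_sset (xob s) R)) (quotient_map (Idn sS (xob s)) Q R)) =
        germ sF QX (co (s, R)) (Idn sF (quotient_sset (xob s) R))"
      using germ_res[OF csF is_pob_QX k i[OF R(2)]] kf X1 by simp
    then show "germ sF QX (co (s, decode (fq s) a)) (Cmp sF (fmor (Dia (Fin_const (xob s))) m)
          (Idn sF (quotient_sset (xob s) (decode (fq s) a)))) =
        germ sF QX (co (s, decode (fq s) b)) (Idn sF (quotient_sset (xob s) (decode (fq s) b)))"
      using R(4,5) dec[OF R(1)] dec[OF R(2)] m cat_idl[OF csF qm] cat_idr[OF csF qm] by simp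
  qed
  assume R: "R \<in> fq s"
  have a: "code (fq s) R \<in> Ob (Idx (Fin_const (xob s)))" using Fin_const_Ob[OF Xs] R by blast
  show "(co (s, R), Idn sF (quotient_sset (xob s) R)) \<in> germs (proj s) (code (fq s) R)"
    using mem_germ[OF csF is_pob_QX QX_ObI[OF s R] i[OF R]] a dec[OF R] QX_ObI[OF s R] i[OF R]
    by (simp add: proj_def)
qed

lemma is_cone_proj: "is_cone (pro sF) J (Fin_diagram X) QX proj"
  unfolding is_cone_def
proof (intro conjI ballI)
  show "QX \<in> Ob (pro sF)" using is_pob_QX by (simp add: pro_Ob)
  show "proj s \<in> homs (pro sF) QX (fob (Fin_diagram X) s)" if "s \<in> Ob J" for s
    using proj_homs[OF that] by (simp add: Fin_diagram_def)
  fix u assume "u \<in> Mor J"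
  then obtain s t where u: "u \<in> homs J s t" "s = Dom J u" "t = Cod J u" by (simp add: Mor_homs)
  have s: "s \<in> Ob J" "t \<in> Ob J" using cat_ob[OF J(1) u(1)] by auto
  note xu = pob_mor[OF X u(1)]
  note Xs = pob_ob[OF X s(1)] and Xt = pob_ob[OF X s(2)]
  note Fm = Fin_const_map_homs[OF xu]
  have "Cmp (pro sF) (Fin_const_map (xmor u)) (proj s) = proj t"
  proof (rule pro_eqI[OF csF pro_cmp[OF csF proj_homs[OF s(1)] Fm] proj_homs[OF s(2)]])
    fix a assume a: "a \<in> Ob (Idx (Fin_const (xob t)))"
    then obtain R where R: "R \<in> fq t" "a = code (fq t) R" using Fin_const_Ob[OF Xt] by blast
    \<comment> \<open>At the index R both morphisms are represented by the map from the quotient of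
      \<open>xob s\<close> by the pullback of R to the quotient of \<open>xob t\<close> by R: on one
      side as the component of \<open>Fin_const_map\<close>, on the other as the restriction of an
      identity along a morphism of \<open>QX\<close>.\<close>
    let ?Q = "pullback_rel (xmor u) R"
    note Q = fin_quotients_pullback[OF R(1) xu] and le = rel_le_pullback[OF xu]
    let ?q = "quotient_map (xmor u) ?Q R"
    note qm = quotient_map_homs[OF xu Q R(1) le]
    have "(co (s, ?Q), Cmp sF ?q (Idn sF (quotient_sset (xob s) ?Q))) \<in> germs (Cmp (pro sF) (Fin_const_map (xmor u)) (proj s)) a"
      using pro_Cmp_mem(2)[OF csF proj_homs[OF s(1)] Fm a] Fin_const_map_mem[OF xu R(1)] R(2) proj_mem[OF s(1) Q] by metis
    then have 1: "(co (s, ?Q), ?q) \<in> germs (Cmp (pro sF) (Fin_const_map (xmor u)) (proj s)) a"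
      using cat_idr[OF csF qm] by simp
    have it: "Idn sF (quotient_sset (xob t) R) \<in> homs sF (fob (Dia QX) (co (t, R))) (quotient_sset (xob t) R)"
      using cat_id[OF csF quotient_sset[OF Xt R(1)]] QX_fob[OF s(2) R(1)] by simp
    have "germ sF QX (co (s, ?Q)) ?q = germ sF QX (co (t, R)) (Idn sF (quotient_sset (xob t) R))"
      using germ_res[OF csF is_pob_QX QX_homsI[OF s Q R(1) u(1) le] it] QX_fmor[OF s Q R(1) u(1) le]
        cat_idl[OF csF qm] by simp
    also have "\<dots> = germs (proj t) a"
      using pro_memD(3)[OF csF proj_homs[OF s(2)] a] proj_mem[OF s(2) R(1)] R(2) by simp
    finally have "(co (s, ?Q), ?q) \<in> germs (proj t) a"
      using mem_germ[OF csF is_pob_QX QX_ObI[OF s(1) Q], of ?q] qm QX_fob[OF s(1) Q] QX_ObI[OF s(1) Q] by auto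
    then show "\<exists>t' f. (t', f) \<in> germs (Cmp (pro sF) (Fin_const_map (xmor u)) (proj s)) a \<and> (t', f) \<in> germs (proj t) a"
      using 1 by blast
  qed
  then show "Cmp (pro sF) (fmor (Fin_diagram X) u) (proj (Dom J u)) = proj (Cod J u)"
    using u by (simp add: Fin_diagram_def)
qed

lemma proj_comp_mem:
  assumes h: "h \<in> homs (pro sF) M QX" and s: "s \<in> Ob J" and R: "R \<in> fq s" and f: "(i, f) \<in> germs h (co (s, R))"
  shows "(i, f) \<in> germs (Cmp (pro sF) (proj s) h) (code (fq s) R)"
proof -
  note Xs = pob_ob[OF X s]
  have a: "code (fq s) R \<in> Ob (Idx (Fin_const (xob s)))" using Fin_const_Ob[OF Xs] R by blast
  have "f \<in> homs sF (fob (Dia M) i) (quotient_sset (xob s) R)"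
    using pro_memD(2)[OF csF h QX_ObI[OF s R] f] QX_fob[OF s R] by simp
  then show ?thesis
    using pro_Cmp_mem(2)[OF csF h proj_homs[OF s] a proj_mem[OF s R] f] by (simp only: cat_idl[OF csF])
qed

text \<open>Every index of \<open>QX\<close> belongs to one stage s, and composition with
  \<open>proj s\<close> leaves the component at that index unchanged
  (\<open>proj_comp_mem\<close>).\<close>

lemma proj_jointly_monic:
  assumes h: "h \<in> homs (pro sF) M QX" and k: "k \<in> homs (pro sF) M QX"
    and eq: "\<And>s. s \<in> Ob J \<Longrightarrow> Cmp (pro sF) (proj s) h = Cmp (pro sF) (proj s) k"
  shows "h = k"
proof (rule pro_eqI[OF csF h k])
  fix a assume a: "a \<in> Ob (Idx QX)"
  then obtain s R where s: "s \<in> Ob J" "R \<in> fq s" "a = co (s, R)" unfolding QX_Ob by blast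
  note Xs = pob_ob[OF X s(1)]
  have b: "code (fq s) R \<in> Ob (Idx (Fin_const (xob s)))" using Fin_const_Ob[OF Xs] s(2) by blast
  obtain i f where f: "(i, f) \<in> germs h a" using pro_rep[OF csF h a] by blast
  obtain j g where g: "(j, g) \<in> germs k a" using pro_rep[OF csF k a] by blast
  have 1: "(i, f) \<in> germs (Cmp (pro sF) (proj s) h) (code (fq s) R)"
    using proj_comp_mem[OF h s(1,2)] f s(3) by simp
  have 2: "(j, g) \<in> germs (Cmp (pro sF) (proj s) h) (code (fq s) R)"
    using proj_comp_mem[OF k s(1,2)] g s(3) eq[OF s(1)] by simp
  note c = pro_cmp[OF csF h proj_homs[OF s(1)]]
  have "germ sF M i f = germ sF M j g" using pro_memD(3)[OF csF c b 1] pro_memD(3)[OF csF c b 2] by simp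
  then have "germs h a = germs k a" using pro_memD(3)[OF csF h a f] pro_memD(3)[OF csF k a g] by simp
  then show "\<exists>t f. (t, f) \<in> germs h a \<and> (t, f) \<in> germs k a" using f by blast
qed

text \<open>The component at (s, R) is forced to be that of \<open>\<rho> s\<close> at R. Its
  compatibility with a morphism of quotients over u combines compatibility inside
  \<open>Fin_const (xob s)\<close> with the cone condition for u. With
  \<open>proj_jointly_monic\<close> this is the universal property of \<open>QX\<close>.\<close>

lemma lift_cone:
  assumes c: "is_cone (pro sF) J (Fin_diagram X) M \<rho>"
  shows "\<exists>h\<in>homs (pro sF) M QX. \<forall>s\<in>Ob J. Cmp (pro sF) (proj s) h = \<rho> s"
proof -
  have M: "is_pob sF M" using c by (simp add: is_cone_def pro_Ob)
  have \<rho>: "\<rho> s \<in> homs (pro sF) M (Fin_const (xob s))" if "s \<in> Ob J" for s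
    using c that by (simp add: is_cone_def Fin_diagram_def)
  have \<rho>u: "Cmp (pro sF) (Fin_const_map (xmor u)) (\<rho> s) = \<rho> t" if "u \<in> homs J s t" for u s t
    using c homsD[OF that] by (auto simp: is_cone_def Fin_diagram_def)
  have b: "code (fq s) R \<in> Ob (Idx (Fin_const (xob s)))" if "s \<in> Ob J" "R \<in> fq s" for s R
    using Fin_const_Ob[OF pob_ob[OF X that(1)]] that(2) by blast
  let ?g = "\<lambda>a. case decode (Ob (quot_cat X)) a of (s, R) \<Rightarrow> germs (\<rho> s) (code (fq s) R)"
  let ?h = "(M, QX, \<lambda>a\<in>Ob (Idx QX). ?g a)"
  have gh: "germs ?h (co (s, R)) = germs (\<rho> s) (code (fq s) R)" if "s \<in> Ob J" "R \<in> fq s" for s R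
  proof -
    have "decode (Ob (quot_cat X)) (co (s, R)) = (s, R)" by (rule Q.decode_Ob) (use that in simp)
    then show ?thesis using QX_ObI[OF that] by (simp only: germs_simp restrict_apply' prod.case)
  qed
  have h: "?h \<in> homs (pro sF) M QX"
    unfolding pro_homs
  proof (intro conjI ballI)
    fix a assume "a \<in> Ob (Idx QX)"
    then obtain s R where s: "s \<in> Ob J" "R \<in> fq s" "a = co (s, R)" unfolding QX_Ob by blast
    obtain i f where f: "(i, f) \<in> germs (\<rho> s) (code (fq s) R)" using pro_rep[OF csF \<rho>[OF s(1)] b[OF s(1,2)]] by blast
    note f' = pro_memD[OF csF \<rho>[OF s(1)] b[OF s(1,2)] f]
    show "\<exists>t\<in>Ob (Idx M). \<exists>f\<in>homs sF (fob (Dia M) t) (fob (Dia QX) a). germs ?h a = germ sF M t f"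
      using f' gh[OF s(1,2)] s(3) QX_fob[OF s(1,2)] Fin_const_sel(2)[OF pob_ob[OF X s(1)] s(2)] by auto
  next
    fix m z assume m: "m \<in> Mor (Idx QX)" and z: "z \<in> germs ?h (Dom (Idx QX) m)"
    obtain s Q u t R where k: "Dom (Idx QX) m = co (s, Q)" "Cod (Idx QX) m = co (t, R)" "m = cm ((s, Q), u, (t, R))"
      "s \<in> Ob J" "t \<in> Ob J" "Q \<in> fq s" "R \<in> fq t" "u \<in> homs J s t" "rel_le (xmor u) Q R"
      using Mor_homs[OF m] unfolding QX_homs by blast
    note xu = pob_mor[OF X k(8)] and Xs = pob_ob[OF X k(4)]
    obtain i f where zf: "z = (i, f)" by (cases z)
    have f: "(i, f) \<in> germs (\<rho> s) (code (fq s) Q)" using z unfolding zf k(1) gh[OF k(4,6)] .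
    note f' = pro_memD[OF csF \<rho>[OF k(4)] b[OF k(4,6)] f]
    \<comment> \<open>The map from the quotient by Q to that by R is factored through the quotient
      of the same stage by the pullback of R: the first factor lies in the system for s, the second
      is the component of \<open>Fin_const_map\<close>.\<close>
    let ?P = "pullback_rel (xmor u) R"
    note P = fin_quotients_pullback[OF k(7) xu]
    have QP: "Q n \<subseteq> ?P n" for n
      using k(9) fin_quotients_mem[OF k(6)] by (auto simp: rel_le_def pullback_rel_mem[OF xu])
    have n: "code (Mor (quotient_cat (xob s))) (Q, ?P) \<in> homs (Idx (Fin_const (xob s))) (code (fq s) Q) (code (fq s) ?P)"
      unfolding Fin_const_homs[OF Xs] using k(6) P QP by blast
    have nf: "fmor (Dia (Fin_const (xob s))) (code (Mor (quotient_cat (xob s))) (Q, ?P)) = quotient_map (Idn sS (xob s)) Q ?P"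
      using Fin_const_sel(3)[OF Xs, of "(Q, ?P)" Q ?P] k(6) P QP by (simp add: quotient_cat_homs)
    have 1: "(i, Cmp sF (quotient_map (Idn sS (xob s)) Q ?P) f) \<in> germs (\<rho> s) (code (fq s) ?P)"
      using pro_compat[OF csF \<rho>[OF k(4)] n f] nf by simp
    have 2: "(i, Cmp sF (quotient_map (xmor u) ?P R) (Cmp sF (quotient_map (Idn sS (xob s)) Q ?P) f)) \<in> germs (\<rho> t) (code (fq t) R)"
      using pro_Cmp_mem(2)[OF csF \<rho>[OF k(4)] Fin_const_map_homs[OF xu] b[OF k(5,7)] Fin_const_map_mem[OF xu k(7)] 1]
        \<rho>u[OF k(8)] by simp
    have ff: "f \<in> homs sF (fob (Dia M) i) (quotient_sset (xob s) Q)"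
      using f'(2) Fin_const_sel(2)[OF Xs k(6)] by simp
    have le: "rel_le (Idn sS (xob s)) Q ?P" using rel_le_Idn[OF k(6)] QP by blast
    have "Cmp sF (quotient_map (xmor u) ?P R) (Cmp sF (quotient_map (Idn sS (xob s)) Q ?P) f) =
        Cmp sF (quotient_map (xmor u) Q R) f"
      using cat_assoc[OF csF ff quotient_map_homs[OF cat_id[OF csS Xs] k(6) P le]
          quotient_map_homs[OF xu P k(7) rel_le_pullback[OF xu]]]
        quotient_map_le1(2)[OF xu k(6) P k(7) QP rel_le_pullback[OF xu]] subC by simp
    then show "case z of (i, f) \<Rightarrow> (i, Cmp sF (fmor (Dia QX) m) f) \<in> germs ?h (Cod (Idx QX) m)"
      using 2 gh[OF k(5,7)] QX_fmor[OF k(4-9)] k(2,3) zf by simp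
  qed (use M is_pob_QX in auto)
  have "Cmp (pro sF) (proj s) ?h = \<rho> s" if s: "s \<in> Ob J" for s
  proof (rule pro_eqI[OF csF pro_cmp[OF csF h proj_homs[OF s]] \<rho>[OF s]])
    fix a assume "a \<in> Ob (Idx (Fin_const (xob s)))"
    then obtain R where R: "R \<in> fq s" "a = code (fq s) R" using Fin_const_Ob[OF pob_ob[OF X s]] by blast
    obtain i f where f: "(i, f) \<in> germs (\<rho> s) a" using pro_rep[OF csF \<rho>[OF s]] b[OF s R(1)] R(2) by blast
    then have "(i, f) \<in> germs (Cmp (pro sF) (proj s) ?h) a"
      using proj_comp_mem[OF h s R(1)] gh[OF s R(1)] R(2) by simp
    then show "\<exists>t f. (t, f) \<in> germs (Cmp (pro sF) (proj s) ?h) a \<and> (t, f) \<in> germs (\<rho> s) a" using f by blast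
  qed
  then show ?thesis using h by blast
qed

text \<open>The canonical map from a pro-space to the model: at the index (s, R) it is the
  projection of \<open>xob s\<close> onto its quotient by R.\<close>

definition quots :: "('u, 'u ssetob, 'u ssetarr) parr" where
  "quots = (X, QX, \<lambda>a\<in>Ob (Idx QX). case decode (Ob (quot_cat X)) a of (s, R) \<Rightarrow> germ sS X s (quotient_proj (xob s) R))"

lemma quots:
  shows quots_homs: "quots \<in> homs (pro sS) X QX"
    and quots_mem: "s \<in> Ob J \<Longrightarrow> R \<in> fq s \<Longrightarrow> (s, quotient_proj (xob s) R) \<in> germs quots (co (s, R))"
proof -
  let ?t = "\<lambda>a. fst (decode (Ob (quot_cat X)) a)"
  let ?f = "\<lambda>a. quotient_proj (xob (?t a)) (snd (decode (Ob (quot_cat X)) a))"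
  have eq: "quots = (X, QX, \<lambda>a\<in>Ob (Idx QX). germ sS X (?t a) (?f a))"
    by (simp add: quots_def case_prod_unfold)
  have dec: "?t (co (s, R)) = s" "?f (co (s, R)) = quotient_proj (xob s) R" if "s \<in> Ob J" "R \<in> fq s" for s R
  proof -
    have "decode (Ob (quot_cat X)) (co (s, R)) = (s, R)" by (rule Q.decode_Ob) (use that in simp)
    then show "?t (co (s, R)) = s" "?f (co (s, R)) = quotient_proj (xob s) R" by (simp_all only: fst_conv snd_conv)
  qed
  have p: "quotient_proj (xob s) R \<in> homs sS (xob s) (fob (Dia QX) (co (s, R)))" if "s \<in> Ob J" "R \<in> fq s" for s R
    using quotient_proj[OF pob_ob[OF X that(1)] that(2)] QX_fob[OF that] by simp
  show "quots \<in> homs (pro sS) X QX"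
    unfolding eq
  proof (rule pro_homsI[OF csS X is_pob_QX_S])
    fix a assume "a \<in> Ob (Idx QX)"
    then obtain s R where s: "s \<in> Ob J" "R \<in> fq s" "a = co (s, R)" unfolding QX_Ob by blast
    show "?t a \<in> Ob J" "?f a \<in> homs sS (xob (?t a)) (fob (Dia QX) a)" using s dec[OF s(1,2)] p[OF s(1,2)] by simp_all
  next
    fix m a b assume "m \<in> homs (Idx QX) a b"
    then obtain s Q u t R where k: "a = co (s, Q)" "b = co (t, R)" "m = cm ((s, Q), u, (t, R))"
      "s \<in> Ob J" "t \<in> Ob J" "Q \<in> fq s" "R \<in> fq t" "u \<in> homs J s t" "rel_le (xmor u) Q R"
      unfolding QX_homs by blast
    show "germ sS X (?t a) (Cmp sS (fmor (Dia QX) m) (?f a)) = germ sS X (?t b) (?f b)"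
      using germ_res[OF csS X k(8) p[OF k(5,7)]] quotient_map_proj[OF pob_mor[OF X k(8)] k(6,7,9)]
        QX_fmor[OF k(4-9)] k(1-3) dec[OF k(4,6)] dec[OF k(5,7)] by simp
  qed
  assume s: "s \<in> Ob J" "R \<in> fq s"
  show "(s, quotient_proj (xob s) R) \<in> germs quots (co (s, R))"
    unfolding eq germs_simp using mem_germ[OF csS X s(1) p[OF s]] QX_ObI[OF s] dec[OF s] s(1) p[OF s] by simp
qed

text \<open>For injectivity, cochains on a quotient of \<open>xob s\<close> that become equal on a
  stage l already become equal on a finite quotient of that stage, and this quotient is again an
  index of \<open>QX\<close>. For surjectivity, a cochain is constant on the classes of its own
  \<open>cochain_rel\<close>.\<close>

lemma quots_cochains:
  assumes p: "p > 0"
  shows "bij_betw (pull (colim_presheaf (maps_to_Zmod p)) (at_level (fmor (levelwise Sets) quots) n))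
    (carrier (grp (colim_presheaf (maps_to_Zmod p)) (level_pob QX n)))
    (carrier (grp (colim_presheaf (maps_to_Zmod p)) (level_pob X n)))"
proof -
  let ?P = "maps_to_Zmod p :: ('u set, 'u setm, 'u \<Rightarrow> int) presheaf"
  let ?C = "Sets :: ('u set, 'u setm) cat"
  let ?\<phi> = "at_level (fmor (levelwise ?C) quots) n"
  note C = is_cat_sets_cat[of "small :: 'u set \<Rightarrow> bool"]
  note PS = ab_presheaf_set[OF ab_presheaf_maps[of small p]]
  interpret L: colim ?C ?P "level_pob QX n" by standard (use PS is_pob_level[OF C is_pob_QX_S] in auto)
  interpret X: colim ?C ?P "level_pob X n" by standard (use PS is_pob_level[OF C X] in auto)
  note ph = simp_at_level[OF levelwise_mor_simp[OF C quots_homs], of n, unfolded levelwise_ob_fob]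
  define q where "q s R = at_level (quotient_proj (xob s) R) n" for s R
  have car: "L.car (co (s, R)) = carrier (grp ?P (quotient_set (xob s) R n))" if "s \<in> Ob J" "R \<in> fq s" for s R
    using QX_ObI[OF that] QX_fob[OF that] by simp
  have carX: "X.car s = carrier (grp ?P (fob (xob s) n))" if "s \<in> Ob J" for s
    using that by simp
  have q: "q s R \<in> homs ?C (fob (xob s) n) (quotient_set (xob s) R n)" if "s \<in> Ob J" "R \<in> fq s" for s R
    using simp_at_level[OF quotient_proj[OF pob_ob[OF X that(1)] that(2)], of n] by (simp add: q_def)
  have pull: "pull (colim_presheaf ?P) ?\<phi> (L.cls (co (s, R)) y) = X.cls s (pull ?P (q s R) y)"
    if s: "s \<in> Ob J" "R \<in> fq s" and y: "y \<in> L.car (co (s, R))" for s R y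
    unfolding q_def
    by (rule pull_colim_class[OF C PS ph _ levelwise_mor_mem[OF C quots_homs QX_ObI[OF s] quots_mem[OF s]] y])
       (use QX_ObI[OF s] in simp)
  have pq: "pull ?P (q s R) y x = y (rep R n x)" if "x \<in> fob (xob s) n" for s R x y
    using that by (simp add: q_def quotient_proj_def compose_def)
  have q_inj: "y = y'" if s: "s \<in> Ob J" "R \<in> fq s" and y: "y \<in> L.car (co (s, R))" "y' \<in> L.car (co (s, R))"
    and eq: "pull ?P (q s R) y = pull ?P (q s R) y'" for s R y y'
  proof -
    have "y z = y' z" if z: "z \<in> quotient_set (xob s) R n" for z
      using fun_cong[OF eq, of z] pq[of z s R] quotient_proj_surj(1)[OF s(2) z] rep_quotient_set[OF s(2) z] by simp
    then show ?thesis using y unfolding car[OF s] by (auto intro: PiE_ext)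
  qed
  show ?thesis unfolding bij_betw_def
  proof
    show "inj_on (pull (colim_presheaf ?P) ?\<phi>) (carrier (grp (colim_presheaf ?P) (level_pob QX n)))"
      unfolding L.colims_carrier
    proof (rule inj_onI)
      fix c d assume c: "c \<in> L.colims" and d: "d \<in> L.colims" and eq: "pull (colim_presheaf ?P) ?\<phi> c = pull (colim_presheaf ?P) ?\<phi> d"
      obtain a x y where a: "a \<in> Ob L.J" "x \<in> L.car a" "y \<in> L.car a" "c = L.cls a x" "d = L.cls a y"
        using c d by (rule L.colims2E)
      from a(1) obtain s R where s: "s \<in> Ob J" "R \<in> fq s" "a = co (s, R)" unfolding level_pob_Idx QX_Ob by blast
      note Xs = pob_ob[OF X s(1)]
      have xy: "x \<in> carrier (grp ?P (quotient_set (xob s) R n))" "y \<in> carrier (grp ?P (quotient_set (xob s) R n))"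
        using a(2,3) s(3) car[OF s(1,2)] by auto
      have m: "pull ?P (q s R) x \<in> X.car s" "pull ?P (q s R) y \<in> X.car s"
        unfolding carX[OF s(1)] using set_presheaf_mem[OF PS q[OF s(1,2)]] xy by auto
      have "X.cls s (pull ?P (q s R) x) = X.cls s (pull ?P (q s R) y)"
        using eq a pull[OF s(1,2)] s(3) by simp
      then obtain l w where w: "w \<in> homs J l s" "X.res w (pull ?P (q s R) x) = X.res w (pull ?P (q s R) y)"
        using X.cls_eq_coequalize[OF _ m] s(1) by auto
      have l: "l \<in> Ob J" using cat_ob[OF J(1) w(1)] by simp
      note xw = pob_mor[OF X w(1)]
      \<comment> \<open>Equality holds on the stage l, but an equality over \<open>QX\<close> is
        needed. The map \<open>xmor w\<close> descends to this quotient of l, and since pullback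
        along a projection is injective on cochains, equality there follows.\<close>
      let ?Q = "pullback_rel (xmor w) R"
      note Q = fin_quotients_pullback[OF s(2) xw] and le = rel_le_pullback[OF xw]
      let ?m = "cm ((l, ?Q), w, (s, R))"
      note mh = QX_homsI[OF l s(1) Q s(2) w(1) le]
      note qm = simp_at_level[OF quotient_map_Sets[OF xw Q s(2) le], of n, unfolded quotient_sset_fob]
      have Lm: "fmor (Dia (level_pob QX n)) ?m = at_level (quotient_map (xmor w) ?Q R) n"
        using level_pob_mor[OF mh] QX_fmor[OF l s(1) Q s(2) w(1) le] by simp
      have Lmh: "?m \<in> homs L.J (co (l, ?Q)) a" using mh s(3) by simp
      have sq: "Cmp ?C (at_level (quotient_map (xmor w) ?Q R) n) (q l ?Q) = Cmp ?C (q s R) (at_level (xmor w) n)"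
        using at_level_Cmp[OF quotient_proj[OF pob_ob[OF X l] Q] quotient_map_Sets[OF xw Q s(2) le], of n]
          at_level_Cmp[OF xw quotient_proj[OF Xs s(2)], of n] quotient_map_proj[OF xw Q s(2) le] unfolding q_def by simp
      have "pull ?P (q l ?Q) (L.res ?m z) = X.res w (pull ?P (q s R) z)"
        if z: "z \<in> carrier (grp ?P (quotient_set (xob s) R n))" for z
        using set_presheaf_cmp[OF PS q[OF l Q] qm z] set_presheaf_cmp[OF PS simp_at_level[OF xw, of n] q[OF s(1,2)] z]
          sq Lm level_pob_mor[OF w(1)] by simp
      then have "pull ?P (q l ?Q) (L.res ?m x) = pull ?P (q l ?Q) (L.res ?m y)" using xy w(2) by simp
      then have "L.res ?m x = L.res ?m y"
        by (rule q_inj[OF l Q L.res_mem[OF Lmh a(2)] L.res_mem[OF Lmh a(3)]])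
      then show "c = d" using L.cls_res[OF Lmh a(2)] L.cls_res[OF Lmh a(3)] a(4,5) by simp
    qed
    show "pull (colim_presheaf ?P) ?\<phi> ` carrier (grp (colim_presheaf ?P) (level_pob QX n)) =
        carrier (grp (colim_presheaf ?P) (level_pob X n))"
    proof (rule subset_antisym)
      show "pull (colim_presheaf ?P) ?\<phi> ` carrier (grp (colim_presheaf ?P) (level_pob QX n)) \<subseteq>
        carrier (grp (colim_presheaf ?P) (level_pob X n))"
        using set_presheaf_mem[OF ab_presheaf_set[OF ab_presheaf_colim[OF C ab_presheaf_maps[of small p]]] ph] by blast
      show "carrier (grp (colim_presheaf ?P) (level_pob X n)) \<subseteq>
        pull (colim_presheaf ?P) ?\<phi> ` carrier (grp (colim_presheaf ?P) (level_pob QX n))"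
      proof
        fix c assume "c \<in> carrier (grp (colim_presheaf ?P) (level_pob X n))"
        then obtain s x where s': "s \<in> Ob X.J" "x \<in> X.car s" "c = X.cls s x"
          unfolding X.colims_carrier by (rule X.colimsE)
        then have s: "s \<in> Ob J" and x: "x \<in> fob (xob s) n \<rightarrow>\<^sub>E carrier (integer_mod_group p)" by auto
        note Xs = pob_ob[OF X s]
        \<comment> \<open>This quotient is the image of the map to K classified by x, hence finite
          in every degree although \<open>xob s\<close> need not be.\<close>
        let ?R = "cochain_rel (xob s) n x"
        have R: "?R \<in> fq s"
          by (rule fin_quotients_cochain_rel[OF Xs, of _ _ "carrier (integer_mod_group p)"])
             (use x p in \<open>auto simp: carrier_integer_mod_group\<close>)
        \<comment> \<open>Simplices of the quotient are chosen simplices of \<open>xob s\<close>, so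
          the descended cochain is the restriction of x.\<close>
        let ?y = "\<lambda>z\<in>quotient_set (xob s) ?R n. x z"
        have y: "?y \<in> L.car (co (s, ?R))"
          unfolding car[OF s R] using x quotient_set_sub[OF R, of n] by fastforce
        have "pull ?P (q s ?R) ?y = x"
        proof
          fix z
          show "pull ?P (q s ?R) ?y z = x z"
          proof (cases "z \<in> fob (xob s) n")
            case True
            have "(z, rep ?R n z) \<in> ?R n" by (rule rep_rel[OF R True])
            \<comment> \<open>In degree n the identity is one of the operators in the definition of
              \<open>cochain_rel\<close>, so related n-simplices have the same value under
              x.\<close>
            then have "x (opr (xob s) (Idn simplex_cat n) z) = x (opr (xob s) (Idn simplex_cat n) (rep ?R n z))"
              unfolding cochain_rel_def using cat_id[OF is_cat_simplex_cat, of n] by (simp del: simplex_cat_sel add: simplex_cat_sel(1))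
            then have "x z = x (rep ?R n z)"
              using opr_Idn[OF Xs True] opr_Idn[OF Xs rep_mem[OF R True]] by simp
            then show ?thesis using pq[OF True] rep_in[OF True] by simp
          next
            case False
            then show ?thesis using x by (auto simp: q_def quotient_proj_def compose_def PiE_def extensional_def)
          qed
        qed
        then have "c = pull (colim_presheaf ?P) ?\<phi> (L.cls (co (s, ?R)) ?y)"
          using pull[OF s R y] s'(3) by simp
        moreover have "L.cls (co (s, ?R)) ?y \<in> L.colims" by (rule L.colimsI[OF _ y]) (use QX_ObI[OF s R] in simp)
        ultimately show "c \<in> pull (colim_presheaf ?P) ?\<phi> ` carrier (grp (colim_presheaf ?P) (level_pob QX n))"
          unfolding L.colims_carrier by blast
      qed
    qed
  qed
qed

end

section \<open>Cohomology isomorphisms\<close>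

lemma inverted_by_iff:
  "f \<in> homs C a b \<Longrightarrow> f \<in> inverted_by C H \<longleftrightarrow> (\<forall>n. pull (H n) f \<in> iso (grp (H n) b) (grp (H n) a))"
  by (auto simp: inverted_by_def homs_def)

context
  fixes C :: "('o, 'm) cat" and H :: "nat \<Rightarrow> ('o, 'm, 'g) presheaf"
  assumes C: "is_cat C" and H: "\<And>n. ab_presheaf C (H n)"
begin

lemma inverted_by_group: "a \<in> Ob C \<Longrightarrow> group (grp (H n) a)"
  using ab_presheaf_grp[OF H] by (simp add: comm_group_def)

lemma inverted_by_iso:
  assumes f: "f \<in> homs C a b" and g: "g \<in> homs C b a" and gf: "Cmp C g f = Idn C a" "Cmp C f g = Idn C b"
  shows "f \<in> inverted_by C H"
  unfolding inverted_by_iff[OF f]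
proof
  fix n
  note S = ab_presheaf_set[OF H[of n]] and o = cat_ob[OF C f]
  have "bij_betw (pull (H n) f) (carrier (grp (H n) b)) (carrier (grp (H n) a))"
    by (rule bij_betw_byWitness[where f' = "pull (H n) g"])
      (use set_presheaf_mem[OF S f] set_presheaf_mem[OF S g] set_presheaf_cmp[OF S f g] set_presheaf_cmp[OF S g f]
        set_presheaf_id[OF S o(1)] set_presheaf_id[OF S o(2)] gf in auto)
  then show "pull (H n) f \<in> iso (grp (H n) b) (grp (H n) a)"
    using ab_presheaf_hom[OF H f] by (simp add: iso_def)
qed

lemma inverted_by_Cmp:
  assumes f: "f \<in> homs C a b" "f \<in> inverted_by C H" and g: "g \<in> homs C b c" "g \<in> inverted_by C H"
  shows "Cmp C g f \<in> inverted_by C H"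
  unfolding inverted_by_iff[OF cat_cmp[OF C f(1) g(1)]]
proof
  fix n
  note i = iso_set_trans[of "pull (H n) g" "grp (H n) c" "grp (H n) b" "pull (H n) f" "grp (H n) a"]
  show "pull (H n) (Cmp C g f) \<in> iso (grp (H n) c) (grp (H n) a)"
    by (rule iso_cong[OF i])
      (use f g inverted_by_iff[OF f(1)] inverted_by_iff[OF g(1)] inverted_by_group cat_ob[OF C g(1)]
        set_presheaf_cmp[OF ab_presheaf_set[OF H] f(1) g(1)] in auto)
qed

text \<open>The induced map of g is that of the composite followed by the inverse of that of f. This
  part of two-out-of-three turns a naturality square of a weakly invertible unit into preservation
  of weak equivalences.\<close>

lemma inverted_by_cancel:
  assumes f: "f \<in> homs C a b" "f \<in> inverted_by C H" and g: "g \<in> homs C b c" and gf: "Cmp C g f \<in> inverted_by C H"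
  shows "g \<in> inverted_by C H"
  unfolding inverted_by_iff[OF g(1)]
proof
  fix n
  let ?f = "pull (H n) f" and ?g = "pull (H n) g" and ?gf = "pull (H n) (Cmp C g f)"
  have fi: "?f \<in> iso (grp (H n) b) (grp (H n) a)" using f inverted_by_iff[OF f(1)] by blast
  have gfi: "?gf \<in> iso (grp (H n) c) (grp (H n) a)" using gf inverted_by_iff[OF cat_cmp[OF C f(1) g]] by blast
  note o = cat_ob[OF C f(1)] and o' = cat_ob[OF C g]
  note i = iso_set_trans[OF gfi group.iso_set_sym[OF inverted_by_group[OF o(2)] fi]]
  show "?g \<in> iso (grp (H n) c) (grp (H n) b)"
  proof (rule iso_cong[OF i inverted_by_group[OF o'(2)]])
    fix x assume x: "x \<in> carrier (grp (H n) c)"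
    have "inv_into (carrier (grp (H n) b)) ?f (?f (?g x)) = ?g x"
      by (rule inv_into_f_f) (use fi set_presheaf_mem[OF ab_presheaf_set[OF H] g x] in \<open>auto simp: iso_def bij_betw_def\<close>)
    then show "?g x = (inv_into (carrier (grp (H n) b)) ?f \<circ> ?gf) x"
      using set_presheaf_cmp[OF ab_presheaf_set[OF H] f(1) g x] by simp
  qed
qed

end

section \<open>Weak equivalences in the two categories\<close>

locale mod_p_cohomology = universe U for U :: "'u itself" +
  fixes p :: nat
  assumes p: "prime p"
begin

abbreviation pS :: "(('u, 'u ssetob, 'u ssetarr) pob, ('u, 'u ssetob, 'u ssetarr) parr) cat" where "pS \<equiv> pro sS"
abbreviation pF :: "(('u, 'u ssetob, 'u ssetarr) pob, ('u, 'u ssetob, 'u ssetarr) parr) cat" where "pF \<equiv> pro sF"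
abbreviation F :: "('u set, 'u setm) cat" where "F \<equiv> FinSets"
abbreviation sP :: "((('u, 'u set, 'u setm) pob, ('u, 'u set, 'u setm) parr) sob,
    (('u, 'u set, 'u setm) pob, ('u, 'u set, 'u setm) parr) sarr) cat" where "sP \<equiv> simp (pro F)"
abbreviation P :: "('u set, 'u setm, 'u \<Rightarrow> int) presheaf" where "P \<equiv> maps_to_Zmod p"
abbreviation W where "W \<equiv> inverted_by pS (H_pro_sset p)"
abbreviation V where "V \<equiv> inverted_by sP (H_simp_pro_fin p)"

lemmas p0 = prime_gt_0_nat[OF p]

lemma is_cat_pS: "is_cat pS" by (rule is_cat_pro[OF csS])
lemma is_cat_pF: "is_cat pF" by (rule is_cat_pro[OF csF])
lemma is_cat_sP: "is_cat sP" by (rule is_cat_simp[OF is_cat_pro[OF cF]])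

lemma HW: "ab_presheaf pS (H_pro_sset p n)"
  unfolding H_pro_sset_def by (rule ab_presheaf_colim[OF csS ab_presheaf_cohomology[OF cS ab_presheaf_maps]])

lemma HV: "ab_presheaf sP (H_simp_pro_fin p n)"
  unfolding H_simp_pro_fin_def
  by (rule ab_presheaf_cohomology[OF is_cat_pro[OF cF] ab_presheaf_colim[OF cF ab_presheaf_maps]])

lemmas W_iso = inverted_by_iso[OF is_cat_pS HW] and V_iso = inverted_by_iso[OF is_cat_sP HV]
lemmas W_Cmp = inverted_by_Cmp[OF is_cat_pS HW] and V_Cmp = inverted_by_Cmp[OF is_cat_sP HV]
lemmas W_cancel = inverted_by_cancel[OF is_cat_pS HW] and V_cancel = inverted_by_cancel[OF is_cat_sP HV]

lemma pF_pS: "\<phi> \<in> homs pF X Y \<Longrightarrow> \<phi> \<in> homs pS X Y"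
  using pro_homs_sub[OF csF csS sub pro_homsD(1,2)[OF csF]] by blast

lemma pF_Cmp: "\<phi> \<in> homs pF X Y \<Longrightarrow> \<psi> \<in> homs pF Y Z \<Longrightarrow> Cmp pF \<psi> \<phi> = Cmp pS \<psi> \<phi>"
  by (rule pro_Cmp_sub[OF csF csS sub])

lemma W_iff_V:
  assumes ph: "\<phi> \<in> homs pF X Y"
  shows "\<phi> \<in> W \<longleftrightarrow> fmor (levelwise F) \<phi> \<in> V"
  unfolding inverted_by_iff[OF pF_pS[OF ph]] inverted_by_iff[OF levelwise_mor_simp[OF cF ph]]
    H_pro_sset_def H_simp_pro_fin_def
  using iso_levelwise_iff[OF cF ab_presheaf_maps ph] by blast

lemma V_cochains:
  assumes f: "f \<in> homs sP X Y"
    and b: "\<And>n. bij_betw (pull (colim_presheaf P) (at_level f n))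
      (carrier (grp (colim_presheaf P) (fob Y n))) (carrier (grp (colim_presheaf P) (fob X n)))"
  shows "f \<in> V"
  unfolding inverted_by_iff[OF f] H_simp_pro_fin_def
  using cochain_map.cohomology_iso[OF cochain_mapI[OF is_cat_pro[OF cF] ab_presheaf_colim[OF cF ab_presheaf_maps] f] b]
  by blast

text \<open>The cohomology of a pro-space is a colimit of cohomologies and has no cochain complex of
  its own. \<open>iso_levelwise_iff\<close> for \<open>Sets\<close> replaces it by the cohomology of
  the colimit complex, where bijections of cochains suffice.\<close>

lemma W_cochains:
  assumes ph: "\<phi> \<in> homs pS X Y"
    and b: "\<And>n. bij_betw (pull (colim_presheaf P) (at_level (fmor (levelwise Sets) \<phi>) n))
      (carrier (grp (colim_presheaf P) (level_pob Y n))) (carrier (grp (colim_presheaf P) (level_pob X n)))"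
  shows "\<phi> \<in> W"
  unfolding inverted_by_iff[OF ph] H_pro_sset_def iso_levelwise_iff[OF cS ab_presheaf_maps ph]
  using cochain_map.cohomology_iso[OF cochain_mapI[OF is_cat_pro[OF cS] ab_presheaf_colim[OF cS ab_presheaf_maps]
        levelwise_mor_simp[OF cS ph]]] b by simp

lemma quots_W:
  assumes "is_pob sS X"
  shows "pro_space.quots X \<in> W"
proof -
  interpret pro_space U X by standard (use U assms in auto)
  show ?thesis by (rule W_cochains[OF quots_homs quots_cochains[OF p0]])
qed

end

section \<open>The unit of the adjunction between pro-spaces and pro-finite spaces\<close>

locale finite_completion = mod_p_cohomology U p for U :: "'u itself" and p +
  fixes Fin :: "(('u, 'u ssetob, 'u ssetarr) pob, ('u, 'u ssetob, 'u ssetarr) parr,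
                 ('u, 'u ssetob, 'u ssetarr) pob, ('u, 'u ssetob, 'u ssetarr) parr) ftr"
    and \<pi> :: "('u, 'u ssetob, 'u ssetarr) pob \<Rightarrow> 'u \<Rightarrow> ('u, 'u ssetob, 'u ssetarr) parr"
  assumes Fin: "is_functor pS pF Fin"
    and lim: "\<And>X. is_pob sS X \<Longrightarrow> is_limit pF (Idx X) (Fin_diagram X) (fob Fin X) (\<pi> X)"
    and Fin_mor: "\<And>\<phi> X Y s t f. \<phi> \<in> homs pS X Y \<Longrightarrow> s \<in> Ob (Idx Y) \<Longrightarrow> (t, f) \<in> germs \<phi> s \<Longrightarrow>
      Cmp pF (\<pi> Y s) (fmor Fin \<phi>) = Cmp pF (Fin_const_map f) (\<pi> X t)"
begin

lemma pro_space: "is_pob sS X \<Longrightarrow> pro_space X"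
  by standard (use U in auto)

lemma Fin_ob: "is_pob sS X \<Longrightarrow> is_pob sF (fob Fin X)"
  using ftr_ob[OF Fin] by (simp add: pro_Ob)

text \<open>Both \<open>fob Fin X\<close> and \<open>QX\<close> are limits of the same diagram.\<close>

lemma compare_limits:
  assumes X: "is_pob sS X"
  shows "\<exists>j h. j \<in> homs pF (pro_space.QX X) (fob Fin X) \<and> h \<in> homs pF (fob Fin X) (pro_space.QX X) \<and>
    Cmp pF h j = Idn pF (pro_space.QX X) \<and> Cmp pF j h = Idn pF (fob Fin X) \<and>
    (\<forall>s\<in>Ob (Idx X). Cmp pF (\<pi> X s) j = pro_space.proj X s \<and> Cmp pF (pro_space.proj X s) h = \<pi> X s)"
proof -
  interpret pro_space U X by (rule pro_space[OF X])
  note L = lim[OF X]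
  have cone: "is_cone pF (Idx X) (Fin_diagram X) (fob Fin X) (\<pi> X)" using L by (simp add: is_limit_def)
  have uni: "\<exists>!h. h \<in> homs pF M (fob Fin X) \<and> (\<forall>s\<in>Ob (Idx X). Cmp pF (\<pi> X s) h = \<rho> s)"
    if "is_cone pF (Idx X) (Fin_diagram X) M \<rho>" for M \<rho> using L that unfolding is_limit_def by blast
  obtain j where j: "j \<in> homs pF QX (fob Fin X)" "\<And>s. s \<in> Ob J \<Longrightarrow> Cmp pF (\<pi> X s) j = proj s"
    using uni[OF is_cone_proj] by blast
  obtain h where h: "h \<in> homs pF (fob Fin X) QX" "\<And>s. s \<in> Ob J \<Longrightarrow> Cmp pF (proj s) h = \<pi> X s"
    using lift_cone[OF cone] by blast
  have \<pi>: "\<pi> X s \<in> homs pF (fob Fin X) (fob (Fin_diagram X) s)" if "s \<in> Ob J" for s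
    using cone that by (simp add: is_cone_def)
  have pj: "proj s \<in> homs pF QX (fob (Fin_diagram X) s)" if "s \<in> Ob J" for s
    using is_cone_proj that by (simp add: is_cone_def)
  note hj = cat_cmp[OF is_cat_pF j(1) h(1)] and jh = cat_cmp[OF is_cat_pF h(1) j(1)]
  \<comment> \<open>Maps into the model are compared by their projections; the other composite below
    is compared by the uniqueness clause of the given limit.\<close>
  have "Cmp pF h j = Idn pF QX"
  proof (rule proj_jointly_monic[OF hj pro_id[OF csF is_pob_QX]])
    show "Cmp pF (proj s) (Cmp pF h j) = Cmp pF (proj s) (Idn pF QX)" if s: "s \<in> Ob J" for s
      using cat_assoc[OF is_cat_pF j(1) h(1) pj[OF s]] h(2)[OF s] j(2)[OF s] cat_idr[OF is_cat_pF pj[OF s]] by simp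
  qed
  moreover have "Cmp pF j h = Idn pF (fob Fin X)"
  proof -
    have "Cmp pF (\<pi> X s) (Cmp pF j h) = \<pi> X s" "Cmp pF (\<pi> X s) (Idn pF (fob Fin X)) = \<pi> X s" if s: "s \<in> Ob J" for s
      using cat_assoc[OF is_cat_pF h(1) j(1) \<pi>[OF s]] h(2)[OF s] j(2)[OF s] cat_idr[OF is_cat_pF \<pi>[OF s]] by simp_all
    then show ?thesis using uni[OF cone] jh pro_id[OF csF Fin_ob[OF X]] by blast
  qed
  ultimately show ?thesis using j h by blast
qed

text \<open>The comparison isomorphism, fixed for every X so that the unit becomes a function of X.
  Its compatibility with the projections is recorded because naturality of the unit depends on
  it.\<close>

definition jmap :: "('u, 'u ssetob, 'u ssetarr) pob \<Rightarrow> ('u, 'u ssetob, 'u ssetarr) parr" where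
  "jmap X = (SOME j. \<exists>h. j \<in> homs pF (pro_space.QX X) (fob Fin X) \<and> h \<in> homs pF (fob Fin X) (pro_space.QX X) \<and>
    Cmp pF h j = Idn pF (pro_space.QX X) \<and> Cmp pF j h = Idn pF (fob Fin X) \<and>
    (\<forall>s\<in>Ob (Idx X). Cmp pF (\<pi> X s) j = pro_space.proj X s \<and> Cmp pF (pro_space.proj X s) h = \<pi> X s))"

lemma jmap:
  assumes X: "is_pob sS X"
  obtains h where "jmap X \<in> homs pF (pro_space.QX X) (fob Fin X)" "h \<in> homs pF (fob Fin X) (pro_space.QX X)"
    "Cmp pF h (jmap X) = Idn pF (pro_space.QX X)" "Cmp pF (jmap X) h = Idn pF (fob Fin X)"
    "\<And>s. s \<in> Ob (Idx X) \<Longrightarrow> Cmp pF (\<pi> X s) (jmap X) = pro_space.proj X s"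
    "\<And>s. s \<in> Ob (Idx X) \<Longrightarrow> Cmp pF (pro_space.proj X s) h = \<pi> X s"
  using someI_ex[OF compare_limits[OF X]] unfolding jmap_def[symmetric] by blast

definition unit :: "('u, 'u ssetob, 'u ssetarr) pob \<Rightarrow> ('u, 'u ssetob, 'u ssetarr) parr" where
  "unit X = Cmp pS (jmap X) (pro_space.quots X)"

lemma unit_homs:
  assumes X: "is_pob sS X"
  shows "unit X \<in> homs pS X (fob Fin X)"
proof -
  obtain h where "jmap X \<in> homs pF (pro_space.QX X) (fob Fin X)" using jmap[OF X] .
  then show ?thesis unfolding unit_def
    using cat_cmp[OF is_cat_pS pro_space.quots_homs[OF pro_space[OF X]] pF_pS] by blast
qed

lemma unit_W:
  assumes X: "is_pob sS X"
  shows "unit X \<in> W"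
proof -
  obtain h where j: "jmap X \<in> homs pF (pro_space.QX X) (fob Fin X)" and h: "h \<in> homs pF (fob Fin X) (pro_space.QX X)"
    and hj: "Cmp pF h (jmap X) = Idn pF (pro_space.QX X)" "Cmp pF (jmap X) h = Idn pF (fob Fin X)"
    using jmap[OF X] .
  \<comment> \<open>The inverse is one in \<open>pF\<close>. It is also an inverse in
    \<open>pS\<close>, where composites and identities of pro-simplicial finite sets are the
    same.\<close>
  have "jmap X \<in> W"
    by (rule W_iso[OF pF_pS[OF j] pF_pS[OF h]])
      (use hj pF_Cmp[OF j h] pF_Cmp[OF h j] pro_Idn_sub[OF csF csS sub pro_homsD(1)[OF csF j]]
        pro_Idn_sub[OF csF csS sub pro_homsD(1)[OF csF h]] in simp_all)
  then show ?thesis unfolding unit_def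
    using W_Cmp[OF pro_space.quots_homs[OF pro_space[OF X]] quots_W[OF X] pF_pS[OF j]] by blast
qed

text \<open>Nothing is known about \<open>fmor Fin \<phi>\<close> except its composites with the
  limit projections. It is therefore transported to a map between the models, whose germs can be
  found from these composites and compared with the projections onto quotients.\<close>

lemma unit_natural:
  assumes ph: "\<phi> \<in> homs pS X Y"
  shows "Cmp pS (unit Y) \<phi> = Cmp pS (fmor Fin \<phi>) (unit X)"
proof -
  note X = pro_homsD(1)[OF csS ph] and Y = pro_homsD(2)[OF csS ph]
  interpret X: pro_space U X by (rule pro_space[OF X])
  interpret Y: pro_space U Y by (rule pro_space[OF Y])
  obtain hX where jX: "jmap X \<in> homs pF X.QX (fob Fin X)"
    "\<And>s. s \<in> Ob (Idx X) \<Longrightarrow> Cmp pF (\<pi> X s) (jmap X) = X.proj s" using jmap[OF X] by metis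
  obtain hY where jY: "jmap Y \<in> homs pF Y.QX (fob Fin Y)" and hY: "hY \<in> homs pF (fob Fin Y) Y.QX"
    "Cmp pF (jmap Y) hY = Idn pF (fob Fin Y)" "\<And>s. s \<in> Ob (Idx Y) \<Longrightarrow> Cmp pF (Y.proj s) hY = \<pi> Y s"
    using jmap[OF Y] by metis
  note Fph = ftr_mor[OF Fin ph]
  note Fj = cat_cmp[OF is_cat_pF jX(1) Fph]
  \<comment> \<open>\<open>fmor Fin \<phi>\<close> seen between the two models, by conjugation with
    the comparison isomorphisms.\<close>
  define k where "k = Cmp pF hY (Cmp pF (fmor Fin \<phi>) (jmap X))"
  have k: "k \<in> homs pF X.QX Y.QX" unfolding k_def by (rule cat_cmp[OF is_cat_pF Fj hY(1)])
  have \<pi>X: "\<pi> X t \<in> homs pF (fob Fin X) (Fin_const (fob (Dia X) t))" if "t \<in> Ob (Idx X)" for t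
    using lim[OF X] that by (simp add: is_limit_def is_cone_def Fin_diagram_def)
  have \<pi>Y: "\<pi> Y s \<in> homs pF (fob Fin Y) (Fin_const (fob (Dia Y) s))" if "s \<in> Ob (Idx Y)" for s
    using lim[OF Y] that by (simp add: is_limit_def is_cone_def Fin_diagram_def)
  have pk: "Cmp pF (Y.proj s) k = Cmp pF (Fin_const_map f) (X.proj t)"
    if s: "s \<in> Ob (Idx Y)" and f: "(t, f) \<in> germs \<phi> s" for s t f
  proof -
    note f' = pro_memD[OF csS ph s f]
    have "Cmp pF (Y.proj s) k = Cmp pF (\<pi> Y s) (Cmp pF (fmor Fin \<phi>) (jmap X))"
      unfolding k_def using cat_assoc[OF is_cat_pF Fj hY(1) Y.proj_homs[OF s]] hY(3)[OF s] by simp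
    also have "\<dots> = Cmp pF (Cmp pF (Fin_const_map f) (\<pi> X t)) (jmap X)"
      using cat_assoc[OF is_cat_pF jX(1) Fph \<pi>Y[OF s]] Fin_mor[OF ph s f] by simp
    also have "\<dots> = Cmp pF (Fin_const_map f) (X.proj t)"
      using cat_assoc[OF is_cat_pF jX(1) \<pi>X[OF f'(1)] Fin_const_map_homs[OF f'(2)]] jX(2)[OF f'(1)] by simp
    finally show ?thesis .
  qed
  have sq: "Cmp pS k X.quots = Cmp pS Y.quots \<phi>"
  proof (rule pro_eqI[OF csS cat_cmp[OF is_cat_pS X.quots_homs pF_pS[OF k]] cat_cmp[OF is_cat_pS ph Y.quots_homs]])
    fix a assume a: "a \<in> Ob (Idx Y.QX)"
    then obtain s R where s: "s \<in> Ob (Idx Y)" "R \<in> Y.fq s" "a = Y.co (s, R)" unfolding Y.QX_Ob by blast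
    note Ys = pob_ob[OF Y s(1)]
    obtain t f where f: "(t, f) \<in> germs \<phi> s" using pro_rep[OF csS ph s(1)] by blast
    note f' = pro_memD[OF csS ph s(1) f]
    let ?Q = "pullback_rel f R"
    note Q = fin_quotients_pullback[OF s(2) f'(2)] and le = rel_le_pullback[OF f'(2)]
    let ?q = "quotient_map f ?Q R"
    note qm = quotient_map_homs[OF f'(2) Q s(2) le]
    note Fm = Fin_const_map_homs[OF f'(2)]
    have b: "code (Y.fq s) R \<in> Ob (Idx (Fin_const (Y.xob s)))" using Fin_const_Ob[OF Ys] s(2) by blast
    have "(X.co (t, ?Q), Cmp sF ?q (Idn sF (quotient_sset (X.xob t) ?Q))) \<in>
        germs (Cmp pF (Fin_const_map f) (X.proj t)) (code (Y.fq s) R)"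
      by (rule pro_Cmp_mem(2)[OF csF X.proj_homs[OF f'(1)] Fm b Fin_const_map_mem[OF f'(2) s(2)] X.proj_mem[OF f'(1) Q]])
    then have 1: "(X.co (t, ?Q), ?q) \<in> germs (Cmp pF (Y.proj s) k) (code (Y.fq s) R)"
      unfolding pk[OF s(1) f] cat_idr[OF csF qm] .
    obtain i g where g: "(i, g) \<in> germs k a" using pro_rep[OF csF k a] by blast
    note g' = pro_memD[OF csF k a g]
    note c = pro_cmp[OF csF k Y.proj_homs[OF s(1)]]
    have "germ sF X.QX i g = germ sF X.QX (X.co (t, ?Q)) ?q"
      using pro_memD(3)[OF csF c b 1] pro_memD(3)[OF csF c b Y.proj_comp_mem[OF k s(1,2)], of i g] g s(3) by simp
    moreover have "?q \<in> homs sF (fob (Dia X.QX) (X.co (t, ?Q))) (quotient_sset (Y.xob s) R)"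
      using qm X.QX_fob[OF f'(1) Q] by simp
    \<comment> \<open>The component of k at (s, R) is recognised after composition with
      \<open>Y.proj s\<close>, which does not change it: it is the map induced by f from the
      quotient by the pullback of R.\<close>
    ultimately have kq: "(X.co (t, ?Q), ?q) \<in> germs k a"
      using germ_self[OF csF X.is_pob_QX X.QX_ObI[OF f'(1) Q]] g'(3) by simp
    have "(t, Cmp sS ?q (quotient_proj (X.xob t) ?Q)) \<in> germs (Cmp pS k X.quots) a"
      by (rule pro_Cmp_mem(2)[OF csS X.quots_homs pF_pS[OF k] a kq X.quots_mem[OF f'(1) Q]])
    moreover have "(t, Cmp sS (quotient_proj (Y.xob s) R) f) \<in> germs (Cmp pS Y.quots \<phi>) a"
      by (rule pro_Cmp_mem(2)[OF csS ph Y.quots_homs a _ f]) (use Y.quots_mem[OF s(1,2)] s(3) in simp)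
    ultimately show "\<exists>t g. (t, g) \<in> germs (Cmp pS k X.quots) a \<and> (t, g) \<in> germs (Cmp pS Y.quots \<phi>) a"
      unfolding quotient_map_proj[OF f'(2) Q s(2) le] by blast
  qed
  have jk: "Cmp pF (jmap Y) k = Cmp pF (fmor Fin \<phi>) (jmap X)"
    unfolding k_def using cat_assoc[OF is_cat_pF Fj hY(1) jY] hY(2) cat_idl[OF is_cat_pF Fj] by simp
  have "Cmp pS (unit Y) \<phi> = Cmp pS (jmap Y) (Cmp pS k X.quots)"
    unfolding unit_def sq using cat_assoc[OF is_cat_pS ph Y.quots_homs pF_pS[OF jY]] by simp
  also have "\<dots> = Cmp pS (Cmp pS (fmor Fin \<phi>) (jmap X)) X.quots"
    using cat_assoc[OF is_cat_pS X.quots_homs pF_pS[OF k] pF_pS[OF jY]] jk pF_Cmp[OF k jY] pF_Cmp[OF jX(1) Fph] by simp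
  also have "\<dots> = Cmp pS (fmor Fin \<phi>) (unit X)"
    unfolding unit_def using cat_assoc[OF is_cat_pS X.quots_homs pF_pS[OF jX(1)] pF_pS[OF Fph]] by simp
  finally show ?thesis .
qed

text \<open>In the naturality square of the unit three sides are weak equivalences, and the fourth,
  \<open>fmor Fin w\<close>, follows by cancellation.\<close>

lemma Fin_W:
  assumes w: "w \<in> homs pS X Y" "w \<in> W"
  shows "fmor Fin w \<in> W"
proof -
  note X = pro_homsD(1)[OF csS w(1)] and Y = pro_homsD(2)[OF csS w(1)]
  have "Cmp pS (fmor Fin w) (unit X) \<in> W"
    using W_Cmp[OF w unit_homs[OF Y] unit_W[OF Y]] unit_natural[OF w(1)] by simp
  then show ?thesis by (rule W_cancel[OF unit_homs[OF X] unit_W[OF X] pF_pS[OF ftr_mor[OF Fin w(1)]]])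
qed

end

section \<open>The adjunction between pro-simplicial finite sets and simplicial pro-finite sets\<close>

locale level_adjoint = mod_p_cohomology U p for U :: "'u itself" and p +
  fixes G :: "((('u, 'u set, 'u setm) pob, ('u, 'u set, 'u setm) parr) sob,
               (('u, 'u set, 'u setm) pob, ('u, 'u set, 'u setm) parr) sarr,
               ('u, 'u ssetob, 'u ssetarr) pob, ('u, 'u ssetob, 'u ssetarr) parr) ftr"
    and \<Phi>
  assumes G: "is_functor sP pF G" and lev: "is_functor pF sP (levelwise F)"
    and \<Phi>_bij: "\<And>a c. a \<in> Ob sP \<Longrightarrow> c \<in> Ob pF \<Longrightarrow>
      bij_betw (\<Phi> a c) (homs pF (fob G a) c) (homs sP a (fob (levelwise F) c))"
    and \<Phi>_nat: "\<And>f g h a b c d. f \<in> homs sP a b \<Longrightarrow> g \<in> homs pF c d \<Longrightarrow> h \<in> homs pF (fob G b) c \<Longrightarrow>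
      \<Phi> a d (Cmp pF g (Cmp pF h (fmor G f))) = Cmp sP (fmor (levelwise F) g) (Cmp sP (\<Phi> b c h) f)"
begin

abbreviation Lw where "Lw \<equiv> levelwise F"

definition unit' where "unit' Z = \<Phi> Z (fob G Z) (Idn pF (fob G Z))"

lemma G_ob: "Z \<in> Ob sP \<Longrightarrow> fob G Z \<in> Ob pF"
  by (rule ftr_ob[OF G])

lemma unit'_homs: "Z \<in> Ob sP \<Longrightarrow> unit' Z \<in> homs sP Z (fob Lw (fob G Z))"
  unfolding unit'_def using bij_betwE[OF \<Phi>_bij[OF _ G_ob]] cat_id[OF is_cat_pF G_ob] by blast

text \<open>Naturality of \<open>\<Phi>\<close>, applied to the identity of \<open>fob G Z\<close>,
  turns the abstract bijection into composition with the unit, the form in which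
  \<open>adjunction_unit_cochains\<close> takes it.\<close>

lemma \<Phi>_unit':
  assumes Z: "Z \<in> Ob sP" and h: "h \<in> homs pF (fob G Z) Y"
  shows "\<Phi> Z Y h = Cmp sP (fmor Lw h) (unit' Z)"
proof -
  note i = cat_id[OF is_cat_sP Z] and iG = cat_id[OF is_cat_pF G_ob[OF Z]]
  have "\<Phi> Z Y (Cmp pF h (Cmp pF (Idn pF (fob G Z)) (fmor G (Idn sP Z)))) =
      Cmp sP (fmor Lw h) (Cmp sP (unit' Z) (Idn sP Z))"
    unfolding unit'_def by (rule \<Phi>_nat[OF i h iG])
  then show ?thesis
    by (simp only: ftr_id[OF G Z] cat_idl[OF is_cat_pF iG] cat_idr[OF is_cat_pF h] cat_idr[OF is_cat_sP unit'_homs[OF Z]])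
qed

lemma unit'_natural:
  assumes f: "f \<in> homs sP Z Z'"
  shows "Cmp sP (unit' Z') f = Cmp sP (fmor Lw (fmor G f)) (unit' Z)"
proof -
  note o = cat_ob[OF is_cat_sP f]
  note Gf = ftr_mor[OF G f] and i = cat_id[OF is_cat_pF G_ob[OF o(2)]]
  have "\<Phi> Z (fob G Z') (Cmp pF (Idn pF (fob G Z')) (Cmp pF (Idn pF (fob G Z')) (fmor G f))) =
      Cmp sP (fmor Lw (Idn pF (fob G Z'))) (Cmp sP (unit' Z') f)"
    unfolding unit'_def by (rule \<Phi>_nat[OF f i i])
  then have "\<Phi> Z (fob G Z') (fmor G f) = Cmp sP (unit' Z') f"
    by (simp only: cat_idl[OF is_cat_pF Gf] ftr_id[OF lev G_ob[OF o(2)]]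
        cat_idl[OF is_cat_sP cat_cmp[OF is_cat_sP f unit'_homs[OF o(2)]]])
  then show ?thesis using \<Phi>_unit'[OF o(1) Gf] by simp
qed

lemma unit'_V:
  assumes Z: "Z \<in> Ob sP"
  shows "unit' Z \<in> V"
proof (rule V_cochains[OF unit'_homs[OF Z]])
  fix n
  have Y: "is_pob sF (fob G Z)" using G_ob[OF Z] by (simp add: pro_Ob)
  have "bij_betw (pull (colim_presheaf P) (at_level (unit' Z) n))
      (carrier (grp (colim_presheaf P) (level_pob (fob G Z) n))) (carrier (grp (colim_presheaf P) (fob Z n)))"
  proof (rule adjunction_unit_cochains[OF p0 inaccessible_infinite Z Y])
    show "unit' Z \<in> homs sP Z (levelwise_ob F (fob G Z))" using unit'_homs[OF Z] unfolding levelwise_fob[OF cF] .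
    fix X :: "('u, 'u ssetob, 'u ssetarr) pob" assume X: "is_pob sF X"
    have "bij_betw (\<Phi> Z X) (homs pF (fob G Z) X) (homs sP Z (levelwise_ob F X))"
      using \<Phi>_bij[OF Z, of X] X unfolding levelwise_fob[OF cF] by (simp add: pro_Ob)
    then show "bij_betw (\<lambda>h. Cmp sP (fmor Lw h) (unit' Z)) (homs pF (fob G Z) X) (homs sP Z (levelwise_ob F X))"
      by (rule bij_betw_cong[THEN iffD1, rotated]) (rule \<Phi>_unit'[OF Z])
  qed
  then show "bij_betw (pull (colim_presheaf P) (at_level (unit' Z) n))
      (carrier (grp (colim_presheaf P) (fob (fob Lw (fob G Z)) n))) (carrier (grp (colim_presheaf P) (fob Z n)))"
    unfolding levelwise_fob[OF cF] levelwise_ob_fob .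
qed

text \<open>Weak equivalences between pro-simplicial finite sets are detected by
  \<open>levelwise\<close>, so it suffices to treat the image of \<open>fmor G v\<close>; this is
  the fourth side of the naturality square of the unit.\<close>

lemma G_W:
  assumes v: "v \<in> homs sP Z Z'" "v \<in> V"
  shows "fmor G v \<in> W"
proof -
  note o = cat_ob[OF is_cat_sP v(1)]
  have "Cmp sP (fmor Lw (fmor G v)) (unit' Z) \<in> V"
    using V_Cmp[OF v unit'_homs[OF o(2)] unit'_V[OF o(2)]] unit'_natural[OF v(1)] by simp
  then have "fmor Lw (fmor G v) \<in> V"
    by (rule V_cancel[OF unit'_homs[OF o(1)] unit'_V[OF o(1)] ftr_mor[OF lev ftr_mor[OF G v(1)]]])
  then show ?thesis using W_iff_V[OF ftr_mor[OF G v(1)]] by blast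
qed

definition counit where
  "counit Y = inv_into (homs pF (fob G (fob Lw Y)) Y) (\<Phi> (fob Lw Y) Y) (Idn sP (fob Lw Y))"

lemma counit:
  assumes Y: "Y \<in> Ob pF"
  shows counit_homs: "counit Y \<in> homs pF (fob G (fob Lw Y)) Y"
    and \<Phi>_counit: "\<Phi> (fob Lw Y) Y (counit Y) = Idn sP (fob Lw Y)"
proof -
  note L = ftr_ob[OF lev Y]
  have "Idn sP (fob Lw Y) \<in> \<Phi> (fob Lw Y) Y ` homs pF (fob G (fob Lw Y)) Y"
    using \<Phi>_bij[OF L Y] cat_id[OF is_cat_sP L] by (simp only: bij_betw_def)
  then show "counit Y \<in> homs pF (fob G (fob Lw Y)) Y" "\<Phi> (fob Lw Y) Y (counit Y) = Idn sP (fob Lw Y)"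
    unfolding counit_def by (rule inv_into_into, rule f_inv_into_f)
qed

lemma counit_W:
  assumes Y: "Y \<in> Ob pF"
  shows "counit Y \<in> W"
proof -
  note L = ftr_ob[OF lev Y] and c = counit_homs[OF Y]
  have i: "Idn sP (fob Lw Y) \<in> V"
    by (rule V_iso[OF cat_id[OF is_cat_sP L] cat_id[OF is_cat_sP L]]) (rule cat_idl[OF is_cat_sP cat_id[OF is_cat_sP L]])+
  have "Cmp sP (fmor Lw (counit Y)) (unit' (fob Lw Y)) \<in> V"
    using i \<Phi>_unit'[OF L c] \<Phi>_counit[OF Y] by simp
  then have "fmor Lw (counit Y) \<in> V" by (rule V_cancel[OF unit'_homs[OF L] unit'_V[OF L] ftr_mor[OF lev c]])
  then show ?thesis using W_iff_V[OF c] by blast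
qed

text \<open>Both composites correspond under \<open>\<Phi>\<close> to \<open>fmor Lw f\<close>, and
  \<open>\<Phi>\<close> is injective.\<close>

lemma counit_natural:
  assumes f: "f \<in> homs pF Y Y'"
  shows "Cmp pF (counit Y') (fmor G (fmor Lw f)) = Cmp pF f (counit Y)"
proof -
  note o = cat_ob[OF is_cat_pF f]
  note L = ftr_ob[OF lev o(1)] and L' = ftr_ob[OF lev o(2)] and Lf = ftr_mor[OF lev f]
  note c = counit_homs[OF o(1)] and c' = counit_homs[OF o(2)] and GLf = ftr_mor[OF G Lf]
  note 1 = cat_cmp[OF is_cat_pF GLf c'] and 2 = cat_cmp[OF is_cat_pF c f]
  have "\<Phi> (fob Lw Y) Y' (Cmp pF (Idn pF Y') (Cmp pF (counit Y') (fmor G (fmor Lw f)))) =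
      Cmp sP (fmor Lw (Idn pF Y')) (Cmp sP (\<Phi> (fob Lw Y') Y' (counit Y')) (fmor Lw f))"
    by (rule \<Phi>_nat[OF Lf cat_id[OF is_cat_pF o(2)] c'])
  then have a: "\<Phi> (fob Lw Y) Y' (Cmp pF (counit Y') (fmor G (fmor Lw f))) = fmor Lw f"
    by (simp only: cat_idl[OF is_cat_pF 1] ftr_id[OF lev o(2)] \<Phi>_counit[OF o(2)] cat_idl[OF is_cat_sP Lf])
  have "\<Phi> (fob Lw Y) Y' (Cmp pF f (Cmp pF (counit Y) (fmor G (Idn sP (fob Lw Y))))) =
      Cmp sP (fmor Lw f) (Cmp sP (\<Phi> (fob Lw Y) Y (counit Y)) (Idn sP (fob Lw Y)))"
    by (rule \<Phi>_nat[OF cat_id[OF is_cat_sP L] f c])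
  then have b: "\<Phi> (fob Lw Y) Y' (Cmp pF f (counit Y)) = fmor Lw f"
    by (simp only: ftr_id[OF G L] cat_idr[OF is_cat_pF c] \<Phi>_counit[OF o(1)]
        cat_idl[OF is_cat_sP cat_id[OF is_cat_sP L]] cat_idr[OF is_cat_sP Lf])
  show ?thesis
    using \<Phi>_bij[OF L o(2)] 1 2 a b unfolding bij_betw_def inj_on_def by metis
qed

end

section \<open>The equivalence of homotopy categories\<close>

theorem theorem8p7:
  fixes p :: nat
    and Fin :: "(('u, 'u ssetob, 'u ssetarr) pob, ('u, 'u ssetob, 'u ssetarr) parr,
                 ('u, 'u ssetob, 'u ssetarr) pob, ('u, 'u ssetob, 'u ssetarr) parr) ftr"
    and G :: "((('u, 'u set, 'u setm) pob, ('u, 'u set, 'u setm) parr) sob,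
               (('u, 'u set, 'u setm) pob, ('u, 'u set, 'u setm) parr) sarr,
               ('u, 'u ssetob, 'u ssetarr) pob, ('u, 'u ssetob, 'u ssetarr) parr) ftr"
  assumes "inaccessible TYPE('u)"
    and "prime p"
    and "is_Fin Fin"
    and "left_adjoint (simp (pro FinSets)) (pro (simp FinSets)) G (levelwise FinSets)"
  shows "induce_inverse_equivalences
           (pro (simp Sets)) (inverted_by (pro (simp Sets)) (H_pro_sset p))
           (simp (pro FinSets)) (inverted_by (simp (pro FinSets)) (H_simp_pro_fin p))
           (comp_ftr (levelwise FinSets) Fin) (comp_ftr incl G)"
proof -
  interpret mod_p_cohomology "TYPE('u)" p by standard (use assms in auto)
  obtain \<pi> where Fin: "is_functor pS pF Fin"
    and \<pi>: "\<forall>X\<in>Ob pS. is_limit pF (Idx X) (Fin_diagram X) (fob Fin X) (\<pi> X)"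
      "\<forall>\<phi>\<in>Mor pS. \<forall>s\<in>Ob (Idx (Cod pS \<phi>)). \<forall>(t, f)\<in>germs \<phi> s.
        Cmp pF (\<pi> (Cod pS \<phi>) s) (fmor Fin \<phi>) = Cmp pF (Fin_const_map f) (\<pi> (Dom pS \<phi>) t)"
    using assms(3) unfolding is_Fin_def by blast
  interpret Fin: finite_completion "TYPE('u)" p Fin \<pi>
  proof
    show "is_functor pS pF Fin" by (rule Fin)
    show "is_limit pF (Idx X) (Fin_diagram X) (fob Fin X) (\<pi> X)" if "is_pob sS X" for X
      by (rule bspec[OF \<pi>(1)]) (use that in \<open>simp only: pro_Ob\<close>)
    show "Cmp pF (\<pi> Y s) (fmor Fin \<phi>) = Cmp pF (Fin_const_map f) (\<pi> X t)"
      if "\<phi> \<in> homs pS X Y" "s \<in> Ob (Idx Y)" "(t, f) \<in> germs \<phi> s" for \<phi> X Y s t f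
    proof -
      have "s \<in> Ob (Idx (Cod pS \<phi>))" using that(2) unfolding homsD(3)[OF that(1)] .
      from bspec[OF bspec[OF bspec[OF \<pi>(2) homsD(1)[OF that(1)]] this] that(3)]
      show ?thesis unfolding homsD(2,3)[OF that(1)] prod.case .
    qed
  qed
  obtain \<Phi> where G: "is_functor sP pF G" and lev: "is_functor pF sP (levelwise F)"
    and \<Phi>: "\<forall>a\<in>Ob sP. \<forall>c\<in>Ob pF. bij_betw (\<Phi> a c) (homs pF (fob G a) c) (homs sP a (fob (levelwise F) c))"
      "\<forall>f\<in>Mor sP. \<forall>g\<in>Mor pF. \<forall>h\<in>homs pF (fob G (Cod sP f)) (Dom pF g).
        \<Phi> (Dom sP f) (Cod pF g) (Cmp pF g (Cmp pF h (fmor G f))) =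
        Cmp sP (fmor (levelwise F) g) (Cmp sP (\<Phi> (Cod sP f) (Dom pF g) h) f)"
    using assms(4) unfolding left_adjoint_def by blast
  interpret G: level_adjoint "TYPE('u)" p G \<Phi>
  proof
    show "is_functor sP pF G" "is_functor pF sP (levelwise F)" by (rule G, rule lev)
    show "bij_betw (\<Phi> a c) (homs pF (fob G a) c) (homs sP a (fob (levelwise F) c))" if "a \<in> Ob sP" "c \<in> Ob pF" for a c
      using \<Phi>(1) that by blast
    show "\<Phi> a d (Cmp pF g (Cmp pF h (fmor G f))) = Cmp sP (fmor (levelwise F) g) (Cmp sP (\<Phi> b c h) f)"
      if "f \<in> homs sP a b" "g \<in> homs pF c d" "h \<in> homs pF (fob G b) c" for f g h a b c d
    proof -
      have "h \<in> homs pF (fob G (Cod sP f)) (Dom pF g)"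
        using that(3) unfolding homsD(3)[OF that(1)] homsD(2)[OF that(2)] .
      from bspec[OF bspec[OF bspec[OF \<Phi>(2) homsD(1)[OF that(1)]] homsD(1)[OF that(2)]] this]
      show ?thesis unfolding homsD(2,3)[OF that(1)] homsD(2,3)[OF that(2)] .
    qed
  qed
  have incl: "is_functor pF pS incl" unfolding incl_def by (rule is_functor_pro_sub[OF csF csS sub])
  have fob_incl: "fob incl X = X" and fmor_incl: "fmor incl \<phi> = \<phi>" for X :: "('u, 'u ssetob, 'u ssetarr) pob" and \<phi>
    by (simp_all add: incl_def)
  let ?S = "comp_ftr (levelwise F) Fin" and ?T = "comp_ftr incl G" and ?L = "comp_ftr incl Fin"
  have WM: "w \<in> homs pS (Dom pS w) (Cod pS w)" if "w \<in> W" for w using that by (simp add: inverted_by_def homs_def)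
  have VM: "v \<in> homs sP (Dom sP v) (Cod sP v)" if "v \<in> V" for v using that by (simp add: inverted_by_def homs_def)
  have S: "relative_functor pS W sP V ?S"
  proof
    show "is_functor pS sP ?S" by (rule is_functor_comp[OF Fin lev])
    \<comment> \<open>\<open>Fin\<close> keeps weak equivalences in W, and for maps of
      pro-simplicial finite sets W is exactly what \<open>levelwise\<close> sends into V.\<close>
    show "fmor ?S w \<in> V" if "w \<in> W" for w
      using Fin.Fin_W[OF WM[OF that] that] W_iff_V[OF ftr_mor[OF Fin WM[OF that]]] unfolding comp_ftr_sel by blast
  qed (rule is_cat_pS is_cat_sP)+
  have T: "relative_functor sP V pS W ?T"
  proof
    show "is_functor sP pS ?T" by (rule is_functor_comp[OF G incl])
    show "fmor ?T v \<in> W" if "v \<in> V" for v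
      using G.G_W[OF VM[OF that] that] unfolding comp_ftr_sel fmor_incl .
  qed (rule is_cat_pS is_cat_sP)+
  have L: "relative_functor pS W pS W ?L"
  proof
    show "is_functor pS pS ?L" by (rule is_functor_comp[OF Fin incl])
    show "fmor ?L w \<in> W" if "w \<in> W" for w
      using Fin.Fin_W[OF WM[OF that] that] unfolding comp_ftr_sel fmor_incl .
  qed (rule is_cat_pS)+
  have \<alpha>: "natural_weq pS W pS W id_ftr ?L Fin.unit"
  proof (rule natural_weq.intro[OF relative_functor_id[OF is_cat_pS] L], standard)
    fix X assume "X \<in> Ob pS"
    then have X: "is_pob sS X" by (simp add: pro_Ob)
    show "Fin.unit X \<in> homs pS (fob id_ftr X) (fob ?L X)"
      using Fin.unit_homs[OF X] by (simp only: comp_ftr_sel id_ftr_sel fob_incl)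
    show "Fin.unit X \<in> W" by (rule Fin.unit_W[OF X])
  next
    fix \<phi> X Y assume "\<phi> \<in> homs pS X Y"
    then show "Cmp pS (Fin.unit Y) (fmor id_ftr \<phi>) = Cmp pS (fmor ?L \<phi>) (Fin.unit X)"
      using Fin.unit_natural by (simp only: comp_ftr_sel id_ftr_sel fmor_incl)
  qed
  have \<beta>: "natural_weq pS W pS W (comp_ftr ?T ?S) ?L (\<lambda>X. G.counit (fob Fin X))"
  proof (rule natural_weq.intro[OF relative_functor_comp[OF S T] L], standard)
    fix X assume X: "X \<in> Ob pS"
    show "G.counit (fob Fin X) \<in> homs pS (fob (comp_ftr ?T ?S) X) (fob ?L X)"
      using pF_pS[OF G.counit_homs[OF ftr_ob[OF Fin X]]] by (simp only: comp_ftr_sel fob_incl)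
    show "G.counit (fob Fin X) \<in> W" by (rule G.counit_W[OF ftr_ob[OF Fin X]])
  next
    fix \<phi> X Y assume ph: "\<phi> \<in> homs pS X Y"
    note o = cat_ob[OF is_cat_pS ph]
    note f = ftr_mor[OF Fin ph]
    note c = G.counit_homs[OF ftr_ob[OF Fin o(1)]] and c' = G.counit_homs[OF ftr_ob[OF Fin o(2)]]
    show "Cmp pS (G.counit (fob Fin Y)) (fmor (comp_ftr ?T ?S) \<phi>) = Cmp pS (fmor ?L \<phi>) (G.counit (fob Fin X))"
      using G.counit_natural[OF f]
      unfolding comp_ftr_sel fmor_incl pF_Cmp[OF c f] pF_Cmp[OF ftr_mor[OF G ftr_mor[OF lev f]] c'] .
  qed
  have \<epsilon>: "natural_weq sP V sP V id_ftr (comp_ftr ?S ?T)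
      (\<lambda>Z. Cmp sP (fmor (levelwise F) (Fin.unit (fob G Z))) (G.unit' Z))"
  proof (rule natural_weq.intro[OF relative_functor_id[OF is_cat_sP] relative_functor_comp[OF T S]], standard)
    \<comment> \<open>The unit is constructed as a map of pro-spaces, and \<open>levelwise F\<close>
      acts on maps of pro-simplicial finite sets. For Y in \<open>pF\<close> both ends lie in the
      full subcategory, so the unit is a map there.\<close>
    have u: "Fin.unit Y \<in> homs pF Y (fob Fin Y)" if Y: "Y \<in> Ob pF" for Y
    proof -
      have YS: "is_pob sS Y" using ftr_ob[OF incl Y] unfolding fob_incl pro_Ob .
      show ?thesis
        using Fin.unit_homs[OF YS] pro_homs_sub[OF csF csS sub Y[unfolded pro_Ob] Fin.Fin_ob[OF YS]] by blast
    qed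
    {
      fix Z assume Z: "Z \<in> Ob sP"
      note GZ = ftr_ob[OF G Z]
      note FGZ = ftr_mor[OF lev u[OF GZ]]
      show "Cmp sP (fmor (levelwise F) (Fin.unit (fob G Z))) (G.unit' Z) \<in> homs sP (fob id_ftr Z) (fob (comp_ftr ?S ?T) Z)"
        using cat_cmp[OF is_cat_sP G.unit'_homs[OF Z] FGZ] by (simp only: comp_ftr_sel id_ftr_sel fob_incl)
      have YS: "is_pob sS (fob G Z)" using ftr_ob[OF incl GZ] unfolding fob_incl pro_Ob .
      have "fmor (levelwise F) (Fin.unit (fob G Z)) \<in> V" using Fin.unit_W[OF YS] W_iff_V[OF u[OF GZ]] by blast
      then show "Cmp sP (fmor (levelwise F) (Fin.unit (fob G Z))) (G.unit' Z) \<in> V"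
        by (rule V_Cmp[OF G.unit'_homs[OF Z] G.unit'_V[OF Z] FGZ])
    next
      fix f Z Z' assume f: "f \<in> homs sP Z Z'"
      note o = cat_ob[OF is_cat_sP f]
      note Gf = ftr_mor[OF G f]
      note GZ = ftr_ob[OF G o(1)] and GZ' = ftr_ob[OF G o(2)]
      have Gf': "fmor G f \<in> homs pS (fob G Z) (fob G Z')" by (rule pF_pS[OF Gf])
      note FGf = ftr_mor[OF Fin Gf']
      have nat: "Cmp pF (Fin.unit (fob G Z')) (fmor G f) = Cmp pF (fmor Fin (fmor G f)) (Fin.unit (fob G Z))"
        using Fin.unit_natural[OF Gf'] pF_Cmp[OF Gf u[OF GZ']] pF_Cmp[OF u[OF GZ] FGf] by simp
      let ?F = "fmor (levelwise F)"
      note Lu = ftr_mor[OF lev u[OF GZ]] and Lu' = ftr_mor[OF lev u[OF GZ']]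
      \<comment> \<open>Two squares are pasted: the naturality square of \<open>G.unit'\<close>, and
        the image under \<open>levelwise\<close> of the naturality square of \<open>Fin.unit\<close>
        at \<open>fmor G f\<close>.\<close>
      have "Cmp sP (Cmp sP (?F (Fin.unit (fob G Z'))) (G.unit' Z')) f =
          Cmp sP (?F (Fin.unit (fob G Z'))) (Cmp sP (?F (fmor G f)) (G.unit' Z))"
        using cat_assoc[OF is_cat_sP f G.unit'_homs[OF o(2)] Lu'] G.unit'_natural[OF f] by simp
      also have "\<dots> = Cmp sP (?F (Cmp pF (Fin.unit (fob G Z')) (fmor G f))) (G.unit' Z)"
        using cat_assoc[OF is_cat_sP G.unit'_homs[OF o(1)] ftr_mor[OF lev Gf] Lu'] ftr_cmp[OF lev Gf u[OF GZ']] by simp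
      also have "\<dots> = Cmp sP (?F (fmor Fin (fmor G f))) (Cmp sP (?F (Fin.unit (fob G Z))) (G.unit' Z))"
        using cat_assoc[OF is_cat_sP G.unit'_homs[OF o(1)] Lu ftr_mor[OF lev FGf]] ftr_cmp[OF lev u[OF GZ] FGf] nat by simp
      finally show "Cmp sP (Cmp sP (?F (Fin.unit (fob G Z'))) (G.unit' Z')) (fmor id_ftr f) =
          Cmp sP (fmor (comp_ftr ?S ?T) f) (Cmp sP (?F (Fin.unit (fob G Z))) (G.unit' Z))"
        by (simp only: comp_ftr_sel id_ftr_sel fmor_incl)
    }
  qed
  show ?thesis by (rule induce_inverse_equivalencesI[OF S T \<alpha> \<beta> \<epsilon>])
qed

end
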